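(* There is the following bound as $x\to\infty$. Suppose $N=N(x)$ satisfies $N>\exp(4.8365\sqrt{\log x})$. Then for any positive constant $E$, $$ \frac1N\sum_{a\leq N}\left(\sum_{p<x}\frac{\ell_a(p)}{p-1}-C\,\mathrm{Li}(x)\right)^2\ll \frac{x^2}{(\log x)^E}, $$ where the implied constant depends only on $E$.
   Context: $a$ runs over positive integers and $p$ over primes. For a prime $p$ and an integer $a$ coprime to $p$, $\ell_a(p)$ denotes the multiplicative order of $a$ modulo $p$ (terms with $p\mid a$ are taken to be $0$). $\mathrm{Li}(x)=\int_2^x\frac{dt}{\log t}$. $C=\prod_p\left(1-\frac{p}{p^3-1}\right)$ (Stephens' constant), the product over all primes. *)

theory Defs
  imports "HOL-Analysis.Analysis" "HOL-Number_Theory.Number_Theory"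
begin

definition Li :: "real \<Rightarrow> real" where
  "Li x = integral {2..x} (\<lambda>t. 1 / ln t)"

definition stephens_C :: real where
  "stephens_C = (\<Prod>n. (if prime n then 1 - real n / (real n ^ 3 - 1) else 1))"

text \<open>The inner sum: sum over primes p < x of l_a(p)/(p-1), with l_a(p) = ord p a
  (which is 0 when p divides a).\<close>
definition order_sum :: "nat \<Rightarrow> real \<Rightarrow> real" where
  "order_sum a x = (\<Sum>p\<in>{p. prime p \<and> real p < x}. real (ord p a) / (real p - 1))"

end

theory Submission
  imports Defs "HOL-Complex_Analysis.Complex_Analysis" "HOL-Probability.Probability"
begin

text \<open>The average of \<open>ord p a / (p - 1)\<close> over the residue classes prime to \<open>p\<close> is
  \<open>m(p - 1) = (\<Sum>d | d dvd p - 1. h0 d / d)\<close>, where \<open>h0\<close> is the Moebius transform of \<open>1 / n\<close>. Summing over \<open>p\<close> and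
  exchanging the sums leads to primes congruent to 1 modulo \<open>d\<close>, and \<open>stephens_C\<close> arises as the Euler product of
  \<open>(\<Sum>d. h0 d / (d * totient d))\<close>. The error terms require the prime number theorem for these progressions with
  a saving of any power of the logarithm, uniformly in \<open>d\<close> up to powers of \<open>ln x\<close>. It is obtained without zero-free
  regions: \<open>L\<close> is bounded below next to the line \<open>Re s = 1\<close> by the 3-4-1 inequality, and for real characters near \<open>s = 1\<close>
  by Siegel's theorem, so that Cauchy's inequality bounds all derivatives of \<open>L'/L\<close> there; a Fourier inversion then bounds
  sums weighted by powers of the logarithm, and Abel summation removes the weights.

  For the variance, the deviation of \<open>ord p a / (p - 1)\<close> from its average is expanded in nonprincipal characters modulo
  \<open>p\<close>. By duality and a power mean inequality the second moment is controlled by \<open>2 r\<close>-th moments of character sums over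
  \<open>a \<le> N\<close>, with \<open>N ^ r\<close> slightly larger than \<open>x ^ 2\<close>. Two finite Parseval identities pass from characters to additive
  characters, and the large sieve together with a Rankin bound for the \<open>r\<close>-fold divisor function concludes.\<close>

section \<open>Dirichlet characters\<close>

text \<open>In the mean value the obstacle is a real zero close to s = 1. It is met by Siegel's
  theorem, which is why the implied constant comes out ineffective. The analysis stays in Re s > 0,
  where Abel summation alone continues the series, so neither a functional equation nor primitive
  characters occur; imprimitive characters are compared through finite Euler factors. In the
  variance the obstacle is that N may be far shorter than x^2, the length at which the large sieve
  over all primes below x is sharp. Taking r-th powers, with r about 2 ln x / ln N, repairs the
  length at the price of a mean square of r-fold divisor functions, exponential in r^2. The gain of
  the large sieve is a single factor 1/x in the 2r-th moment, hence x^(-1/(2r)) after the root. Gain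
  exceeds price only while r is at most a suitable multiple of sqrt(ln x), and this is where a lower
  bound exp(c sqrt(ln x)) for N comes from. The saving that remains is exp(-c' sqrt(ln x)), better
  than any power of the logarithm, so the exponent E is limited only by the mean value.\<close>

definition dchar :: "nat => (nat => complex) => bool" where
 "dchar q X \<longleftrightarrow> q > 0 \<and> (\<forall>m n. X (m * n) = X m * X n) \<and> (\<forall>n. X (n + q) = X n) \<and>
   (\<forall>n. X n = 0 \<longleftrightarrow> \<not> coprime n q)"

definition dprin :: "nat => nat => complex" where
 "dprin q n = (if coprime n q then 1 else 0)"

text \<open>A character of the subgroup of residue classes represented by \<open>H\<close>; such characters are extended one
 generator at a time.\<close>
definition pchar :: "nat => nat set => (nat => complex) => bool" where
 "pchar q H X \<longleftrightarrow> q > 0 \<and> 1 \<in> H \<and> (\<forall>a\<in>H. \<forall>b\<in>H. a * b \<in> H \<and> X (a * b) = X a * X b) \<and>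
   (\<forall>a\<in>H. \<forall>b. [a = b] (mod q) --> b \<in> H \<and> X b = X a) \<and> (\<forall>a\<in>H. coprime a q \<and> X a ~= 0)"

lemma pcharD:
 assumes "pchar q H X"
 shows "q > 0" "1 \<in> H" "a \<in> H ==> b \<in> H ==> a * b \<in> H"
  "a \<in> H ==> b \<in> H ==> X (a * b) = X a * X b" "a \<in> H ==> [a = b] (mod q) ==> b \<in> H"
  "a \<in> H ==> [a = b] (mod q) ==> X b = X a" "a \<in> H ==> coprime a q" "a \<in> H ==> X a ~= 0"
proof -
 note * = assms[unfolded pchar_def, THEN conjunct2, THEN conjunct2]
 note m = *[THEN conjunct1, rule_format] and c = *[THEN conjunct2, THEN conjunct1, rule_format]
  and z = *[THEN conjunct2, THEN conjunct2, rule_format]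
 show "q > 0" "1 \<in> H" using assms unfolding pchar_def by iprover+
 show "a \<in> H ==> b \<in> H ==> a * b \<in> H" "a \<in> H ==> b \<in> H ==> X (a * b) = X a * X b"
  using m[of a b] by auto
 show "a \<in> H ==> [a = b] (mod q) ==> b \<in> H" "a \<in> H ==> [a = b] (mod q) ==> X b = X a"
  using c[of a b] by iprover+
 show "a \<in> H ==> coprime a q" "a \<in> H ==> X a ~= 0" using z[of a] by auto
qed

lemma dcharD:
 assumes "dchar q X"
 shows "q > 0" "X (m * n) = X m * X n" "X (n + q) = X n" "X n = 0 \<longleftrightarrow> \<not> coprime n q"
 using assms by (auto simp: dchar_def)

lemma pchar_power:
 assumes "pchar q H X" "a \<in> H"
 shows "a ^ i \<in> H \<and> X (a ^ i) = X a ^ i"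
proof (induction i)
 case 0
 have 1: "1 \<in> H" using assms by (simp add: pchar_def)
 have "X 1 * X 1 = X 1" using pcharD(4)[OF assms(1) 1 1] by (simp only: mult_1)
 hence "X 1 = 1" using pcharD(8)[OF assms(1) 1] by simp
 with 1 show ?case by simp
next
 case (Suc i)
 thus ?case using pcharD(3,4)[OF assms(1,2), of "a ^ i"] by simp
qed

text \<open>The inverse of \<open>h\<close> modulo \<open>q\<close> is the power
  \<open>h ^ (totient q - 1)\<close>, so closure under products already makes \<open>H\<close> a
  group of residue classes.\<close>

lemma pchar_cancel:
 assumes H: "pchar q H X" and "h \<in> H" "h' \<in> H" "[h * b = h'] (mod q)"
 shows "b \<in> H"
proof -
 have q: "q > 0" and cop: "coprime h q" using pcharD(1,7)[OF H] assms by auto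
 have t: "totient q > 0" using q by simp
 have "h ^ (totient q - 1) * h' \<in> H"
  using pcharD(3)[OF H] pchar_power[OF H \<open>h \<in> H\<close>] assms(3) by auto
 moreover have "[h ^ (totient q - 1) * h' = b] (mod q)"
 proof -
  have "[h ^ (totient q - 1) * h' = h ^ (totient q - 1) * (h * b)] (mod q)"
   using assms(4) cong_scalar_left cong_sym by blast
  also have "h ^ (totient q - 1) * (h * b) = h ^ totient q * b"
   using t by (subst power_minus_mult[symmetric, of "totient q"]) (auto simp: mult.assoc)
  also have "[h ^ totient q * b = 1 * b] (mod q)"
   using euler_theorem[OF cop] cong_scalar_right by blast
  finally show ?thesis by simp
 qed
 ultimately show ?thesis by (rule pcharD(5)[OF H])
qed

text \<open>The new element may receive any \<open>k\<close>-th root \<open>w\<close> of the value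
  already fixed at \<open>a ^ k\<close>. The rule \<open>h * a ^ i\<close> maps to
  \<open>X h * w ^ i\<close> is well defined because two such representations of one class have
  exponents that differ by a multiple of \<open>k\<close>. The freedom in \<open>w\<close> is used
  later to separate points.\<close>

lemma pchar_extend:
 assumes H: "pchar q H X" and a: "coprime a q" and k: "k > 0" "a ^ k \<in> H"
  and kmin: "!!i. 0 < i ==> i < k ==> a ^ i \<notin> H" and w: "w ^ k = X (a ^ k)"
 shows "\<exists>H' X'. pchar q H' X' \<and> H \<subseteq> H' \<and> a \<in> H' \<and> X' a = w \<and> (\<forall>h\<in>H. X' h = X h)"
proof -
 have q: "q > 0" and one: "1 \<in> H" using pcharD(1,2)[OF H] by auto
 have chi1: "X 1 = 1" using pchar_power[OF H one, of 0] by simp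
 have w0: "w ~= 0" using w k pcharD(8)[OF H k(2)] by (auto simp: zero_power)
 \<comment> \<open>Division with remainder: the remainder would be a smaller exponent with power in
   \<open>H\<close>, against \<open>kmin\<close>.\<close>
 have dvd: "k dvd m" if "a ^ m \<in> H" for m
 proof -
  have "(a ^ k) ^ (m div k) \<in> H" using pchar_power[OF H k(2)] by auto
  moreover have "[(a ^ k) ^ (m div k) * a ^ (m mod k) = a ^ m] (mod q)"
   by (simp add: power_mult[symmetric] power_add[symmetric])
  ultimately have "a ^ (m mod k) \<in> H" using pchar_cancel[OF H] that by blast
  thus ?thesis using kmin[of "m mod k"] k(1) by (cases "m mod k = 0") auto
 qed
 have wd0: "X h * w ^ i = X h' * w ^ j"
  if "h \<in> H" "h' \<in> H" "[h * a ^ i = h' * a ^ j] (mod q)" "j <= i" for h h' i j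
 proof -
  define m where "m = i - j"
  have i: "i = m + j" using that by (simp add: m_def)
  have "[h * a ^ m * a ^ j = h' * a ^ j] (mod q)" using that(3) by (simp add: i power_add mult.assoc)
  hence c: "[h * a ^ m = h'] (mod q)" using a by (simp add: cong_mult_rcancel_nat)
  have am: "a ^ m \<in> H" using pchar_cancel[OF H that(1,2) c] .
  obtain c where c': "m = k * c" using dvd[OF am] by (auto elim: dvdE)
  have "X h' = X (h * a ^ m)" using pcharD(6)[OF H pcharD(3)[OF H that(1) am] c] .
  also have "... = X h * X ((a ^ k) ^ c)" using pcharD(4)[OF H that(1) am] by (simp add: c' power_mult)
  also have "X ((a ^ k) ^ c) = w ^ m" using pchar_power[OF H k(2), of c] w by (simp add: c' power_mult)
  finally show ?thesis by (simp add: i power_add)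
 qed
 have wd: "X h * w ^ i = X h' * w ^ j"
  if "h \<in> H" "h' \<in> H" "[h * a ^ i = h' * a ^ j] (mod q)" for h h' i j
  using wd0[OF that] wd0[OF that(2,1) cong_sym[OF that(3)]] by (cases "j <= i") auto
 define H' where "H' = {n. \<exists>h\<in>H. \<exists>i. [n = h * a ^ i] (mod q)}"
 define X' where "X' = (%n. THE z. \<exists>h\<in>H. \<exists>i. [n = h * a ^ i] (mod q) \<and> z = X h * w ^ i)"
 have val: "X' n = X h * w ^ i" if "h \<in> H" "[n = h * a ^ i] (mod q)" for n h i
  unfolding X'_def
 proof (rule the_equality)
  fix z assume "\<exists>h'\<in>H. \<exists>j. [n = h' * a ^ j] (mod q) \<and> z = X h' * w ^ j"
  then obtain h' j where "h' \<in> H" "[n = h' * a ^ j] (mod q)" "z = X h' * w ^ j" by auto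
  thus "z = X h * w ^ i" using wd[of h' h j i] that by (meson cong_sym cong_trans)
 qed (use that in auto)
 have "pchar q H' X'" unfolding pchar_def
 proof (intro conjI ballI allI impI)
  show "q > 0" by fact
  show "1 \<in> H'" using one unfolding H'_def by (auto intro!: bexI[of _ 1] exI[of _ 0])
 next
  fix x y assume "x \<in> H'" "y \<in> H'"
  then obtain h i h' j where *: "h \<in> H" "[x = h * a ^ i] (mod q)" "h' \<in> H" "[y = h' * a ^ j] (mod q)"
   unfolding H'_def by auto
  have "[x * y = (h * a ^ i) * (h' * a ^ j)] (mod q)" using * cong_mult by blast
  hence 1: "[x * y = (h * h') * a ^ (i + j)] (mod q)" by (simp add: power_add ac_simps)
  have 2: "h * h' \<in> H" "X (h * h') = X h * X h'" using * pcharD(3,4)[OF H] by auto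
  show "x * y \<in> H'" unfolding H'_def using 1 2 by blast
  show "X' (x * y) = X' x * X' y"
   using val[OF 2(1) 1] val[OF *(1,2)] val[OF *(3,4)] 2 by (simp add: power_add)
 next
  fix x y assume "x \<in> H'" "[x = y] (mod q)"
  then obtain h i where *: "h \<in> H" "[x = h * a ^ i] (mod q)" unfolding H'_def by auto
  have 1: "[y = h * a ^ i] (mod q)" using * \<open>[x = y] (mod q)\<close> by (meson cong_sym cong_trans)
  show "y \<in> H'" unfolding H'_def using 1 * by blast
  show "X' y = X' x" using val[OF *] val[OF *(1) 1] by simp
 next
  fix x assume "x \<in> H'"
  then obtain h i where *: "h \<in> H" "[x = h * a ^ i] (mod q)" unfolding H'_def by auto
  have "coprime (h * a ^ i) q" using * pcharD(7)[OF H] a by auto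
  thus "coprime x q" using *(2) cong_imp_coprime cong_sym by blast
  show "X' x ~= 0" using val[OF *] w0 * pcharD(8)[OF H] by auto
 qed
 moreover have "H \<subseteq> H'" unfolding H'_def by (auto intro!: bexI exI[of _ 0])
 moreover have "a \<in> H'" unfolding H'_def using one by (auto intro!: bexI[of _ 1] exI[of _ 1])
 moreover have "X' a = w" using val[of 1 a 1] one chi1 by simp
 moreover have "X' h = X h" if "h \<in> H" for h using val[of h h 0] that by simp
 ultimately show ?thesis by blast
qed

text \<open>Every adjunction adds at least one residue below \<open>q\<close>, so the number of
  residues outside \<open>H\<close> decreases until all coprime classes are reached.\<close>

lemma pchar_extend_all:
 assumes "pchar q H X"
 shows "\<exists>X'. pchar q {n. coprime n q} X' \<and> (\<forall>h\<in>H. X' h = X h)"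
 using assms
proof (induction "q - card ({..<q} \<inter> H)" arbitrary: H X rule: less_induct)
 case less
 note H = less.prems
 have q: "q > 0" and Hcop: "!!n. n \<in> H ==> coprime n q" using pcharD(1,7)[OF H] by auto
 show ?case
 proof (cases "\<exists>a. coprime a q \<and> a \<notin> H")
  case False
  hence "H = {n. coprime n q}" using Hcop by auto
  thus ?thesis using H by blast
 next
  case True
  then obtain a where a: "coprime a q" "a \<notin> H" by blast
  define k where "k = (LEAST k. k > 0 \<and> a ^ k \<in> H)"
  have "a ^ totient q \<in> H"
   using pcharD(5)[OF H pcharD(2)[OF H] cong_sym[OF euler_theorem[OF a(1)]]] .
  hence "totient q > 0 \<and> a ^ totient q \<in> H" using q by simp
  hence k: "k > 0 \<and> a ^ k \<in> H" unfolding k_def by (rule LeastI)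
  have kmin: "a ^ i \<notin> H" if "0 < i" "i < k" for i
   using not_less_Least[of i "%k. k > 0 \<and> a ^ k \<in> H"] that by (auto simp: k_def)
  obtain w where w: "X (a ^ k) = w ^ k" using k by (auto intro: exists_complex_root[of k])
  obtain H' X' where *: "pchar q H' X'" "H \<subseteq> H'" "a \<in> H'" "\<forall>h\<in>H. X' h = X h"
   using pchar_extend[OF H a(1) k[THEN conjunct1] k[THEN conjunct2] kmin w[symmetric]] by blast
  have "a mod q \<in> H'" by (rule pcharD(5)[OF *(1,3)]) simp
  moreover have "a mod q \<notin> H" using a(2) pcharD(5)[OF H, of "a mod q" a] by auto
  ultimately have "{..<q} \<inter> H \<subset> {..<q} \<inter> H'" using *(2) q by auto
  hence "card ({..<q} \<inter> H) < card ({..<q} \<inter> H')" by (intro psubset_card_mono) auto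
  moreover have "card ({..<q} \<inter> H') <= q" using card_mono[of "{..<q}" "{..<q} \<inter> H'"] by simp
  ultimately have "q - card ({..<q} \<inter> H') < q - card ({..<q} \<inter> H)" by linarith
  from less.hyps[OF this *(1)] obtain X'' where "pchar q {n. coprime n q} X''" "\<forall>h\<in>H'. X'' h = X' h" by blast
  thus ?thesis using *(2,4) by (intro exI[of _ X'']) auto
 qed
qed

lemma dchar_cong:
 assumes "dchar q X" "[m = n] (mod q)"
 shows "X m = X n"
proof -
 have *: "X (n + k * q) = X n" for n k
  using assms(1) by (induction k) (auto simp: dchar_def add.assoc[symmetric] add.commute[of q])
 have "X n = X (n mod q)" for n using *[of "n mod q" "n div q"] by (simp add: mult.commute)
 thus ?thesis using assms(2) by (metis cong_def)
qed

lemma dchar_1 [simp]: "dchar q X ==> X (Suc 0) = 1"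
proof -
 assume *: "dchar q X"
 have "X 1 * X 1 = X 1" using dcharD(2)[OF *, of 1 1] by (simp only: mult_1)
 thus ?thesis using dcharD(4)[OF *, of 1] by simp
qed

lemma dchar_power:
 assumes "dchar q X"
 shows "X (n ^ k) = X n ^ k"
 by (induction k) (simp_all add: dcharD(2)[OF assms] dchar_1[OF assms])

lemma dchar_norm:
 assumes "dchar q X"
 shows "norm (X n) = (if coprime n q then 1 else 0)"
proof (cases "coprime n q")
 case True
 have "X n ^ totient q = 1"
  using dchar_power[OF assms, of n "totient q"] dchar_cong[OF assms euler_theorem[OF True]] dchar_1[OF assms] by simp
 hence "norm (X n) ^ totient q = 1" by (metis norm_one norm_power)
 moreover have "totient q > 0" using assms by (simp add: dchar_def)
 ultimately show ?thesis using True power_eq_imp_eq_base[of "norm (X n)" "totient q" 1] by simp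
qed (use assms in \<open>auto simp: dchar_def\<close>)

lemma dchar_norm_le: "dchar q X ==> norm (X n) <= 1"
 by (simp add: dchar_norm)

lemma coprime_add_modulus: "coprime (n + q) q \<longleftrightarrow> coprime n (q :: nat)"
 unfolding coprime_iff_gcd_eq_1 by simp

lemma dchar_prin: "q > 0 ==> dchar q (dprin q)"
 by (simp add: dchar_def dprin_def coprime_add_modulus)

lemma dchar_mult:
 assumes X: "dchar q X" and Y: "dchar r Y"
 shows "dchar (q * r) (%n. X n * Y n)"
proof -
 have "X (n + q * r) = X n" "Y (n + q * r) = Y n" for n
  by (rule dchar_cong[OF X], simp add: cong_def) (rule dchar_cong[OF Y], simp add: cong_def)
 thus ?thesis
  using dcharD(1)[OF X] dcharD(1)[OF Y] unfolding dchar_def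
  by (simp add: dcharD(2,4)[OF X] dcharD(2,4)[OF Y])
qed

text \<open>The start is the trivial character on the class of 1. Adjoining \<open>g\<close>, whose
  first power in that class is the one with exponent \<open>ord q g\<close>, allows a primitive root
  of unity of this order as its value, which differs from 1.\<close>

lemma dchar_separate:
 assumes q: "q > 0" and g: "coprime g q" "\<not> [g = 1] (mod q)"
 shows "\<exists>X. dchar q X \<and> X g ~= 1"
proof -
 define k where "k = ord q g"
 have k1: "k > 1"
 proof -
  have "k ~= 0" using g by (simp add: k_def ord_eq_0 coprime_commute)
  moreover have "k ~= 1" using g by (simp add: k_def ord_eq_Suc_0_iff)
  ultimately show ?thesis by simp
 qed
 define H where "H = {n. [n = 1] (mod q)}"
 have H: "pchar q H (%_. 1)" using q unfolding pchar_def H_def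
 proof (intro conjI ballI allI impI, goal_cases)
  case (3 a b) thus ?case using cong_mult[of a 1 q b 1] by simp
 next
  case (5 a b) thus ?case by (auto intro: cong_trans cong_sym)
 next
  case (7 a) thus ?case using cong_imp_coprime[of 1 a q] cong_sym by auto
 qed auto
 define w where "w = cis (2 * pi / k)"
 have wk: "w ^ k = 1" using k1 by (simp add: w_def Complex.DeMoivre)
 have w1: "w ~= 1"
 proof
  assume "w = 1"
  hence "cos (2 * pi / k) = 1" by (simp add: w_def complex_eq_iff)
  then obtain n :: int where "2 * pi / k = n * 2 * pi" using cos_one_2pi_int by auto
  hence "1 = n * real k" using k1 by (simp add: field_simps)
  hence "real_of_int 1 = real_of_int (n * int k)" by simp
  hence "1 = n * int k" by (simp only: of_int_eq_iff)
  hence "int k dvd 1" by (intro dvdI[of _ _ n]) (simp add: mult.commute)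
  thus False using k1 by simp
 qed
 have "\<exists>H' X'. pchar q H' X' \<and> H \<subseteq> H' \<and> g \<in> H' \<and> X' g = w \<and> (\<forall>h\<in>H. X' h = 1)"
 proof (rule pchar_extend[OF H g(1)])
  show "g ^ k \<in> H" unfolding H_def k_def using ord by blast
  show "g ^ i \<notin> H" if "0 < i" "i < k" for i
   using that ord_minimal unfolding H_def k_def by blast
 qed (use k1 wk in auto)
 then obtain H' X' where X': "pchar q H' X'" "g \<in> H'" "X' g = w" by blast
 obtain Y where Y: "pchar q {n. coprime n q} Y" "\<forall>h\<in>H'. Y h = X' h"
  using pchar_extend_all[OF X'(1)] by blast
 define Z where "Z = (%n. if coprime n q then Y n else 0)"
 have "dchar q Z" unfolding dchar_def
 proof (intro conjI allI)
  show "Z (n + q) = Z n" for n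
  proof (cases "coprime n q")
   case True
   have "[n = n + q] (mod q)" by (simp add: cong_def)
   hence "Y (n + q) = Y n" by (intro pcharD(6)[OF Y(1)]) (simp_all add: True)
   thus ?thesis by (simp add: Z_def coprime_add_modulus)
  next
   case False
   thus ?thesis by (simp add: Z_def coprime_add_modulus)
  qed
  show "Z (m * n) = Z m * Z n" for m n using pcharD(4)[OF Y(1), of m n] by (simp add: Z_def)
  show "Z n = 0 \<longleftrightarrow> \<not> coprime n q" for n using pcharD(8)[OF Y(1), of n] by (simp add: Z_def)
 qed (rule q)
 moreover have "Z g ~= 1" using X' Y w1 g by (auto simp: Z_def)
 ultimately show ?thesis by blast
qed

section \<open>Finiteness and orthogonality of the characters\<close>

lemma finite_dchars: "finite {X. dchar q X}"
proof (cases "q = 0")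
 case False
 define R where "R = {z::complex. z ^ totient q = 1} \<union> {0}"
 have fR: "finite R" unfolding R_def using False
  by (intro finite_UnI finite_roots_unity) (auto simp: Suc_le_eq)
 have "inj_on (%X. restrict X {..<q}) {X. dchar q X}"
 proof (rule inj_onI, clarsimp)
  fix X Y assume *: "dchar q X" "dchar q Y" "restrict X {..<q} = restrict Y {..<q}"
  show "X = Y"
  proof
   fix n
   have "restrict X {..<q} (n mod q) = restrict Y {..<q} (n mod q)" using *(3) by simp
   hence "X (n mod q) = Y (n mod q)" using False by simp
   thus "X n = Y n" using dchar_cong[OF *(1), of n "n mod q"] dchar_cong[OF *(2), of n "n mod q"] by simp
  qed
 qed
 moreover have "(%X. restrict X {..<q}) ` {X. dchar q X} \<subseteq> Pi\<^sub>E {..<q} (%_. R)"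
 proof clarsimp
  fix X :: "nat => complex" and n assume X: "dchar q X" and "n < q"
  show "X n \<in> R"
  proof (cases "coprime n q")
   case True
   have "X n ^ totient q = 1"
    using dchar_power[OF X, of n "totient q"] dchar_cong[OF X euler_theorem[OF True]] dchar_1[OF X] by simp
   thus ?thesis by (simp add: R_def)
  qed (use X in \<open>auto simp: dchar_def R_def\<close>)
 qed
 ultimately show ?thesis using fR by (meson finite_PiE finite_imageD finite_lessThan finite_subset)
qed (auto simp: dchar_def)

lemma dchar_sum_period:
 assumes X: "dchar q X" "X ~= dprin q"
 shows "(\<Sum>n<q. X n) = 0"
proof -
 have q: "q > 0" using X by (auto simp: dchar_def)
 obtain g where g: "X g ~= dprin q g" using X by auto
 have gc: "coprime g q" using g X(1) by (auto simp: dprin_def dchar_def split: if_splits)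
 have "(\<Sum>n<q. X n) = (\<Sum>n<q. X (g * n mod q))"
 proof (rule sum.reindex_bij_betw[symmetric])
  have inj: "inj_on (%n. g * n mod q) {..<q}"
  proof (rule inj_onI)
   fix a b assume *: "a \<in> {..<q}" "b \<in> {..<q}" "g * a mod q = g * b mod q"
   hence "[g * a = g * b] (mod q)" by (simp add: cong_def)
   hence "[a = b] (mod q)" using gc by (simp add: cong_mult_lcancel_nat)
   thus "a = b" using * by (simp add: cong_def)
  qed
  show "bij_betw (%n. g * n mod q) {..<q} {..<q}"
   using inj q by (intro endo_inj_surj bij_betw_imageI) auto
 qed
 also have "... = (\<Sum>n<q. X g * X n)"
 proof (rule sum.cong[OF refl])
  fix n show "X (g * n mod q) = X g * X n"
   using dchar_cong[OF X(1), of "g * n mod q" "g * n"] X(1) by (simp add: dchar_def)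
 qed
 also have "... = X g * (\<Sum>n<q. X n)" by (simp add: sum_distrib_left)
 finally have "(X g - 1) * (\<Sum>n<q. X n) = 0" by (simp add: algebra_simps)
 thus ?thesis using g gc by (auto simp: dprin_def)
qed

lemma periodic_partial_sum:
 fixes f :: "nat => complex"
 assumes q: "q > 0" and per: "!!n. f (n + q) = f n" and z: "(\<Sum>n=1..q. f n) = 0" and b: "!!n. norm (f n) <= 1"
 shows "norm (\<Sum>n=1..N. f n) <= real q"
proof (induction N rule: less_induct)
 case (less N)
 show ?case
 proof (cases "N < q")
  case True
  have "norm (\<Sum>n=1..N. f n) <= (\<Sum>n=1..N. 1)" by (rule sum_norm_le) (rule b)
  thus ?thesis using True by simp
 next
  case False
  then obtain M where M: "N = q + M" using le_Suc_ex not_less by blast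
  have "(\<Sum>n=1..q + M. f n) = (\<Sum>n=1..q. f n) + (\<Sum>n=1..M. f n)"
   by (induction M) (simp_all add: per[of "Suc _", simplified] add.commute[of q])
  thus ?thesis using less[of M] M z q by simp
 qed
qed

lemma card_coprime_lessThan:
 assumes "q > 0"
 shows "card {n \<in> {..<q}. coprime n q} = totient q"
proof (cases "q = 1")
 case False
 have "{n \<in> {..<q}. coprime n q} = totatives q"
 proof (rule Set.set_eqI)
  fix n
  have "n = 0 ==> \<not> coprime n q" "n = q ==> \<not> coprime n q" using False by auto
  thus "n \<in> {n \<in> {..<q}. coprime n q} \<longleftrightarrow> n \<in> totatives q"
   by (auto simp: totatives_def intro: Nat.gr0I le_neq_implies_less)
 qed
 thus ?thesis by (simp add: totient_def)
qed (auto simp: lessThan_Suc)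

text \<open>For \<open>n\<close> not congruent to 1, multiplication by a character that separates
  \<open>n\<close> from 1 permutes the characters and forces the sum to vanish. The number of
  characters is then found by summing over \<open>n < q\<close> in both orders: only the residue 1
  contributes on one side, only the principal character on the other.\<close>

lemma dchar_orthogonality:
 assumes q: "q > 0"
 shows "(\<Sum>X | dchar q X. X n) = (if [n = 1] (mod q) then of_nat (totient q) else 0)"
proof -
 define C where "C = {X. dchar q X}"
 have fin: "finite C" using finite_dchars by (simp add: C_def)
 have zero: "(\<Sum>X\<in>C. X g) = 0" if g: "\<not> [g = 1] (mod q)" for g
 proof (cases "coprime g q")
  case True
  obtain Y where Y: "dchar q Y" "Y g ~= 1" using dchar_separate[OF q True g] by blast
  define m where "m = (%X n. Y n * X n :: complex)"
  have mC: "m X \<in> C" if "X \<in> C" for X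
   using that Y(1) by (auto simp: C_def m_def dchar_def)
  have inj: "inj_on m C"
  proof (rule inj_onI)
   fix X Z assume *: "X \<in> C" "Z \<in> C" "m X = m Z"
   show "X = Z"
   proof
    fix n
    have "Y n * X n = Y n * Z n" using *(3) unfolding m_def by meson
    thus "X n = Z n" using * Y(1) dcharD(4)[of q X n] dcharD(4)[of q Z n] dcharD(4)[of q Y n] by (auto simp: C_def)
   qed
  qed
  have "bij_betw m C C" using inj mC fin by (intro bij_betw_imageI endo_inj_surj) auto
  hence "(\<Sum>X\<in>C. X g) = (\<Sum>X\<in>C. m X g)" by (rule sum.reindex_bij_betw[symmetric])
  also have "... = Y g * (\<Sum>X\<in>C. X g)" by (simp add: m_def sum_distrib_left)
  finally have "(Y g - 1) * (\<Sum>X\<in>C. X g) = 0" by (simp add: algebra_simps)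
  thus ?thesis using Y(2) by auto
 qed (auto simp: C_def dchar_def intro: sum.neutral)
 have one: "(\<Sum>X\<in>C. X g) = of_nat (card C)" if "[g = 1] (mod q)" for g
 proof -
  have "X g = 1" if "X \<in> C" for X
   using dchar_cong[of q X g 1] that \<open>[g = 1] (mod q)\<close> by (simp add: C_def)
  hence "(\<Sum>X\<in>C. X g) = (\<Sum>X\<in>C. 1)" by (intro sum.cong) auto
  thus ?thesis by simp
 qed
 have "(\<Sum>n<q. \<Sum>X\<in>C. X n) = (\<Sum>n<q. if n = 1 mod q then of_nat (card C) else 0)"
 proof (rule sum.cong[OF refl])
  fix n assume "n \<in> {..<q}"
  hence "[n = 1] (mod q) \<longleftrightarrow> n = 1 mod q" by (simp add: cong_def)
  thus "(\<Sum>X\<in>C. X n) = (if n = 1 mod q then of_nat (card C) else 0)"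
   using zero[of n] one[of n] by presburger
 qed
 also have "... = of_nat (card C)" using q by (simp add: sum.delta)
 finally have 1: "(\<Sum>n<q. \<Sum>X\<in>C. X n) = of_nat (card C)" .
 have "(\<Sum>n<q. \<Sum>X\<in>C. X n) = (\<Sum>X\<in>C. \<Sum>n<q. X n)" by (rule sum.swap)
 also have "... = (\<Sum>X\<in>C. if X = dprin q then of_nat (totient q) else 0)"
 proof (rule sum.cong[OF refl])
  fix X assume "X \<in> C"
  have "(\<Sum>n<q. dprin q n) = of_nat (card {n\<in>{..<q}. coprime n q})"
   by (simp add: dprin_def sum.If_cases Int_def del: of_nat_eq_iff)
  also have "card {n\<in>{..<q}. coprime n q} = totient q"
   using card_coprime_lessThan[OF q] .
  finally show "(\<Sum>n<q. X n) = (if X = dprin q then of_nat (totient q) else 0)"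
   using dchar_sum_period[of q X] \<open>X \<in> C\<close> unfolding C_def by (cases "X = dprin q") (simp_all)
 qed
 also have "... = of_nat (totient q)" using fin dchar_prin[OF q] by (subst sum.delta) (simp_all add: C_def)
 finally have "(of_nat (card C) :: complex) = of_nat (totient q)" using 1 by (simp only:)
 hence "card C = totient q" by (simp only: of_nat_eq_iff)
 thus ?thesis using zero[of n] one[of n] unfolding C_def by presburger
qed

section \<open>Dirichlet series\<close>

text \<open>Absolute convergence turns the product into an unordered sum over pairs, which is
  regrouped along the products \<open>n = a * b\<close>. The value at 0 is required to vanish
  because 0 has infinitely many divisors.\<close>

lemma dirichlet_product:
 fixes F G H :: "nat => complex"
 assumes F: "F 0 = 0" "summable (%n. norm (F n))" and G: "G 0 = 0" "summable (%n. norm (G n))"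
  and H: "H 0 = 0" "!!n. n > 0 ==> H n = (\<Sum>d | d dvd n. F d * G (n div d))"
 shows "summable (%n. norm (H n))" and "suminf H = suminf F * suminf G"
proof -
 define P where "P = (%(a, b). F a * G b)"
 have Fs: "(F has_sum suminf F) UNIV" and Gs: "(G has_sum suminf G) UNIV"
  using F G by (auto intro!: norm_summable_imp_has_sum summable_sums summable_norm_cancel)
 have Gn: "(%n. norm (G n)) summable_on UNIV" and Fn: "(%n. norm (F n)) summable_on UNIV"
  using F G by (auto intro!: norm_summable_imp_summable_on)
 have "(%x. norm (P x)) summable_on (UNIV \<times> UNIV)"
 proof (subst Infinite_Sum.abs_summable_on_Sigma_iff, intro conjI ballI)
  fix a show "(%b. norm (P (a, b))) summable_on UNIV"
   using summable_on_cmult_right[OF Gn, of "norm (F a)"] by (simp add: P_def norm_mult)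
 next
  have "(%a. norm (F a) * infsum (%b. norm (G b)) UNIV) summable_on UNIV"
   by (rule summable_on_cmult_left[OF Fn])
  thus "(%a. norm (infsum (%b. norm (P (a, b))) UNIV)) summable_on UNIV"
   by (simp add: P_def norm_mult infsum_cmult_right' infsum_nonneg)
 qed
 hence "P summable_on (UNIV \<times> UNIV)" by (rule Infinite_Sum.abs_summable_summable)
 then obtain S where S: "(P has_sum S) (UNIV \<times> UNIV)" by (auto simp: summable_on_def)
 have "((%a. F a * suminf G) has_sum S) UNIV"
  by (rule has_sum_SigmaD[OF S]) (auto simp: P_def intro: has_sum_cmult_right[OF Gs])
 moreover have "((%a. F a * suminf G) has_sum (suminf F * suminf G)) UNIV"
  by (rule has_sum_cmult_left[OF Fs])
 ultimately have S_eq: "S = suminf F * suminf G" by (rule has_sum_unique)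
 have "(P has_sum S) ({0<..} \<times> {0<..})"
  using S by (rule has_sum_cong_neutral[THEN iffD1, rotated -1]) (auto simp: P_def F G intro!: Nat.gr0I)
 also have "(P has_sum S) ({0<..} \<times> {0<..}) \<longleftrightarrow>
   ((%(n, d). F d * G (n div d)) has_sum S) (SIGMA n:{0<..}. {d. d dvd n})"
  by (rule has_sum_reindex_bij_witness[of _ "%(n, d). (d, n div d)" "%(a, b). (a * b, a)"])
    (auto simp: P_def elim!: dvdE intro: Nat.gr0I)
 finally have "((%(n, d). F d * G (n div d)) has_sum S) (SIGMA n:{0<..}. {d. d dvd n})" .
 hence "(H has_sum S) {0<..}"
 proof (rule has_sum_SigmaD)
  fix n :: nat assume "n \<in> {0<..}"
  thus "((%d. case (n, d) of (n, d) => F d * G (n div d)) has_sum H n) {d. d dvd n}"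
   using has_sum_finite[of "{d. d dvd n}" "%d. F d * G (n div d)"] by (simp add: H(2))
 qed
 hence HS: "(H has_sum S) UNIV"
  by (rule has_sum_cong_neutral[THEN iffD1, rotated -1]) (use H(1) in auto)
 show "suminf H = suminf F * suminf G" using sums_unique[OF has_sum_imp_sums[OF HS]] S_eq by (simp only:)
 have "H summable_on UNIV" using HS by (auto simp: summable_on_def)
 hence "(%n. norm (H n)) summable_on UNIV" using summable_on_iff_abs_summable_on_complex by blast
 thus "summable (%n. norm (H n))" by (rule summable_on_imp_summable)
qed

text \<open>Reindexing the multiples of \<open>p\<close> as \<open>p * m\<close> gives a linear
  relation between the full sum and the part prime to \<open>p\<close>. With separate factors
  \<open>c\<close> and \<open>d\<close> the Euler factor at \<open>p\<close> is 1 + d/(1 - c);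
  completely multiplicative functions have \<open>c = d\<close>, while the coefficients of Stephens'
  constant need both.\<close>

lemma suminf_coprime_part:
 fixes g :: "nat => complex"
 assumes g: "summable (%n. norm (g n))" and p: "p > 0"
  and mul: "!!n. g (p * n) = (if p dvd n then c else d) * g n"
 shows "(1 - c + d) * (\<Sum>n. if p dvd n then 0 else g n) = (1 - c) * suminf g"
proof -
 define S S0 where "S = suminf g" and "S0 = (\<Sum>n. if p dvd n then 0 else g n)"
 have gs: "summable g" using g by (rule summable_norm_cancel)
 have mono: "strict_mono (%m. p * m)" using p by (auto simp: strict_mono_def)
 have z: "(if p dvd n then g n else 0) = 0" if "n \<notin> range (%m. p * m)" for n
  using that by (auto elim: dvdE)
 have s0: "summable (%n. if p dvd n then 0 else g n)"
  by (rule summable_comparison_test'[OF g, of 0]) auto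
 have 1: "(%m. c * g m - (c - d) * (if p dvd m then 0 else g m)) sums (c * S - (c - d) * S0)"
  unfolding S_def S0_def by (intro sums_diff sums_mult summable_sums gs s0)
 have 2: "(%m. g (p * m)) = (%m. c * g m - (c - d) * (if p dvd m then 0 else g m))"
  unfolding fun_eq_iff mul by (auto simp: algebra_simps)
 have "(%n. if p dvd n then g n else 0) sums (c * S - (c - d) * S0)"
  using sums_mono_reindex[OF mono, of "%n. if p dvd n then g n else 0"] z 1[folded 2] by simp
 from sums_diff[OF summable_sums[OF gs] this]
 have "(%n. g n - (if p dvd n then g n else 0)) sums (S - (c * S - (c - d) * S0))" unfolding S_def .
 moreover have "(%n. g n - (if p dvd n then g n else 0)) = (%n. if p dvd n then 0 else g n)" by auto
 ultimately have "S0 = S - (c * S - (c - d) * S0)" unfolding S0_def by (simp only: sums_iff)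
 thus ?thesis unfolding S_def[symmetric] S0_def[symmetric] by (simp add: algebra_simps)
qed

section \<open>Euler products\<close>

lemma euler_finite_general:
 fixes f :: "nat => complex"
 assumes f: "summable (%n. norm (f n))"
  and mul: "!!p n. prime p ==> f (p * n) = (if p dvd n then c p else d p) * f n"
  and P: "finite P" "!!p. p \<in> P ==> prime p"
 shows "(\<Prod>p\<in>P. 1 - c p) * suminf f = (\<Prod>p\<in>P. 1 - c p + d p) * (\<Sum>n. if \<exists>p\<in>P. p dvd n then 0 else f n)"
 using P
proof (induction P rule: finite_induct)
 case (insert p P)
 define g where "g = (%n. if \<exists>p\<in>P. p dvd n then 0 else f n)"
 have p: "prime p" using insert by auto
 have gm: "g (p * n) = (if p dvd n then c p else d p) * g n" for n
 proof -
  have "r dvd p * n \<longleftrightarrow> r dvd n" if "r \<in> P" for r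
  proof -
   have r: "prime r" "r ~= p" using that insert by auto
   hence "\<not> r dvd p" using p primes_dvd_imp_eq by blast
   thus ?thesis using r by (simp add: prime_dvd_mult_iff)
  qed
  hence "(\<exists>r\<in>P. r dvd p * n) \<longleftrightarrow> (\<exists>r\<in>P. r dvd n)" by blast
  thus ?thesis unfolding g_def mul[OF p] by simp
 qed
 have gs: "summable (%n. norm (g n))"
  by (rule summable_comparison_test'[OF f]) (auto simp: g_def)
 have e: "(%n. if \<exists>p\<in>insert p P. p dvd n then 0 else f n) = (%n. if p dvd n then 0 else g n)"
  by (auto simp: g_def)
 have "(\<Prod>p\<in>insert p P. 1 - c p) * suminf f = (\<Prod>p\<in>P. 1 - c p + d p) * ((1 - c p) * suminf g)"
  using insert by (simp add: g_def mult.assoc)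
 also have "(1 - c p) * suminf g = (1 - c p + d p) * (\<Sum>n. if p dvd n then 0 else g n)"
  by (rule suminf_coprime_part[OF gs prime_gt_0_nat[OF p] gm, symmetric])
 finally show ?case unfolding e prod.insert[OF insert.hyps] by (simp only: mult_ac)
qed simp

lemma euler_finite:
 fixes f :: "nat => complex"
 assumes f: "summable (%n. norm (f n))" and mul: "!!m n. f (m * n) = f m * f n"
  and P: "finite P" "!!p. p \<in> P ==> prime p"
 shows "(\<Prod>p\<in>P. 1 - f p) * suminf f = (\<Sum>n. if \<exists>p\<in>P. p dvd n then 0 else f n)"
 using euler_finite_general[OF f _ P, of f f] mul by simp

text \<open>An index above 1 without prime factors up to \<open>y\<close> exceeds \<open>y\<close>,
  so apart from \<open>f 1\<close> only a tail of the absolutely convergent series remains.\<close>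

lemma suminf_rough_tendsto:
 fixes f :: "nat => complex"
 assumes f: "summable (%n. norm (f n))" and f0: "f 0 = 0"
 shows "(%y. \<Sum>n. if \<exists>p\<in>{p. prime p \<and> p <= y}. p dvd n then 0 else f n) \<longlonglongrightarrow> f 1"
proof -
 define g where "g = (%y n. if \<exists>p\<in>{p. prime p \<and> p <= y}. p dvd n then 0 else f n)"
 have gs: "summable (%n. norm (g y n))" for y
  by (rule summable_comparison_test'[OF f]) (auto simp: g_def)
 have g0: "g y n = 0" if n: "n ~= 1" "n < Suc y" for y n
 proof (cases "n = 0")
  case False
  obtain p where "prime p" "p dvd n" using n prime_factor_nat by blast
  moreover have "p <= n" using calculation False by (auto dest: dvd_imp_le)
  ultimately show ?thesis using n by (auto simp: g_def intro!: bexI[of _ p])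
 qed (simp add: g_def f0)
 have g1: "g y 1 = f 1" for y by (auto simp: g_def)
 have bd: "norm (suminf (g y) - f 1) <= (\<Sum>n. norm (f (n + Suc y)))" if "y >= 1" for y
 proof -
  have "suminf (g y) = (\<Sum>n. g y (n + Suc y)) + (\<Sum>n<Suc y. g y n)"
   by (rule suminf_split_initial_segment[OF summable_norm_cancel[OF gs]])
  also have "(\<Sum>n<Suc y. g y n) = (\<Sum>n\<in>{1}. g y n)"
   using that g0 by (intro sum.mono_neutral_right) auto
  finally have "suminf (g y) - f 1 = (\<Sum>n. g y (n + Suc y))" using g1 by simp
  also have "norm ... <= (\<Sum>n. norm (g y (n + Suc y)))"
   using gs by (intro summable_norm summable_ignore_initial_segment)
  also have "... <= (\<Sum>n. norm (f (n + Suc y)))"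
   by (intro suminf_le summable_ignore_initial_segment gs f) (auto simp: g_def)
  finally show ?thesis .
 qed
 have tail: "(%y. \<Sum>n. norm (f (n + Suc y))) \<longlonglongrightarrow> 0"
  using LIMSEQ_Suc[OF suminf_exist_split2[OF f]] by simp
 have "(%y. suminf (g y) - f 1) \<longlonglongrightarrow> 0"
  by (rule Lim_null_comparison[OF _ tail]) (use bd in \<open>auto simp: eventually_at_top_linorder\<close>)
 thus ?thesis unfolding g_def using LIM_zero_iff by blast
qed

lemma euler_product_tendsto:
 fixes f :: "nat => complex"
 assumes f: "summable (%n. norm (f n))" and mul: "!!m n. f (m * n) = f m * f n"
  and "f 0 = 0" "f 1 = 1"
 shows "(%y. (\<Prod>p | prime p \<and> p <= y. 1 - f p) * suminf f) \<longlonglongrightarrow> 1"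
 using suminf_rough_tendsto[OF f] assms(3,4) by (subst euler_finite[OF f mul]) auto

section \<open>Dirichlet series in the half-plane of absolute convergence\<close>

definition ds :: "(nat => complex) => complex => complex" where
 "ds a s = (\<Sum>n. a n * of_nat n powr (- s))"

text \<open>Real exponents suffice because the modulus of \<open>of_nat n powr (- s)\<close> depends
  on \<open>Re s\<close> only.\<close>

definition dsum :: "(nat => complex) => bool" where
 "dsum a \<longleftrightarrow> (\<forall>u>1. summable (%n. norm (a n) * real n powr (- u)))"

lemma dsumD: "dsum a ==> u > 1 ==> summable (%n. norm (a n) * real n powr (- u))"
 by (simp add: dsum_def)

lemma norm_nat_powr: "norm (of_nat n powr (- s) :: complex) = real n powr (- Re s)"
 by (cases "n = 0") (simp_all add: norm_powr_real_powr)

lemma ds_summable_norm: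
 assumes "dsum a" "Re s > 1"
 shows "summable (%n. norm (a n * of_nat n powr (- s)))"
 using assms by (simp add: dsum_def norm_mult norm_nat_powr)

lemma ds_summable: "dsum a ==> Re s > 1 ==> summable (%n. a n * of_nat n powr (- s))"
 by (rule summable_norm_cancel[OF ds_summable_norm])

lemma ds_sums: "dsum a ==> Re s > 1 ==> (%n. a n * of_nat n powr (- s)) sums ds a s"
 unfolding ds_def by (rule summable_sums[OF ds_summable])

lemma dsum_le:
 assumes "dsum a" "!!n. n > 0 ==> norm (b n) <= c * norm (a n)"
 shows "dsum b"
 unfolding dsum_def
proof (intro allI impI)
 fix u :: real assume "u > 1"
 hence "summable (%n. c * (norm (a n) * real n powr (- u)))"
  by (intro summable_mult dsumD[OF assms(1)])
 thus "summable (%n. norm (b n) * real n powr (- u))"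
 proof (rule summable_comparison_test'[where N = 0])
  fix n :: nat
  show "norm (norm (b n) * real n powr (- u)) <= c * (norm (a n) * real n powr (- u))" using mult_right_mono[OF assms(2)[of n], of "real n powr (- u)"]
   by (cases "n = 0") (simp_all add: mult.assoc)
 qed
qed

lemma dsum_1: "dsum (%n. 1)"
 by (auto simp: dsum_def summable_real_powr_iff)

lemma dsum_bounded: "(!!n. norm (a n) <= c) ==> dsum a"
 by (rule dsum_le[OF dsum_1, of _ c]) auto

lemma dsum_ln:
 assumes "dsum a"
 shows "dsum (%n. a n * of_real (ln (real n)))"
 unfolding dsum_def
proof (intro allI impI)
 fix u :: real assume s: "u > 1"
 define h where "h = (u - 1) / 2"
 have d: "h > 0" "u - h > 1" using s by (auto simp: h_def field_simps)
 have "summable (%n. (1 / h) * (norm (a n) * real n powr (- (u - h))))"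
  by (intro summable_mult dsumD[OF assms]) (use d in auto)
 thus "summable (%n. norm (a n * complex_of_real (ln (real n))) * real n powr (- u))"
 proof (rule summable_comparison_test'[where N = 0])
  fix n :: nat
  show "norm (norm (a n * complex_of_real (ln (real n))) * real n powr (- u)) <= (1 / h) * (norm (a n) * real n powr (- (u - h)))"
  proof (cases "n = 0")
   case False
   have "ln (real n) <= real n powr h / h" using ln_powr_bound[of "real n" h] False d by simp
   hence "\<bar>ln (real n)\<bar> * real n powr (- u) <= real n powr h / h * real n powr (- u)"
    using False by (intro mult_right_mono) auto
   also have "... = (1 / h) * real n powr (- (u - h))" using False by (simp add: powr_add[symmetric])
   finally have "norm (a n) * (\<bar>ln (real n)\<bar> * real n powr (- u)) <= norm (a n) * ((1 / h) * real n powr (- (u - h)))"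
    by (rule mult_left_mono) simp
   thus ?thesis by (simp add: norm_mult abs_mult mult_ac)
  qed simp
 qed
qed

lemma dsum_add: "dsum a ==> dsum b ==> dsum (%n. a n + b n)"
proof -
 assume a: "dsum a" and b: "dsum b"
 show ?thesis unfolding dsum_def
 proof (intro allI impI)
  fix u :: real assume s: "u > 1"
  have "summable (%n. norm (a n) * real n powr (- u) + norm (b n) * real n powr (- u))"
   using a b s by (intro summable_add) (simp_all add: dsum_def)
  thus "summable (%n. norm (a n + b n) * real n powr (- u))"
   by (rule summable_comparison_test'[where N = 0])
    (simp add: distrib_right[symmetric] abs_mult mult_right_mono norm_triangle_ineq)
 qed
qed

lemma dsum_cmult: "dsum a ==> dsum (%n. c * a n)"
 by (rule dsum_le[of a _ "norm c"]) (simp_all add: norm_mult)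

lemma ds_add: "dsum a ==> dsum b ==> Re s > 1 ==> ds (%n. a n + b n) s = ds a s + ds b s"
 unfolding ds_def by (subst suminf_add) (simp_all add: ds_summable distrib_right)

lemma ds_cmult: "dsum a ==> Re s > 1 ==> ds (%n. c * a n) s = c * ds a s"
 unfolding ds_def by (subst suminf_mult[symmetric]) (simp_all add: ds_summable mult.assoc)

lemma ds_has_field_derivative:
 assumes a: "dsum a" and s: "Re s > 1"
 shows "(ds a has_field_derivative - ds (%n. a n * of_real (ln (real n))) s) (at s)"
proof -
 define u where "u = (1 + Re s) / 2"
 have u: "u > 1" "u < Re s" using s by (auto simp: u_def)
 define S where "S = {z. Re z > u}"
 define f' where "f' = (%n z. - (a n * of_real (ln (real n)) * of_nat n powr (- z)))"
 have open_S: "open S" unfolding S_def by (rule open_halfspace_Re_gt)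
 have "convex S" unfolding S_def by (rule convex_halfspace_Re_gt)
 have 1: "((%z. a n * of_nat n powr (- z)) has_field_derivative f' n z) (at z within S)" for n z
 proof (cases "n = 0")
  case False
  have l: "Ln (of_nat n) = of_real (ln (real n))" using False by (simp add: Ln_of_nat)
  show ?thesis unfolding f'_def
   using False by (auto simp: powr_def l intro!: derivative_eq_intros)
 qed (simp add: f'_def)
 have 2: "uniformly_convergent_on S (%n z. \<Sum>i<n. f' i z)"
 proof (rule Weierstrass_m_test'[where M = "%n. norm (a n * of_real (ln (real n))) * real n powr (- u)"])
  show "summable (%n. norm (a n * complex_of_real (ln (real n))) * real n powr - u)"
   using dsum_ln[OF a] u by (simp add: dsum_def)
  fix n z assume "z \<in> S"
  show "norm (f' n z) <= norm (a n * complex_of_real (ln (real n))) * real n powr - u"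
  proof (cases "n = 0")
   case False
   have "real n powr (- Re z) <= real n powr (- u)" using \<open>z \<in> S\<close> False by (intro powr_mono) (auto simp: S_def)
   thus ?thesis by (simp add: f'_def norm_mult norm_nat_powr mult_left_mono)
  qed (simp add: f'_def)
 qed
 have "s \<in> S" using u by (simp add: S_def)
 have "((%z. \<Sum>n. a n * of_nat n powr (- z)) has_field_derivative (\<Sum>n. f' n s)) (at s)"
  by (rule has_field_derivative_series'(2)[OF \<open>convex S\<close> 1 2 \<open>s \<in> S\<close> ds_summable[OF a s]])
    (use open_S \<open>s \<in> S\<close> in \<open>simp_all add: interior_open\<close>)
 also have "(\<Sum>n. f' n s) = - ds (%n. a n * of_real (ln (real n))) s"
  unfolding ds_def f'_def by (rule suminf_minus) (rule ds_summable[OF dsum_ln[OF a] s])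
 finally show ?thesis unfolding ds_def .
qed

lemma ds_higher_deriv:
 assumes a: "dsum a" and s: "Re s > 1"
 shows "(deriv ^^ k) (ds a) s = (-1) ^ k * ds (%n. a n * of_real (ln (real n)) ^ k) s"
 using a s
proof (induction k arbitrary: a s)
 case (Suc k)
 define b where "b = (%n. a n * of_real (ln (real n)))"
 have b: "dsum b" unfolding b_def by (rule dsum_ln[OF Suc.prems(1)])
 have "(deriv ^^ Suc k) (ds a) s = (deriv ^^ k) (deriv (ds a)) s" by (simp only: funpow_Suc_right o_def)
 also have "... = (deriv ^^ k) (%z. - ds b z) s"
 proof (rule higher_deriv_cong_ev[OF _ refl])
  have "eventually (%z. Re z > 1) (nhds s)"
   using Suc.prems(2) open_halfspace_Re_gt[of 1] by (auto simp: eventually_nhds)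
  thus "eventually (%z. deriv (ds a) z = - ds b z) (nhds s)"
   by eventually_elim (auto simp: b_def intro!: DERIV_imp_deriv ds_has_field_derivative Suc.prems)
 qed
 also have "... = (deriv ^^ k) (ds (%n. - b n)) s"
 proof (rule higher_deriv_cong_ev[OF _ refl])
  have "eventually (%z. Re z > 1) (nhds s)"
   using Suc.prems(2) open_halfspace_Re_gt[of 1] by (auto simp: eventually_nhds)
  thus "eventually (%z. - ds b z = ds (%n. - b n) z) (nhds s)"
   by eventually_elim (use ds_cmult[OF b, of _ "-1"] in simp)
 qed
 also have "... = (-1) ^ k * ds (%n. - b n * of_real (ln (real n)) ^ k) s"
  using dsum_cmult[OF b, of "-1"] Suc.prems(2) by (intro Suc.IH) simp_all
 also have "(%n. - b n * of_real (ln (real n)) ^ k) = (%n. (-1) * (a n * of_real (ln (real n)) ^ Suc k))"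
  by (simp add: b_def mult_ac fun_eq_iff)
 also have "ds ... s = (-1) * ds (%n. a n * of_real (ln (real n)) ^ Suc k) s"
 proof (rule ds_cmult[OF _ Suc.prems(2)])
  have "dsum (%n. a n * of_real (ln (real n)) ^ j)" for j
  proof (induction j)
   case (Suc j)
   show ?case using dsum_ln[OF Suc] by (simp add: mult_ac)
  qed (simp add: Suc.prems)
  thus "dsum (%n. a n * of_real (ln (real n)) ^ Suc k)" .
 qed
 finally show ?case by simp
qed simp

lemma dsum_ln_power:
 assumes "dsum a"
 shows "dsum (%n. a n * of_real (ln (real n)) ^ k)"
proof (induction k)
 case (Suc k)
 show ?case using dsum_ln[OF Suc] by (simp add: mult_ac)
qed (simp add: assms)

lemma ds_mult:
 assumes a: "dsum a" and b: "dsum b"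
  and c: "!!n. n > 0 ==> c n = (\<Sum>d | d dvd n. a d * b (n div d))"
 shows "dsum c" and "Re s > 1 ==> ds c s = ds a s * ds b s"
proof -
 have *: "summable (%n. norm (c n * of_nat n powr (- s)))" "ds c s = ds a s * ds b s"
  if s: "Re s > 1" for s
 proof -
  have "c n * of_nat n powr (- s) = (\<Sum>d | d dvd n. a d * of_nat d powr (- s) * (b (n div d) * of_nat (n div d) powr (- s)))"
   if n: "n > 0" for n
  proof -
  have "a d * b (n div d) * of_nat n powr (- s) = a d * of_nat d powr (- s) * (b (n div d) * of_nat (n div d) powr (- s))"
   if "d dvd n" for d
  proof -
   have "n = d * (n div d)" using that by simp
   hence "(of_nat n :: complex) powr (- s) = (of_nat d * of_nat (n div d)) powr (- s)" by (metis of_nat_mult)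
   also have "... = of_nat d powr (- s) * of_nat (n div d) powr (- s)"
    by (subst powr_times_real) simp_all
   finally show ?thesis by (simp add: mult_ac)
  qed
  hence "(\<Sum>d | d dvd n. a d * b (n div d) * of_nat n powr (- s)) =
    (\<Sum>d | d dvd n. a d * of_nat d powr (- s) * (b (n div d) * of_nat (n div d) powr (- s)))"
   by (intro sum.cong) auto
  thus ?thesis unfolding c[OF n] sum_distrib_right .
  qed
  from dirichlet_product[OF _ ds_summable_norm[OF a s] _ ds_summable_norm[OF b s] _ this]
  show "summable (%n. norm (c n * of_nat n powr (- s)))" "ds c s = ds a s * ds b s"
   by (simp_all add: ds_def)
 qed
 show "dsum c" unfolding dsum_def
  using *(1)[of "of_real _"] by (auto simp: norm_mult norm_nat_powr)
 show "Re s > 1 ==> ds c s = ds a s * ds b s" by (rule *)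
qed

lemma dsum_mangoldt: "dsum (%n. mangoldt n * a n)" if "!!n. norm (a n) <= 1"
proof (rule dsum_le[OF dsum_ln[OF dsum_1], of _ 1])
 fix n :: nat assume n: "n > 0"
 have "norm (mangoldt n * a n) <= mangoldt n * 1"
  unfolding norm_mult using that mangoldt_nonneg by (intro mult_mono) auto
 also have "... <= ln (real n)" using mangoldt_le[OF n] by simp
 also have "... <= \<bar>ln (real n)\<bar>" by simp
 finally show "norm (mangoldt n * a n) <= 1 * norm (1 * complex_of_real (ln (real n)))" by simp
qed

text \<open>The identity ln = Lambda * 1 of Dirichlet convolution, twisted by the completely
  multiplicative \<open>a\<close>. It is the formula for the logarithmic derivative without a
  division, so it asks for no information about zeros.\<close>

lemma ds_mangoldt:
 assumes bd: "!!n. norm (a n) <= 1" and mul: "!!m n. a (m * n) = a m * a n" and s: "Re s > 1"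
 shows "ds (%n. a n * of_real (ln (real n))) s = ds (%n. mangoldt n * a n) s * ds a s"
proof (rule ds_mult(2)[OF dsum_mangoldt[OF bd] dsum_bounded[OF bd] _ s])
 fix n :: nat assume n: "n > 0"
 have "(\<Sum>d | d dvd n. mangoldt d * a d * a (n div d)) = (\<Sum>d | d dvd n. mangoldt d * a n)"
  by (rule sum.cong[OF refl]) (auto simp: mul[symmetric] mult.assoc)
 also have "... = a n * of_real (ln (real n))"
  using mangoldt_sum[of n, where ?'a = complex] n by (simp add: sum_distrib_right[symmetric] mult.commute)
 finally show "a n * of_real (ln (real n)) = (\<Sum>d | d dvd n. mangoldt d * a d * a (n div d))" ..
qed

section \<open>Continuation to the right half-plane\<close>

lemma powr_has_vector_derivative:
 assumes "u > 0"
 shows "((%u. of_real u powr s) has_vector_derivative (s * of_real u powr (s - 1) :: complex)) (at u within A)"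
proof -
 have *: "complex_of_real u \<notin> \<real>\<^sub>\<le>\<^sub>0" using assms by simp
 have "((%z. z powr s) has_field_derivative s * of_real u powr (s - 1)) (at (of_real u))"
  using * by (intro has_field_derivative_powr) 
 thus ?thesis
  using has_vector_derivative_real_field[of "%z. z powr s"] by simp
qed

lemma norm_real_powr: "u > 0 ==> norm (of_real u powr s :: complex) = u powr Re s"
 by (simp add: norm_powr_real_powr)

text \<open>The derivative of \<open>u powr (- s)\<close> has modulus equal to the derivative of
  \<open>- (norm s / Re s) * u powr (- Re s)\<close>. Keeping the right side as a difference lets
  sums over consecutive integers telescope.\<close>

lemma powr_diff_bound:
 fixes s :: complex
 assumes a: "0 < a" "a <= b" and s: "Re s > 0"
 shows "norm (of_real a powr (- s) - of_real b powr (- s)) <= norm s / Re s * (a powr (- Re s) - b powr (- Re s))"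
proof (cases "a = b")
 case False
 hence ab: "a < b" using a by simp
 define \<phi> where "\<phi> = (%u. - (norm s / Re s * u powr (- Re s)))"
 have 1: "((%u. of_real u powr (- s)) has_vector_derivative (- s * of_real u powr (- s - 1))) (at u within A)"
  if "u > 0" for u A using that by (rule powr_has_vector_derivative)
 have 2: "(\<phi> has_vector_derivative (norm s * u powr (- Re s - 1))) (at u within A)" if "u > 0" for u A
  unfolding \<phi>_def has_real_derivative_iff_has_vector_derivative[symmetric]
  using that s by (auto intro!: derivative_eq_intros)
 have "norm (of_real b powr (- s) - of_real a powr (- s)) <= \<phi> b - \<phi> a"
 proof (rule differentiable_bound_general[OF ab])
  show "continuous_on {a..b} \<phi>"
   by (rule continuous_on_vector_derivative[OF 2]) (use a in auto)
  show "continuous_on {a..b} (%u. of_real u powr (- s) :: complex)"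
   by (rule continuous_on_vector_derivative[OF 1]) (use a in auto)
  fix u assume u: "a < u" "u < b"
  show "((%u. of_real u powr (- s)) has_vector_derivative (- s * of_real u powr (- s - 1))) (at u)"
   using 1 u a by auto
  show "(\<phi> has_vector_derivative (norm s * u powr (- Re s - 1))) (at u)" using 2 u a by auto
  show "norm (- s * of_real u powr (- s - 1)) <= norm s * u powr (- Re s - 1)"
   using u a by (simp add: norm_mult norm_real_powr)
 qed
 thus ?thesis by (simp add: \<phi>_def norm_minus_commute algebra_simps)
qed simp

lemma real_powr_diff_le:
 fixes a b v :: real
 assumes "0 < a" "a <= b" "v > 0"
 shows "a powr (- v) - b powr (- v) <= v * (b - a) * a powr (- v - 1)"
proof (cases "a = b")
 case False
 have "\<exists>z>a. z < b \<and> b powr (- v) - a powr (- v) = (b - a) * (- v * z powr (- v - 1))"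
  using assms False by (intro MVT2) (auto intro!: derivative_eq_intros)
 then obtain z where z: "z > a" "z < b" "b powr (- v) - a powr (- v) = (b - a) * (- v * z powr (- v - 1))"
  by blast
 have "z powr (- v - 1) <= a powr (- v - 1)" using z assms by (intro powr_mono2') auto
 hence "v * (b - a) * z powr (- v - 1) <= v * (b - a) * a powr (- v - 1)"
  using assms by (intro mult_left_mono) auto
 thus ?thesis using z by (simp add: algebra_simps)
qed simp

definition npow :: "nat => complex => complex" where "npow n s = of_nat n powr (- s)"

lemma norm_npow: "norm (npow n s) = real n powr (- Re s)"
 by (simp add: npow_def norm_nat_powr)

lemma npow_diff_bound:
 assumes "n > 0" "Re s > 0"
 shows "norm (npow n s - npow (Suc n) s) <= norm s / Re s * (real n powr (- Re s) - real (Suc n) powr (- Re s))"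
 using powr_diff_bound[of "real n" "real (Suc n)" s] assms by (simp add: npow_def)

lemma npow_diff_bound':
 assumes "n > 0" "Re s > 0"
 shows "norm (npow n s - npow (Suc n) s) <= norm s * real n powr (- Re s - 1)"
proof -
 have "norm s / Re s * (real n powr (- Re s) - real (Suc n) powr (- Re s)) <= norm s / Re s * (Re s * real n powr (- Re s - 1))"
  using real_powr_diff_le[of "real n" "real (Suc n)" "Re s"] assms by (intro mult_left_mono) auto
 thus ?thesis using npow_diff_bound[OF assms] assms by simp
qed

lemma holomorphic_npow [holomorphic_intros]:
 assumes "f holomorphic_on A"
 shows "(%s. npow n (f s)) holomorphic_on A"
proof (cases "n = 0")
 case False
 hence "(%s. npow n (f s)) = (%s. exp (- f s * of_real (ln (real n))))"
  by (simp add: npow_def powr_def Ln_of_nat)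
 thus ?thesis using assms by (auto intro!: holomorphic_intros)
qed (simp add: npow_def)

lemma holomorphic_suminf:
 fixes f :: "nat => complex => complex"
 assumes S: "open S" and hol: "!!n. f n holomorphic_on S"
  and M: "!!z. z \<in> S ==> \<exists>d>0. cball z d \<subseteq> S \<and> (\<exists>M. summable M \<and> (\<forall>n. \<forall>w\<in>cball z d. norm (f n w) <= M n))"
 shows "(%z. \<Sum>n. f n z) holomorphic_on S"
proof (rule holomorphic_uniform_sequence[OF S, where f = "%N z. \<Sum>n<N. f n z"])
 show "(%z. \<Sum>n<N. f n z) holomorphic_on S" for N by (intro holomorphic_intros hol)
 fix z assume "z \<in> S"
 from M[OF this] obtain d M where d: "d > 0" "cball z d \<subseteq> S" "summable M" "\<forall>n. \<forall>w\<in>cball z d. norm (f n w) <= M n"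
  by blast
 have "uniform_limit (cball z d) (%N z. \<Sum>n<N. f n z) (%z. \<Sum>n. f n z) sequentially"
  by (rule Weierstrass_m_test[where M = M]) (use d in auto)
 with d show "\<exists>d>0. cball z d \<subseteq> S \<and> uniform_limit (cball z d) (%N z. \<Sum>n<N. f n z) (%z. \<Sum>n. f n z) sequentially"
  by blast
qed

lemma halfplane_series_holomorphic:
 fixes f :: "nat => complex => complex" and g :: "complex => real"
 assumes hol: "!!n. f n holomorphic_on {s. Re s > 0}"
  and bd: "!!n s. Re s > 0 ==> norm (f n s) <= g s * real n powr (- Re s - 1)"
  and g: "continuous_on UNIV g"
 shows "(%z. \<Sum>n. f n z) holomorphic_on {s. Re s > 0}"
proof (rule holomorphic_suminf[OF open_halfspace_Re_gt hol])
 fix z assume z: "z \<in> {s. Re s > 0}"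
 define d where "d = Re z / 2"
 have d: "d > 0" using z by (simp add: d_def)
 have Re: "Re w >= d" if "w \<in> cball z d" for w
  using abs_Re_le_cmod[of "z - w"] that by (simp add: dist_norm d_def)
 have "compact (g ` cball z d)" using g by (intro compact_continuous_image) (auto intro: continuous_on_subset)
 then obtain B where B: "B > 0" "!!w. w \<in> cball z d ==> \<bar>g w\<bar> <= B"
  using compact_imp_bounded bounded_pos[of "g ` cball z d"] by auto
 have "norm (f n w) <= B * real n powr (- d - 1)" if "w \<in> cball z d" for n w
 proof -
  have "norm (f n w) <= g w * real n powr (- Re w - 1)" using bd Re[OF that] d by simp
  also have "... <= B * real n powr (- Re w - 1)" using B(2)[OF that] by (intro mult_right_mono) auto
  also have "... <= B * real n powr (- d - 1)"
   using B Re[OF that] by (cases "n = 0") (auto intro!: mult_left_mono powr_mono)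
  finally show ?thesis .
 qed
 moreover have "summable (%n. B * real n powr (- d - 1))"
  using d by (intro summable_mult) (simp add: summable_real_powr_iff)
 moreover have "cball z d \<subseteq> {s. Re s > 0}" using Re d by force
 ultimately show "\<exists>d>0. cball z d \<subseteq> {s. 0 < Re s} \<and> (\<exists>M. summable M \<and> (\<forall>n. \<forall>w\<in>cball z d. norm (f n w) <= M n))"
  using d by blast
qed

text \<open>\<open>Q\<close> is the only trace of the modulus in the continuation: for a
  nonprincipal character modulo \<open>q\<close> one may take \<open>Q = q\<close>.\<close>

definition bsum :: "(nat => complex) => real => bool" where
 "bsum a Q \<longleftrightarrow> Q >= 1 \<and> (\<forall>n. norm (a n) <= 1) \<and> (\<forall>N. norm (\<Sum>k=1..N. a k) <= Q)"

text \<open>Abel summation continues the Dirichlet series of \<open>a\<close> to \<open>Re s > 0\<close> when its partial sums are bounded.\<close>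
definition Lc :: "(nat => complex) => complex => complex" where
 "Lc a s = (\<Sum>n. (\<Sum>k=1..n. a k) * (npow n s - npow (Suc n) s))"

lemma npow_0 [simp]: "npow 0 s = 0" by (simp add: npow_def)

lemma Lc_term_bound:
 assumes "bsum a Q" "Re s > 0"
 shows "norm ((\<Sum>k=1..n. a k) * (npow n s - npow (Suc n) s)) <= (Q * norm s) * real n powr (- Re s - 1)"
proof (cases "n = 0")
 case False
 have "norm ((\<Sum>k=1..n. a k) * (npow n s - npow (Suc n) s)) <= Q * (norm s * real n powr (- Re s - 1))"
  unfolding norm_mult using assms False npow_diff_bound'[of n s] by (intro mult_mono) (auto simp: bsum_def)
 thus ?thesis by (simp add: mult.assoc)
qed simp

lemma Lc_holomorphic:
 assumes "bsum a Q"
 shows "Lc a holomorphic_on {s. Re s > 0}"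
proof -
 have "(%s. \<Sum>n. (\<Sum>k=1..n. a k) * (npow n s - npow (Suc n) s)) holomorphic_on {s. Re s > 0}"
  by (rule halfplane_series_holomorphic[OF _ Lc_term_bound[OF assms]])
    (auto intro!: holomorphic_intros continuous_intros)
 thus ?thesis unfolding Lc_def[abs_def] .
qed

lemma Lc_summable:
 assumes "bsum a Q" "Re s > 0"
 shows "summable (%n. (\<Sum>k=1..n. a k) * (npow n s - npow (Suc n) s))"
 by (rule summable_comparison_test'[where N = 0 and g = "%n. (Q * norm s) * real n powr (- Re s - 1)"])
   (use assms in \<open>auto intro!: summable_mult Lc_term_bound[unfolded One_nat_def] simp: summable_real_powr_iff\<close>)

lemma Lc_partial:
 "(\<Sum>n<Suc N. (\<Sum>k=1..n. a k) * (npow n s - npow (Suc n) s)) =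
   (\<Sum>k=1..N. a k * npow k s) - (\<Sum>k=1..N. a k) * npow (Suc N) s"
 by (induction N) (simp_all add: algebra_simps)

lemma npow_tendsto_0:
 assumes "Re s > 0"
 shows "(%n. npow n s) \<longlonglongrightarrow> 0"
proof (rule tendsto_norm_zero_cancel)
 have "(%n. real n powr (- Re s)) \<longlonglongrightarrow> 0"
  using assms by (intro tendsto_neg_powr filterlim_real_sequentially) auto
 thus "(%n. norm (npow n s)) \<longlonglongrightarrow> 0" by (simp add: norm_npow)
qed

lemma bsum_dsum: "bsum a Q ==> dsum a"
 by (rule dsum_bounded) (auto simp: bsum_def)

lemma Lc_eq_ds:
 assumes a: "bsum a Q" and s: "Re s > 1"
 shows "Lc a s = ds a s"
proof -
 have "(%N. \<Sum>n<N. (\<Sum>k=1..n. a k) * (npow n s - npow (Suc n) s)) \<longlonglongrightarrow> Lc a s"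
  unfolding Lc_def using Lc_summable[OF a, of s] s summable_LIMSEQ by auto
 hence 1: "(%N. \<Sum>n<Suc N. (\<Sum>k=1..n. a k) * (npow n s - npow (Suc n) s)) \<longlonglongrightarrow> Lc a s"
  by (rule LIMSEQ_Suc)
 have "(%N. \<Sum>n<N. a n * npow n s) \<longlonglongrightarrow> ds a s"
  using ds_sums[OF bsum_dsum[OF a] s] by (simp add: sums_def npow_def)
 hence "(%N. \<Sum>n<Suc N. a n * npow n s) \<longlonglongrightarrow> ds a s" by (rule LIMSEQ_Suc)
 moreover have "(\<Sum>n<Suc N. a n * npow n s) = (\<Sum>k=1..N. a k * npow k s)" for N
  by (rule sum.mono_neutral_right) (auto simp: Suc_le_eq)
 ultimately have 2: "(%N. \<Sum>k=1..N. a k * npow k s) \<longlonglongrightarrow> ds a s" by simp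
 have "(%N. (\<Sum>k=1..N. a k) * npow (Suc N) s) \<longlonglongrightarrow> 0"
 proof (rule Lim_null_comparison)
  show "\<forall>\<^sub>F N in sequentially. norm ((\<Sum>k=1..N. a k) * npow (Suc N) s) <= Q * norm (npow (Suc N) s)"
   using a by (intro always_eventually allI) (simp add: norm_mult bsum_def mult_right_mono del: npow_0)
  show "(%N. Q * norm (npow (Suc N) s)) \<longlonglongrightarrow> 0"
   using LIMSEQ_Suc[OF npow_tendsto_0[of s]] s by (auto intro!: tendsto_mult_right_zero tendsto_norm_zero)
 qed
 from tendsto_diff[OF 2 this] have "(%N. \<Sum>n<Suc N. (\<Sum>k=1..n. a k) * (npow n s - npow (Suc n) s)) \<longlonglongrightarrow> ds a s"
  unfolding Lc_partial by simp
 with 1 show ?thesis by (rule LIMSEQ_unique)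
qed

text \<open>Up to the free cut \<open>N\<close> the terms are estimated trivially; beyond it Abel
  summation telescopes and leaves only the boundary term. The choice of \<open>N\<close> is
  postponed to \<open>Lc_bound\<close>.\<close>

lemma Lc_split_bound:
 assumes a: "bsum a Q" and s: "Re s > 0"
 shows "norm (Lc a s) <= (\<Sum>k=1..N. real k powr (- Re s)) + Q * (1 + norm s / Re s) * real (Suc N) powr (- Re s)"
proof -
 define t where "t = (%n. (\<Sum>k=1..n. a k) * (npow n s - npow (Suc n) s))"
 define M where "M = Suc N"
 have Q: "Q >= 1" "!!n. norm (a n) <= 1" "!!N. norm (\<Sum>k=1..N. a k) <= Q" using a by (auto simp: bsum_def)
 have sm: "summable t" unfolding t_def by (rule Lc_summable[OF a s])
 define r where "r = (%n. Q * (norm s / Re s) * (real (n + M) powr (- Re s) - real (Suc n + M) powr (- Re s)))"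
 have tl: "(%n. real (n + M) powr (- Re s)) \<longlonglongrightarrow> 0"
  using s by (intro LIMSEQ_ignore_initial_segment tendsto_neg_powr filterlim_real_sequentially) auto
 have rs: "r sums (Q * (norm s / Re s) * (real M powr (- Re s)))"
  unfolding r_def using telescope_sums'[OF tl] by (intro sums_mult) simp
 have tr: "norm (t (n + M)) <= r n" for n
 proof -
  have "norm (t (n + M)) <= Q * (norm s / Re s * (real (n + M) powr (- Re s) - real (Suc (n + M)) powr (- Re s)))"
   unfolding t_def norm_mult using Q
   by (intro mult_mono Q(3) npow_diff_bound s) (auto simp: M_def)
  thus ?thesis by (simp add: r_def mult.assoc)
 qed
 have "Lc a s = (\<Sum>n. t (n + M)) + (\<Sum>n<M. t n)"
  unfolding Lc_def t_def[symmetric] by (rule suminf_split_initial_segment[OF sm])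
 also have "(\<Sum>n<M. t n) = (\<Sum>k=1..N. a k * npow k s) - (\<Sum>k=1..N. a k) * npow M s"
  unfolding t_def M_def by (rule Lc_partial)
 finally have "norm (Lc a s) <= norm (\<Sum>n. t (n + M)) + (norm (\<Sum>k=1..N. a k * npow k s) + norm ((\<Sum>k=1..N. a k) * npow M s))"
  by (simp add: norm_triangle_le norm_triangle_ineq4)
 moreover have "norm (\<Sum>n. t (n + M)) <= Q * (norm s / Re s) * (real M powr (- Re s))"
 proof -
  have "norm (\<Sum>n. t (n + M)) <= suminf r" using rs by (intro norm_suminf_le[OF tr]) (auto simp: sums_iff)
  thus ?thesis using rs by (simp add: sums_iff)
 qed
 moreover have "norm (\<Sum>k=1..N. a k * npow k s) <= (\<Sum>k=1..N. real k powr (- Re s))"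
  using Q by (intro sum_norm_le) (auto simp: norm_mult norm_npow intro!: mult_left_le_one_le)
 moreover have "norm ((\<Sum>k=1..N. a k) * npow M s) <= Q * real M powr (- Re s)"
  unfolding norm_mult norm_npow using Q by (intro mult_right_mono) auto
 ultimately show ?thesis by (simp add: M_def algebra_simps)
qed

section \<open>Bounds slightly to the left of the line Re s = 1\<close>

definition zeps :: "real => real" where "zeps h = (\<Sum>n. real n powr (- 1 - h))"

lemma zeps_nonneg: "h > 0 ==> zeps h >= 0"
 unfolding zeps_def by (intro suminf_nonneg) (auto simp: summable_real_powr_iff)

text \<open>Giving away \<open>k powr (2 * h)\<close> leaves the convergent exponent
  \<open>- 1 - h\<close>, so that \<open>zeps h\<close>, the value of the zeta function at 1 + h,
  bounds the sum uniformly up to the power of \<open>N\<close>.\<close>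

lemma powr_sum_bound:
 assumes e: "0 < h" and s: "v >= 1 - h"
 shows "(\<Sum>k=1..N. real k powr (- v)) <= zeps h * real (Suc N) powr (2 * h)"
proof -
 have "(\<Sum>k=1..N. real k powr (- v)) <= (\<Sum>k=1..N. real k powr (- 1 - h) * real (Suc N) powr (2 * h))"
 proof (rule sum_mono)
  fix k assume k: "k \<in> {1..N}"
  have "real k powr (- v) <= real k powr (- 1 - h + 2 * h)" using k s by (intro powr_mono) auto
  also have "... = real k powr (- 1 - h) * real k powr (2 * h)" by (simp only: powr_add)
  also have "... <= real k powr (- 1 - h) * real (Suc N) powr (2 * h)"
   using k e by (intro mult_left_mono powr_mono2) auto
  finally show "real k powr (- v) <= real k powr (- 1 - h) * real (Suc N) powr (2 * h)" .
 qed
 also have "... = (\<Sum>k=1..N. real k powr (- 1 - h)) * real (Suc N) powr (2 * h)"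
  by (simp add: sum_distrib_right)
 also have "(\<Sum>k=1..N. real k powr (- 1 - h)) <= zeps h"
  unfolding zeps_def using e by (intro sum_le_suminf) (auto simp: summable_real_powr_iff)
 finally show ?thesis by (simp add: mult_right_mono)
qed

text \<open>The cut is made at \<open>N\<close> about \<open>Q * (1 + 2 * norm s)\<close>. From
  there on the boundary term is no larger than the trivial bound of the initial part, because
  \<open>Re s >= 1/2\<close> gives \<open>norm s / Re s <= 2 * norm s\<close>.\<close>

lemma Lc_bound:
 assumes e: "0 < h" "h <= 1/2"
 shows "\<exists>C\<ge>1. \<forall>a Q s. bsum a Q --> Re s >= 1 - h --> norm (Lc a s) <= C * (Q * (1 + norm s)) powr (2 * h)"
proof -
 define C where "C = (zeps h + 1) * 6 powr (2 * h)"
 have C1: "C >= 1"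
 proof -
  have "1 * 1 <= (zeps h + 1) * 6 powr (2 * h)"
   using zeps_nonneg[OF e(1)] e ge_one_powr_ge_zero[of 6 "2 * h"] by (intro mult_mono) auto
  thus ?thesis by (simp add: C_def)
 qed
 have "norm (Lc a s) <= C * (Q * (1 + norm s)) powr (2 * h)"
  if a: "bsum a Q" and s: "Re s >= 1 - h" for a Q s
 proof -
  have Q: "Q >= 1" using a by (simp add: bsum_def)
  have s0: "Re s >= 1/2" using s e by simp
  define X where "X = Q * (1 + 2 * norm s)"
  have X1: "X >= 1"
  proof -
   have "1 * 1 <= Q * (1 + 2 * norm s)" using Q by (intro mult_mono) auto
   thus ?thesis by (simp add: X_def)
  qed
  define N where "N = nat \<lceil>X\<rceil>"
  have N: "real N >= X" "real N <= X + 1" using X1 by (auto simp: N_def)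
  have "norm s / Re s <= norm s / (1/2)" using s0 by (intro divide_left_mono) auto
  hence "Q * (1 + norm s / Re s) <= X" unfolding X_def using Q by (intro mult_left_mono) auto
  hence "Q * (1 + norm s / Re s) * real (Suc N) powr (- Re s) <= real (Suc N) * real (Suc N) powr (- Re s)"
   using N by (intro mult_right_mono) auto
  also have "... = real (Suc N) powr (1 - Re s)"
   using powr_add[of "real (Suc N)" 1 "- Re s"] by simp
  also have "... <= real (Suc N) powr (2 * h)" using s e by (intro powr_mono) auto
  finally have 1: "Q * (1 + norm s / Re s) * real (Suc N) powr (- Re s) <= real (Suc N) powr (2 * h)" .
  have "norm (Lc a s) <= (\<Sum>k=1..N. real k powr (- Re s)) + Q * (1 + norm s / Re s) * real (Suc N) powr (- Re s)"
   by (rule Lc_split_bound[OF a]) (use s0 in simp)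
  also have "... <= (zeps h + 1) * real (Suc N) powr (2 * h)"
   using 1 powr_sum_bound[OF e(1) s, of N] by (simp add: algebra_simps)
  also have "real (Suc N) powr (2 * h) <= (6 * (Q * (1 + norm s))) powr (2 * h)"
  proof (rule powr_mono2)
   have "real (Suc N) <= X + 2" using N by simp
   also have "... <= 3 * X" using X1 by simp
   also have "3 * X <= 6 * (Q * (1 + norm s))" using Q by (simp add: X_def algebra_simps)
   finally show "real (Suc N) <= 6 * (Q * (1 + norm s))" .
  qed (use e in auto)
  also have "(6 * (Q * (1 + norm s))) powr (2 * h) = 6 powr (2 * h) * (Q * (1 + norm s)) powr (2 * h)"
   using Q by (intro powr_mult)
  finally show ?thesis using zeps_nonneg[OF e(1)] by (simp add: C_def mult_left_mono mult.assoc)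
 qed
 thus ?thesis using C1 by blast
qed

lemma Lc_bound_trivial:
 assumes "bsum a Q" "Re s > 0"
 shows "norm (Lc a s) <= Q * (1 + norm s / Re s)"
 using Lc_split_bound[OF assms, of 0] by simp

text \<open>\<open>zt n s\<close> is \<open>s - 1\<close> times the difference of \<open>n powr (- s)\<close> and the integral of \<open>u powr (- s)\<close> over
 \<open>[n, n + 1]\<close>, so that \<open>Zf s\<close> continues \<open>(s - 1)\<zeta>(s)\<close>.\<close>
definition zt :: "nat => complex => complex" where
 "zt n s = (if n = 0 then 0 else (s - 1) * npow n s - npow n (s - 1) + npow (Suc n) (s - 1))"

definition Zf :: "complex => complex" where "Zf s = 1 + (\<Sum>n. zt n s)"

text \<open>\<open>zt n s\<close> is the increment over [n, n + 1] of (s - 1) n^(-s) u + u^(1 - s)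
  as a function of u. Its derivative contains the difference of n^(-s) and u^(-s), which is small;
  the bound again telescopes.\<close>

lemma zt_bound:
 assumes n: "n > 0" and s: "Re s > 0"
 shows "norm (zt n s) <= norm (s - 1) * (norm s / Re s * (real n powr (- Re s) - real (Suc n) powr (- Re s)))"
proof -
 define B where "B = norm (s - 1) * (norm s / Re s * (real n powr (- Re s) - real (Suc n) powr (- Re s)))"
 define g where "g = (%u. (s - 1) * npow n s * of_real u + of_real u powr (1 - s))"
 have 1: "(g has_vector_derivative ((s - 1) * (npow n s - of_real u powr (- s)))) (at u within A)" if "u > 0" for u A
 proof -
  have "((%u. of_real u powr (1 - s)) has_vector_derivative ((1 - s) * of_real u powr (1 - s - 1))) (at u within A)"
   by (rule powr_has_vector_derivative[OF that])
  thus ?thesis unfolding g_def by (auto intro!: derivative_eq_intros simp: algebra_simps)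
 qed
 have 2: "((%u. B * u) has_vector_derivative B) (at u within A)" for u A
  by (auto intro!: derivative_eq_intros)
 have "norm (g (real (Suc n)) - g (real n)) <= B * real (Suc n) - B * real n"
 proof (rule differentiable_bound_general)
  show "continuous_on {real n..real (Suc n)} g"
   by (rule continuous_on_vector_derivative[OF 1]) (use n in auto)
  fix u assume u: "real n < u" "u < real (Suc n)"
  show "(g has_vector_derivative ((s - 1) * (npow n s - of_real u powr (- s)))) (at u)"
   by (rule 1) (use u in linarith)
  show "((%u. B * u) has_vector_derivative B) (at u)" by (rule 2)
  have "norm (npow n s - of_real u powr (- s)) <= norm s / Re s * (real n powr (- Re s) - u powr (- Re s))"
   using powr_diff_bound[of "real n" u s] u n s by (simp add: npow_def)
  also have "... <= norm s / Re s * (real n powr (- Re s) - real (Suc n) powr (- Re s))"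
   using u n s by (intro mult_left_mono diff_left_mono powr_mono2') auto
  finally show "norm ((s - 1) * (npow n s - of_real u powr (- s))) <= B"
   unfolding norm_mult B_def by (intro mult_left_mono) auto
 qed (auto intro!: continuous_intros)
 also have "B * real (Suc n) - B * real n = B" by (simp add: algebra_simps)
 also have "g (real (Suc n)) - g (real n) = zt n s"
  using n by (simp add: g_def zt_def npow_def algebra_simps)
 finally show ?thesis by (simp add: B_def)
qed

lemma zt_bound':
 assumes s: "Re s > 0"
 shows "norm (zt n s) <= (norm (s - 1) * norm s) * real n powr (- Re s - 1)"
proof (cases "n = 0")
 case False
 have "norm s / Re s * (real n powr (- Re s) - real (Suc n) powr (- Re s)) <= norm s / Re s * (Re s * real n powr (- Re s - 1))"
  using real_powr_diff_le[of "real n" "real (Suc n)" "Re s"] False s by (intro mult_left_mono) auto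
 hence "norm (s - 1) * (norm s / Re s * (real n powr (- Re s) - real (Suc n) powr (- Re s))) <= norm (s - 1) * (norm s * real n powr (- Re s - 1))"
  using s by (intro mult_left_mono) auto
 thus ?thesis using zt_bound[of n s] False s by (simp add: mult.assoc)
qed (simp add: zt_def)

lemma zt_summable: "Re s > 0 ==> summable (%n. zt n s)"
 by (rule summable_comparison_test'[where N = 0 and g = "%n. (norm (s - 1) * norm s) * real n powr (- Re s - 1)"])
   (auto intro!: summable_mult zt_bound' simp: summable_real_powr_iff)

lemma Zf_holomorphic: "Zf holomorphic_on {s. Re s > 0}"
proof -
 have "(%s. \<Sum>n. zt n s) holomorphic_on {s. Re s > 0}"
 proof (rule halfplane_series_holomorphic[OF _ zt_bound'])
  show "zt n holomorphic_on {s. Re s > 0}" for n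
   unfolding zt_def[abs_def] by (cases "n = 0") (auto intro!: holomorphic_intros)
 qed (auto intro!: continuous_intros)
 thus ?thesis unfolding Zf_def[abs_def] by (auto intro!: holomorphic_intros)
qed

lemma npow_1 [simp]: "npow (Suc 0) s = 1" by (simp add: npow_def)

lemma zt_partial:
 "(\<Sum>n<Suc N. zt n s) = (s - 1) * (\<Sum>k=1..N. npow k s) + npow (Suc N) (s - 1) - 1"
proof (induction N)
 case (Suc N)
 have "(\<Sum>n<Suc (Suc N). zt n s) = (\<Sum>n<Suc N. zt n s) + zt (Suc N) s" by simp
 thus ?case unfolding Suc by (simp add: zt_def algebra_simps)
qed (simp add: zt_def)

lemma Zf_eq_ds:
 assumes s: "Re s > 1"
 shows "Zf s = (s - 1) * ds (%_. 1) s"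
proof -
 have "(%N. \<Sum>n<Suc N. zt n s) \<longlonglongrightarrow> (\<Sum>n. zt n s)"
  using s by (intro LIMSEQ_Suc summable_LIMSEQ zt_summable) auto
 moreover have "(%N. \<Sum>n<Suc N. zt n s) \<longlonglongrightarrow> (s - 1) * ds (%_. 1) s + 0 - 1"
  unfolding zt_partial
 proof (intro tendsto_intros)
  have "(%N. \<Sum>n<N. npow n s) \<longlonglongrightarrow> ds (%_. 1) s"
   using ds_sums[OF dsum_1 s] by (simp add: sums_def npow_def)
  hence "(%N. \<Sum>n<Suc N. npow n s) \<longlonglongrightarrow> ds (%_. 1) s" by (rule LIMSEQ_Suc)
  moreover have "(\<Sum>n<Suc N. npow n s) = (\<Sum>k=1..N. npow k s)" for N
   by (rule sum.mono_neutral_right) (auto simp: Suc_le_eq)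
  ultimately show "(%N. \<Sum>k=1..N. npow k s) \<longlonglongrightarrow> ds (%_. 1) s" by simp
  show "(%N. npow (Suc N) (s - 1)) \<longlonglongrightarrow> 0"
   using s by (intro LIMSEQ_Suc npow_tendsto_0) auto
 qed
 ultimately have "(\<Sum>n. zt n s) = (s - 1) * ds (%_. 1) s + 0 - 1" by (rule LIMSEQ_unique)
 thus ?thesis by (simp add: Zf_def)
qed

lemma zt_tail:
 assumes s: "Re s > 0" and M: "M > 0"
 shows "norm (\<Sum>n. zt (n + M) s) <= norm (s - 1) * (norm s / Re s * real M powr (- Re s))"
proof -
 define r where "r = (%n. norm (s - 1) * (norm s / Re s * (real (n + M) powr (- Re s) - real (Suc n + M) powr (- Re s))))"
 have tl: "(%n. real (n + M) powr (- Re s)) \<longlonglongrightarrow> 0"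
  using s by (intro LIMSEQ_ignore_initial_segment tendsto_neg_powr filterlim_real_sequentially) auto
 have rs: "r sums (norm (s - 1) * (norm s / Re s * (real M powr (- Re s))))"
  unfolding r_def using telescope_sums'[OF tl] by (intro sums_mult) simp
 have "norm (zt (n + M) s) <= r n" for n
  using zt_bound[of "n + M" s] M s by (simp add: r_def)
 hence "norm (\<Sum>n. zt (n + M) s) <= suminf r" using rs by (intro norm_suminf_le) (auto simp: sums_iff)
 thus ?thesis using rs by (simp add: sums_iff)
qed

lemma Zf_near:
 assumes s: "Re s > 0"
 shows "norm (Zf s - 1) <= norm (s - 1) * (norm s / Re s)"
proof -
 have "(\<Sum>n. zt n s) = (\<Sum>n. zt (n + 1) s) + (\<Sum>n<1. zt n s)"
  by (rule suminf_split_initial_segment[OF zt_summable[OF s]])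
 thus ?thesis using zt_tail[OF s, of 1] by (simp add: Zf_def zt_def)
qed

lemma Zf_1 [simp]: "Zf 1 = 1" using Zf_near[of 1] by simp

lemma Zf_split_bound:
 assumes s: "Re s > 0"
 shows "norm (Zf s) <= norm (s - 1) * (\<Sum>k=1..N. real k powr (- Re s)) + real (Suc N) powr (1 - Re s)
   + norm (s - 1) * (norm s / Re s * real (Suc N) powr (- Re s))"
proof -
 have "(\<Sum>n. zt n s) = (\<Sum>n. zt (n + Suc N) s) + (\<Sum>n<Suc N. zt n s)"
  by (rule suminf_split_initial_segment[OF zt_summable[OF s]])
 hence "Zf s = (s - 1) * (\<Sum>k=1..N. npow k s) + npow (Suc N) (s - 1) + (\<Sum>n. zt (n + Suc N) s)"
  unfolding Zf_def zt_partial by simp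
 hence "norm (Zf s) <= norm ((s - 1) * (\<Sum>k=1..N. npow k s)) + norm (npow (Suc N) (s - 1)) + norm (\<Sum>n. zt (n + Suc N) s)"
  by (simp only:) (intro norm_triangle_mono norm_triangle_ineq order_refl)
 also have "norm ((s - 1) * (\<Sum>k=1..N. npow k s)) <= norm (s - 1) * (\<Sum>k=1..N. real k powr (- Re s))"
  unfolding norm_mult by (intro mult_left_mono sum_norm_le) (auto simp: norm_npow)
 also have "norm (npow (Suc N) (s - 1)) = real (Suc N) powr (1 - Re s)" by (simp add: norm_npow)
 finally show ?thesis using zt_tail[OF s, of "Suc N"] by simp
qed

text \<open>Same cut as in \<open>Lc_bound\<close>; the additional factor \<open>1 + norm s\<close>
  comes from the multiplication by s - 1.\<close>

lemma Zf_bound: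
 assumes e: "0 < h" "h <= 1/2"
 shows "\<exists>C\<ge>1. \<forall>s. Re s >= 1 - h --> norm (Zf s) <= C * ((1 + norm s) * (1 + norm s) powr (2 * h))"
proof -
 define C where "C = (zeps h + 3) * 5 powr (2 * h)"
 have z0: "zeps h >= 0" using zeps_nonneg[OF e(1)] .
 have C1: "C >= 1"
 proof -
  have "1 * 1 <= (zeps h + 3) * 5 powr (2 * h)"
   using z0 e ge_one_powr_ge_zero[of 5 "2 * h"] by (intro mult_mono) auto
  thus ?thesis by (simp add: C_def)
 qed
 have "norm (Zf s) <= C * ((1 + norm s) * (1 + norm s) powr (2 * h))" if s: "Re s >= 1 - h" for s
 proof -
  have s0: "Re s >= 1/2" using s e by simp
  define X where "X = 1 + 2 * norm s"
  have X1: "X >= 1" by (simp add: X_def)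
  define N where "N = nat \<lceil>X\<rceil>"
  have N: "real N >= X" "real N <= X + 1" using X1 by (auto simp: N_def)
  define W where "W = real (Suc N) powr (2 * h)"
  have "norm s / Re s <= norm s / (1/2)" using s0 by (intro divide_left_mono) auto
  hence "norm s / Re s <= real (Suc N)" using N by (simp add: X_def)
  hence "norm s / Re s * real (Suc N) powr (- Re s) <= real (Suc N) * real (Suc N) powr (- Re s)"
   by (intro mult_right_mono) auto
  also have "... = real (Suc N) powr (1 - Re s)"
   using powr_add[of "real (Suc N)" 1 "- Re s"] by simp
  finally have 1: "norm s / Re s * real (Suc N) powr (- Re s) <= real (Suc N) powr (1 - Re s)" .
  have 2: "real (Suc N) powr (1 - Re s) <= W" unfolding W_def using s e by (intro powr_mono) auto
  have "norm (Zf s) <= norm (s - 1) * (zeps h * W) + W + norm (s - 1) * W"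
   using 1 2 powr_sum_bound[OF e(1) s, of N] Zf_split_bound[of s N] s0
    mult_left_mono[of _ _ "norm (s - 1)", OF powr_sum_bound[OF e(1) s, of N]]
    mult_left_mono[of _ _ "norm (s - 1)", OF order_trans[OF 1 2]]
   by (simp add: W_def)
  also have "... = (norm (s - 1) * (zeps h + 1) + 1) * W" by (simp add: algebra_simps)
  also have "... <= ((1 + norm s) * (zeps h + 3)) * W"
  proof (rule mult_right_mono)
   have "norm (s - 1) <= 1 + norm s" using norm_triangle_ineq4[of s 1] by simp
   hence "norm (s - 1) * (zeps h + 1) <= (1 + norm s) * (zeps h + 1)" using z0 by (intro mult_right_mono) auto
   also have "... + 1 <= (1 + norm s) * (zeps h + 3)" using norm_ge_zero[of s] by (simp add: algebra_simps)
   finally show "norm (s - 1) * (zeps h + 1) + 1 <= (1 + norm s) * (zeps h + 3)" by simp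
  qed (simp add: W_def)
  also have "... <= ((1 + norm s) * (zeps h + 3)) * (5 * (1 + norm s)) powr (2 * h)"
  proof (rule mult_left_mono)
   show "W <= (5 * (1 + norm s)) powr (2 * h)" unfolding W_def
   proof (rule powr_mono2)
    show "real (Suc N) <= 5 * (1 + norm s)" using N(2) norm_ge_zero[of s] unfolding X_def of_nat_Suc distrib_left by linarith
   qed (use e in auto)
  qed (use z0 in auto)
  also have "(5 * (1 + norm s)) powr (2 * h) = 5 powr (2 * h) * (1 + norm s) powr (2 * h)"
   by (rule powr_mult)
  finally show ?thesis using z0 unfolding C_def by (simp add: mult_ac)
 qed
 thus ?thesis using C1 by blast
qed

text \<open>The regular part \<open>\<zeta>(s) - 1/(s-1)\<close> is \<open>(Zf s - 1)/(s - 1)\<close>.\<close>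
lemma zeta_regular_bound:
 assumes e: "0 < h" "h <= 1/2"
 shows "\<exists>C\<ge>1. \<forall>s. Re s >= 1 - h --> norm ((Zf s - 1) / (s - 1)) <= C * (1 + norm s) powr (2 * h)"
proof -
 obtain C where C: "C >= 1" "!!s. Re s >= 1 - h ==> norm (Zf s) <= C * ((1 + norm s) * (1 + norm s) powr (2 * h))"
  using Zf_bound[OF e] by blast
 have "norm ((Zf s - 1) / (s - 1)) <= (5 * C + 3) * (1 + norm s) powr (2 * h)" if s: "Re s >= 1 - h" for s
 proof -
  define P where "P = (1 + norm s) powr (2 * h)"
  have P1: "P >= 1" unfolding P_def using e by (intro ge_one_powr_ge_zero) auto
  have s0: "Re s >= 1/2" using s e by simp
  \<comment> \<open>Near 1 the quotient is controlled by \<open>Zf_near\<close>, which has the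
    factor \<open>norm (s - 1)\<close>; at distance at least 1/2 the size of \<open>Zf\<close>
    suffices.\<close>
  show ?thesis
  proof (cases "norm (s - 1) < 1/2")
   case True
   have "norm s <= 3/2" using norm_triangle_ineq2[of s 1] True by simp
   hence ns: "norm s / Re s <= (3/2) / (1/2)" using s0 by (intro frac_le) auto
   have "norm ((Zf s - 1) / (s - 1)) <= 3"
   proof (cases "s = 1")
    case False
    have "norm (Zf s - 1) <= norm (s - 1) * 3"
     using Zf_near[of s] s0 mult_left_mono[OF ns, of "norm (s - 1)"] by simp
    thus ?thesis using False by (simp add: norm_divide field_simps)
   qed simp
   also have "... <= (5 * C + 3) * P" using mult_mono[of 3 "5 * C + 3" 1 P] P1 C by simp
   finally show ?thesis by (simp add: P_def)
  next
   case False
   have "1 + norm s <= 2 + norm (s - 1)" using norm_triangle_ineq2[of s 1] by simp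
   also have "... <= 5 * norm (s - 1)" using False by simp
   finally have 1: "1 + norm s <= 5 * norm (s - 1)" .
   have "norm (Zf s - 1) <= norm (Zf s) + 1" using norm_triangle_ineq4[of "Zf s" 1] by simp
   also have "norm (Zf s) <= C * (5 * norm (s - 1) * P)"
    using C(2)[OF s] 1 C(1) P1 by (intro order_trans[OF C(2)[OF s]] mult_left_mono mult_mono) (auto simp: P_def)
   also have "(1::real) <= 2 * norm (s - 1) * P" using mult_mono[of 1 "2 * norm (s - 1)" 1 P] False P1 by simp
   finally have "norm (Zf s - 1) <= norm (s - 1) * ((5 * C + 2) * P)" by (simp add: algebra_simps)
   also have "... <= norm (s - 1) * ((5 * C + 3) * P)" using P1 by (intro mult_left_mono mult_right_mono) auto
   finally have *: "norm (Zf s - 1) <= norm (s - 1) * ((5 * C + 3) * P)" .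
   have "norm (s - 1) > 0" using False by linarith
   thus ?thesis using * unfolding norm_divide P_def by (simp add: divide_le_eq mult.commute)
  qed
 qed
 thus ?thesis using C(1) by (intro exI[of _ "5 * C + 3"]) auto
qed

section \<open>Lower bounds from the 3-4-1 inequality\<close>

lemma ln_norm_series:
 fixes w :: complex
 assumes "norm w < 1"
 shows "(%n. Re (w ^ n) / real n) sums (- ln (norm (1 - w)))"
proof -
 have "(%n. - ((- (- w)) ^ n) / of_nat n) sums Ln (1 + (- w))"
  by (rule Ln_series') (use assms in simp)
 hence "(%n. Re (- ((- (- w)) ^ n) / of_nat n)) sums Re (Ln (1 + (- w)))"
  by (rule sums_Re)
 moreover have "1 - w ~= 0" using assms by auto
 ultimately have "(%n. - (Re (w ^ n) / real n)) sums ln (norm (1 - w))" by simp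
 from sums_minus[OF this] show ?thesis by simp
qed

text \<open>Taking logarithms and expanding, the n-th coefficient is a positive multiple of 3 + 4
  cos a + cos 2a = 2 (1 + cos a)^2, where a is the argument of z^n. The case \<open>z = 0\<close>
  covers the primes dividing the modulus.\<close>

lemma local_341:
 fixes z :: complex and r :: real
 assumes r: "0 < r" "r < 1" and z: "norm z = 1 \<or> z = 0"
 shows "norm (1 - complex_of_real r) ^ 3 * norm (1 - of_real r * z) ^ 4 * norm (1 - of_real r * z\<^sup>2) <= 1"
proof (cases "z = 0")
 case True
 have "norm (1 - complex_of_real r) = 1 - r" using r by (metis abs_of_nonneg diff_ge_0_iff_ge less_imp_le norm_of_real of_real_1 of_real_diff)
 thus ?thesis using r True by (simp add: power_le_one)
next
 case False
 hence z1: "norm z = 1" using z by simp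
 define w0 w1 w2 where "w0 = complex_of_real r" and "w1 = of_real r * z" and "w2 = of_real r * z\<^sup>2"
 have n: "norm w0 < 1" "norm w1 < 1" "norm w2 < 1" using r z1
  by (simp_all add: w0_def w1_def w2_def norm_mult norm_power)
 have pos: "norm (1 - w) > 0" if "norm w < 1" for w :: complex using that by auto
 have S: "(%n. 3 * (Re (w0 ^ n) / real n) + 4 * (Re (w1 ^ n) / real n) + Re (w2 ^ n) / real n) sums
   (3 * (- ln (norm (1 - w0))) + 4 * (- ln (norm (1 - w1))) + (- ln (norm (1 - w2))))"
  using n by (intro sums_add sums_mult ln_norm_series)
 have N: "0 <= 3 * (Re (w0 ^ n) / real n) + 4 * (Re (w1 ^ n) / real n) + Re (w2 ^ n) / real n" for n
 proof -
  define u where "u = z ^ n"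
  have u1: "norm u = 1" by (simp add: u_def norm_power z1)
  have "(Re u)\<^sup>2 + (Im u)\<^sup>2 = 1" using u1 by (metis cmod_power2 power_one)
  hence sq: "Re (u\<^sup>2) = 2 * (Re u)\<^sup>2 - 1" by (simp add: power2_eq_square)
  have e0: "Re (w0 ^ n) = r ^ n" by (simp add: w0_def flip: of_real_power)
  have "w1 ^ n = of_real (r ^ n) * u" by (simp add: w1_def u_def power_mult_distrib)
  hence e1: "Re (w1 ^ n) = r ^ n * Re u" by simp
  have "w2 ^ n = of_real (r ^ n) * u\<^sup>2"
   by (simp add: w2_def u_def power_mult_distrib flip: power_mult) (simp add: mult.commute)
  hence e2: "Re (w2 ^ n) = r ^ n * Re (u\<^sup>2)" by simp
  have "3 * (Re (w0 ^ n) / real n) + 4 * (Re (w1 ^ n) / real n) + Re (w2 ^ n) / real n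
    = r ^ n / real n * (2 * (Re u + 1)\<^sup>2)"
   unfolding e0 e1 e2 sq by (cases "n = 0") (simp_all add: field_simps power2_eq_square)
  thus ?thesis using r by simp
 qed
 have "0 <= 3 * (- ln (norm (1 - w0))) + 4 * (- ln (norm (1 - w1))) + (- ln (norm (1 - w2)))"
  by (rule sums_le[OF N sums_zero S])
 also have "... = - ln (norm (1 - w0) ^ 3 * norm (1 - w1) ^ 4 * norm (1 - w2))"
 proof -
 have "3 * (- ln a) + 4 * (- ln b) + (- ln c) = - ln (a ^ 3 * b ^ 4 * c)" if "a > 0" "b > 0" "c > 0" for a b c :: real
  using that by (simp add: ln_mult ln_realpow)
 from this[OF pos[OF n(1)] pos[OF n(2)] pos[OF n(3)]] show ?thesis .
 qed
 finally have "ln (norm (1 - w0) ^ 3 * norm (1 - w1) ^ 4 * norm (1 - w2)) <= 0" by simp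
 moreover have "norm (1 - w0) ^ 3 * norm (1 - w1) ^ 4 * norm (1 - w2) > 0" using pos n by simp
 ultimately show ?thesis unfolding w0_def w1_def w2_def by (simp add: ln_le_zero_iff)
qed

lemma npow_mult: "npow (m * n) s = npow m s * npow n s"
proof -
 have "(of_nat m * of_nat n :: complex) powr (- s) = of_nat m powr (- s) * of_nat n powr (- s)"
  by (subst powr_times_real) simp_all
 thus ?thesis by (simp add: npow_def)
qed

lemma npow_add: "npow n (s + w) = npow n s * npow n w"
 by (simp add: npow_def powr_add[symmetric])

text \<open>The local inequality is multiplied over the primes up to \<open>y\<close>, and
  \<open>y\<close> tends to infinity. Finite products and their limit replace any choice of a
  logarithm of the series.\<close>

lemma three_four_one:
 assumes X: "dchar q X" and v: "v > 1"
 shows "norm (ds (%_. 1) (of_real v)) ^ 3 * norm (ds X (Complex v t)) ^ 4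
   * norm (ds (%n. X n * X n) (Complex v (2 * t))) >= 1"
proof -
 define f0 where "f0 = (%n. npow n (of_real v))"
 define f1 where "f1 = (%n. X n * npow n (Complex v t))"
 define f2 where "f2 = (%n. (X n * X n) * npow n (Complex v (2 * t)))"
 have X1: "norm (X n) <= 1" for n using dchar_norm_le[OF X] .
 have dX: "dsum X" by (rule dsum_bounded[OF X1])
 have dX2: "dsum (%n. X n * X n)" by (rule dsum_bounded[of _ 1]) (use X1 in \<open>simp add: norm_mult mult_le_one\<close>)
 have s0: "summable (%n. norm (f0 n))" using ds_summable_norm[OF dsum_1, of "of_real v"] v by (simp add: f0_def npow_def)
 have s1: "summable (%n. norm (f1 n))" using ds_summable_norm[OF dX, of "Complex v t"] v by (simp add: f1_def npow_def)
 have s2: "summable (%n. norm (f2 n))" using ds_summable_norm[OF dX2, of "Complex v (2*t)"] v by (simp add: f2_def npow_def)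
 have e: "suminf f0 = ds (%_. 1) (of_real v)" "suminf f1 = ds X (Complex v t)"
  "suminf f2 = ds (%n. X n * X n) (Complex v (2 * t))"
  by (simp_all add: f0_def f1_def f2_def ds_def npow_def)
 define P where "P = (%f y. \<Prod>p | prime p \<and> p <= (y::nat). 1 - (f p :: complex))"
 have l0: "(%y. P f0 y * suminf f0) \<longlonglongrightarrow> 1"
  unfolding P_def by (rule euler_product_tendsto[OF s0]) (simp_all add: f0_def npow_mult)
 have l1: "(%y. P f1 y * suminf f1) \<longlonglongrightarrow> 1"
  unfolding P_def by (rule euler_product_tendsto[OF s1])
   (simp_all add: f1_def npow_mult dcharD(2)[OF X] dchar_1[OF X])
 have l2: "(%y. P f2 y * suminf f2) \<longlonglongrightarrow> 1"
  unfolding P_def by (rule euler_product_tendsto[OF s2])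
   (simp_all add: f2_def npow_mult dcharD(2)[OF X] dchar_1[OF X])
 have "(%y. norm (P f0 y * suminf f0) ^ 3 * norm (P f1 y * suminf f1) ^ 4 * norm (P f2 y * suminf f2))
   \<longlonglongrightarrow> norm (1::complex) ^ 3 * norm (1::complex) ^ 4 * norm (1::complex)"
  by (intro tendsto_intros l0 l1 l2)
 hence lim: "(%y. norm (P f0 y * suminf f0) ^ 3 * norm (P f1 y * suminf f1) ^ 4 * norm (P f2 y * suminf f2)) \<longlonglongrightarrow> 1"
  by simp
 have loc: "norm (1 - f0 p) ^ 3 * norm (1 - f1 p) ^ 4 * norm (1 - f2 p) <= 1" if p: "prime p" for p
 proof -
  define r where "r = real p powr (- v)"
  define z where "z = X p * npow p (Complex 0 t)"
  have p1: "p > 1" using p by (rule prime_gt_1_nat)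
  have r: "0 < r" "r < 1" using p1 v by (simp_all add: r_def powr_less_one)
  have z: "norm z = 1 \<or> z = 0"
   using dchar_norm[OF X, of p] p1 by (auto simp: z_def norm_mult norm_npow)
  have f0: "f0 p = of_real r" using p1 by (simp add: f0_def r_def npow_def powr_of_real[symmetric])
  have "Complex v t = of_real v + Complex 0 t" by (simp add: complex_eq_iff)
  hence "npow p (Complex v t) = npow p (of_real v) * npow p (Complex 0 t)" by (simp only: npow_add)
  hence f1: "f1 p = of_real r * z" using f0 by (simp add: f1_def z_def f0_def)
  have "Complex v (2 * t) = of_real v + (Complex 0 t + Complex 0 t)" by (simp add: complex_eq_iff)
  hence "npow p (Complex v (2 * t)) = npow p (of_real v) * (npow p (Complex 0 t) * npow p (Complex 0 t))"
   by (simp only: npow_add)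
  hence f2: "f2 p = of_real r * z\<^sup>2" using f0 by (simp add: f2_def z_def f0_def power2_eq_square)
  show ?thesis using local_341[OF r z] by (simp only: f0 f1 f2)
 qed
 have le1: "norm (P f0 y) ^ 3 * norm (P f1 y) ^ 4 * norm (P f2 y) <= 1" for y
 proof -
  have "norm (P f0 y) ^ 3 * norm (P f1 y) ^ 4 * norm (P f2 y) =
    (\<Prod>p | prime p \<and> p <= y. norm (1 - f0 p) ^ 3 * norm (1 - f1 p) ^ 4 * norm (1 - f2 p))"
   by (simp add: P_def prod_norm[symmetric] prod_power_distrib[symmetric] prod.distrib)
  also have "... <= 1" by (rule prod_le_1) (use loc in auto)
  finally show ?thesis .
 qed
 have "norm (P f0 y * suminf f0) ^ 3 * norm (P f1 y * suminf f1) ^ 4 * norm (P f2 y * suminf f2)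
   <= norm (suminf f0) ^ 3 * norm (suminf f1) ^ 4 * norm (suminf f2)" for y
 proof -
  have "norm (P f0 y * suminf f0) ^ 3 * norm (P f1 y * suminf f1) ^ 4 * norm (P f2 y * suminf f2)
    = (norm (P f0 y) ^ 3 * norm (P f1 y) ^ 4 * norm (P f2 y)) * (norm (suminf f0) ^ 3 * norm (suminf f1) ^ 4 * norm (suminf f2))"
   by (simp add: norm_mult power_mult_distrib mult_ac)
  also have "... <= 1 * (norm (suminf f0) ^ 3 * norm (suminf f1) ^ 4 * norm (suminf f2))"
   using le1 by (intro mult_right_mono) auto
  finally show ?thesis by simp
 qed
 hence "1 <= norm (suminf f0) ^ 3 * norm (suminf f1) ^ 4 * norm (suminf f2)"
  by (intro LIMSEQ_le_const2[OF lim]) auto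
 thus ?thesis by (simp only: e)
qed

lemma norm_zeta_real_le:
 assumes "1 < v" "v <= 2"
 shows "norm (ds (%_. 1) (of_real v)) <= 3 / (v - 1)"
proof -
 have "norm (Zf (of_real v) - 1) <= norm (complex_of_real v - 1) * (norm (complex_of_real v) / v)"
  using Zf_near[of "of_real v"] assms by simp
 also have "norm (complex_of_real v - 1) = v - 1"
  using assms by (metis abs_of_nonneg diff_ge_0_iff_ge less_imp_le norm_of_real of_real_1 of_real_diff)
 finally have "norm (Zf (of_real v) - 1) <= 1" using assms by simp
 hence "norm (Zf (of_real v)) <= 3" using norm_triangle_ineq2[of "Zf (of_real v)" 1] by simp
 hence "norm (complex_of_real v - 1) * norm (ds (%_. 1) (of_real v)) <= 3"
  using Zf_eq_ds[of "of_real v"] assms by (simp add: norm_mult)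
 moreover have "norm (complex_of_real v - 1) = v - 1"
  using assms by (metis abs_of_nonneg diff_ge_0_iff_ge less_imp_le norm_of_real of_real_1 of_real_diff)
 ultimately show ?thesis using assms by (simp add: field_simps)
qed

text \<open>The exponent 7 comes from balancing \<open>h\<^sup>3 / A\<close> (the bound of the 3-4-1 inequality at distance
 \<open>h\<close> to the right of the line) against \<open>(h A\<^sup>2)\<^sup>4\<close> (the variation over that distance) with \<open>h = d / A\<^sup>9\<close>.\<close>
lemma lower_bound_341:
 fixes C3 C4 A :: real
 assumes X: "dchar q X" and v: "1 < v" "v <= 2" and C: "C3 >= 1" "C4 >= 1" and A: "A >= 1"
  and ub: "!!v1. v <= v1 ==> v1 <= 2 ==> norm (ds (%n. X n * X n) (Complex v1 (2 * t))) <= C3 * A"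
  and lip: "!!v1. v <= v1 ==> v1 <= 2 ==> norm (ds X (Complex v t) - ds X (Complex v1 t)) <= (v1 - v) * (C4 * A\<^sup>2)"
 shows "norm (ds X (Complex v t)) >= (C4 / (433 * C3 * C4 ^ 4)) / A ^ 7"
proof (rule ccontr)
 assume neg: "\<not> ?thesis"
 \<comment> \<open>The inequality below produces 3^3 * 2^4 = 432 from the bound \<open>3 / h\<close>
   and the factor 2 in \<open>l\<close>; 433 makes the contradiction strict.\<close>
 define d where "d = 1 / (433 * C3 * C4 ^ 4)"
 have "1 * 1 <= C3 * C4 ^ 4" using C by (intro mult_mono one_le_power) auto
 hence d: "d > 0" "d <= 1" "432 * d * (C3 * C4 ^ 4) < 1" using C by (auto simp: d_def field_simps)
 define h where "h = d / A ^ 9"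
 have A9: "A ^ 9 >= 1" using A by (rule one_le_power)
 have h: "h > 0" "h <= 1" using d(1) order_trans[OF d(2) A9] A by (auto simp: h_def)
 define v1 where "v1 = max v (1 + h)"
 have v1: "v1 > 1" "v1 <= 2" "v <= v1" "v1 - 1 >= h" "v1 - v <= h" using v h by (auto simp: v1_def)
 define l where "l = norm (ds X (Complex v1 t))"
 have l: "l <= 2 * d * C4 / A ^ 7"
 proof -
  define E where "E = d * C4 / A ^ 7"
  have "(v1 - v) * (C4 * A\<^sup>2) <= h * (C4 * A\<^sup>2)" using v1 C A by (intro mult_right_mono) auto
  also have "... = d * C4 / A ^ 7" using A by (simp add: h_def field_simps flip: power_add)
  finally have h1: "norm (ds X (Complex v t) - ds X (Complex v1 t)) <= E" using lip[of v1] v1 by (simp add: E_def)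
  have h2: "norm (ds X (Complex v t)) <= E" using neg by (simp add: d_def E_def)
  have "l <= norm (ds X (Complex v t)) + norm (ds X (Complex v t) - ds X (Complex v1 t))"
   unfolding l_def using norm_triangle_ineq4[of "ds X (Complex v t)" "ds X (Complex v t) - ds X (Complex v1 t)"] by simp
  also have "... <= E + E" by (rule add_mono[OF h2 h1])
  finally show ?thesis by (simp add: E_def mult_ac)
 qed
 have "1 <= norm (ds (%_. 1) (of_real v1)) ^ 3 * l ^ 4 * norm (ds (%n. X n * X n) (Complex v1 (2 * t)))"
  unfolding l_def by (rule three_four_one[OF X v1(1)])
 also have "... <= (3 / h) ^ 3 * (2 * d * C4 / A ^ 7) ^ 4 * (C3 * A)"
 proof (intro mult_mono power_mono)
  have "norm (ds (%_. 1) (of_real v1)) <= 3 / (v1 - 1)" by (rule norm_zeta_real_le[OF v1(1,2)])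
  also have "... <= 3 / h" using v1 h by (intro divide_left_mono) auto
  finally show "norm (ds (%_. 1) (of_real v1)) <= 3 / h" .
  show "norm (ds (%n. X n * X n) (Complex v1 (2 * t))) <= C3 * A" using ub v1 by simp
 qed (use l h d C A in \<open>auto simp: l_def\<close>)
 also have "... = 432 * d * (C3 * C4 ^ 4)"
 proof -
  have "A ^ 28 = A ^ 9 * A ^ 9 * A ^ 9 * A" by (simp flip: power_add power_Suc2)
  thus ?thesis using A d(1) unfolding h_def
   by (simp add: power_divide power_mult_distrib power_mult[symmetric] divide_simps)
     (simp add: power3_eq_cube power4_eq_xxxx algebra_simps)
 qed
 finally show False using d(3) by simp
qed

section \<open>Upper bounds uniform in the modulus and Lipschitz estimates\<close>

lemma dchar_bsum:
 assumes X: "dchar q X" "X ~= dprin q"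
 shows "bsum X (real q)"
proof -
 have q: "q > 0" by (rule dcharD(1)[OF X(1)])
 have per: "X (n + q) = X n" for n by (rule dchar_cong[OF X(1)]) (simp add: cong_def)
 have "(\<Sum>n=1..m. X n) + X 0 = (\<Sum>n<m. X n) + X (0 + m)" for m
  by (induction m) simp_all
 from this[of q] have "(\<Sum>n=1..q. X n) = 0" unfolding per dchar_sum_period[OF X] by simp
 from periodic_partial_sum[OF q per this dchar_norm_le[OF X(1)]] show ?thesis
  using q dchar_norm_le[OF X(1)] by (simp add: bsum_def)
qed

lemma dchar_mult_same:
 assumes "dchar q X" "dchar q Y"
 shows "dchar q (%n. X n * Y n)"
 unfolding dchar_def
 by (simp add: dcharD(1,2,3,4)[OF assms(1)] dcharD(2,3,4)[OF assms(2)])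

text \<open>The zeta function minus 1/(s - 1), since \<open>Zf 1 = 1\<close>; the value at 1 fills
  the removable singularity.\<close>

definition zreg :: "complex => complex" where
 "zreg s = (if s = 1 then deriv Zf 1 else (Zf s - Zf 1) / (s - 1))"

lemma zreg_holomorphic: "zreg holomorphic_on {s. Re s > 0}"
 unfolding zreg_def[abs_def] by (rule pole_lemma_open[OF Zf_holomorphic open_halfspace_Re_gt])

lemma zreg_bound:
 assumes e: "0 < d" "d <= 1/2"
 shows "\<exists>C\<ge>1. \<forall>s. Re s >= 1 - d --> norm (zreg s) <= C * (1 + norm s) powr (2 * d)"
proof -
 obtain C where C: "C >= 1" "!!s. Re s >= 1 - d ==> norm ((Zf s - 1) / (s - 1)) <= C * (1 + norm s) powr (2 * d)"
  using zeta_regular_bound[OF e] by blast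
 have "norm (zreg s) <= max C (norm (deriv Zf 1)) * (1 + norm s) powr (2 * d)" if "Re s >= 1 - d" for s
 proof (cases "s = 1")
  case True
  have "1 <= (1 + norm s) powr (2 * d)" using e by (intro ge_one_powr_ge_zero) auto
  hence "norm (deriv Zf 1) * 1 <= max C (norm (deriv Zf 1)) * (1 + norm s) powr (2 * d)"
   using C(1) by (intro mult_mono) auto
  thus ?thesis using True by (simp add: zreg_def)
 next
  case False
  have "norm (zreg s) <= C * (1 + norm s) powr (2 * d)" using C(2)[OF that] False by (simp add: zreg_def)
  also have "... <= max C (norm (deriv Zf 1)) * (1 + norm s) powr (2 * d)" by (intro mult_right_mono) auto
  finally show ?thesis .
 qed
 thus ?thesis using C(1) by (intro exI[of _ "max C (norm (deriv Zf 1))"]) auto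
qed

lemma zeta_eq_zreg:
 assumes "Re s > 1"
 shows "ds (%_. 1) s = zreg s + 1 / (s - 1)"
proof -
 have "s ~= 1" using assms by auto
 thus ?thesis using Zf_eq_ds[OF assms] by (simp add: zreg_def diff_divide_distrib[symmetric] add_divide_distrib[symmetric])
qed

lemma powr_ge1_mono: "1 <= x ==> x <= y ==> 0 <= e ==> x powr e <= y powr (e::real)"
 by (rule powr_mono2) auto

text \<open>For the principal character the factors at the primes dividing \<open>q\<close> are not
  estimated. Instead a constant, the mean value \<open>totient q / q\<close>, is subtracted: what
  remains is periodic with mean zero, hence a series with partial sums bounded by \<open>q\<close>,
  and the subtracted part is a multiple of the zeta function with factor at most 1.\<close>

lemma dchar_ds_upper:
 assumes e: "0 < d" "d <= 1/2"
 shows "\<exists>C\<ge>1. \<forall>q X s. dchar q X --> Re s > 1 -->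
   norm (ds X s) <= C * (real q * (1 + norm s)) powr (2 * d) + 1 / norm (s - 1)"
proof -
 obtain C where C: "C >= 1" "!!a Q s. bsum a Q ==> Re s >= 1 - d ==> norm (Lc a s) <= C * (Q * (1 + norm s)) powr (2 * d)"
  using Lc_bound[OF e] by blast
 obtain D where D: "D >= 1" "!!s. Re s >= 1 - d ==> norm (zreg s) <= D * (1 + norm s) powr (2 * d)"
  using zreg_bound[OF e] by blast
 have "norm (ds X s) <= (C + D) * (real q * (1 + norm s)) powr (2 * d) + 1 / norm (s - 1)"
  if X: "dchar q X" and s: "Re s > 1" for q X s
 proof -
  define K where "K = (real q * (1 + norm s)) powr (2 * d)"
  have K: "K >= 0" by (simp add: K_def)
  have q: "q > 0" using dcharD(1)[OF X] .
  have s': "Re s >= 1 - d" using s e by simp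
  show ?thesis
  proof (cases "X = dprin q")
   case False
   have b: "bsum X (real q)" by (rule dchar_bsum[OF X False])
   have "norm (ds X s) <= C * K" using C(2)[OF b s'] Lc_eq_ds[OF b s] by (simp add: K_def)
   also have "... <= (C + D) * K" using D K by (intro mult_right_mono) auto
   also have "... <= (C + D) * K + 1 / norm (s - 1)" by simp
   finally show ?thesis by (simp add: K_def)
  next
   case True
   define r where "r = real (totient q) / real q"
   have r: "0 <= r" "r <= 1" using q totient_le[of q] by (auto simp: r_def)
   define a where "a = (%n. dprin q n + of_real (- r) * 1)"
   have an: "norm (a n) <= 1" for n
   proof (cases "coprime n q")
    case True
    hence "a n = of_real (1 - r)" by (simp add: a_def dprin_def)
    hence "norm (a n) = \<bar>1 - r\<bar>" by (simp only: norm_of_real)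
    thus ?thesis using r by simp
   qed (use r in \<open>simp add: a_def dprin_def\<close>)
   have "{1..q} \<inter> {n. coprime n q} = totatives q" by (auto simp: totatives_def)
   hence "(\<Sum>n=1..q. a n) = 0"
    using q by (simp add: a_def sum.distrib sum_subtractf dprin_def sum.If_cases totient_def r_def)
   moreover have "a (n + q) = a n" for n
    using dchar_cong[OF dchar_prin[OF q], of "n + q" n] by (simp add: a_def cong_def)
   ultimately have b: "bsum a (real q)"
    using periodic_partial_sum[OF q, of a] an q by (simp add: bsum_def)
   have "ds a s = ds (dprin q) s + ds (%n. of_real (- r) * 1) s"
    unfolding a_def using s dsum_cmult[OF dsum_1, of "of_real (- r)"]
    using r by (intro ds_add dsum_bounded[of _ 1]) (auto simp: dprin_def)
   also have "ds (%n. of_real (- r) * 1) s = of_real (- r) * ds (%_. 1) s" by (rule ds_cmult[OF dsum_1 s])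
   finally have "ds X s = Lc a s + of_real r * (zreg s + 1 / (s - 1))"
    using True Lc_eq_ds[OF b s] zeta_eq_zreg[OF s] by simp
   hence "norm (ds X s) <= norm (Lc a s) + norm (of_real r * (zreg s + 1 / (s - 1)))"
    by (simp only: norm_triangle_ineq)
   also have "norm (of_real r * (zreg s + 1 / (s - 1))) <= 1 * norm (zreg s + 1 / (s - 1))"
    unfolding norm_mult using r by (intro mult_right_mono) auto
   also have "... <= norm (zreg s) + 1 / norm (s - 1)"
    using norm_triangle_ineq[of "zreg s" "1 / (s - 1)"] by (simp add: norm_divide)
   also have "norm (zreg s) <= D * K"
   proof -
    have "1 + norm s <= real q * (1 + norm s)" using q mult_right_mono[of 1 "real q" "1 + norm s"] by simp
    hence "(1 + norm s) powr (2 * d) <= K" unfolding K_def using e by (intro powr_ge1_mono) auto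
    thus ?thesis using D(2)[OF s'] D(1) mult_left_mono[of "(1 + norm s) powr (2 * d)" K D] by linarith
   qed
   also have "norm (Lc a s) <= C * K" using C(2)[OF b s'] by (simp add: K_def)
   finally show ?thesis by (simp add: K_def algebra_simps)
  qed
 qed
 thus ?thesis using C(1) D(1) by (intro exI[of _ "C + D"]) auto
qed

lemma deriv_cauchy_bound:
 assumes f: "f holomorphic_on {s. Re s > 0}" and r: "0 < r" "r < Re z"
  and B: "!!w. norm (w - z) = r ==> norm (f w) <= B"
 shows "norm ((deriv ^^ k) f z) <= fact k * B / r ^ k"
proof (rule Cauchy_inequality[OF _ _ r(1)])
 have sub: "cball z r \<subseteq> {s. Re s > 0}"
 proof
  fix w assume "w \<in> cball z r"
  hence "\<bar>Re (z - w)\<bar> <= r" using abs_Re_le_cmod[of "z - w"] by (simp add: dist_norm)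
  thus "w \<in> {s. Re s > 0}" using r by simp
 qed
 show "f holomorphic_on ball z r" using holomorphic_on_subset[OF f] sub ball_subset_cball by blast
 show "continuous_on (cball z r) f"
  using holomorphic_on_imp_continuous_on[OF holomorphic_on_subset[OF f sub]] .
qed (use B in \<open>simp add: norm_minus_commute\<close>)

text \<open>Cauchy's inequality on the circle of radius \<open>d / 2\<close>. There
  \<open>1 + norm w\<close> is at most \<open>3 * (1 + R)\<close>, which costs 3^2 as
  \<open>p <= 2\<close>; division by the radius gives 18 / d.\<close>

lemma deriv_region_bound:
 assumes f: "f holomorphic_on {s. Re s > 0}" and e: "0 < d" "d <= 1/2" and Q: "Q >= 1" and C: "C >= 0" and p: "p >= 0" "p <= 2"
  and B: "!!w. Re w >= 1 - d ==> norm (f w) <= C * (Q * (1 + norm w)) powr p"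
  and z: "Re z >= 1 - d / 2" "norm z <= R + 1" "R >= 0"
 shows "norm (deriv f z) <= (18 * C / d) * (Q * (1 + R)) powr p"
proof -
 note R = z(3)
 have "norm ((deriv ^^ 1) f z) <= fact 1 * (C * (9 * (Q * (1 + R)) powr p)) / (d / 2) ^ 1"
 proof (rule deriv_cauchy_bound[OF f])
  show "d / 2 < Re z" "0 < d / 2" using z e by auto
  fix w assume w: "norm (w - z) = d / 2"
  have "\<bar>Re (w - z)\<bar> <= d / 2" using abs_Re_le_cmod[of "w - z"] w by simp
  hence Rw: "Re w >= 1 - d" using z e abs_le_D2[of "Re (w - z)" "d / 2"] by simp
  have "norm w <= norm (w - z) + norm z" using norm_triangle_ineq[of "w - z" z] by simp
  hence "1 + norm w <= 3 * (1 + R)" using w e z R by simp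
  hence "Q * (1 + norm w) <= 3 * (Q * (1 + R))"
   using Q mult_left_mono[of "1 + norm w" "3 * (1 + R)" Q] by simp
  moreover have "1 <= Q * (1 + norm w)" using mult_mono[of 1 Q 1 "1 + norm w"] Q by simp
  ultimately have "(Q * (1 + norm w)) powr p <= (3 * (Q * (1 + R))) powr p"
   using p by (intro powr_ge1_mono) auto
  also have "... = 3 powr p * (Q * (1 + R)) powr p" using Q R by (intro powr_mult)
  also have "... <= 3 powr 2 * (Q * (1 + R)) powr p"
   using p by (intro mult_right_mono powr_mono) auto
  finally have "C * (Q * (1 + norm w)) powr p <= C * (9 * (Q * (1 + R)) powr p)"
   using C by (intro mult_left_mono) auto
  thus "norm (f w) <= C * (9 * (Q * (1 + R)) powr p)" using B[OF Rw] by linarith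
 qed
 thus ?thesis by (simp add: mult_ac)
qed

lemma segment_lipschitz:
 assumes f: "f holomorphic_on {s. Re s > 0}" and S: "convex S" "S \<subseteq> {s. Re s > 0}" "a \<in> S" "b \<in> S"
  and B: "!!z. z \<in> S ==> norm (deriv f z) <= B"
 shows "norm (f a - f b) <= B * norm (a - b)"
proof (rule field_differentiable_bound[OF S(1) _ B S(3,4)])
 fix z assume "z \<in> S"
 hence "(f has_field_derivative deriv f z) (at z)"
  using holomorphic_derivI[OF f open_halfspace_Re_gt, of z] S by auto
 thus "(f has_field_derivative deriv f z) (at z within S)" by (rule DERIV_subset) simp
qed

lemma kappa_ge_1: "Q >= 1 ==> Q * (1 + norm s) >= (1::real)"
 using mult_mono[of 1 Q 1 "1 + norm s"] by simp

lemma horizontal_lipschitz: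
 assumes f: "f holomorphic_on {s. Re s > 0}" and e: "0 < d" "d <= 1/2" and u: "1 < u" "u <= u1" "u1 <= 2"
  and Q: "Q >= 1" and C: "C >= 0"
  and B: "!!w. Re w >= 1 - d ==> norm (f w) <= C * (Q * (1 + norm w)) powr (2 * d)"
 shows "norm (f (Complex u t) - f (Complex u1 t)) <= (u1 - u) * (18 * C / d * (Q * (1 + norm (Complex u t))) powr (2 * d))"
proof -
 \<comment> \<open>\<open>S\<close> is the horizontal segment itself, written as an intersection of
   half-planes so that convexity is immediate.\<close>
 define s S where "s = Complex u t" and "S = {z. u <= Re z} \<inter> {z. Re z <= u1} \<inter> ({z. t <= Im z} \<inter> {z. Im z <= t})"
 have "norm (f s - f (Complex u1 t)) <= (18 * C / d * (Q * (1 + norm s)) powr (2 * d)) * norm (s - Complex u1 t)"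
 proof (rule segment_lipschitz[OF f, of S])
  have "convex {z. u <= Re z}" "convex {z. t <= Im z}"
   using convex_halfspace_Re_ge[of u] convex_halfspace_Im_ge[of t] by simp_all
  thus "convex S" unfolding S_def by (intro convex_Int convex_halfspace_Re_le convex_halfspace_Im_le)
  fix z assume z: "z \<in> S"
  hence Sz: "u <= Re z" "Re z <= u1" "Im z = t" by (auto simp: S_def)
  have "z - s = of_real (Re z - u)" using Sz by (simp add: complex_eq_iff s_def)
  hence "norm (z - s) = \<bar>Re z - u\<bar>" by (simp only: norm_of_real)
  hence "norm z <= norm s + 1" using norm_triangle_ineq[of "z - s" s] Sz u by simp
  thus "norm (deriv f z) <= 18 * C / d * (Q * (1 + norm s)) powr (2 * d)"
   by (intro deriv_region_bound[OF f e Q C _ _ B]) (use e Sz u in auto)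
 qed (use u in \<open>auto simp: S_def s_def\<close>)
 also have "s - Complex u1 t = of_real (u - u1)" by (simp add: complex_eq_iff s_def)
 also have "norm (complex_of_real (u - u1)) = u1 - u" using u by (simp only: norm_of_real)
 finally show ?thesis by (simp add: s_def mult_ac)
qed

text \<open>The pole terms at all points where the 3-4-1 inequality is evaluated are thus bounded by
  the one at the point of interest.\<close>

lemma double_height:
 assumes "1 < u" "u <= u1" "u1 <= 2"
 shows "1 + norm (Complex u1 (2 * t)) <= 3 * (1 + norm (Complex u t))"
  and "norm (Complex u t - 1) <= norm (Complex u1 (2 * t) - 1)"
  and "norm (Complex u t - 1) <= norm (Complex u1 t - 1)"
proof -
 have "norm (Complex u1 (2 * t)) <= \<bar>u1\<bar> + \<bar>2 * t\<bar>" using cmod_le[of "Complex u1 (2 * t)"] by simp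
 moreover have "\<bar>t\<bar> <= norm (Complex u t)" using abs_Im_le_cmod[of "Complex u t"] by simp
 ultimately show "1 + norm (Complex u1 (2 * t)) <= 3 * (1 + norm (Complex u t))" using assms by simp
 have "(u - 1)\<^sup>2 <= (u1 - 1)\<^sup>2" using assms by (intro power_mono) auto
 thus "norm (Complex u t - 1) <= norm (Complex u1 (2 * t) - 1)"
  and "norm (Complex u t - 1) <= norm (Complex u1 t - 1)"
  by (simp_all add: cmod_def power_mult_distrib add_increasing)
qed

text \<open>One statement for nonprincipal characters and for the zeta function. \<open>h\<close> is
  the part of the series that is regular at 1, \<open>P\<close> its residue there, and
  \<open>R\<close> records whether the series of the squared character may have a pole. If a pole
  can occur, \<open>A\<close> has to dominate \<open>1 / norm (s - 1)\<close> as well.\<close>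

lemma lower_bound_at:
 assumes e: "0 < d" "d <= 1/2" and X: "dchar q X" and C: "C >= 1"
  and h: "h holomorphic_on {s. Re s > 0}"
  and hb: "!!z. Re z >= 1 - d ==> norm (h z) <= C * (real q * (1 + norm z)) powr (2 * d)"
  and hX: "!!z. Re z > 1 ==> ds X z = h z + of_real P / (z - 1)"
  and ub: "!!z. Re z > 1 ==> norm (ds (%n. X n * X n) z) <= C * (real q * (1 + norm z)) powr (2 * d) + R / norm (z - 1)"
  and s: "1 < Re s" "Re s <= 2" and A: "A >= 1" "(real q * (1 + norm s)) powr (2 * d) <= A"
  and P: "P = 0 \<and> R = 0 \<or> P \<in> {0, 1} \<and> R \<in> {0, 1} \<and> 1 / norm (s - 1) <= A"
 defines "C3 \<equiv> 3 * C + 1" and "C4 \<equiv> 18 * C / d + 1"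
 shows "(C4 / (433 * C3 * C4 ^ 4)) / A ^ 7 <= norm (ds X s)"
proof -
 define u t where "u = Re s" and "t = Im s"
 have st: "s = Complex u t" by (simp add: u_def t_def)
 have C34: "C3 >= 1" "C4 >= 1" using C e by (auto simp: C3_def C4_def)
 have q: "real q >= 1" using dcharD(1)[OF X] by simp
 have u: "1 < u" "u <= 2" using s by (simp_all add: u_def)
 have pole: "P / norm (z - 1) <= A" "R / norm (z - 1) <= A" if "norm (s - 1) <= norm (z - 1)" for z
 proof -
  have "norm (s - 1) > 0" using s by auto
  hence "1 / norm (z - 1) <= 1 / norm (s - 1)" using that by (intro frac_le) auto
  thus "P / norm (z - 1) <= A" "R / norm (z - 1) <= A" using P A by auto
 qed
 have "(C4 / (433 * C3 * C4 ^ 4)) / A ^ 7 <= norm (ds X (Complex u t))"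
 proof (rule lower_bound_341[OF X u C34 A(1)])
  fix u1 assume u1: "u <= u1" "u1 <= 2"
  note dh = double_height[OF u(1) u1, of t, folded st]
  define s1 s2 where "s1 = Complex u1 t" and "s2 = Complex u1 (2 * t)"
  have "real q * (1 + norm s2) <= 3 * (real q * (1 + norm s))"
   using q dh(1) mult_left_mono[of "1 + norm s2" "3 * (1 + norm s)" "real q"] by (simp add: s2_def)
  hence "(real q * (1 + norm s2)) powr (2 * d) <= (3 * (real q * (1 + norm s))) powr (2 * d)"
   using e kappa_ge_1[OF q] by (intro powr_ge1_mono) auto
  also have "... = 3 powr (2 * d) * (real q * (1 + norm s)) powr (2 * d)" by (rule powr_mult)
  also have "... <= 3 powr 1 * A"
   using e A by (intro mult_mono powr_mono) auto
  finally have "C * (real q * (1 + norm s2)) powr (2 * d) <= C * (3 * A)" using C by (intro mult_left_mono) auto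
  moreover have "Re s2 > 1" using u u1 by (simp add: s2_def)
  ultimately show "norm (ds (%n. X n * X n) (Complex u1 (2 * t))) <= C3 * A"
   using ub[of s2] pole(2)[of s2] dh(2) by (simp add: s2_def C3_def algebra_simps)
  have "norm (h s - h s1) <= (u1 - u) * (18 * C / d * (real q * (1 + norm (Complex u t))) powr (2 * d))"
   unfolding st s1_def by (rule horizontal_lipschitz[OF h e u(1) u1 q _ hb]) (use C in auto)
  also have "... <= (u1 - u) * (18 * C / d * (A * A))"
   using order_trans[OF A(2) self_le_power[OF A(1), of 2]] u1 C e
   by (intro mult_left_mono) (simp_all add: power2_eq_square flip: st)
  finally have 1: "norm (h s - h s1) <= (u1 - u) * (18 * C / d * (A * A))" .
  have ne: "s ~= 1" "s1 ~= 1" using u u1 by (auto simp: st s1_def complex_eq_iff)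
  \<comment> \<open>\<open>P\<close> is 0 or 1, hence idempotent; the difference of the two pole
    terms thus becomes a product of two quantities each bounded by \<open>A\<close>.\<close>
  have P1: "P * P = P" "0 <= P" using P by auto
  have "of_real P / (s - 1) - of_real P / (s1 - 1) = (s1 - s) * (of_real (P * P) / ((s - 1) * (s1 - 1)))"
   using ne unfolding P1 by (simp add: divide_simps algebra_simps)
  hence "norm (of_real P / (s - 1) - of_real P / (s1 - 1)) = norm (s1 - s) * (P / norm (s - 1) * (P / norm (s1 - 1)))"
   using P1 by (simp add: norm_mult norm_divide)
  also have "s1 - s = of_real (u1 - u)" by (simp add: complex_eq_iff s1_def st)
  also have "norm (complex_of_real (u1 - u)) = u1 - u" using u1 by (simp only: norm_of_real)
  also have "(u1 - u) * (P / norm (s - 1) * (P / norm (s1 - 1))) <= (u1 - u) * (A * A)"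
   using pole(1)[of s] pole(1)[of s1] dh(3) P1 A(1) u1 by (intro mult_left_mono mult_mono) (auto simp: s1_def)
  finally have 2: "norm (of_real P / (s - 1) - of_real P / (s1 - 1)) <= (u1 - u) * (A * A)" .
  have "ds X s - ds X s1 = (h s - h s1) + (of_real P / (s - 1) - of_real P / (s1 - 1))"
   using hX[of s] hX[of s1] u u1 by (simp add: st s1_def)
  hence "norm (ds X s - ds X s1) <= norm (h s - h s1) + norm (of_real P / (s - 1) - of_real P / (s1 - 1))"
   by (simp only: norm_triangle_ineq)
  thus "norm (ds X (Complex u t) - ds X (Complex u1 t)) <= (u1 - u) * (C4 * A\<^sup>2)"
   using 1 2 by (simp add: C4_def st s1_def algebra_simps power2_eq_square)
 qed
 thus ?thesis by (simp add: st)
qed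

text \<open>The disjunction excludes the single bad situation, a character whose square is principal
  at a point very close to 1. This is left to Siegel's theorem.\<close>

lemma lower_bound_nonprincipal:
 assumes e: "0 < d" "d <= 1/2"
 shows "\<exists>c>0. \<forall>q X s A. dchar q X --> X ~= dprin q --> 1 < Re s --> Re s <= 2 --> A >= 1 -->
   (real q * (1 + norm s)) powr (2 * d) <= A --> 1 / norm (s - 1) <= A \<or> (%n. X n * X n) ~= dprin q -->
   c / A ^ 7 <= norm (ds X s)"
proof -
 obtain C where C: "C >= 1" "!!a Q s. bsum a Q ==> Re s >= 1 - d ==> norm (Lc a s) <= C * (Q * (1 + norm s)) powr (2 * d)"
  using Lc_bound[OF e] by blast
 obtain D where D: "D >= 1" "!!q X s. dchar q X ==> Re s > 1 ==>
   norm (ds X s) <= D * (real q * (1 + norm s)) powr (2 * d) + 1 / norm (s - 1)"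
  using dchar_ds_upper[OF e] by blast
 define M where "M = max C D"
 have M: "C * K powr a <= M * K powr a" "D * K powr a <= M * K powr a" for K a
  by (auto simp: M_def intro!: mult_right_mono)
 define c where "c = (18 * M / d + 1) / (433 * (3 * M + 1) * (18 * M / d + 1) ^ 4)"
 have "c / A ^ 7 <= norm (ds X s)"
  if X: "dchar q X" "X ~= dprin q" and s: "1 < Re s" "Re s <= 2" and A: "A >= 1"
   "(real q * (1 + norm s)) powr (2 * d) <= A" "1 / norm (s - 1) <= A \<or> (%n. X n * X n) ~= dprin q" for q X s A
  unfolding c_def
 proof (rule lower_bound_at[where h = "Lc X" and P = 0 and R = "if (%n. X n * X n) ~= dprin q then 0 else 1", OF e X(1) _ _ _ _ _ s A(1,2)])
  have b: "bsum X (real q)" by (rule dchar_bsum[OF X])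
  show "M >= 1" using C by (simp add: M_def)
  show "Lc X holomorphic_on {s. Re s > 0}" by (rule Lc_holomorphic[OF b])
  show "norm (Lc X z) <= M * (real q * (1 + norm z)) powr (2 * d)" if "Re z >= 1 - d" for z
   using C(2)[OF b that] M(1) by (rule order_trans)
  fix z assume z: "Re z > 1"
  show "ds X z = Lc X z + of_real 0 / (z - 1)" using Lc_eq_ds[OF b z] by simp
  note X2 = dchar_mult_same[OF X(1) X(1)]
  show "norm (ds (%n. X n * X n) z) <= M * (real q * (1 + norm z)) powr (2 * d) +
    (if (%n. X n * X n) ~= dprin q then 0 else 1) / norm (z - 1)"
  proof (cases "(%n. X n * X n) ~= dprin q")
   case True
   have b2: "bsum (%n. X n * X n) (real q)" by (rule dchar_bsum[OF X2 True])
   show ?thesis using order_trans[OF C(2)[OF b2, of z] M(1)] Lc_eq_ds[OF b2 z] z e True by simp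
  next
   case False
   show ?thesis using order_trans[OF D(2)[OF X2 z] add_right_mono[OF M(2)]] False by simp
  qed
 qed (use A in auto)
 moreover have "c > 0" using C(1) e by (auto simp: c_def M_def intro!: divide_pos_pos mult_pos_pos zero_less_power add_nonneg_pos)
 ultimately show ?thesis by blast
qed

lemma dchar_one: "dchar 1 (%_. 1)" by (simp add: dchar_def)

lemma lower_bound_zeta:
 assumes e: "0 < d" "d <= 1/2"
 shows "\<exists>c>0. \<forall>s A. 1 < Re s --> Re s <= 2 --> A >= 1 -->
   (1 + norm s) powr (2 * d) <= A --> 1 / norm (s - 1) <= A --> c / A ^ 7 <= norm (ds (%_. 1) s)"
proof -
 obtain C where C: "C >= 1" "!!s. Re s >= 1 - d ==> norm (zreg s) <= C * (1 + norm s) powr (2 * d)"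
  using zreg_bound[OF e] by blast
 define c where "c = (18 * C / d + 1) / (433 * (3 * C + 1) * (18 * C / d + 1) ^ 4)"
 have "c / A ^ 7 <= norm (ds (%_. 1) s)"
  if s: "1 < Re s" "Re s <= 2" and A: "A >= 1"
   "(1 + norm s) powr (2 * d) <= A" "1 / norm (s - 1) <= A" for s A
  unfolding c_def
 proof (rule lower_bound_at[where h = zreg and P = 1 and R = 1, OF e dchar_one C(1) zreg_holomorphic _ _ _ s A(1)])
  fix z assume z: "Re z > 1"
  show "ds (%_. 1) z = zreg z + of_real 1 / (z - 1)" using zeta_eq_zreg[OF z] by simp
  have "norm (zreg z + 1 / (z - 1)) <= norm (zreg z) + norm (1 / (z - 1))" by (rule norm_triangle_ineq)
  thus "norm (ds (%n. 1 * 1) z) <= C * (real 1 * (1 + norm z)) powr (2 * d) + 1 / norm (z - 1)"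
   using C(2)[of z] z e zeta_eq_zreg[OF z] by (simp add: norm_divide)
 qed (use C A in auto)
 moreover have "c > 0" using C(1) e by (auto simp: c_def intro!: divide_pos_pos mult_pos_pos zero_less_power add_nonneg_pos)
 ultimately show ?thesis by blast
qed

section \<open>Siegel's theorem\<close>

lemma higher_deriv_pole:
 assumes "s ~= 1"
 shows "(deriv ^^ m) (%s. 1 / (s - 1)) s = (-1) ^ m * fact m / (s - 1 :: complex) ^ Suc m"
 using assms
proof (induction m arbitrary: s)
 case (Suc m)
 have "(deriv ^^ Suc m) (%s. 1 / (s - 1)) s = deriv ((deriv ^^ m) (%s. 1 / (s - 1))) s" by simp
 also have "... = deriv (%s. (-1) ^ m * fact m / (s - 1) ^ Suc m) s"
 proof (rule deriv_cong_ev[OF _ refl])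
  have "eventually (%z. z \<in> - {1}) (nhds s)" using Suc.prems by (intro eventually_nhds_in_open) auto
  thus "\<forall>\<^sub>F z in nhds s. (deriv ^^ m) (%s. 1 / (s - 1)) z = (-1) ^ m * fact m / (z - 1) ^ Suc m"
   by eventually_elim (use Suc.IH in auto)
 qed
 also have "... = (-1) ^ Suc m * fact (Suc m) / (s - 1) ^ Suc (Suc m)"
 proof (rule DERIV_imp_deriv)
  have "((%s. ((-1) ^ m * fact m) * inverse ((s - 1) ^ Suc m)) has_field_derivative
    ((-1) ^ m * fact m) * (- (inverse ((s - 1) ^ Suc m) * (of_nat (Suc m) * (s - 1) ^ m) * inverse ((s - 1) ^ Suc m)))) (at s)"
   using Suc.prems by (intro derivative_eq_intros refl | simp)+
  also have "((-1) ^ m * fact m) * (- (inverse ((s - 1) ^ Suc m) * (of_nat (Suc m) * (s - 1) ^ m) * inverse ((s - 1) ^ Suc m)))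
    = (-1) ^ Suc m * fact (Suc m) / (s - 1) ^ Suc (Suc m)"
  proof -
   have gen: "c * (- (inverse (a ^ Suc m) * (k * a ^ m) * inverse (a ^ Suc m))) = - (c * k / a ^ Suc (Suc m))"
    if "a ~= 0" for a c k :: complex using that by (simp add: field_simps)
   show ?thesis by (subst gen) (use Suc.prems in \<open>simp_all add: mult_ac\<close>)
  qed
  finally show "((%s. (-1) ^ m * fact m / (s - 1) ^ Suc m) has_field_derivative
    (-1) ^ Suc m * fact (Suc m) / (s - 1) ^ Suc (Suc m)) (at s)" by (simp only: divide_inverse)
 qed
 finally show ?case .
qed simp

text \<open>The coefficient of (2 - s)^m in the Taylor series of \<open>F\<close> at 2. The sign is
  chosen so that the coefficients are nonnegative for the products of series considered
  below.\<close>

definition tcoef :: "(complex => complex) => nat => complex" where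
 "tcoef F m = (-1) ^ m * (deriv ^^ m) F 2 / fact m"

text \<open>For \<open>H s = (s - 1) * F s\<close> this is \<open>F\<close> minus its polar part at
  1, continued across 1.\<close>

definition polepart :: "(complex => complex) => complex => complex" where
 "polepart H s = (if s = 1 then deriv H 1 else (H s - H 1) / (s - 1))"

text \<open>In powers of 2 - s the function 1/(s - 1) has all coefficients equal to 1, so removing
  the pole shifts every coefficient by the residue \<open>H 1\<close>. The radius of convergence
  rises to 2 because the disc of that radius about 2 lies in Re s > 0.\<close>

lemma taylor_pole:
 assumes H: "H holomorphic_on {s. Re s > 0}" and F: "F holomorphic_on {s. Re s > 1}"
  and HF: "!!s. Re s > 1 ==> H s = (s - 1) * F s"
 shows "polepart H holomorphic_on {s. Re s > 0}"
  and "tcoef (polepart H) m = tcoef F m - H 1"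
  and "norm (w - 2) < 2 ==> (%m. (tcoef F m - H 1) * (2 - w) ^ m) sums polepart H w"
proof -
 show hol: "polepart H holomorphic_on {s. Re s > 0}"
  unfolding polepart_def[abs_def] by (rule pole_lemma_open[OF H open_halfspace_Re_gt])
 have op: "open {s. Re s > 1}" by (rule open_halfspace_Re_gt)
 have hp: "(%s. 1 / (s - 1)) holomorphic_on {s. Re s > 1}" by (auto intro!: holomorphic_intros)
 show tc: "tcoef (polepart H) m = tcoef F m - H 1" for m
 proof -
  have "(deriv ^^ m) (polepart H) 2 = (deriv ^^ m) (%s. F s - H 1 * (1 / (s - 1))) 2"
  proof (rule higher_deriv_cong_ev[OF _ refl])
   have "eventually (%z. z \<in> {s. Re s > 1}) (nhds 2)" using op by (intro eventually_nhds_in_open) auto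
   thus "\<forall>\<^sub>F z in nhds 2. polepart H z = F z - H 1 * (1 / (z - 1))"
   proof eventually_elim
    case (elim z)
    hence "z ~= 1" by auto
    thus ?case using HF[of z] elim by (simp add: polepart_def field_simps)
   qed
  qed
  also have "... = (deriv ^^ m) F 2 - (deriv ^^ m) (%s. H 1 * (1 / (s - 1))) 2"
   by (rule higher_deriv_diff[OF F _ op]) (use hp in \<open>auto intro!: holomorphic_intros\<close>)
  also have "(deriv ^^ m) (%s. H 1 * (1 / (s - 1))) 2 = H 1 * (deriv ^^ m) (%s. 1 / (s - 1)) 2"
   by (rule higher_deriv_cmult[OF hp _ op]) simp
  also have "(deriv ^^ m) (%s. 1 / (s - 1)) (2::complex) = (-1) ^ m * fact m"
   by (subst higher_deriv_pole) simp_all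
  finally have D: "(deriv ^^ m) (polepart H) 2 = (deriv ^^ m) F 2 - H 1 * ((-1) ^ m * fact m)" .
  have "(-1) ^ m * (-1) ^ m = (1 :: complex)" by (simp flip: power_mult_distrib)
  hence "(-1) ^ m * (H 1 * ((-1) ^ m * fact m)) = H 1 * fact m" by (simp only: mult_ac) (simp add: mult_ac)
  thus ?thesis unfolding tcoef_def D by (simp add: right_diff_distrib diff_divide_distrib)
 qed
 assume w: "norm (w - 2) < 2"
 have sub: "ball 2 2 \<subseteq> {s. Re s > 0}"
 proof
  fix z :: complex assume "z \<in> ball 2 2"
  hence "\<bar>Re (2 - z)\<bar> < 2" using abs_Re_le_cmod[of "2 - z"] by (simp add: dist_norm)
  thus "z \<in> {s. Re s > 0}" by simp
 qed
 have "(%m. (deriv ^^ m) (polepart H) 2 / fact m * (w - 2) ^ m) sums polepart H w"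
  by (rule holomorphic_power_series[OF holomorphic_on_subset[OF hol sub]])
    (use w in \<open>simp add: dist_norm norm_minus_commute\<close>)
 moreover have "(deriv ^^ m) (polepart H) 2 / fact m * (w - 2) ^ m = (tcoef F m - H 1) * (2 - w) ^ m" for m
 proof -
  have "(w - 2) ^ m = (-1) ^ m * (2 - w) ^ m" by (simp flip: power_mult_distrib)
  thus ?thesis by (simp only: tc[symmetric]) (simp add: tcoef_def mult_ac)
 qed
 ultimately show "(%m. (tcoef F m - H 1) * (2 - w) ^ m) sums polepart H w" by simp
qed

lemma ds_derivs_at_2:
 fixes m :: nat
 assumes g: "dsum g" "!!n. \<exists>r\<ge>0. g n = of_real r"
 defines "b \<equiv> %n. Re (g n) * ln (real n) ^ m * real n powr (-2)"
 shows "b n >= 0" "summable b" "(-1) ^ m * (deriv ^^ m) (ds g) 2 = of_real (suminf b)"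
proof -
 have r: "Re (g n) >= 0" "g n = of_real (Re (g n))" for n using g(2)[of n] by auto
 show "b n >= 0" for n using r by (cases "n = 0") (auto simp: b_def)
 have e: "g n * of_real (ln (real n)) ^ m * of_nat n powr (-2) = of_real (b n)" for n
  by (subst r(2)) (cases "n = 0"; simp add: b_def powr_of_real[symmetric])
 have S: "(%n. complex_of_real (b n)) sums ds (%n. g n * of_real (ln (real n)) ^ m) 2"
  using ds_sums[OF dsum_ln_power[OF g(1)], of 2 m] by (simp add: e)
 thus s: "summable b" using summable_of_real_iff sums_iff by blast
 have "(-1) ^ m * (deriv ^^ m) (ds g) 2 = ds (%n. g n * of_real (ln (real n)) ^ m) 2"
  by (subst ds_higher_deriv[OF g(1)]) (simp_all flip: power_mult_distrib mult.assoc)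
 thus "(-1) ^ m * (deriv ^^ m) (ds g) 2 = of_real (suminf b)"
  using S suminf_of_real[OF s, where ?'a = complex] by (simp add: sums_iff)
qed

text \<open>Leibniz' rule for F' = - G F, where G is the series of \<open>g\<close>, computes the
  derivatives at 2 recursively from nonnegative quantities. Their alternating signs follow without
  an expansion of \<open>F\<close> into a Dirichlet series. The last claim keeps a single term of
  the recursion, the one with the undifferentiated \<open>F\<close>.\<close>

lemma derivs_of_log_deriv:
 assumes F: "F holomorphic_on {s. Re s > 1}" and g: "dsum g" "!!n. \<exists>r\<ge>0. g n = of_real r"
  and ode: "!!s. Re s > 1 ==> deriv F s = - (ds g s * F s)" and F2: "F 2 = of_real r0" "r0 >= 0"
 obtains b where "!!m. b m >= 0" "!!m. (-1) ^ m * (deriv ^^ m) F 2 = of_real (b m)"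
  "!!m. r0 * (\<Sum>n. Re (g n) * ln (real n) ^ m * real n powr (-2)) <= b (Suc m)"
proof -
 have op: "open {s. Re s > 1}" by (rule open_halfspace_Re_gt)
 have dg: "ds g holomorphic_on {s. Re s > 1}"
  using ds_has_field_derivative[OF g(1)] unfolding holomorphic_on_open[OF op] by blast
 define G where "G = (%m. \<Sum>n. Re (g n) * ln (real n) ^ m * real n powr (-2))"
 note d = ds_derivs_at_2[OF g]
 have G: "G m >= 0" "(-1) ^ m * (deriv ^^ m) (ds g) 2 = of_real (G m)" for m
  using suminf_nonneg[OF d(2,1)] d(3)[of m] by (simp_all add: G_def)
 have e: "(-1) ^ Suc k * (deriv ^^ Suc k) F 2 =
   (\<Sum>i\<le>k. of_nat (k choose i) * of_real (G i) * ((-1) ^ (k - i) * (deriv ^^ (k - i)) F 2))" for k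
 proof -
  have "(deriv ^^ Suc k) F 2 = (deriv ^^ k) (deriv F) 2" by (simp only: funpow_Suc_right o_def)
  also have "... = (deriv ^^ k) (%s. - (ds g s * F s)) 2"
  proof (rule higher_deriv_cong_ev[OF _ refl])
   have "eventually (%z. z \<in> {s. Re s > 1}) (nhds 2)" using op by (intro eventually_nhds_in_open) auto
   thus "\<forall>\<^sub>F z in nhds 2. deriv F z = - (ds g z * F z)" by eventually_elim (use ode in auto)
  qed
  also have "... = - (deriv ^^ k) (%s. ds g s * F s) 2"
   by (rule higher_deriv_uminus[OF _ op]) (use dg F in \<open>auto intro!: holomorphic_intros\<close>)
  also have "(deriv ^^ k) (%s. ds g s * F s) 2 =
    (\<Sum>i=0..k. of_nat (k choose i) * (deriv ^^ i) (ds g) 2 * (deriv ^^ (k - i)) F 2)"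
   by (rule higher_deriv_mult[OF dg F op]) simp
  finally have "(-1) ^ Suc k * (deriv ^^ Suc k) F 2 =
    (\<Sum>i=0..k. (-1) ^ k * (of_nat (k choose i) * (deriv ^^ i) (ds g) 2 * (deriv ^^ (k - i)) F 2))"
   by (simp add: sum_distrib_left sum_negf)
  also have "... = (\<Sum>i\<le>k. of_nat (k choose i) * of_real (G i) * ((-1) ^ (k - i) * (deriv ^^ (k - i)) F 2))"
  proof (rule sum.cong)
   fix i assume "i \<in> {..k}"
   hence "(-1 :: complex) ^ k = (-1) ^ i * (-1) ^ (k - i)" by (simp flip: power_add)
   thus "(-1) ^ k * (of_nat (k choose i) * (deriv ^^ i) (ds g) 2 * (deriv ^^ (k - i)) F 2) =
    of_nat (k choose i) * of_real (G i) * ((-1) ^ (k - i) * (deriv ^^ (k - i)) F 2)"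
    by (simp add: mult_ac flip: G(2))
  qed auto
  finally show ?thesis .
 qed
 have "\<exists>b\<ge>0. (-1) ^ m * (deriv ^^ m) F 2 = of_real b" for m
 proof (induction m rule: less_induct)
  case (less m)
  show ?case
  proof (cases m)
   case 0 thus ?thesis using F2 by auto
  next
   case (Suc k)
   have "\<forall>i. \<exists>r\<ge>0. (-1) ^ (k - i) * (deriv ^^ (k - i)) F 2 = of_real r" using less Suc by simp
   then obtain f where f: "!!i. f i >= 0" "!!i. (-1) ^ (k - i) * (deriv ^^ (k - i)) F 2 = of_real (f i)" by metis
   show ?thesis unfolding Suc e f
    by (intro exI[of _ "\<Sum>i\<le>k. real (k choose i) * G i * f i"]) (simp add: sum_nonneg G(1) f)
  qed
 qed
 then obtain b where b: "!!m. b m >= 0" "!!m. (-1) ^ m * (deriv ^^ m) F 2 = of_real (b m)" by metis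
 have "r0 * G m <= b (Suc m)" for m
 proof -
  have "of_real (b (Suc m)) = complex_of_real (\<Sum>i\<le>m. real (m choose i) * G i * b (m - i))"
   using e[of m] unfolding b(2) by simp
  hence "b (Suc m) = (\<Sum>i\<le>m. real (m choose i) * G i * b (m - i))" unfolding of_real_eq_iff .
  also have "... >= (\<Sum>i\<in>{m}. real (m choose i) * G i * b (m - i))" by (rule sum_mono2) (auto simp: G b)
  moreover have "b 0 = r0" using b(2)[of 0] F2 by simp
  ultimately show ?thesis by (simp add: mult.commute)
 qed
 from that[OF b this[unfolded G_def]] show thesis .
qed

text \<open>Estermann's argument: the power series at 2 of \<open>F(s) - \<lambda>/(s-1)\<close> converges up to \<open>Re s > 0\<close>,
 so its value at \<open>v\<close>, which is at most \<open>\<lambda>/(1-v)\<close>, is bounded below by its initial segment.\<close>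
lemma estermann:
 assumes H: "H holomorphic_on {s. Re s > 0}" and F: "F holomorphic_on {s. Re s > 1}"
  and HF: "!!s. Re s > 1 ==> H s = (s - 1) * F s"
  and g: "dsum g" "!!n. \<exists>r\<ge>0. g n = of_real r"
  and ode: "!!s. Re s > 1 ==> deriv F s = - (ds g s * F s)" and F2: "F 2 = of_real r0" "r0 >= 1 / 200"
  and B: "B >= 1" "!!w. norm (w - 2) <= 3 / 2 ==> norm (H w) <= B"
  and v: "3 / 4 < v" "v < 1" and Hb: "Re (H (of_real v)) >= 0"
 shows "Re (H 1) >= (1 - v) / 1200 * (9600 * B) powr (- 6 * (1 - v))"
proof -
 define l where "l = Re (H 1)"
 have tp1: "polepart H holomorphic_on {s. Re s > 0}" by (rule taylor_pole(1)[OF H F]) (use HF in auto)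
 have tp2: "tcoef (polepart H) m = tcoef F m - H 1" for m by (rule taylor_pole(2)[OF H F]) (use HF in auto)
 have tp3: "(%m. (tcoef F m - H 1) * (2 - w) ^ m) sums polepart H w" if "norm (w - 2) < 2" for w
  by (rule taylor_pole(3)[OF H F]) (use HF that in auto)
 obtain b where b: "!!m. b m >= 0" "!!m. (-1) ^ m * (deriv ^^ m) F 2 = of_real (b m)"
  by (rule derivs_of_log_deriv[OF F g ode F2(1)]) (use F2 in auto)
 define c where "c = (%m. b m / fact m - l)"
 have tc: "Re (tcoef F m - H 1) = c m" for m
 proof -
  have "tcoef F m = of_real (b m / fact m)" by (simp add: tcoef_def b)
  thus ?thesis by (simp add: c_def l_def del: of_real_divide)
 qed
 \<comment> \<open>Cauchy's inequality on the circle of radius 3/2 about 2, which stays at distance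
   1/2 from the removed pole.\<close>
 have cb: "\<bar>c m\<bar> <= 4 * B * (2 / 3) ^ m" for m
 proof -
  have "norm ((deriv ^^ m) (polepart H) 2) <= fact m * (4 * B) / (3 / 2) ^ m"
  proof (rule deriv_cauchy_bound[OF tp1])
   fix w :: complex assume w: "norm (w - 2) = 3 / 2"
   have w1: "norm (w - 1) >= 1 / 2" using norm_triangle_ineq2[of "w - 2" "-1"] w by simp
   have "norm (H w - H 1) <= B + B" using B(2)[of w] B(2)[of 1] w norm_triangle_ineq4[of "H w" "H 1"] by simp
   hence "norm (H w - H 1) / norm (w - 1) <= (2 * B) / (1 / 2)" using w1 B by (intro frac_le) auto
   moreover have "w ~= 1" using w1 by auto
   ultimately show "norm (polepart H w) <= 4 * B" by (simp add: polepart_def norm_divide)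
  qed auto
  hence "norm (tcoef (polepart H) m) <= 4 * B / (3 / 2) ^ m"
   by (simp add: tcoef_def norm_mult norm_divide norm_power field_simps)
  also have "4 * B / (3 / 2) ^ m = 4 * B * (2 / 3) ^ m" by (simp add: power_divide field_simps)
  finally show ?thesis using abs_Re_le_cmod[of "tcoef F m - H 1"] tc[of m] tp2[of m] by simp
 qed
 define y where "y = 2 - v"
 have y: "1 < y" "y < 5 / 4" using v by (auto simp: y_def)
 have "norm (of_real v - 2 :: complex) = \<bar>v - 2\<bar>" by (metis norm_of_real of_real_diff of_real_numeral)
 hence nb: "norm (of_real v - 2 :: complex) < 2" using v by simp
 have "(%m. Re ((tcoef F m - H 1) * (2 - of_real v) ^ m)) sums Re (polepart H (of_real v))"
  by (rule sums_Re[OF tp3[OF nb]])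
 moreover have "Re ((tcoef F m - H 1) * (2 - of_real v) ^ m) = c m * y ^ m" for m
 proof -
  have "(2 - of_real v) ^ m = (of_real (y ^ m) :: complex)" by (simp add: y_def)
  thus ?thesis using tc[of m] by (simp only:) simp
 qed
 ultimately have S: "(%m. c m * y ^ m) sums Re (polepart H (of_real v))" by simp
 have P: "Re (polepart H (of_real v)) <= l / (1 - v)"
 proof -
  have "of_real v ~= (1::complex)" using v by simp
  hence "polepart H (of_real v) = (H (of_real v) - H 1) / of_real (v - 1)" by (simp add: polepart_def)
  hence "Re (polepart H (of_real v)) = (Re (H (of_real v)) - l) / (v - 1)" by (simp only: Re_divide_of_real minus_complex.sel l_def)
  also have "... = (l - Re (H (of_real v))) / (1 - v)" using v by (simp add: field_simps)
  also have "... <= l / (1 - v)" using Hb v by (intro divide_right_mono) auto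
  finally show ?thesis .
 qed
 \<comment> \<open>The tail is at most a geometric series of ratio 5/6, namely the decay 2/3 of the
   coefficients times the bound 5/4 for \<open>y\<close>. With this many terms it is below 1/400,
   half of the lower bound for the constant term; 9600 = 24 * 400, and the 6 comes from ln (6/5) >=
   1/6.\<close>
 define M where "M = nat \<lceil>6 * ln (9600 * B)\<rceil>"
 have lnB: "ln (9600 * B) > 0" using B by simp
 have M: "real M >= 6 * ln (9600 * B)" "real M <= 6 * ln (9600 * B) + 1" using lnB by (auto simp: M_def)
 have M1: "M >= 1" using M lnB by (cases "M = 0") auto
 have ln65: "ln (6 / 5 :: real) >= 1 / 6"
  using ln_le_minus_one[of "5 / 6 :: real"] ln_div[of 5 "6 :: real"] ln_div[of 6 "5 :: real"] by simp
 have small: "24 * B * (5 / 6) ^ M <= 1 / 400"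
 proof -
  have "ln (9600 * B) <= real M * ln (6 / 5)"
   using M(1) ln65 mult_left_mono[of "1/6" "ln (6/5)" "real M"] by simp
  also have "... = ln ((6 / 5) ^ M)" by (simp add: ln_realpow)
  finally have "9600 * B <= (6 / 5) ^ M" using B by simp
  hence "9600 * B * (5 / 6) ^ M <= (6 / 5) ^ M * (5 / 6) ^ M" by (intro mult_right_mono) auto
  also have "... = 1" by (simp flip: power_mult_distrib)
  finally show ?thesis by simp
 qed
 have tailS: "(%m. c (m + M) * y ^ (m + M)) sums (Re (polepart H (of_real v)) - (\<Sum>m<M. c m * y ^ m))"
  using S by (rule sums_split_initial_segment)
 have geo: "(%m. - (4 * B * (5 / 6) ^ M) * (5 / 6) ^ m) sums (- (4 * B * (5 / 6) ^ M) * (1 / (1 - 5 / 6)))"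
  by (intro sums_mult geometric_sums) simp
 have "- (4 * B * (5 / 6) ^ M) * (5 / 6) ^ m <= c (m + M) * y ^ (m + M)" for m
 proof -
  have "\<bar>c (m + M) * y ^ (m + M)\<bar> <= (4 * B * (2 / 3) ^ (m + M)) * (5 / 4) ^ (m + M)"
   unfolding abs_mult using cb y B by (intro mult_mono) (auto intro!: power_mono)
  also have "... = 4 * B * (5 / 6) ^ (m + M)" by (simp flip: power_mult_distrib)
  finally show ?thesis by (simp add: power_add mult_ac)
 qed
 from sums_le[OF this geo tailS]
 have t: "Re (polepart H (of_real v)) - (\<Sum>m<M. c m * y ^ m) >= - 24 * B * (5 / 6) ^ M" by simp
 have "(\<Sum>m<M. c m * y ^ m) >= 1 / 200 - l * (\<Sum>m<M. y ^ m)"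
 proof -
  have "(\<Sum>m<M. (if m = 0 then 1 / 200 else 0) - l * y ^ m) <= (\<Sum>m<M. c m * y ^ m)"
  proof (rule sum_mono)
   fix m
   show "(if m = 0 then 1 / 200 else 0) - l * y ^ m <= c m * y ^ m"
   proof (cases "m = 0")
    case True
    have "b 0 = r0" using b(2)[of 0] F2 by simp
    thus ?thesis using F2 True by (simp add: c_def)
   next
    case False
    have "0 <= b m / fact m * y ^ m" using b y by simp
    thus ?thesis using False by (simp add: c_def algebra_simps)
   qed
  qed
  moreover have "(\<Sum>m<M. (if m = 0 then 1 / 200 else 0) - l * y ^ m) = 1 / 200 - l * (\<Sum>m<M. y ^ m)"
   using M1 by (simp add: sum_subtractf sum_distrib_left)
  ultimately show ?thesis by simp
 qed
 moreover have "(\<Sum>m<M. y ^ m) = (y ^ M - 1) / (1 - v)"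
  using geometric_sum[of y M] y by (simp add: y_def)
 ultimately have "l / (1 - v) >= 1 / 400 - l * ((y ^ M - 1) / (1 - v))" using P t small by simp
 moreover have "l / (1 - v) + l * ((y ^ M - 1) / (1 - v)) = l * y ^ M / (1 - v)"
  by (simp add: right_diff_distrib diff_divide_distrib)
 ultimately have "1 / 400 <= l * y ^ M / (1 - v)" by linarith
 hence main: "l * y ^ M >= (1 - v) / 400" using v by (simp add: field_simps)
 have yM: "y ^ M <= 3 * (9600 * B) powr (6 * (1 - v))"
 proof -
  have "y <= exp (1 - v)" using exp_ge_add_one_self[of "1 - v"] by (simp add: y_def)
  hence "y ^ M <= exp (1 - v) ^ M" using y by (intro power_mono) auto
  also have "... = exp (real M * (1 - v))" by (simp add: exp_of_nat_mult)
  also have "... <= exp (1 + (6 * (1 - v)) * ln (9600 * B))"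
  proof -
   have "real M * (1 - v) <= (6 * ln (9600 * B) + 1) * (1 - v)" using M v by (intro mult_right_mono) auto
   also have "... <= 1 + (6 * (1 - v)) * ln (9600 * B)" using v by (simp add: algebra_simps)
   finally show ?thesis by simp
  qed
  also have "... = exp 1 * (9600 * B) powr (6 * (1 - v))" using B by (simp add: exp_add powr_def)
  also have "... <= 3 * (9600 * B) powr (6 * (1 - v))" using exp_le by (intro mult_right_mono) auto
  finally show ?thesis .
 qed
 have l0: "l > 0" using main y v zero_less_mult_pos2[of l "y ^ M"] by (simp add: field_simps)
 have "(1 - v) / 400 <= l * (3 * (9600 * B) powr (6 * (1 - v)))"
  by (rule order_trans[OF main mult_left_mono[OF yM]]) (use l0 in simp)
 hence "(1 - v) / 1200 <= l * (9600 * B) powr (6 * (1 - v))" by simp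
 hence "(1 - v) / 1200 / (9600 * B) powr (6 * (1 - v)) <= l" using B by (simp add: divide_le_eq)
 moreover have "(9600 * B) powr (- 6 * (1 - v)) = inverse ((9600 * B) powr (6 * (1 - v)))"
  by (simp only: powr_minus[symmetric] mult_minus_left)
 ultimately show ?thesis by (simp only: l_def divide_inverse)
qed

section \<open>Real characters and the series multiplied with them\<close>

lemma sum_divisors_coprime:
 fixes f :: "nat => 'a :: comm_monoid_add"
 assumes "coprime a b" "a > 0" "b > 0"
 shows "(\<Sum>d | d dvd a * b. f d) = (\<Sum>d | d dvd a. \<Sum>e | e dvd b. f (d * e))"
proof -
 have g1: "gcd (d * e) a = d" if "d dvd a" "e dvd b" for d e
 proof -
  have "coprime e a" using assms(1) that(2) by (meson coprime_commute coprime_divisors dvd_refl)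
  hence "gcd a (d * e) = gcd a d" using coprime_commute gcd_mult_right_right_cancel by blast
  hence "gcd (d * e) a = gcd d a" by (simp only: gcd.commute)
  thus ?thesis using that(1) by (simp add: gcd_proj1_iff)
 qed
 have g2: "gcd (d * e) b = e" if "d dvd a" "e dvd b" for d e
 proof -
  have "coprime d b" using assms(1) that(1) by (meson coprime_divisors dvd_refl)
  hence "gcd b (e * d) = gcd b e" using coprime_commute gcd_mult_right_right_cancel by blast
  hence "gcd (d * e) b = gcd e b" by (simp only: gcd.commute mult.commute)
  thus ?thesis using that(2) by (simp add: gcd_proj1_iff)
 qed
 have g3: "gcd c a * gcd c b = c" if c: "c dvd a * b" for c
 proof -
  obtain d e where "c = d * e" "d dvd a" "e dvd b" using division_decomp[OF c] by blast
  thus ?thesis using g1 g2 by simp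
 qed
 have "(\<Sum>d | d dvd a. \<Sum>e | e dvd b. f (d * e)) = (\<Sum>(d, e)\<in>{d. d dvd a} \<times> {e. e dvd b}. f (d * e))"
  by (rule sum.cartesian_product)
 also have "... = (\<Sum>c | c dvd a * b. f c)"
  by (rule sum.reindex_bij_witness[of _ "%c. (gcd c a, gcd c b)" "%(d, e). d * e"])
    (auto simp: g1 g2 g3 mult_dvd_mono)
 finally show ?thesis ..
qed

lemma sum_divisors_prime_power:
 fixes f :: "nat => 'a :: comm_monoid_add"
 assumes "prime p"
 shows "(\<Sum>d | d dvd p ^ k. f d) = (\<Sum>i\<le>k. f (p ^ i))"
proof -
 have "{d. d dvd p ^ k} = (%i. p ^ i) ` {..k}"
  using divides_primepow_nat[OF assms] by (auto simp: image_iff)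
 moreover have "inj_on (%i. p ^ i) {..k}"
  using prime_gt_1_nat[OF assms] by (auto simp: inj_on_def)
 ultimately show ?thesis by (simp add: sum.reindex)
qed

lemma prime_power_cases:
 assumes "n > (1::nat)"
 obtains p k m where "prime p" "k > 0" "\<not> p dvd m" "n = p ^ k * m" "m > 0" "m < n"
proof -
 obtain p where p: "prime p" "p dvd n" using assms prime_factor_nat by (metis less_numeral_extra(4))
 obtain m where m: "n = p ^ multiplicity p n * m" "\<not> p dvd m"
  using multiplicity_decompose'[of n p] p assms by (metis not_prime_unit not_less_zero)
 have k: "multiplicity p n > 0" using p assms by (simp add: prime_multiplicity_gt_zero_iff)
 have m0: "m > 0" using m assms by (cases "m = 0") auto
 have "p ^ multiplicity p n > 1" using prime_gt_1_nat[OF p(1)] k by (intro one_less_power) auto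
 hence "1 * m < p ^ multiplicity p n * m" using m0 by (intro mult_strict_right_mono) auto
 hence "m < n" using m(1) by simp
 from that[OF p(1) k m(2,1) m0 this] show thesis .
qed

definition rchar :: "nat => (nat => complex) => bool" where
 "rchar q X \<longleftrightarrow> dchar q X \<and> (\<forall>n. X n = 0 \<or> X n = 1 \<or> X n = -1)"

lemma rchar_dchar: "rchar q X ==> dchar q X" by (simp add: rchar_def)

lemma rchar_cases: "rchar q X ==> X n = 0 \<or> X n = 1 \<or> X n = -1" by (simp add: rchar_def)

lemma card_multiples:
 assumes "d > 0"
 shows "card {k\<in>{1..n}. d dvd k} = n div (d::nat)"
proof -
 have "{k\<in>{1..n}. d dvd k} = (%i. d * i) ` {1..n div d}"
  using assms by (auto simp: less_eq_div_iff_mult_less_eq mult.commute elim!: dvdE)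
 also have "card ... = n div d" using assms by (subst card_image) (auto simp: inj_on_def)
 finally show ?thesis .
qed

text \<open>Chebyshev's argument: the logarithm of the factorial of 2M is at least M ln M, while it
  equals the sum of Lambda(d) times the number of multiples of d up to 2M. A bound \<open>B\<close>
  for the sums would give ln M <= 2B for all M.\<close>

lemma mangoldt_sum_unbounded: "\<exists>N. B < (\<Sum>d=1..N. mangoldt d / real d)"
proof (rule ccontr)
 assume "\<not> ?thesis"
 hence B: "(\<Sum>d=1..N. mangoldt d / real d) <= B" for N by (simp add: not_less)
 have "ln (real M) <= 2 * B" if M: "M > 0" for M
 proof -
  have "real M * ln (real M) = (\<Sum>n=Suc M..2 * M. ln (real M))" by simp
  also have "... <= (\<Sum>n=Suc M..2 * M. ln (real n))" using M by (intro sum_mono) auto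
  also have "... <= (\<Sum>n=1..2 * M. ln (real n))" by (intro sum_mono2) auto
  also have "... = (\<Sum>n=1..2 * M. \<Sum>d=1..2 * M. if d dvd n then mangoldt d else 0)"
  proof (rule sum.cong[OF refl])
   fix n assume n: "n \<in> {1..2 * M}"
   have "ln (real n) = (\<Sum>d | d dvd n. mangoldt d)" using mangoldt_sum[of n, where ?'a = real] n by simp
   also have "{d. d dvd n} = {1..2 * M} \<inter> {d. d dvd n}" using n by (auto simp: Suc_le_eq intro: dvd_pos_nat order_trans[OF dvd_imp_le])
   finally show "ln (real n) = (\<Sum>d=1..2 * M. if d dvd n then mangoldt d else 0)" by (simp add: sum.If_cases)
  qed
  also have "... = (\<Sum>d=1..2 * M. \<Sum>n=1..2 * M. if d dvd n then mangoldt d else 0)" by (rule sum.swap)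
  also have "... <= (\<Sum>d=1..2 * M. real (2 * M) * (mangoldt d / real d))"
  proof (rule sum_mono)
   fix d assume d: "d \<in> {1..2 * M}"
   have "(\<Sum>n=1..2 * M. if d dvd n then mangoldt d else 0) = real (card {k\<in>{1..2 * M}. d dvd k}) * mangoldt d"
    by (simp add: sum.If_cases Int_def conj_assoc)
   also have "... <= (real (2 * M) / real d) * mangoldt d"
    using card_multiples[of d "2 * M"] of_nat_div_le_of_nat[of "2 * M" d, where ?'a = real]
    by (intro mult_right_mono mangoldt_nonneg) (use d in simp_all)
   finally show "(\<Sum>n=1..2 * M. if d dvd n then mangoldt d else 0) <= real (2 * M) * (mangoldt d / real d)" by simp
  qed
  also have "... <= real (2 * M) * B" unfolding sum_distrib_left[symmetric] using B by (intro mult_left_mono) auto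
  finally show ?thesis using M by simp
 qed
 moreover obtain M :: nat where "exp (2 * B) < real M" using reals_Archimedean2 by blast
 ultimately have "M > 0 ==> real M <= exp (2 * B)" "real M > exp (2 * B)" using ln_ge_iff[of "real M"] by (auto simp: ln_le_cancel_iff[symmetric])
 thus False by (cases "M = 0") (auto simp: not_less order_trans[OF exp_ge_zero])
qed

lemma ds_holomorphic: "dsum a ==> ds a holomorphic_on {s. Re s > 1}"
 using ds_has_field_derivative unfolding holomorphic_on_open[OF open_halfspace_Re_gt] by blast

text \<open>\<open>g\<close> holds the coefficients of minus the logarithmic derivative of
  \<open>F\<close>. The relation is stated without division, so that it needs no nonvanishing and
  adds up under products.\<close>

definition LD :: "(complex => complex) => (nat => complex) => bool" where
 "LD F g \<longleftrightarrow> F holomorphic_on {s. Re s > 1} \<and> dsum g \<and> (\<forall>s. Re s > 1 --> deriv F s = - (ds g s * F s))"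

lemma LD_dchar:
 assumes X: "dchar q X"
 shows "LD (ds X) (%n. mangoldt n * X n)"
proof -
 have n: "norm (X n) <= 1" for n by (rule dchar_norm_le[OF X])
 have d: "dsum X" by (rule dsum_bounded[OF n])
 have "deriv (ds X) s = - (ds (%n. mangoldt n * X n) s * ds X s)" if "Re s > 1" for s
  using DERIV_imp_deriv[OF ds_has_field_derivative[OF d that]] ds_mangoldt[OF n dcharD(2)[OF X] that] by simp
 thus ?thesis unfolding LD_def using ds_holomorphic[OF d] dsum_mangoldt[of X, OF n] by blast
qed

lemma LD_mult:
 assumes "LD F g" "LD F' g'"
 shows "LD (%s. F s * F' s) (%n. g n + g' n)"
proof -
 have op: "open {s. Re s > 1}" by (rule open_halfspace_Re_gt)
 have "deriv (%s. F s * F' s) s = - (ds (%n. g n + g' n) s * (F s * F' s))" if s: "Re s > 1" for s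
 proof -
  have "F field_differentiable at s" "F' field_differentiable at s"
   using assms s op by (auto simp: LD_def holomorphic_on_open field_differentiable_def)
  hence "deriv (%s. F s * F' s) s = F s * deriv F' s + deriv F s * F' s" by (rule deriv_mult)
  moreover have "ds (%n. g n + g' n) s = ds g s + ds g' s" using assms s by (intro ds_add) (auto simp: LD_def)
  ultimately show ?thesis using assms s by (simp add: LD_def algebra_simps)
 qed
 thus ?thesis using assms unfolding LD_def by (auto intro!: holomorphic_intros dsum_add)
qed

lemma inverse_square_sum_le: "(\<Sum>n. real n powr (-2)) <= 7 / 4"
proof -
 have "real (Suc n) powr (-2) = 1 / real ((n + 1)\<^sup>2)" for n
  by (simp add: powr_minus divide_inverse add.commute)
 hence "(%n. real (Suc n) powr (-2)) sums (pi\<^sup>2 / 6)" using inverse_squares_sums by (simp only:)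
 hence "(%n. real n powr (-2)) sums (pi\<^sup>2 / 6)" by (subst (asm) sums_Suc_iff) simp
 moreover have "pi <= 32 / 10" by (rule order_trans[OF pi_approx(2)]) simp
 hence "pi\<^sup>2 <= (32 / 10)\<^sup>2" by (intro power_mono) auto
 ultimately show ?thesis by (simp add: sums_iff power2_eq_square)
qed

lemma rchar_ds_real:
 assumes X: "rchar q X" and s: "\<sigma> > 1"
 shows "ds X (of_real \<sigma>) = of_real (Re (ds X (of_real \<sigma>)))"
  and "(%n. Re (X n) * real n powr (- \<sigma>)) sums Re (ds X (of_real \<sigma>))"
proof -
 have d: "dsum X" by (rule dsum_bounded[OF dchar_norm_le[OF rchar_dchar[OF X]]])
 have S: "(%n. X n * of_nat n powr (- of_real \<sigma>)) sums ds X (of_real \<sigma>)" using ds_sums[OF d, of "of_real \<sigma>"] s by simp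
 have e: "X n * of_nat n powr (- of_real \<sigma>) = of_real (Re (X n) * real n powr (- \<sigma>))" for n
  using rchar_cases[OF X, of n] by (cases "n = 0") (auto simp: powr_of_real[symmetric])
 show "(%n. Re (X n) * real n powr (- \<sigma>)) sums Re (ds X (of_real \<sigma>))"
  using sums_Re[OF S] unfolding e by simp
 have "Im (ds X (of_real \<sigma>)) = 0" using sums_Im[OF S] sums_zero unfolding e by (simp add: sums_iff)
 thus "ds X (of_real \<sigma>) = of_real (Re (ds X (of_real \<sigma>)))" by (simp add: complex_eq_iff)
qed

text \<open>The terms beyond the first sum to at most zeta(2) - 1 <= 3/4 in modulus. This makes the
  constant term in Estermann's argument positive and independent of the modulus.\<close>

lemma rchar_ds_2:
 assumes X: "rchar q X"
 shows "\<exists>r\<ge>1/4. ds X 2 = of_real r"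
proof -
 have sz: "(%n. real n powr (-2)) sums (\<Sum>n. real n powr (-2))"
  by (intro summable_sums) (simp add: summable_real_powr_iff)
 have S1: "(%n. (if n = 1 then 2 else 0) - real n powr (-2)) sums (2 - (\<Sum>n. real n powr (-2)))"
  by (intro sums_diff sz) (use sums_single[of 1 "%_. 2::real"] in simp)
 have S2: "(%n. Re (X n) * real n powr (-2)) sums Re (ds X 2)" using rchar_ds_real(2)[OF X, of 2] by simp
 have le: "(if n = 1 then 2 else 0) - real n powr (-2) <= Re (X n) * real n powr (-2)" for n
  using rchar_cases[OF X, of n] dchar_1[OF rchar_dchar[OF X]] by (cases "n = 1") auto
 have "2 - (\<Sum>n. real n powr (-2)) <= Re (ds X 2)" by (rule sums_le[OF le S1 S2])
 moreover have "ds X 2 = of_real (Re (ds X 2))" using rchar_ds_real(1)[OF X, of 2] by simp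
 ultimately show ?thesis using inverse_square_sum_le by (intro exI[of _ "Re (ds X 2)"]) auto
qed

lemma rchar_one: "rchar 1 (%_. 1)" using dchar_one by (simp add: rchar_def)

lemma zeta_2: "\<exists>r\<ge>1. ds (%_. 1) 2 = of_real r"
proof -
 have S: "(%n. real n powr (-2)) sums Re (ds (%_. 1) 2)" using rchar_ds_real(2)[OF rchar_one, of 2] by simp
 have "(\<Sum>n\<in>{1::nat}. real n powr (-2)) <= (\<Sum>n. real n powr (-2))"
  by (rule sum_le_suminf) (auto simp: summable_real_powr_iff)
 hence "1 <= Re (ds (%_. 1) 2)" using S by (simp add: sums_iff)
 moreover have "ds (%_. 1) 2 = of_real (Re (ds (%_. 1) 2))" using rchar_ds_real(1)[OF rchar_one, of 2] by simp
 ultimately show ?thesis by blast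
qed

lemma rchar_mult:
 assumes "rchar q X" "rchar r Y"
 shows "rchar (q * r) (%n. X n * Y n)"
 unfolding rchar_def
proof (intro conjI allI)
 show "dchar (q * r) (%n. X n * Y n)" by (rule dchar_mult) (use assms in \<open>auto intro: rchar_dchar\<close>)
 show "X n * Y n = 0 \<or> X n * Y n = 1 \<or> X n * Y n = -1" for n
  using rchar_cases[OF assms(1), of n] rchar_cases[OF assms(2), of n] by auto
qed

lemma mangoldt_of_real: "(mangoldt n :: complex) = of_real (mangoldt n)" by simp

text \<open>On this disc the real part is at least 1/2 and the trivial estimates suffice. The
  products 152 = 19 * 8 and 9728 = 19 * 8^3 enter the applications of
  \<open>estermann\<close>.\<close>

lemma disc_bounds:
 fixes w :: complex
 assumes "norm (w - 2) <= 3 / 2"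
 shows "norm (Zf w) <= 19" and "bsum a Q ==> norm (Lc a w) <= 8 * Q"
proof -
 have "\<bar>Re (w - 2)\<bar> <= 3 / 2" using abs_Re_le_cmod[of "w - 2"] assms by linarith
 hence Re: "Re w >= 1 / 2" using abs_le_D2[of "Re (w - 2)" "3 / 2"] by simp
 have n: "norm w <= 7 / 2" using norm_triangle_ineq[of "w - 2" 2] assms by simp
 have n1: "norm (w - 1) <= 5 / 2" using norm_triangle_ineq[of "w - 2" 1] assms by simp
 have q: "norm w / Re w <= 7" using frac_le[OF _ n _ Re] by simp
 have z: "norm (w - 1) * (norm w / Re w) <= 5 / 2 * 7" using n1 q Re by (intro mult_mono) auto
 have "norm (Zf w - 1) <= norm (w - 1) * (norm w / Re w)" by (rule Zf_near) (use Re in simp)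
 hence "norm (Zf w - 1) <= 18" using z by linarith
 thus "norm (Zf w) <= 19" using norm_triangle_ineq2[of "Zf w" 1] by simp
 show "norm (Lc a w) <= 8 * Q" if a: "bsum a Q"
 proof -
  have "norm (Lc a w) <= Q * (1 + norm w / Re w)" by (rule Lc_bound_trivial[OF a]) (use Re in simp)
  also have "... <= Q * 8" using q a by (intro mult_left_mono) (auto simp: bsum_def)
  finally show ?thesis by simp
 qed
qed

lemma rchar_Lc_real:
 assumes X: "rchar q X" "X ~= dprin q" and s: "\<sigma> > 0"
 shows "Lc X (of_real \<sigma>) = of_real (Re (Lc X (of_real \<sigma>)))"
proof -
 have b: "bsum X (real q)" by (rule dchar_bsum[OF rchar_dchar[OF X(1)] X(2)])
 define t where "t = (%n. (\<Sum>k=1..n. X k) * (npow n (of_real \<sigma>) - npow (Suc n) (of_real \<sigma>)))"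
 have np: "npow n (of_real \<sigma>) = of_real (real n powr (- \<sigma>))" for n
  by (cases "n = 0") (simp_all add: npow_def powr_of_real[symmetric])
 have "Im (X k) = 0" for k using rchar_cases[OF X(1), of k] by auto
 hence "Im (t n) = 0" for n unfolding t_def np by (simp add: Im_sum del: of_nat_Suc)
 moreover have "(%n. Im (t n)) sums Im (Lc X (of_real \<sigma>))"
  unfolding Lc_def t_def[symmetric] by (intro sums_Im summable_sums) (use Lc_summable[OF b, of "of_real \<sigma>"] s in \<open>simp add: t_def\<close>)
 ultimately have "(%n. 0) sums Im (Lc X (of_real \<sigma>))" by simp
 hence "Im (Lc X (of_real \<sigma>)) = 0" by (rule sums_unique2[OF _ sums_zero])
 thus ?thesis by (simp add: complex_eq_iff)
qed

lemma Zf_real_pos: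
 assumes "3 / 4 < l" "l <= 1"
 shows "\<exists>r\<ge>0. Zf (of_real l) = of_real r"
proof -
 have np: "npow n (of_real x) = of_real (real n powr (- x))" for n x
  by (cases "n = 0") (simp_all add: npow_def powr_of_real[symmetric])
 have np': "npow n (of_real x - 1) = of_real (real n powr (- (x - 1)))" for n x
  using np[of n "x - 1"] by simp
 have "Im (zt n (of_real l)) = 0" for n unfolding zt_def np np' by simp
 moreover have "(%n. Im (zt n (of_real l))) sums Im (\<Sum>n. zt n (of_real l))"
  by (intro sums_Im summable_sums zt_summable) (use assms in simp)
 ultimately have "(%n. 0) sums Im (\<Sum>n. zt n (of_real l))" by simp
 hence "Im (\<Sum>n. zt n (of_real l)) = 0" by (rule sums_unique2[OF _ sums_zero])
 hence "Im (Zf (of_real l)) = 0" by (simp add: Zf_def)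
 hence e: "Zf (of_real l) = of_real (Re (Zf (of_real l)))" by (simp add: complex_eq_iff)
 have "norm (complex_of_real l - 1) = \<bar>l - 1\<bar>" by (metis norm_of_real of_real_1 of_real_diff)
 hence "norm (Zf (of_real l) - 1) <= \<bar>l - 1\<bar>" using Zf_near[of "of_real l"] assms by simp
 hence "\<bar>Re (Zf (of_real l) - 1)\<bar> <= 1" using abs_Re_le_cmod[of "Zf (of_real l) - 1"] assms by linarith
 thus ?thesis using e by (intro exI[of _ "Re (Zf (of_real l))"]) auto
qed

definition zF :: "(nat => complex) => complex => complex" where "zF X s = ds (%_. 1) s * ds X s"

definition zH :: "(nat => complex) => complex => complex" where "zH X s = Zf s * Lc X s"

text \<open>Coefficients of minus the logarithmic derivative of \<open>zF X\<close>; they are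
  Lambda(n) (1 + X(n)), hence nonnegative for real characters.\<close>

definition zg :: "(nat => complex) => nat => complex" where "zg X n = mangoldt n * 1 + mangoldt n * X n"

lemma zeta_mult_rchar:
 assumes X: "rchar q X" "X ~= dprin q"
 shows "LD (zF X) (zg X)" "\<exists>r\<ge>0. zg X n = of_real r" "\<exists>r\<ge>1/4. zF X 2 = of_real r"
  "zH X holomorphic_on {s. Re s > 0}" "Re s > 1 ==> zH X s = (s - 1) * zF X s"
proof -
 have dX: "dchar q X" by (rule rchar_dchar[OF X(1)])
 have b: "bsum X (real q)" by (rule dchar_bsum[OF dX X(2)])
 show "LD (zF X) (zg X)" unfolding zF_def[abs_def] zg_def[abs_def] by (rule LD_mult[OF LD_dchar[OF dchar_one] LD_dchar[OF dX]])
 show "\<exists>r\<ge>0. zg X n = of_real r"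
  using rchar_cases[OF X(1), of n] mangoldt_nonneg[of n]
  by (auto simp: zg_def mangoldt_of_real simp del: of_real_mangoldt intro: exI[of _ 0] exI[of _ "2 * mangoldt n"] exI[of _ "mangoldt n"])
 obtain r1 where r1: "r1 >= 1" "ds (%_. 1) 2 = of_real r1" using zeta_2 by blast
 obtain r2 where r2: "r2 >= 1/4" "ds X 2 = of_real r2" using rchar_ds_2[OF X(1)] by blast
 have "1 * (1/4) <= r1 * r2" using r1 r2 by (intro mult_mono) auto
 thus "\<exists>r\<ge>1/4. zF X 2 = of_real r" by (intro exI[of _ "r1 * r2"]) (simp add: zF_def r1 r2)
 show "zH X holomorphic_on {s. Re s > 0}" unfolding zH_def[abs_def]
  by (intro holomorphic_intros Zf_holomorphic Lc_holomorphic[OF b])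
 show "zH X s = (s - 1) * zF X s" if "Re s > 1"
  using Zf_eq_ds[OF that] Lc_eq_ds[OF b that] by (simp add: zH_def zF_def)
qed

text \<open>If \<open>L(1)\<close> vanished, \<open>\<zeta>L\<close> would be regular on \<open>Re s > 0\<close>. Its Taylor coefficients at 2 dominate those
 of its logarithmic derivative, which would thus converge at \<open>1/2\<close>, where the squares contribute \<open>\<Sum>\<Lambda>(n)/n\<close>.\<close>
lemma Lc_nonzero_at_1:
 assumes X: "rchar q X" "X ~= dprin q"
 shows "Lc X 1 ~= 0"
proof
 assume z: "Lc X 1 = 0"
 define F H g where "F = zF X" and "H = zH X" and "g = zg X"
 note zr = zeta_mult_rchar[OF X, folded F_def H_def g_def]
 have H1: "H 1 = 0" by (simp add: H_def zH_def z)
 have F: "F holomorphic_on {s. Re s > 1}" and dg: "dsum g"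
  and ode: "!!s. Re s > 1 ==> deriv F s = - (ds g s * F s)" using zr(1) by (auto simp: LD_def)
 obtain r0 where r0: "r0 >= 1/4" "F 2 = of_real r0" using zr(3) by blast
 define G where "G = (%m n. Re (g n) * ln (real n) ^ m * real n powr (-2))"
 have dG: "G m n >= 0" "summable (G m)" for m n using ds_derivs_at_2[OF dg zr(2)] by (simp_all add: G_def)
 obtain b where b: "!!m. b m >= 0" "!!m. (-1) ^ m * (deriv ^^ m) F 2 = of_real (b m)"
   "!!m. r0 * suminf (G m) <= b (Suc m)"
  unfolding G_def by (rule derivs_of_log_deriv[OF F dg zr(2) ode r0(2)]) (use r0 in auto)
 have "summable (%m. b m / fact m * x ^ m)" if x: "norm x < 2" for x :: real
 proof -
  have "(%m. (tcoef F m - H 1) * (2 - of_real (2 - x)) ^ m) sums polepart H (of_real (2 - x))"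
   by (rule taylor_pole(3)[OF zr(4) F zr(5)]) (use x in simp_all)
  hence "summable (%m. complex_of_real (b m / fact m * x ^ m))"
   by (simp add: H1 sums_iff tcoef_def b(2))
  thus ?thesis unfolding summable_of_real_iff .
 qed
 \<comment> \<open>The distance 3/2 from the centre 2 corresponds to the point 1/2. The shifted
   index is the termwise derivative, matching the logarithmic derivative in \<open>b(3)\<close>, and
   the factor 4 compensates \<open>r0 >= 1/4\<close>.\<close>
 from termdiff_converges[where K = 2 and x = "3 / 2", OF _ this]
 have TS: "summable (%m. 4 * (b (Suc m) / fact m * (3 / 2) ^ m))"
  by (intro summable_mult) (simp add: diffs_def field_simps del: of_nat_Suc)
 define T where "T = (\<Sum>m. 4 * (b (Suc m) / fact m * (3 / 2) ^ m))"
 have bound: "(\<Sum>n=1..N. Re (g n) * real n powr (-1/2)) <= T" for N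
 proof -
  have ex: "(%m. (3 / 2 * ln (real n)) ^ m / fact m) sums real n powr (3 / 2)" if "n > 0" for n
  proof -
   have "(%m. x ^ m / fact m) sums exp x" for x :: real
    using exp_converges[of x] by (simp add: divide_inverse mult.commute[of "inverse _"])
   from this[of "3 / 2 * ln (real n)"] show ?thesis using that by (simp only: powr_def) simp
  qed
  have "(%m. \<Sum>n=1..N. Re (g n) * real n powr (-2) * ((3 / 2 * ln (real n)) ^ m / fact m)) sums
    (\<Sum>n=1..N. Re (g n) * real n powr (-2) * real n powr (3 / 2))"
   by (intro sums_sum sums_mult ex) auto
  moreover have "(\<Sum>n=1..N. Re (g n) * real n powr (-2) * real n powr (3 / 2)) = (\<Sum>n=1..N. Re (g n) * real n powr (-1/2))"
   by (intro sum.cong) (auto simp: mult.assoc simp flip: powr_add)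
  ultimately have "(%m. \<Sum>n=1..N. Re (g n) * real n powr (-2) * ((3 / 2 * ln (real n)) ^ m / fact m)) sums
    (\<Sum>n=1..N. Re (g n) * real n powr (-1/2))" by simp
  moreover have "(\<Sum>n=1..N. Re (g n) * real n powr (-2) * ((3 / 2 * ln (real n)) ^ m / fact m))
    <= 4 * (b (Suc m) / fact m * (3 / 2) ^ m)" for m
  proof -
   have "(\<Sum>n=1..N. Re (g n) * real n powr (-2) * ((3 / 2 * ln (real n)) ^ m / fact m)) = (3 / 2) ^ m / fact m * (\<Sum>n=1..N. G m n)"
    unfolding sum_distrib_left G_def power_mult_distrib[of "3 / 2"] by (intro sum.cong refl) (simp only: times_divide_eq_left times_divide_eq_right mult_ac)
   also have "... <= (3 / 2) ^ m / fact m * (4 * b (Suc m))"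
   proof (rule mult_left_mono)
    have "(\<Sum>n=1..N. G m n) <= suminf (G m)" by (rule sum_le_suminf) (use dG in auto)
    also have "1/4 * suminf (G m) <= r0 * suminf (G m)" using r0 suminf_nonneg[OF dG(2,1)] by (intro mult_right_mono) auto
    hence "suminf (G m) <= 4 * b (Suc m)" using b(3)[of m] by linarith
    finally show "(\<Sum>n=1..N. G m n) <= 4 * b (Suc m)" .
   qed simp
   finally show ?thesis by (simp add: mult_ac)
  qed
  ultimately show ?thesis unfolding T_def by (intro sums_le[OF _ _ summable_sums[OF TS]]) auto
 qed
 have g0: "Re (g n) >= 0" for n using zr(2)[of n] by auto
 have "(\<Sum>j=1..N. mangoldt j / real j) <= T" for N
 proof -
  \<comment> \<open>At squares the character is not negative, so \<open>g (j ^ 2)\<close> is at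
    least Lambda(j^2) = Lambda(j) whatever the value of \<open>X j\<close>.\<close>
  have "(\<Sum>j=1..N. mangoldt j / real j) <= (\<Sum>j=1..N. Re (g (j ^ 2)) * real (j ^ 2) powr (-1/2))"
  proof (rule sum_mono)
   fix j assume j: "j \<in> {1..N}"
   have "mangoldt (j ^ 2) = (mangoldt j :: real)"
    using j by (simp add: mangoldt_def primepow_power_iff_nat aprimedivisor_primepow_power)
   hence "mangoldt j <= Re (g (j ^ 2))"
    using rchar_cases[OF X(1), of j] mangoldt_nonneg[of j] dcharD(2)[OF rchar_dchar[OF X(1)], of j j]
    by (auto simp: g_def zg_def power2_eq_square)
   moreover have "real (j ^ 2) powr (-1/2) = 1 / real j"
    using j powr_powr[of "real j" 2 "-1/2"] by (simp add: powr_minus_divide)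
   ultimately show "mangoldt j / real j <= Re (g (j ^ 2)) * real (j ^ 2) powr (-1/2)"
    by (simp add: divide_right_mono)
  qed
  also have "... = (\<Sum>n\<in>(%j. j ^ 2) ` {1..N}. Re (g n) * real n powr (-1/2))"
   by (subst sum.reindex) (auto simp: inj_on_def)
  also have "... <= (\<Sum>n=1..N ^ 2. Re (g n) * real n powr (-1/2))"
   using g0 by (intro sum_mono2) (auto intro!: power_mono mult_nonneg_nonneg)
  also have "... <= T" by (rule bound)
  finally show ?thesis .
 qed
 thus False using mangoldt_sum_unbounded[of T] by (meson not_less)
qed

text \<open>Applied to the product of the zeta function with one series. A sign condition at a point
  \<open>l\<close> close to 1 is enough, and \<open>q\<close> is lost only to the power 6(1 -
  l).\<close>

lemma estermann_one:
 assumes X: "rchar q X" "X ~= dprin q" and l: "3 / 4 < l" "l < 1" and L: "Re (Lc X (of_real l)) >= 0"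
 shows "Re (Lc X 1) >= (1 - l) / 1200 * (9600 * (152 * real q)) powr (- 6 * (1 - l))"
proof -
 have dX: "dchar q X" by (rule rchar_dchar[OF X(1)])
 note zr = zeta_mult_rchar[OF X]
 obtain r0 where r0: "r0 >= 1/4" "zF X 2 = of_real r0" using zr(3) by blast
 have "Re (zH X 1) >= (1 - l) / 1200 * (9600 * (152 * real q)) powr (- 6 * (1 - l))"
 proof (rule estermann[OF zr(4) _ zr(5) _ zr(2) _ r0(2)])
  show "1 <= 152 * real q" using dcharD(1)[OF dX] by simp
  show "norm (zH X w) <= 152 * real q" if w: "norm (w - 2) <= 3 / 2" for w
   using mult_mono[OF disc_bounds(1)[OF w] disc_bounds(2)[OF w dchar_bsum[OF dX X(2)]]] by (simp add: zH_def norm_mult)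
  obtain z where z: "z >= 0" "Zf (of_real l) = of_real z" using Zf_real_pos[of l] l by auto
  show "0 <= Re (zH X (of_real l))" using z L by (simp add: zH_def)
 qed (use l zr(1) r0 in \<open>auto simp: LD_def\<close>)
 thus ?thesis by (simp add: zH_def)
qed

text \<open>With a second character the coefficients are Lambda(n) (1 + X(n)) (1 + Y(n)), still
  nonnegative, and a zero of the series of \<open>Y\<close> at \<open>l\<close> provides the sign
  condition whatever \<open>X\<close> is.\<close>

lemma estermann_two:
 assumes X: "rchar q X" "X ~= dprin q" and Y: "rchar r Y" "Y ~= dprin r"
  and XY: "(%n. X n * Y n) ~= dprin (q * r)"
  and l: "3 / 4 < l" "l < 1" and L: "Lc Y (of_real l) = 0"
 shows "Re (Lc X 1 * Lc Y 1 * Lc (%n. X n * Y n) 1)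
   >= (1 - l) / 1200 * (9600 * (9728 * (real q * real r)\<^sup>2)) powr (- 6 * (1 - l))"
proof -
 define V where "V = (%n. X n * Y n)"
 have V: "rchar (q * r) V" "V ~= dprin (q * r)" using rchar_mult[OF X(1) Y(1)] XY by (simp_all add: V_def)
 have dX: "dchar q X" and dY: "dchar r Y" and dV: "dchar (q * r) V"
  using X(1) Y(1) V(1) by (auto intro: rchar_dchar)
 have bX: "bsum X (real q)" by (rule dchar_bsum[OF dX X(2)])
 have bY: "bsum Y (real r)" by (rule dchar_bsum[OF dY Y(2)])
 have bV: "bsum V (real (q * r))" by (rule dchar_bsum[OF dV V(2)])
 have qr1: "real q >= 1" "real r >= 1" using dcharD(1)[OF dX] dcharD(1)[OF dY] by simp_all
 define F where "F = (%s. (ds (%_. 1) s * ds X s) * (ds Y s * ds V s))"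
 define H where "H = (%s. (Zf s * Lc X s) * (Lc Y s * Lc V s))"
 define g where "g = (%n. (mangoldt n * (1::complex) + mangoldt n * X n) + (mangoldt n * Y n + mangoldt n * V n))"
 have ld: "LD F g" unfolding F_def g_def
  by (rule LD_mult[OF LD_mult[OF LD_dchar[OF dchar_one] LD_dchar[OF dX]] LD_mult[OF LD_dchar[OF dY] LD_dchar[OF dV]]])
 have g: "\<exists>r\<ge>0. g n = of_real r" for n
 proof -
  have ge: "g n = of_real (mangoldt n) * ((1 + X n) * (1 + Y n))" by (simp add: g_def V_def algebra_simps)
  have "\<exists>u\<ge>0. 1 + X n = of_real u" using rchar_cases[OF X(1), of n]
   by (auto intro: exI[of _ 0] exI[of _ 1] exI[of _ 2])
  moreover have "\<exists>u\<ge>0. 1 + Y n = of_real u" using rchar_cases[OF Y(1), of n]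
   by (auto intro: exI[of _ 0] exI[of _ 1] exI[of _ 2])
  ultimately obtain u v where uv: "u >= 0" "1 + X n = of_real u" "v >= 0" "1 + Y n = of_real v" by blast
  show ?thesis unfolding ge uv using uv mangoldt_nonneg[of n]
   by (intro exI[of _ "mangoldt n * (u * v)"]) (auto intro!: mult_nonneg_nonneg)
 qed
 obtain r1 where r1: "r1 >= 1" "ds (%_. 1) 2 = of_real r1" using zeta_2 by blast
 obtain r2 where r2: "r2 >= 1/4" "ds X 2 = of_real r2" using rchar_ds_2[OF X(1)] by blast
 obtain r3 where r3: "r3 >= 1/4" "ds Y 2 = of_real r3" using rchar_ds_2[OF Y(1)] by blast
 obtain r4 where r4: "r4 >= 1/4" "ds V 2 = of_real r4" using rchar_ds_2[OF V(1)] by blast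
 have F2: "F 2 = of_real ((r1 * r2) * (r3 * r4))" by (simp add: F_def r1 r2 r3 r4)
 have "(1 * (1/4)) * ((1/4) * (1/4)) <= (r1 * r2) * (r3 * r4)" using r1 r2 r3 r4 by (intro mult_mono) auto
 hence r12: "1 / 64 <= (r1 * r2) * (r3 * r4)" by simp
 have "Re (H 1) >= (1 - l) / 1200 * (9600 * (9728 * (real q * real r)\<^sup>2)) powr (- 6 * (1 - l))"
 proof (rule estermann[where F = F and g = g and ?r0.0 = "(r1 * r2) * (r3 * r4)"])
  show "H holomorphic_on {s. Re s > 0}" unfolding H_def
   by (intro holomorphic_intros Zf_holomorphic Lc_holomorphic[OF bX] Lc_holomorphic[OF bY] Lc_holomorphic[OF bV])
  show "F holomorphic_on {s. Re s > 1}" using ld by (simp add: LD_def)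
  show "H s = (s - 1) * F s" if "Re s > 1" for s
   using Zf_eq_ds[OF that] Lc_eq_ds[OF bX that] Lc_eq_ds[OF bY that] Lc_eq_ds[OF bV that] by (simp add: H_def F_def)
  have "1 * 1 <= real q * real r" using qr1 by (intro mult_mono) auto
  hence "1 <= (real q * real r)\<^sup>2" by (intro one_le_power) simp
  thus "1 <= 9728 * (real q * real r)\<^sup>2" by simp
  show "norm (H w) <= 9728 * (real q * real r)\<^sup>2" if w: "norm (w - 2) <= 3 / 2" for w
  proof -
   have "norm (H w) <= (19 * (8 * real q)) * ((8 * real r) * (8 * real (q * r)))" unfolding H_def norm_mult
    using disc_bounds(1)[OF w] disc_bounds(2)[OF w bX] disc_bounds(2)[OF w bY] disc_bounds(2)[OF w bV]
    by (intro mult_mono) auto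
   also have "... = 9728 * (real q * real r)\<^sup>2" by (simp add: power2_eq_square)
   finally show ?thesis .
  qed
  show "0 <= Re (H (of_real l))" using L by (simp add: H_def)
 qed (use l ld r12 g F2 in \<open>auto simp: LD_def\<close>)
 thus ?thesis by (simp add: H_def V_def mult_ac)
qed

lemma dchar_ds_nonzero:
 assumes X: "dchar q X" and z: "Re z > 1"
 shows "ds X z ~= 0"
proof
 assume z0: "ds X z = 0"
 have "(%y::nat. (\<Prod>p | prime p \<and> p <= y. 1 - X p * npow p z) * suminf (%n. X n * npow n z)) \<longlonglongrightarrow> 1"
  by (rule euler_product_tendsto)
    (use ds_summable_norm[OF dsum_bounded[OF dchar_norm_le[OF X]] z] in
     \<open>simp_all add: npow_mult dcharD(2)[OF X] dchar_1[OF X] npow_def[symmetric]\<close>)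
 moreover have "suminf (%n. X n * npow n z) = 0" using z0 by (simp add: ds_def npow_def)
 ultimately show False by (simp add: LIMSEQ_const_iff)
qed

lemma rchar_Lc_zero:
 assumes X: "rchar q X" "X ~= dprin q" and a: "0 < a" "a <= b" and L: "Re (Lc X (of_real a)) <= 0" "0 <= Re (Lc X (of_real b))"
 shows "\<exists>x\<ge>a. x <= b \<and> Lc X (of_real x) = 0"
proof -
 have "continuous_on {a..b} (%x. Re (Lc X (of_real x)))"
 proof (intro continuous_intros continuous_on_compose2[OF holomorphic_on_imp_continuous_on[OF Lc_holomorphic]])
  show "bsum X (real q)" by (rule dchar_bsum[OF rchar_dchar[OF X(1)] X(2)])
 qed (use a in auto)
 from IVT'[OF L a(2) this] obtain x where "a <= x" "x <= b" "Re (Lc X (of_real x)) = 0" by blast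
 thus ?thesis using rchar_Lc_real[OF X, of x] a by (intro exI[of _ x]) simp
qed

text \<open>The series is positive at 2, and a change of sign between 1 and 2 would give a zero,
  excluded at 1 by \<open>Lc_nonzero_at_1\<close> and beyond 1 by the Euler product.\<close>

lemma rchar_Lc_1_pos:
 assumes X: "rchar q X" "X ~= dprin q"
 shows "Re (Lc X 1) > 0"
proof (rule ccontr)
 have dX: "dchar q X" by (rule rchar_dchar[OF X(1)])
 note e = Lc_eq_ds[OF dchar_bsum[OF dX X(2)]]
 assume "\<not> ?thesis"
 moreover obtain r where "r >= 1/4" "ds X 2 = of_real r" using rchar_ds_2[OF X(1)] by blast
 ultimately obtain x where x: "1 <= x" "Lc X (of_real x) = 0"
  using rchar_Lc_zero[OF X, of 1 2] e[of 2] by auto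
 show False
 proof (cases "x = 1")
  case True
  thus ?thesis using x Lc_nonzero_at_1[OF X] by simp
 next
  case False
  thus ?thesis using x e[of "of_real x"] dchar_ds_nonzero[OF dX, of "of_real x"] by simp
 qed
qed

lemma ds_restrict_coprime:
 assumes X: "dchar q X" and r: "r > 0" and s: "Re s > 1"
 shows "(\<Prod>p\<in>prime_factors r. 1 - X p * npow p s) * ds X s = ds (%n. X n * dprin r n) s"
proof -
 define f where "f = (%n. X n * npow n s)"
 have d: "dsum X" by (rule dsum_bounded[OF dchar_norm_le[OF X]])
 have sf: "summable (%n. norm (f n))" using ds_summable_norm[OF d s] by (simp add: f_def npow_def)
 have "(\<Prod>p\<in>prime_factors r. 1 - f p) * suminf f = (\<Sum>n. if \<exists>p\<in>prime_factors r. p dvd n then 0 else f n)"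
  by (rule euler_finite[OF sf]) (auto simp: f_def npow_mult dcharD(2)[OF X])
 also have "(%n. if \<exists>p\<in>prime_factors r. p dvd n then 0 else f n) = (%n. X n * dprin r n * npow n s)"
 proof
  fix n
  have "(\<exists>p\<in>prime_factors r. p dvd n) \<longleftrightarrow> \<not> coprime n r"
  proof
   assume "\<exists>p\<in>prime_factors r. p dvd n"
   then obtain p where p: "prime p" "p dvd r" "p dvd n" using r by (auto simp: prime_factors_dvd)
   thus "\<not> coprime n r" using coprime_common_divisor[of n r p] not_prime_unit[of p] by argo
  next
   assume "\<not> coprime n r"
   hence "gcd n r ~= 1" unfolding coprime_iff_gcd_eq_1 .
   then obtain p where "prime p" "p dvd gcd n r" using prime_factor_nat by blast
   thus "\<exists>p\<in>prime_factors r. p dvd n" using r by (auto simp: prime_factors_dvd)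
  qed
  thus "(if \<exists>p\<in>prime_factors r. p dvd n then 0 else f n) = X n * dprin r n * npow n s"
   by (simp add: f_def dprin_def)
 qed
 finally show ?thesis by (simp add: f_def ds_def npow_def)
qed

text \<open>If the product is principal, the two characters agree wherever both are nonzero. Their
  series then differ by finitely many Euler factors, which have no zeros in Re s > 0. This takes the
  place of a reduction to primitive characters.\<close>

lemma Lc_zero_transfer:
 assumes X: "rchar q X" "X ~= dprin q" and Y: "rchar r Y" "Y ~= dprin r"
  and XY: "(%n. X n * Y n) = dprin (q * r)" and l: "l > 0" and L: "Lc Y (of_real l) = 0"
 shows "Lc X (of_real l) = 0"
proof -
 have dX: "dchar q X" and dY: "dchar r Y" using X(1) Y(1) by (auto intro: rchar_dchar)
 have bX: "bsum X (real q)" by (rule dchar_bsum[OF dX X(2)])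
 have bY: "bsum Y (real r)" by (rule dchar_bsum[OF dY Y(2)])
 have qr: "q > 0" "r > 0" using dcharD(1)[OF dX] dcharD(1)[OF dY] by auto
 define f where "f = (%s. (\<Prod>p\<in>prime_factors r. 1 - X p * npow p s) * Lc X s)"
 define g where "g = (%s. (\<Prod>p\<in>prime_factors q. 1 - Y p * npow p s) * Lc Y s)"
 have eq: "X n * dprin r n = Y n * dprin q n" for n
 proof -
  have *: "X n * Y n = dprin (q * r) n" using XY by (rule fun_cong)
  have "coprime n (q * r) \<longleftrightarrow> coprime n q \<and> coprime n r" by simp
  thus ?thesis using * rchar_cases[OF X(1), of n] rchar_cases[OF Y(1), of n] dcharD(4)[OF dX, of n] dcharD(4)[OF dY, of n]
   by (auto simp: dprin_def split: if_splits)
 qed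
 have "f (of_real l) = g (of_real l)"
 proof (rule analytic_continuation_open[of "{s. Re s > 1}" "{s. Re s > 0}" f g])
  show "f holomorphic_on {s. Re s > 0}" unfolding f_def
   by (intro holomorphic_intros Lc_holomorphic[OF bX])
  show "g holomorphic_on {s. Re s > 0}" unfolding g_def
   by (intro holomorphic_intros Lc_holomorphic[OF bY])
  show "connected {s. Re s > 0}" by (intro convex_connected convex_halfspace_Re_gt)
  show "f z = g z" if "z \<in> {s. Re s > 1}" for z
   using that ds_restrict_coprime[OF dX qr(2), of z] ds_restrict_coprime[OF dY qr(1), of z]
    Lc_eq_ds[OF bX, of z] Lc_eq_ds[OF bY, of z] by (simp add: f_def g_def eq)
  show "{s. Re s > 1} ~= {}" using zero_less_one by (auto intro!: exI[of _ 2])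
 qed (use l in \<open>auto simp: open_halfspace_Re_gt\<close>)
 hence "f (of_real l) = 0" by (simp add: g_def L)
 moreover have "(\<Prod>p\<in>prime_factors r. 1 - X p * npow p (of_real l)) ~= 0"
 proof (subst prod_zero_iff, simp, intro notI, elim bexE)
  fix p assume p: "p \<in> prime_factors r" and z: "1 - X p * npow p (of_real l) = 0"
  hence "prime p" by auto
  have "norm (X p * npow p (of_real l)) <= 1 * real p powr (- l)"
   unfolding norm_mult norm_npow using dchar_norm_le[OF dX] by (intro mult_mono) auto
  also have "... < 1" using prime_gt_1_nat[OF \<open>prime p\<close>] l by (simp add: powr_less_one)
  finally have "norm (X p * npow p (of_real l)) < 1" .
  moreover have "X p * npow p (of_real l) = 1" using z by simp
  ultimately show False by simp
 qed
 ultimately show ?thesis by (simp add: f_def)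
qed

text \<open>Either no real nonprincipal character has a negative value at
  \<open>1 - \<delta>\<close>, and \<open>estermann_one\<close> applies to all of them at that
  point; or some \<open>Y\<close> has one, hence a zero \<open>l\<close> between there and 1. In the
  second case \<open>estermann_two\<close> treats every \<open>X\<close> whose product with
  \<open>Y\<close> is not principal, and the others share the zero \<open>l\<close>, so that
  \<open>estermann_one\<close> applies at \<open>l\<close>. The constant depends on the unspecified
  \<open>Y\<close>.\<close>

theorem siegel:
 assumes e: "h > 0"
 shows "\<exists>c>0. \<forall>q X. rchar q X --> X ~= dprin q --> c / real q powr h <= norm (Lc X 1)"
proof -
 \<comment> \<open>14 = 12 + 2: the exponent 12(1 - l) of \<open>q\<close> in
   \<open>estermann_two\<close> and the \<open>2 * \<delta>\<close> in the upper bound for the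
   series of the product character. The bound 1/8 keeps the points above 3/4.\<close>
 define \<delta> where "\<delta> = min (h / 14) (1 / 8)"
 have \<delta>: "0 < \<delta>" "\<delta> <= 1 / 8" "14 * \<delta> <= h" using e by (auto simp: \<delta>_def)
 have one: "\<exists>c>0. \<forall>q X. rchar q X --> X ~= dprin q --> Re (Lc X (of_real l)) >= 0 --> c / real q powr h <= norm (Lc X 1)"
  if l: "1 - \<delta> <= l" "l < 1" for l
 proof -
  define c where "c = (1 - l) / 1200 * (9600 * 152) powr (- 6 * (1 - l))"
  have c: "c > 0" using l by (simp add: c_def)
  have "c / real q powr h <= norm (Lc X 1)"
   if X: "rchar q X" "X ~= dprin q" and L: "Re (Lc X (of_real l)) >= 0" for q X
  proof -
   have q1: "real q >= 1" using dcharD(1)[OF rchar_dchar[OF X(1)]] by simp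
   have "real q powr (- h) <= real q powr (- 6 * (1 - l))" using q1 l \<delta> by (intro powr_mono) auto
   hence "c * real q powr (- h) <= c * real q powr (- 6 * (1 - l))" using c by (intro mult_left_mono) auto
   also have "... = (1 - l) / 1200 * (9600 * (152 * real q)) powr (- 6 * (1 - l))"
    using powr_mult[of "9600 * 152" "real q" "- 6 * (1 - l)"] by (simp add: c_def)
   also have "... <= Re (Lc X 1)" by (rule estermann_one[OF X _ _ L]) (use l \<delta> in auto)
   also have "... <= norm (Lc X 1)" by (rule complex_Re_le_cmod)
   finally show ?thesis by (simp add: powr_minus divide_inverse)
  qed
  thus ?thesis using c by blast
 qed
 show ?thesis
 proof (cases "\<forall>q X. rchar q X --> X ~= dprin q --> Re (Lc X (of_real (1 - \<delta>))) >= 0")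
  case True
  thus ?thesis using one[of "1 - \<delta>"] \<delta> by auto
 next
  case False
  then obtain r Y where Y: "rchar r Y" "Y ~= dprin r" and neg: "Re (Lc Y (of_real (1 - \<delta>))) < 0" by force
  have dY: "dchar r Y" by (rule rchar_dchar[OF Y(1)])
  have bY: "bsum Y (real r)" by (rule dchar_bsum[OF dY Y(2)])
  have r1: "real r >= 1" using dcharD(1)[OF dY] by simp
  obtain l where l: "1 - \<delta> <= l" "l <= 1" and bz: "Lc Y (of_real l) = 0"
   using rchar_Lc_zero[OF Y, of "1 - \<delta>" 1] neg rchar_Lc_1_pos[OF Y] \<delta> by auto
  hence b1: "l < 1" using Lc_nonzero_at_1[OF Y] by (cases "l = 1") auto
  obtain c1 where c1: "c1 > 0" "!!q X. rchar q X ==> X ~= dprin q ==> Re (Lc X (of_real l)) >= 0 ==> c1 / real q powr h <= norm (Lc X 1)"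
   using one[OF l(1) b1] by blast
  obtain C where C: "C >= 1" "!!a Q s. bsum a Q ==> Re s >= 1 - \<delta> ==> norm (Lc a s) <= C * (Q * (1 + norm s)) powr (2 * \<delta>)"
   using Lc_bound[of \<delta>] \<delta> by auto
  define k where "k = (1 - l) / 1200 * (9600 * 9728 * (real r)\<^sup>2) powr (- 6 * (1 - l))"
  have k: "k > 0" using b1 r1 by (simp add: k_def)
  define m where "m = norm (Lc Y 1) * (C * (2 * real r) powr (2 * \<delta>))"
  have Y1: "norm (Lc Y 1) > 0" using Lc_nonzero_at_1[OF Y] by simp
  have m: "m > 0" using Y1 C r1 by (simp add: m_def)
  have two: "(k / m) / real q powr h <= norm (Lc X 1)"
   if X: "rchar q X" "X ~= dprin q" and XY: "(%n. X n * Y n) ~= dprin (q * r)" for q X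
  proof -
   have q1: "real q >= 1" using dcharD(1)[OF rchar_dchar[OF X(1)]] by simp
   define V where "V = (%n. X n * Y n)"
   have bV: "bsum V (real (q * r))"
    using dchar_bsum[OF rchar_dchar[OF rchar_mult[OF X(1) Y(1)]] XY] by (simp add: V_def)
   have "- 12 * \<delta> <= - 12 * (1 - l)" using l(1) by simp
   from powr_mono[OF this q1] have "k * real q powr (- 12 * \<delta>) <= k * real q powr (- 12 * (1 - l))"
    using k by (intro mult_left_mono) auto
   also have "... = (1 - l) / 1200 * (9600 * (9728 * (real q * real r)\<^sup>2)) powr (- 6 * (1 - l))"
   proof -
    have "(9600 * (9728 * (real q * real r)\<^sup>2)) powr (- 6 * (1 - l)) =
      (9600 * 9728 * (real r)\<^sup>2) powr (- 6 * (1 - l)) * ((real q)\<^sup>2) powr (- 6 * (1 - l))"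
     using powr_mult[of "9600 * 9728 * (real r)\<^sup>2" "(real q)\<^sup>2" "- 6 * (1 - l)"] by (simp add: power_mult_distrib mult_ac)
    also have "((real q)\<^sup>2) powr (- 6 * (1 - l)) = real q powr (- 12 * (1 - l))"
    proof -
     have "(real q)\<^sup>2 = real q powr 2" using q1 by simp
     hence "((real q)\<^sup>2) powr (- 6 * (1 - l)) = real q powr (2 * (- 6 * (1 - l)))" by (simp only: powr_powr)
     also have "2 * (- 6 * (1 - l)) = - 12 * (1 - l)" by simp
     finally show ?thesis .
    qed
    finally show ?thesis by (simp add: k_def)
   qed
   also have "... <= Re (Lc X 1 * Lc Y 1 * Lc V 1)"
    unfolding V_def by (rule estermann_two[OF X Y XY _ b1 bz]) (use l \<delta> in auto)
   also have "... <= norm (Lc X 1) * norm (Lc Y 1) * norm (Lc V 1)"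
    using complex_Re_le_cmod[of "Lc X 1 * Lc Y 1 * Lc V 1"] by (simp add: norm_mult)
   also have "... <= norm (Lc X 1) * norm (Lc Y 1) * (C * ((2 * real r) powr (2 * \<delta>) * real q powr (2 * \<delta>)))"
   proof (rule mult_left_mono)
    show "norm (Lc V 1) <= C * ((2 * real r) powr (2 * \<delta>) * real q powr (2 * \<delta>))"
   proof -
    have "norm (Lc V 1) <= C * (real (q * r) * (1 + norm (1::complex))) powr (2 * \<delta>)"
     by (rule C(2)[OF bV]) (use \<delta> in simp)
    also have "real (q * r) * (1 + norm (1::complex)) = (2 * real r) * real q" by simp
    finally show ?thesis by (simp only: powr_mult)
   qed
   qed simp
   finally have "k * real q powr (- 12 * \<delta>) <= norm (Lc X 1) * m * real q powr (2 * \<delta>)"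
    by (simp add: m_def mult_ac)
   hence "k * real q powr (- 12 * \<delta>) * real q powr (- 2 * \<delta>) <= norm (Lc X 1) * m * real q powr (2 * \<delta>) * real q powr (- 2 * \<delta>)"
    by (rule mult_right_mono) simp
   hence "k * (real q powr (- 12 * \<delta>) * real q powr (- 2 * \<delta>)) <= norm (Lc X 1) * m * (real q powr (2 * \<delta>) * real q powr (- 2 * \<delta>))"
    by (simp only: mult.assoc)
   hence "k * real q powr (- 14 * \<delta>) <= norm (Lc X 1) * m" using q1 by (simp flip: powr_add)
   moreover have "k * real q powr (- h) <= k * real q powr (- 14 * \<delta>)"
    using k q1 \<delta> by (intro mult_left_mono powr_mono) auto
   ultimately have "k * real q powr (- h) <= norm (Lc X 1) * m" by linarith
   hence "k / real q powr h <= norm (Lc X 1) * m" by (simp add: powr_minus divide_inverse)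
   hence "(k / real q powr h) / m <= norm (Lc X 1)" using m by (simp only: pos_divide_le_eq)
   thus ?thesis by (simp add: mult.commute)
  qed
  have "min c1 (k / m) / real q powr h <= norm (Lc X 1)" if X: "rchar q X" "X ~= dprin q" for q X
  proof (cases "(%n. X n * Y n) = dprin (q * r)")
   case True
   have "Lc X (of_real l) = 0" by (rule Lc_zero_transfer[OF X Y True _ bz]) (use l \<delta> in simp)
   hence "c1 / real q powr h <= norm (Lc X 1)" using c1(2)[OF X] by simp
   moreover have "min c1 (k / m) / real q powr h <= c1 / real q powr h" by (intro divide_right_mono) auto
   ultimately show ?thesis by linarith
  next
   case False
   have "min c1 (k / m) / real q powr h <= (k / m) / real q powr h" by (intro divide_right_mono) auto
   thus ?thesis using two[OF X False] by linarith
  qed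
  moreover have "min c1 (k / m) > 0" using c1 k m by simp
  ultimately show ?thesis by blast
 qed
qed

section \<open>Logarithmic derivatives near the line Re s = 1\<close>

text \<open>Away from 1, or if the square is not principal, the 3-4-1 bound applies with
  \<open>A\<close> a small power of \<open>K\<close>. A real character within
  \<open>c1 / K powr (3 * u)\<close> of 1 varies by at most half of Siegel's lower bound between 1
  and \<open>s\<close>, since its derivative is at most \<open>D * K powr (2 * u)\<close>.\<close>

lemma lower_bound_Lc:
 assumes e: "\<epsilon> > 0"
 shows "\<exists>c>0. \<forall>q X s. dchar q X --> X ~= dprin q --> 1 < Re s --> Re s <= 2 -->
   c / (real q * (1 + norm s)) powr \<epsilon> <= norm (ds X s)"
proof -
 \<comment> \<open>21 = 3 * 7: the seventh power of \<open>A\<close>, which is of size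
   \<open>K powr (3 * u)\<close>.\<close>
 define u where "u = min (\<epsilon> / 21) (1 / 2)"
 have u: "0 < u" "u <= 1 / 2" "21 * u <= \<epsilon>" using e by (auto simp: u_def)
 obtain C where C: "C >= 1" "!!a Q s. bsum a Q ==> Re s >= 1 - u ==> norm (Lc a s) <= C * (Q * (1 + norm s)) powr (2 * u)"
  using Lc_bound[OF u(1,2)] by blast
 obtain c where c: "c > 0" "!!q X s A. dchar q X ==> X ~= dprin q ==> 1 < Re s ==> Re s <= 2 ==> A >= 1 ==>
   (real q * (1 + norm s)) powr (2 * u) <= A ==> 1 / norm (s - 1) <= A \<or> (%n. X n * X n) ~= dprin q ==>
   c / A ^ 7 <= norm (ds X s)"
  using lower_bound_nonprincipal[OF u(1,2)] by blast
 obtain c0 where c0: "c0 > 0" "!!q X. rchar q X ==> X ~= dprin q ==> c0 / real q powr u <= norm (Lc X 1)"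
  using siegel[OF u(1)] by blast
 define D where "D = 18 * C / u"
 have D: "D > 0" using C u by (simp add: D_def)
 define c1 where "c1 = min 1 (c0 / (2 * D))"
 have c1: "0 < c1" "c1 <= 1" "D * c1 <= c0 / 2" using c0 D by (auto simp: c1_def min_def field_simps)
 define c2 where "c2 = min (c * c1 ^ 7) (c0 / 2)"
 have c2: "c2 > 0" using c c1 c0 by (simp add: c2_def)
 have "c2 / (real q * (1 + norm s)) powr \<epsilon> <= norm (ds X s)"
  if X: "dchar q X" "X ~= dprin q" and s: "1 < Re s" "Re s <= 2" for q X s
 proof -
  have b: "bsum X (real q)" by (rule dchar_bsum[OF X])
  have q1: "real q >= 1" using dcharD(1)[OF X(1)] by simp
  define K where "K = real q * (1 + norm s)"
  have K: "K >= 1" unfolding K_def by (rule kappa_ge_1[OF q1])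
  have Kp: "K powr a > 0" for a using K by simp
  have Ke: "c2 / K powr \<epsilon> <= c2 / K powr (21 * u)"
   using c2 Kp K u by (intro divide_left_mono powr_mono mult_pos_pos) auto
  have far: "c2 / K powr \<epsilon> <= norm (ds X s)"
   if far: "1 / norm (s - 1) <= K powr (3 * u) / c1 \<or> (%n. X n * X n) ~= dprin q"
  proof -
   have Kb: "K powr (2 * u) <= K powr (3 * u)" using K u by (intro powr_mono) auto
   have "K powr (3 * u) >= 1" using K u by (intro ge_one_powr_ge_zero) auto
   moreover have Kc: "K powr (3 * u) <= K powr (3 * u) / c1"
    using c1 Kp[of "3 * u"] mult_left_mono[of c1 1 "K powr (3 * u)"] by (simp add: pos_le_divide_eq)
   ultimately have "c / (K powr (3 * u) / c1) ^ 7 <= norm (ds X s)"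
    using far Kb by (intro c(2)[OF X s]) (auto simp: K_def)
   moreover have "(K powr (3 * u)) ^ 7 = K powr (21 * u)"
   proof -
    have "(K powr (3 * u)) ^ 7 = (K powr (3 * u)) powr (real 7)" using Kp by (subst powr_realpow) auto
    thus ?thesis by (simp add: powr_powr mult.commute)
   qed
   ultimately have "c * c1 ^ 7 / K powr (21 * u) <= norm (ds X s)" by (simp add: power_divide)
   moreover have "c2 / K powr (21 * u) <= c * c1 ^ 7 / K powr (21 * u)"
    by (intro divide_right_mono) (auto simp: c2_def)
   ultimately show ?thesis using Ke by linarith
  qed
  have "c2 / K powr \<epsilon> <= norm (ds X s)"
  proof (cases "(%n. X n * X n) ~= dprin q \<or> 1 / norm (s - 1) <= K powr (3 * u) / c1")
   case True
   thus ?thesis using far by blast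
  next
   case False
   have sq: "X n * X n = dprin q n" for n using False by metis
   have "X n = 0 \<or> X n = 1 \<or> X n = -1" for n
   proof (cases "coprime n q")
    case True
    hence "(X n - 1) * (X n + 1) = 0" using sq[of n] by (simp add: dprin_def algebra_simps)
    thus ?thesis by (auto simp: eq_neg_iff_add_eq_0)
   qed (use dcharD(4)[OF X(1), of n] in simp)
   hence R: "rchar q X" using X by (simp add: rchar_def)
   have s1: "norm (s - 1) > 0" using s by auto
   have "K powr (3 * u) / c1 < 1 / norm (s - 1)" using False by simp
   hence near: "norm (s - 1) <= c1 / K powr (3 * u)"
    using s1 c1 Kp[of "3 * u"] by (simp add: field_simps)
   define S where "S = {z. Re z >= 1} \<inter> cball 0 (norm s + 1)"
   have "norm (Lc X s - Lc X 1) <= (D * K powr (2 * u)) * norm (s - 1)"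
   proof (rule segment_lipschitz[OF Lc_holomorphic[OF b], of S])
    show "convex S" unfolding S_def by (intro convex_Int convex_halfspace_Re_ge convex_cball)
    show "S \<subseteq> {s. Re s > 0}" by (auto simp: S_def)
    show "s \<in> S" "1 \<in> S" using s by (auto simp: S_def)
    fix z assume "z \<in> S"
    thus "norm (deriv (Lc X) z) <= D * K powr (2 * u)"
     unfolding D_def K_def
     by (intro deriv_region_bound[OF Lc_holomorphic[OF b] u(1,2) q1]) (use C b u in \<open>auto simp: S_def\<close>)
   qed
   also have "... <= (D * K powr (2 * u)) * (c1 / K powr (3 * u))"
    using near D by (intro mult_left_mono) auto
   also have "... = D * c1 / K powr u"
   proof -
    have "K powr (3 * u) = K powr (2 * u) * K powr u" by (simp flip: powr_add)
    thus ?thesis using Kp[of "2 * u"] by simp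
   qed
   also have "... <= (c0 / 2) / K powr u" using c1 by (intro divide_right_mono) auto
   finally have d: "norm (Lc X s - Lc X 1) <= (c0 / 2) / K powr u" .
   have "K >= real q" unfolding K_def using q1 mult_left_mono[of 1 "1 + norm s" "real q"] by simp
   hence "real q powr u <= K powr u" using q1 u by (intro powr_ge1_mono) auto
   hence "c0 / K powr u <= c0 / real q powr u" using c0(1) q1 by (intro frac_le) auto
   also have "... <= norm (Lc X 1)" by (rule c0(2)[OF R X(2)])
   finally have "c0 / K powr u <= norm (Lc X 1)" .
   moreover have "norm (Lc X 1) <= norm (Lc X s) + norm (Lc X s - Lc X 1)"
    using norm_triangle_ineq4[of "Lc X s" "Lc X s - Lc X 1"] by simp
   moreover have "c0 / K powr u = (c0 / 2) / K powr u + (c0 / 2) / K powr u" by (simp flip: add_divide_distrib)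
   ultimately have "(c0 / 2) / K powr u <= norm (Lc X s)" using d by linarith
   moreover have "c2 / K powr \<epsilon> <= (c0 / 2) / K powr u"
    using c2 c0 Kp K u by (intro frac_le powr_mono) (auto simp: c2_def)
   ultimately show ?thesis using Lc_eq_ds[OF b, of s] s by simp
  qed
  thus ?thesis by (simp add: K_def)
 qed
 thus ?thesis using c2 by blast
qed

text \<open>Within distance \<open>v\<close> the function changes by at most half of its size at the
  centre, so the quotient is holomorphic and bounded there and Cauchy's inequality gives all
  derivatives.\<close>

lemma log_deriv_higher_bound:
 assumes f: "f holomorphic_on {s. Re s > 0}" and s: "Re s > 1" and v: "0 < v" "v <= 1 / 2" and m: "m > 0"
  and M: "!!w. norm (w - s) <= v ==> norm (deriv f w) <= M" and lb: "norm (f s) >= m" and vM: "v * M <= m / 2"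
 shows "norm ((deriv ^^ k) (%w. deriv f w / f w) s) <= fact k * (2 * M / m) / v ^ k"
proof (rule Cauchy_inequality)
 have sub: "cball s v \<subseteq> {s. Re s > 0}"
 proof
  fix w assume "w \<in> cball s v"
  hence "\<bar>Re (s - w)\<bar> <= v" using abs_Re_le_cmod[of "s - w"] by (simp add: dist_norm)
  thus "w \<in> {s. Re s > 0}" using v s abs_le_D1[of "Re (s - w)" v] by simp
 qed
 have lw: "norm (f w) >= m / 2" if w: "w \<in> cball s v" for w
 proof -
  have "norm (f s - f w) <= M * norm (s - w)"
   by (rule segment_lipschitz[OF f convex_cball sub _ w]) (use M v in \<open>auto simp: dist_norm norm_minus_commute\<close>)
  also have "... <= M * v"
  proof (rule mult_left_mono)
   have "norm (deriv f s) <= M" by (rule M) (use v in simp)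
   thus "0 <= M" by (rule order_trans[OF norm_ge_zero])
  qed (use w in \<open>simp add: dist_norm\<close>)
  finally have "norm (f s - f w) <= m / 2" using vM by (simp add: mult.commute)
  thus ?thesis using lb norm_triangle_ineq2[of "f s" "f w"] norm_triangle_ineq4[of "f s" "f s - f w"] norm_triangle_ineq3[of "f s" "f w"]
   by linarith
 qed
 have nz: "f w ~= 0" if "w \<in> cball s v" for w using lw[OF that] m by auto
 have hd: "deriv f holomorphic_on {s. Re s > 0}" by (rule holomorphic_deriv[OF f open_halfspace_Re_gt])
 have h: "(%w. deriv f w / f w) holomorphic_on cball s v"
  using nz by (intro holomorphic_on_divide holomorphic_on_subset[OF hd sub] holomorphic_on_subset[OF f sub]) auto
 show "(%w. deriv f w / f w) holomorphic_on ball s v" using h ball_subset_cball holomorphic_on_subset by blast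
 show "continuous_on (cball s v) (%w. deriv f w / f w)" using h by (rule holomorphic_on_imp_continuous_on)
 fix w assume w: "norm (s - w) = v"
 hence "w \<in> cball s v" by (simp add: dist_norm)
 from lw[OF this] M[of w] w m have "norm (deriv f w) / norm (f w) <= M / (m / 2)"
  by (intro frac_le) (auto simp: norm_minus_commute intro: order_trans[OF norm_ge_zero])
 thus "norm (deriv f w / f w) <= 2 * M / m" by (simp add: norm_divide mult.commute)
qed (rule v)

text \<open>If upper and lower bound differ by the power \<open>g\<close> of the conductor-like
  quantity \<open>Q * (1 + norm s)\<close>, there is a disc around \<open>s\<close> free of zeros
  whose radius is of order its \<open>- g\<close>-th power. Every derivative then costs another
  \<open>g\<close>. Since \<open>g\<close> can be made small, derivatives of any fixed order grow
  more slowly than a given power. The exponent \<open>p\<close> is close to 0 for characters and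
  close to 1 for \<open>Zf\<close>.\<close>

lemma log_deriv_power_bound:
 fixes u Q C c p g :: real
 assumes f: "f holomorphic_on {s. Re s > 0}" and u: "0 < u" "u <= 1/2" and Q: "Q >= 1" and C: "C >= 1" and c: "c > 0"
  and p: "0 <= p" "p <= 2" and g: "g >= 0" and s: "Re s > 1"
  and B: "!!w. Re w >= 1 - u ==> norm (f w) <= C * (Q * (1 + norm w)) powr p"
  and lb: "c * (Q * (1 + norm s)) powr (p - g) <= norm (f s)"
 shows "(%w. deriv f w / f w) analytic_on {s}"
  and "norm ((deriv ^^ k) (%w. deriv f w / f w) s)
   <= fact k * (36 * C / (u * c)) / min (u / 2) (c * u / (36 * C)) ^ k * (Q * (1 + norm s)) powr (g + g * real k)"
proof -
 define K D r where "K = Q * (1 + norm s)" and "D = 18 * C / u" and "r = min (u / 2) (c * u / (36 * C))"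
 have K: "K >= 1" unfolding K_def by (rule kappa_ge_1[OF Q])
 have Kp: "K powr a > 0" for a using K by simp
 have r: "0 < r" "r <= u / 2" "r * D <= c / 2" using c C u by (auto simp: r_def D_def min_def field_simps)
 define v m M where "v = r / K powr g" and "m = c * K powr (p - g)" and "M = D * K powr p"
 have K3: "K powr g >= 1" using K g by (intro ge_one_powr_ge_zero) auto
 have Kpg: "K powr p = K powr g * K powr (p - g)" by (simp flip: powr_add)
 have "v <= r" using r K3 by (simp add: v_def divide_le_eq)
 moreover have "v > 0" using r Kp by (simp add: v_def)
 ultimately have v: "v > 0" "v <= u / 2" using r by auto
 have m: "m > 0" "m <= norm (f s)" using c Kp lb by (auto simp: m_def K_def)
 have s0: "s \<in> {s. Re s > 0}" using s by simp
 have "f s ~= 0" using m by auto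
 thus "(%w. deriv f w / f w) analytic_on {s}"
  using f holomorphic_deriv[OF f open_halfspace_Re_gt] open_halfspace_Re_gt s0
  by (intro analytic_on_divide) (auto simp: analytic_at)
 have "norm ((deriv ^^ k) (%w. deriv f w / f w) s) <= fact k * (2 * M / m) / v ^ k"
 proof (rule log_deriv_higher_bound[OF f s v(1) _ m(1) _ m(2)])
  show "v <= 1 / 2" using v u by simp
  have "v * M = (r * D) * K powr (p - g)" unfolding v_def M_def Kpg using Kp[of g] by simp
  also have "... <= (c / 2) * K powr (p - g)" using r by (intro mult_right_mono) auto
  finally show "v * M <= m / 2" by (simp add: m_def)
  fix w assume w: "norm (w - s) <= v"
  show "norm (deriv f w) <= M"
   unfolding M_def D_def K_def
  proof (rule deriv_region_bound[OF f u Q _ p B])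
   have "\<bar>Re (w - s)\<bar> <= u / 2" using abs_Re_le_cmod[of "w - s"] w v by linarith
   thus "Re w >= 1 - u / 2" using s abs_le_D2[of "Re (w - s)" "u / 2"] by simp
   show "norm w <= norm s + 1" using norm_triangle_ineq[of "w - s" s] w v u by simp
  qed (use C in auto)
 qed
 also have "2 * M / m = 36 * C / (u * c) * K powr g" unfolding M_def m_def D_def Kpg using Kp[of "p - g"] by simp
 also have "v ^ k = r ^ k / K powr (g * real k)"
  unfolding v_def power_divide powr_powr[symmetric] using Kp[of g] by (simp add: powr_realpow)
 finally show "norm ((deriv ^^ k) (%w. deriv f w / f w) s)
   <= fact k * (36 * C / (u * c)) / min (u / 2) (c * u / (36 * C)) ^ k * (Q * (1 + norm s)) powr (g + g * real k)"
  unfolding K_def[symmetric] r_def[symmetric] powr_add by (simp add: mult_ac)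
qed

lemma higher_deriv_halfplane_cong:
 assumes "!!z. Re z > 1 ==> f z = h z" "Re s > 1"
 shows "(deriv ^^ k) f s = (deriv ^^ k) h s"
proof (rule higher_deriv_cong_ev[OF _ refl])
 have "eventually (%z. z \<in> {s. Re s > 1}) (nhds s)"
  using open_halfspace_Re_gt assms(2) by (intro eventually_nhds_in_open) auto
 thus "\<forall>\<^sub>F z in nhds s. f z = h z" by eventually_elim (use assms(1) in auto)
qed

lemma log_deriv_nonprincipal:
 assumes e: "\<epsilon> > 0"
 shows "\<exists>C\<ge>1. \<forall>q X s. dchar q X --> X ~= dprin q --> 1 < Re s --> Re s <= 2 -->
   norm (ds (%n. mangoldt n * X n * of_real (ln (real n)) ^ k) s) <= C * (real q * (1 + norm s)) powr \<epsilon>"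
proof -
 \<comment> \<open>Upper exponent \<open>2 * u\<close>, lower exponent \<open>- u\<close>, hence
   \<open>g = 3 * u\<close> and total exponent \<open>(3 + 3 * k) * u\<close>.\<close>
 define u where "u = min (\<epsilon> / (3 + 3 * real k)) (1 / 2)"
 have u: "0 < u" "u <= 1 / 2" using e min.cobounded2[of "\<epsilon> / (3 + 3 * real k)" "1 / 2"] by (auto simp: u_def add_pos_nonneg)
 have "u <= \<epsilon> / (3 + 3 * real k)" by (simp add: u_def)
 hence ue: "(3 + 3 * real k) * u <= \<epsilon>" by (simp add: pos_le_divide_eq add_pos_nonneg mult.commute)
 obtain C where C: "C >= 1" "!!a Q s. bsum a Q ==> Re s >= 1 - u ==> norm (Lc a s) <= C * (Q * (1 + norm s)) powr (2 * u)"
  using Lc_bound[OF u(1,2)] by blast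
 obtain c where c: "c > 0" "!!q X s. dchar q X ==> X ~= dprin q ==> 1 < Re s ==> Re s <= 2 ==>
   c / (real q * (1 + norm s)) powr u <= norm (ds X s)"
  using lower_bound_Lc[OF u(1)] by blast
 define E where "E = max 1 (fact k * (36 * C / (u * c)) / min (u / 2) (c * u / (36 * C)) ^ k)"
 have "norm (ds (%n. mangoldt n * X n * of_real (ln (real n)) ^ k) s) <= E * (real q * (1 + norm s)) powr \<epsilon>"
  if X: "dchar q X" "X ~= dprin q" and s: "1 < Re s" "Re s <= 2" for q X s
 proof -
  have b: "bsum X (real q)" by (rule dchar_bsum[OF X])
  have q1: "real q >= 1" using dcharD(1)[OF X(1)] by simp
  define P where "P = (%w. deriv (Lc X) w / Lc X w)"
  have lb: "c * (real q * (1 + norm s)) powr (2 * u - 3 * u) <= norm (Lc X s)"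
   using c(2)[OF X s] Lc_eq_ds[OF b s(1)] by (simp add: powr_minus divide_inverse)
  note P = log_deriv_power_bound[OF Lc_holomorphic[OF b] u q1 C(1) c(1) _ _ _ s(1) C(2)[OF b] lb, folded P_def]
  have "norm ((deriv ^^ k) P s) <= E * (real q * (1 + norm s)) powr (3 * u + 3 * u * real k)"
   using u by (intro order_trans[OF P(2)] mult_right_mono) (auto simp: E_def)
  also have "... <= E * (real q * (1 + norm s)) powr \<epsilon>"
   using ue kappa_ge_1[OF q1, of s] by (intro mult_left_mono powr_mono) (auto simp: E_def algebra_simps)
  finally have main: "norm ((deriv ^^ k) P s) <= E * (real q * (1 + norm s)) powr \<epsilon>" .
  note ld = LD_dchar[OF X(1), unfolded LD_def]
  have "(deriv ^^ k) (ds (%n. mangoldt n * X n)) s = (deriv ^^ k) (%w. - P w) s"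
  proof (rule higher_deriv_halfplane_cong[OF _ s(1)])
   fix z assume z: "Re z > 1"
   have "deriv (Lc X) z = deriv (ds X) z"
    using higher_deriv_halfplane_cong[of "Lc X" "ds X" z 1] Lc_eq_ds[OF b] z by simp
   thus "ds (%n. mangoldt n * X n) z = - P z"
    using ld z dchar_ds_nonzero[OF X(1) z] Lc_eq_ds[OF b z] by (simp add: P_def)
  qed
  also have "... = - (deriv ^^ k) P s" by (rule higher_deriv_uminus_at[OF P(1)]) (use u in auto)
  finally have "norm ((deriv ^^ k) (ds (%n. mangoldt n * X n)) s) <= E * (real q * (1 + norm s)) powr \<epsilon>" using main by simp
  thus ?thesis using ds_higher_deriv[of "%n. mangoldt n * X n" s k] ld s(1) by (simp add: norm_mult norm_power)
 qed
 moreover have "E >= 1" by (simp add: E_def)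
 ultimately show ?thesis by blast
qed

text \<open>Near 1 the function is close to 1. Elsewhere the 3-4-1 bound for the zeta function loses
  the power 14u = 7 * 2u, and multiplication by s - 1 restores the exponent 1.\<close>

lemma Zf_lower:
 assumes e: "0 < u" "u <= 1/2"
 shows "\<exists>c>0. \<forall>s. 1 < Re s --> Re s <= 2 --> c * (1 + norm s) powr (1 - 14 * u) <= norm (Zf s)"
proof -
 obtain c where c: "c > 0" "!!s A. 1 < Re s ==> Re s <= 2 ==> A >= 1 ==>
   (1 + norm s) powr (2 * u) <= A ==> 1 / norm (s - 1) <= A ==> c / A ^ 7 <= norm (ds (%_. 1) s)"
  using lower_bound_zeta[OF e] by blast
 define d where "d = min (c / (9 * 4 ^ 7)) (1 / 6)"
 have d: "d > 0" using c by (simp add: d_def)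
 have "d * (1 + norm s) powr (1 - 14 * u) <= norm (Zf s)" if s: "1 < Re s" "Re s <= 2" for s
 proof -
  define K where "K = 1 + norm s"
  have K: "K >= 1" by (simp add: K_def)
  have Kp: "K powr a > 0" for a using K by simp
  show ?thesis
  proof (cases "norm (s - 1) <= 1 / 4")
   case True
   have n: "norm s <= 5 / 4" using norm_triangle_ineq[of "s - 1" 1] True by simp
   have "norm s / Re s <= (5 / 4) / 1" using n s by (intro frac_le) auto
   hence "norm (s - 1) * (norm s / Re s) <= 1 / 4 * (5 / 4)" using True s by (intro mult_mono) auto
   moreover have "norm (Zf s - 1) <= norm (s - 1) * (norm s / Re s)" by (rule Zf_near) (use s in simp)
   ultimately have "norm (Zf s - 1) <= 1 / 4 * (5 / 4)" by (rule order_trans[rotated])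
   hence "norm (Zf s - 1) <= 5 / 16" by simp
   hence Z: "norm (Zf s) >= 1 / 2" using norm_triangle_ineq2[of 1 "1 - Zf s"] by (simp add: norm_minus_commute)
   have "K powr (1 - 14 * u) <= K powr 1" using K e by (intro powr_mono) auto
   also have "... <= 3" using K n by (simp add: K_def)
   finally have "d * K powr (1 - 14 * u) <= 1 / 6 * 3" using d by (intro mult_mono) (auto simp: d_def)
   thus ?thesis using Z by (simp add: K_def)
  next
   case False
   have K2: "K powr (2 * u) >= 1" using K e by (intro ge_one_powr_ge_zero) auto
   have n1: "norm (s - 1) > 0" using False norm_ge_zero[of "s - 1"] by linarith
   have "1 / norm (s - 1) <= 4" using False n1 by (simp add: field_simps)
   hence "c / (4 * K powr (2 * u)) ^ 7 <= norm (ds (%_. 1) s)"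
    using K2 s by (intro c(2)) (auto simp: K_def)
   moreover have "(K powr (2 * u)) ^ 7 = K powr (14 * u)"
   proof -
    have "(K powr (2 * u)) ^ 7 = (K powr (2 * u)) powr (real 7)" using Kp by (subst powr_realpow) auto
    thus ?thesis by (simp add: powr_powr mult.commute)
   qed
   ultimately have "c / (4 ^ 7 * K powr (14 * u)) <= norm (ds (%_. 1) s)"
    by (simp only: power_mult_distrib)
   moreover have "c / (4 ^ 7 * K powr (14 * u)) = c / 4 ^ 7 * K powr (- (14 * u))"
    by (simp only: powr_minus divide_inverse inverse_mult_distrib mult.assoc)
   ultimately have z: "c / 4 ^ 7 * K powr (- (14 * u)) <= norm (ds (%_. 1) s)" by (simp only:)
   have "norm s <= norm (s - 1) + 1" using norm_triangle_ineq[of "s - 1" 1] by simp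
   hence "K <= 9 * norm (s - 1)" using False by (simp add: K_def)
   hence "(K / 9) * (c / 4 ^ 7 * K powr (- (14 * u))) <= norm (s - 1) * norm (ds (%_. 1) s)"
    using z c Kp by (intro mult_mono) auto
   also have "... = norm (Zf s)" using Zf_eq_ds[OF s(1)] by (simp add: norm_mult)
   also have "(K / 9) * (c / 4 ^ 7 * K powr (- (14 * u))) = c / (9 * 4 ^ 7) * K powr (1 - 14 * u)"
    using K powr_add[of K 1 "- (14 * u)"] by simp
   finally have "c / (9 * 4 ^ 7) * K powr (1 - 14 * u) <= norm (Zf s)" .
   moreover have "d * K powr (1 - 14 * u) <= c / (9 * 4 ^ 7) * K powr (1 - 14 * u)"
    by (intro mult_right_mono) (auto simp: d_def)
   ultimately show ?thesis by (simp add: K_def)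
  qed
 qed
 thus ?thesis using d by blast
qed

text \<open>The coefficient \<open>mangoldt n - 1\<close> subtracts the zeta function from minus its
  logarithmic derivative, which cancels the poles at 1: the difference equals minus the logarithmic
  derivative of \<open>Zf\<close> minus \<open>zreg\<close>. With exponents 1 + 2u above and 1 - 14u
  below, the loss is g = 16u.\<close>

lemma log_deriv_zeta:
 assumes e: "\<epsilon> > 0"
 shows "\<exists>C\<ge>1. \<forall>s. 1 < Re s --> Re s <= 2 -->
   norm (ds (%n. (mangoldt n - 1) * of_real (ln (real n)) ^ k) s) <= C * (1 + norm s) powr \<epsilon>"
proof -
 define u where "u = min (\<epsilon> / (16 + 16 * real k)) (1 / 2)"
 have u: "0 < u" "u <= 1 / 2" using e min.cobounded2[of "\<epsilon> / (16 + 16 * real k)" "1 / 2"] by (auto simp: u_def add_pos_nonneg)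
 have "u <= \<epsilon> / (16 + 16 * real k)" by (simp add: u_def)
 hence ue: "(16 + 16 * real k) * u <= \<epsilon>" by (simp add: pos_le_divide_eq add_pos_nonneg mult.commute)
 have u2: "2 * u <= \<epsilon>" using order_trans[OF mult_right_mono[of 2 "16 + 16 * real k" u] ue] u by simp
 obtain C where C: "C >= 1" "!!s. Re s >= 1 - u ==> norm (Zf s) <= C * ((1 + norm s) * (1 + norm s) powr (2 * u))"
  using Zf_bound[OF u] by blast
 have C': "norm (Zf s) <= C * (1 * (1 + norm s)) powr (1 + 2 * u)" if "Re s >= 1 - u" for s
  using C(2)[OF that] powr_add[of "1 + norm s" 1 "2 * u"] by simp
 obtain C2 where C2: "C2 >= 1" "!!s. Re s >= 1 - u ==> norm (zreg s) <= C2 * (1 + norm s) powr (2 * u)"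
  using zreg_bound[OF u] by blast
 obtain c where c: "c > 0" "!!s. 1 < Re s ==> Re s <= 2 ==> c * (1 + norm s) powr (1 - 14 * u) <= norm (Zf s)"
  using Zf_lower[OF u] by blast
 define E where "E = max 1 (fact k * (36 * C / (u * c)) / min (u / 2) (c * u / (36 * C)) ^ k)"
 define E2 where "E2 = fact k * (3 * C2) / u ^ k"
 have E0: "E >= 1" "E2 >= 0" using C2 u by (auto simp: E_def E2_def)
 have "norm (ds (%n. (mangoldt n - 1) * of_real (ln (real n)) ^ k) s) <= (E + E2) * (1 + norm s) powr \<epsilon>"
  if s: "1 < Re s" "Re s <= 2" for s
 proof -
  define K where "K = 1 + norm s"
  have K: "K >= 1" by (simp add: K_def)
  define P where "P = (%w. deriv Zf w / Zf w)"
  have lb: "c * (1 * (1 + norm s)) powr (1 + 2 * u - 16 * u) <= norm (Zf s)" using c(2)[OF s] by simp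
  note P = log_deriv_power_bound[OF Zf_holomorphic u order_refl C(1) c(1) _ _ _ s(1) C' lb, folded P_def, unfolded mult_1, folded K_def]
  have "norm ((deriv ^^ k) P s) <= E * K powr (16 * u + 16 * u * real k)"
   using u by (intro order_trans[OF P(2)] mult_right_mono) (auto simp: E_def)
  also have "... <= E * K powr \<epsilon>" using ue K E0 by (intro mult_left_mono powr_mono) (auto simp: algebra_simps)
  finally have main: "norm ((deriv ^^ k) P s) <= E * K powr \<epsilon>" .
  have "norm ((deriv ^^ k) zreg s) <= fact k * (C2 * (3 * K powr (2 * u))) / u ^ k"
  proof (rule deriv_cauchy_bound[OF zreg_holomorphic u(1)])
   show "u < Re s" using s u by simp
   fix w assume w: "norm (w - s) = u"
   have "\<bar>Re (w - s)\<bar> <= u" using abs_Re_le_cmod[of "w - s"] w by linarith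
   hence "Re w >= 1 - u" using s abs_le_D2[of "Re (w - s)" "u"] by simp
   from C2(2)[OF this] have "norm (zreg w) <= C2 * (1 + norm w) powr (2 * u)" .
   also have "(1 + norm w) powr (2 * u) <= (3 * K) powr (2 * u)"
   proof (intro powr_mono2)
    have "norm w <= u + norm s" using norm_triangle_ineq[of "w - s" s] w by simp
    thus "1 + norm w <= 3 * K" using u norm_ge_zero[of s] unfolding K_def distrib_left by linarith
   qed (use u in auto)
   also have "(3 * K) powr (2 * u) = 3 powr (2 * u) * K powr (2 * u)" using K by (intro powr_mult)
   also have "... <= 3 powr 1 * K powr (2 * u)" using u by (intro mult_right_mono powr_mono) auto
   finally show "norm (zreg w) <= C2 * (3 * K powr (2 * u))" using C2(1) by simp
  qed
  also have "... = E2 * K powr (2 * u)" by (simp add: E2_def)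
  also have "... <= E2 * K powr \<epsilon>" using u2 K E0 by (intro mult_left_mono powr_mono) auto
  finally have main2: "norm ((deriv ^^ k) zreg s) <= E2 * K powr \<epsilon>" .
  define a where "a = (%n. mangoldt n * 1 + (-1) * 1 :: complex)"
  note ld = LD_dchar[OF dchar_one, unfolded LD_def]
  have d1: "dsum (%n. (-1) * 1)" by (rule dsum_cmult[OF dsum_1])
  have da: "dsum a" unfolding a_def using ld by (intro dsum_add d1) auto
  have "(deriv ^^ k) (ds a) s = (deriv ^^ k) (%w. - P w - zreg w) s"
  proof (rule higher_deriv_halfplane_cong[OF _ s(1)])
   fix z assume z: "Re z > 1"
   define Z where "Z = ds (%_. 1) z"
   have "deriv Zf z = deriv (%z. (z - 1) * ds (%_. 1) z) z"
    using higher_deriv_halfplane_cong[of Zf "%z. (z - 1) * ds (%_. 1) z" z 1] Zf_eq_ds z by simp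
   also have "... = Z + (z - 1) * deriv (ds (%_. 1)) z"
    unfolding Z_def using DERIV_imp_deriv[OF ds_has_field_derivative[OF dsum_1 z]]
    by (intro DERIV_imp_deriv) (auto intro!: derivative_eq_intros ds_has_field_derivative[OF dsum_1 z])
   finally have dL: "deriv Zf z = Z - (z - 1) * (ds (%n. mangoldt n * 1) z * Z)" using ld z by (simp add: Z_def)
   have "Z ~= 0" "z - 1 ~= 0" using dchar_ds_nonzero[OF dchar_one z] z by (auto simp: Z_def)
   hence "P z = 1 / (z - 1) - ds (%n. mangoldt n * 1) z"
    unfolding P_def dL Zf_eq_ds[OF z] Z_def[symmetric] by (simp add: field_simps)
   moreover have "ds a z = ds (%n. mangoldt n * 1) z - Z"
    unfolding a_def using ds_add[OF _ d1 z, of "%n. mangoldt n * 1"] ds_cmult[OF dsum_1 z, of "-1"] ld by (simp add: Z_def)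
   moreover have "Z = zreg z + 1 / (z - 1)" unfolding Z_def by (rule zeta_eq_zreg[OF z])
   ultimately show "ds a z = - P z - zreg z" by simp
  qed
  also have "... = - (deriv ^^ k) P s - (deriv ^^ k) zreg s"
  proof -
   have Pa: "P analytic_on {s}" by (rule P(1)) (use u in auto)
   have za: "zreg analytic_on {s}" 
    unfolding analytic_at using zreg_holomorphic open_halfspace_Re_gt[of 0] s
    by (intro exI[of _ "{s. Re s > 0}"]) auto
   have "(deriv ^^ k) (%w. - P w - zreg w) s = (deriv ^^ k) (%w. - P w) s - (deriv ^^ k) zreg s"
    by (rule higher_deriv_diff_at) (use Pa za in \<open>auto intro: analytic_intros\<close>)
   thus ?thesis by (simp add: higher_deriv_uminus_at[OF Pa])
  qed
  finally have "norm ((deriv ^^ k) (ds a) s) <= norm ((deriv ^^ k) P s) + norm ((deriv ^^ k) zreg s)"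
   using norm_triangle_ineq4[of "- (deriv ^^ k) P s" "(deriv ^^ k) zreg s"] by simp
  also have "... <= (E + E2) * K powr \<epsilon>" using main main2 by (simp add: distrib_right)
  finally show ?thesis unfolding ds_higher_deriv[OF da s(1)] by (simp add: norm_mult norm_power K_def a_def)
 qed
 thus ?thesis using E0 by (intro exI[of _ "E + E2"]) auto
qed

section \<open>From Dirichlet series to partial sums\<close>

lemma integral_exp_complex:
 assumes c: "Re c > 0"
 shows "set_integrable lborel {0<..} (%u. exp (- (c * of_real u)))"
  "(LINT u:{0<..}|lborel. exp (- (c * of_real u))) = 1 / c"
proof -
 have i: "set_integrable lborel {0<..} (%u. exp (- (u * Re c)))"
  using integrable_I0i_exp_mscale[OF c] by simp
 show I: "set_integrable lborel {0<..} (%u. exp (- (c * of_real u)))"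
 proof (rule set_integrable_bound[OF i])
  show "AE u in lborel. u \<in> {0<..} --> norm (exp (- (c * complex_of_real u))) <= norm (exp (- (u * Re c)))"
   by (auto simp: mult.commute)
 qed (auto simp: set_borel_measurable_def)
 have E: "einterval 0 \<infinity> = {0<..}" by (auto simp: einterval_def zero_ereal_def)
 have "((%u. norm (- exp (- (c * complex_of_real u)) / c)) \<longlongrightarrow> 0) at_top"
 proof -
  have "((%u. exp (- (u * r))) \<longlongrightarrow> 0) at_top" if "r > 0" for r :: real
   using that by real_asymp
  from tendsto_divide_zero[OF this[OF c], of "norm c"] have "((%u. exp (- (u * Re c)) / norm c) \<longlongrightarrow> 0) at_top" .
  thus ?thesis by (simp add: norm_divide mult.commute)
 qed
 hence L: "((%u. - exp (- (c * complex_of_real u)) / c) \<longlongrightarrow> 0) at_top"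
  by (rule tendsto_norm_zero_cancel)
 have "(LBINT u=0..\<infinity>. exp (- (c * of_real u))) = 0 - (- exp (- (c * of_real 0)) / c)"
 proof (rule interval_integral_FTC_integrable)
  show "((%u. - exp (- (c * complex_of_real u)) / c) has_vector_derivative exp (- (c * of_real u))) (at u)"
   if "0 < ereal u" "ereal u < \<infinity>" for u
   using c by (auto intro!: derivative_eq_intros has_vector_derivative_real_field)
  show "(((%u. - exp (- (c * complex_of_real u)) / c) \<circ> real_of_ereal) \<longlongrightarrow> - exp (- (c * of_real 0)) / c) (at_right 0)"
   unfolding zero_ereal_def ereal_tendsto_simps
   by (intro tendsto_intros) (use c in auto)
  show "(((%u. - exp (- (c * complex_of_real u)) / c) \<circ> real_of_ereal) \<longlongrightarrow> 0) (at_left \<infinity>)"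
   unfolding ereal_tendsto_simps using L by simp
 qed (use I in \<open>auto simp: E\<close>)
 thus "(LINT u:{0<..}|lborel. exp (- (c * of_real u))) = 1 / c"
  by (simp add: interval_lebesgue_integral_def E)
qed

text \<open>A Fourier pair: with \<open>u = ln y\<close>, \<open>pker\<close> is \<open>y powr (- l) * (1 - 1 / y)\<close>, the weight of the smoothed sums.\<close>
definition pker :: "real => real => real" where
 "pker l u = indicator {0<..} u * (exp (- (l * u)) - exp (- ((l + 1) * u)))"

definition phat :: "real => real => complex" where
 "phat l t = 1 / (Complex l t * (Complex l t + 1))"

lemma pker_bounds: "0 < l ==> 0 <= pker l u" "0 < l ==> pker l u <= 1"
proof -
 assume s: "0 < l"
 show "0 <= pker l u" using s by (auto simp: pker_def indicator_def algebra_simps)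
 have "exp (- (l * u)) - exp (- ((l + 1) * u)) <= 1" if "u > 0"
  using that s by (smt (verit) exp_ge_zero exp_le_one_iff mult_pos_pos)
 thus "pker l u <= 1" by (auto simp: pker_def indicator_def)
qed

lemma pker_pos: "0 <= u ==> pker l u = exp (- (l * u)) * (1 - exp (- u))"
 by (cases "u = 0") (auto simp: pker_def algebra_simps simp flip: exp_add)

lemma pker_nonpos: "u <= 0 ==> pker l u = 0"
 by (simp add: pker_def)

text \<open>The factor 1 - exp (- u) removes the jump at 0. Continuity is what allows inversion at
  every point, including 0, which corresponds to n = x.\<close>

lemma isCont_pker: "isCont (pker l) w"
proof -
 have "pker l = (%u. exp (- (l * max u 0)) * (1 - exp (- max u 0)))"
  by (auto simp: pker_pos pker_nonpos max_def fun_eq_iff)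
 moreover have "isCont (%u::real. exp (- (l * max u 0)) * (1 - exp (- max u 0))) w"
  by (intro continuous_intros)
 ultimately show ?thesis by simp
qed

lemma borel_pker [measurable]: "pker l \<in> borel_measurable borel"
 unfolding pker_def by measurable

lemma pker_fourier:
 assumes s: "l > 0"
 shows "integrable lborel (%u. cis (- (t * u)) * of_real (pker l u))"
  "(LINT u|lborel. cis (- (t * u)) * of_real (pker l u)) = phat l t"
proof -
 have nz: "Complex l t ~= 0" "Complex l t + 1 ~= 0" using s by (auto simp: complex_eq_iff)
 have e: "cis (- (t * u)) * of_real (pker l u) = indicator {0<..} u *\<^sub>R exp (- (Complex l t * of_real u)) -
   indicator {0<..} u *\<^sub>R exp (- ((Complex l t + 1) * of_real u))" for u
  by (auto simp: pker_def indicator_def exp_eq_polar algebra_simps)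
 note I = integral_exp_complex[of "Complex l t"] integral_exp_complex[of "Complex l t + 1"]
 show "integrable lborel (%u. cis (- (t * u)) * of_real (pker l u))"
  unfolding e using I s by (intro Bochner_Integration.integrable_diff) (auto simp: set_integrable_def)
 have "(LINT u|lborel. cis (- (t * u)) * of_real (pker l u)) = 1 / Complex l t - 1 / (Complex l t + 1)"
  unfolding e using I s
  by (subst Bochner_Integration.integral_diff) (auto simp: set_integrable_def set_lebesgue_integral_def)
 also have "... = phat l t" using nz by (simp add: phat_def field_simps)
 finally show "(LINT u|lborel. cis (- (t * u)) * of_real (pker l u)) = phat l t" .
qed

lemma integrable_pker: "l > 0 ==> integrable lborel (pker l)"
 using integrable_norm[OF pker_fourier(1)[of l 0]] pker_bounds(1)[of l] by (simp add: norm_mult)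

lemma gauss_fourier:
 "integrable lborel (%s. cis (s * y) * of_real (exp (- s\<^sup>2 / 2)))"
 "(LINT s|lborel. cis (s * y) * of_real (exp (- s\<^sup>2 / 2))) = of_real (2 * pi * std_normal_density y)"
proof -
 have e: "cis (s * y) * of_real (exp (- s\<^sup>2 / 2)) = of_real (sqrt (2 * pi)) * (std_normal_density s *\<^sub>R cis (s * y))" for s
  by (simp add: std_normal_density_def scaleR_conv_of_real)
 have i: "integrable lborel (%s. std_normal_density s *\<^sub>R cis (s * y))"
  by (rule Bochner_Integration.integrable_bound[OF integrable_normal_moment[of 1 0 0]]) (auto simp: cis_conv_exp)
 thus "integrable lborel (%s. cis (s * y) * of_real (exp (- s\<^sup>2 / 2)))" unfolding e by (rule integrable_mult_right)
 have "(LINT s|lborel. std_normal_density s *\<^sub>R cis (s * y)) = char std_normal_distribution y"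
  unfolding char_def by (subst integral_density) (auto simp: mult.commute cis_conv_exp)
 also have "... = of_real (exp (- y\<^sup>2 / 2))" by (simp add: char_std_normal_distribution)
 finally have "(LINT s|lborel. cis (s * y) * of_real (exp (- s\<^sup>2 / 2))) = of_real (sqrt (2 * pi) * exp (- y\<^sup>2 / 2))"
  unfolding e integral_mult_right_zero by simp
 also have "sqrt (2 * pi) * exp (- y\<^sup>2 / 2) = 2 * pi * std_normal_density y"
 proof -
  have "2 * pi * (1 / sqrt (2 * pi)) = sqrt (2 * pi)" by (simp add: real_div_sqrt)
  thus ?thesis unfolding std_normal_density_def mult.assoc[symmetric] by simp
 qed
 finally show "(LINT s|lborel. cis (s * y) * of_real (exp (- s\<^sup>2 / 2))) = of_real (2 * pi * std_normal_density y)"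
  .
qed

lemma gauss_fourier_scaled:
 assumes h: "h > 0"
 shows "integrable lborel (%s. cis (s * y) * of_real (exp (- (h * s)\<^sup>2 / 2)))"
 "(LINT s|lborel. cis (s * y) * of_real (exp (- (h * s)\<^sup>2 / 2))) = of_real (2 * pi * (std_normal_density (y / h) / h))"
proof -
 have e: "cis (s * y) = cis ((0 + h * s) * (y / h))" for s using h by simp
 have "integrable lborel (%s. cis ((0 + h * s) * (y / h)) * of_real (exp (- (0 + h * s)\<^sup>2 / 2)))"
  using lborel_integrable_real_affine[OF gauss_fourier(1)[of "y/h"], of h 0] h by simp
 thus "integrable lborel (%s. cis (s * y) * of_real (exp (- (h * s)\<^sup>2 / 2)))" unfolding e by simp
 have "(LINT s|lborel. cis (s * (y/h)) * of_real (exp (- s\<^sup>2 / 2))) =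
   \<bar>h\<bar> *\<^sub>R (LINT s|lborel. cis ((0 + h * s) * (y/h)) * of_real (exp (- (0 + h * s)\<^sup>2 / 2)))"
  by (rule lborel_integral_real_affine) (use h in simp)
 thus "(LINT s|lborel. cis (s * y) * of_real (exp (- (h * s)\<^sup>2 / 2))) = of_real (2 * pi * (std_normal_density (y / h) / h))"
  unfolding gauss_fourier(2) e using h
  by (simp add: scaleR_conv_of_real field_simps)
qed


lemma norm_phat_le:
 assumes "l >= 1"
 shows "norm (phat l t) <= 1 / (1 + t\<^sup>2)"
proof -
 have *: "sqrt (1 + t\<^sup>2) <= norm (Complex a t)" if "a >= 1" for a
  using that by (auto simp: cmod_def)
 have "sqrt (1 + t\<^sup>2) * sqrt (1 + t\<^sup>2) <= norm (Complex l t) * norm (Complex l t + 1)"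
  by (intro mult_mono) (use *[of l] *[of "l + 1"] assms in \<open>auto simp: plus_complex.code one_complex.code\<close>)
 hence "1 + t\<^sup>2 <= norm (Complex l t) * norm (Complex l t + 1)" by simp
 moreover have "1 + t\<^sup>2 > 0" by (simp add: add_pos_nonneg)
 ultimately have "1 / (norm (Complex l t) * norm (Complex l t + 1)) <= 1 / (1 + t\<^sup>2)"
  by (intro frac_le) simp_all
 thus ?thesis by (simp add: phat_def norm_divide norm_mult)
qed

lemma borel_phat [measurable]: "phat l \<in> borel_measurable borel"
proof -
 have "phat l = (%t. 1 / ((of_real l + \<i> * of_real t) * (of_real l + \<i> * of_real t + 1)))"
  by (simp add: phat_def fun_eq_iff Complex_eq)
 thus ?thesis by simp
qed

lemma integrable_three_halves:
 "integrable lborel (%t::real. (1 + \<bar>t\<bar>) powr (-3/2))"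
proof -
 have "((%x. x powr (-3/2)) has_integral -((1::real) powr ((-3/2)+1)) / ((-3/2)+1)) {1..}"
  by (rule has_integral_powr_to_inf) auto
 hence "(%x. x powr (-3/2)) absolutely_integrable_on {1::real..}"
  by (intro nonnegative_absolutely_integrable_1) (auto intro: has_integral_integrable)
 hence "set_integrable lebesgue {1::real..} (%x. x powr (-3/2))" by simp
 hence "integrable lborel (%x::real. indicator {1..} x * x powr (-3/2))"
  by (simp add: set_integrable_def integrable_completion)
 hence i: "integrable lborel (%x. indicator {1..} (1 + c * x) * (1 + c * x) powr (-3/2))" if "c ~= 0" for c :: real
  using that by (rule lborel_integrable_real_affine)
 have "integrable lborel (%x. indicator {1..} (1 + 1 * x) * (1 + 1 * x) powr (-3/2) +
   indicator {1..} (1 + (-1) * x) * (1 + (-1) * x) powr (-3/2) :: real)"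
  using i[of 1] i[of "-1"] by (intro Bochner_Integration.integrable_add) auto
 thus ?thesis
  by (rule Bochner_Integration.integrable_bound) (auto simp: indicator_def)
qed

lemma
 fixes t :: real
 shows inverse_le_three_halves: "1 / (1 + t\<^sup>2) <= 2 * (1 + \<bar>t\<bar>) powr (-3/2)" (is ?A)
 and sqrt_inverse_le_three_halves: "(1 + \<bar>t\<bar>) powr (1/2) / (1 + t\<^sup>2) <= 2 * (1 + \<bar>t\<bar>) powr (-3/2)" (is ?B)
proof -
 have "0 <= (1 - \<bar>t\<bar>)\<^sup>2" by simp
 hence "(1 + \<bar>t\<bar>)\<^sup>2 <= 2 * (1 + t\<^sup>2)" by (simp add: power2_eq_square algebra_simps)
 hence "1 / (1 + t\<^sup>2) <= 2 / (1 + \<bar>t\<bar>)\<^sup>2" by (simp add: field_simps add_pos_nonneg)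
 also have "... = 2 * (1 + \<bar>t\<bar>) powr (-2)" by (simp add: powr_minus powr_numeral divide_inverse)
 finally have 1: "1 / (1 + t\<^sup>2) <= 2 * (1 + \<bar>t\<bar>) powr (-2)" .
 also have "... <= 2 * (1 + \<bar>t\<bar>) powr (-3/2)" by (intro mult_left_mono powr_mono) auto
 finally show ?A .
 have "(1 + \<bar>t\<bar>) powr (1/2) * (1 / (1 + t\<^sup>2)) <= (1 + \<bar>t\<bar>) powr (1/2) * (2 * (1 + \<bar>t\<bar>) powr (-2))"
  using 1 by (intro mult_left_mono) auto
 also have "... = 2 * (1 + \<bar>t\<bar>) powr (-3/2)" by (simp flip: powr_add)
 finally show ?B by simp
qed

lemma integrable_phat:
 assumes "l >= 1"
 shows "integrable lborel (phat l)"
 by (rule Bochner_Integration.integrable_bound[OF integrable_mult_right[OF integrable_three_halves, of 2]])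
   (auto intro!: always_eventually order_trans[OF norm_phat_le[OF assms]] order_trans[OF inverse_le_three_halves])

text \<open>Fubini exchanges the kernel and the Gaussian factor, whose transform is again Gaussian;
  on the left stands a mollification of the kernel at scale \<open>h\<close>.\<close>

lemma pker_gauss:
 assumes s: "l >= 1" and h: "h > 0"
 shows "of_real (2 * pi * (LINT u|lborel. pker l (w - h * u) * std_normal_density u)) =
  (LINT s|lborel. cis (s * w) * phat l s * of_real (exp (- (h * s)\<^sup>2 / 2)))"
proof -
 have s0: "l > 0" using s by simp
 define f where "f v s = of_real (pker l v) * (cis (s * (w - v)) * of_real (exp (- (h * s)\<^sup>2 / 2)) :: complex)" for v s
 have m: "case_prod f \<in> borel_measurable (lborel \<Otimes>\<^sub>M lborel)"
  unfolding f_def cis_conv_exp by measurable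
 have g: "integrable lborel (%s. exp (- (h * s)\<^sup>2 / 2))"
  using integrable_norm[OF gauss_fourier_scaled(1)[OF h, of 0]] by simp
 have "integrable (lborel \<Otimes>\<^sub>M lborel) (case_prod f)"
 proof (rule lborel_pair.Fubini_integrable[OF m])
  have "(%v. LINT s|lborel. norm (case (v, s) of (v, s) => f v s)) =
    (%v. pker l v * (LINT s|lborel. exp (- (h * s)\<^sup>2 / 2)))"
   using pker_bounds(1)[OF s0] by (simp add: f_def norm_mult fun_eq_iff)
  thus "integrable lborel (%v. LINT s|lborel. norm (case (v, s) of (v, s) => f v s))"
   using integrable_pker[OF s0] by simp
  show "AE v in lborel. integrable lborel (%s. case (v, s) of (v, s) => f v s)"
   using gauss_fourier_scaled(1)[OF h] by (simp add: f_def)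
 qed
 from lborel_pair.Fubini_integral[OF this]
 have F: "(LINT s|lborel. LINT v|lborel. f v s) = (LINT v|lborel. LINT s|lborel. f v s)" .
 have "(LINT v|lborel. f v s) = cis (s * w) * phat l s * of_real (exp (- (h * s)\<^sup>2 / 2))" for s
 proof -
  have "f v s = (cis (s * w) * of_real (exp (- (h * s)\<^sup>2 / 2))) * (cis (- (s * v)) * of_real (pker l v))" for v
  proof -
   have "cis (s * (w - v)) = cis (s * w) * cis (- (s * v))" by (simp add: cis_mult algebra_simps)
   thus ?thesis by (simp add: f_def)
  qed
  thus ?thesis using pker_fourier(2)[OF s0, of s] by simp
 qed
 hence L: "(LINT s|lborel. LINT v|lborel. f v s) = (LINT s|lborel. cis (s * w) * phat l s * of_real (exp (- (h * s)\<^sup>2 / 2)))"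
  by simp
 have "(LINT s|lborel. f v s) = of_real (2 * pi / h * (pker l v * std_normal_density ((w - v) / h)))" for v
  unfolding f_def integral_mult_right_zero gauss_fourier_scaled(2)[OF h] by simp
 hence "(LINT v|lborel. LINT s|lborel. f v s) = of_real (2 * pi / h * (LINT v|lborel. pker l v * std_normal_density ((w - v) / h)))"
  by (simp only: integral_complex_of_real integral_mult_right_zero)
 also have "(LINT v|lborel. pker l v * std_normal_density ((w - v) / h)) =
   \<bar>-h\<bar> *\<^sub>R (LINT u|lborel. pker l (w + -h * u) * std_normal_density ((w - (w + -h * u)) / h))"
  by (rule lborel_integral_real_affine) (use h in simp)
 also have "... = h * (LINT u|lborel. pker l (w - h * u) * std_normal_density u)" using h by simp
 finally show ?thesis using F L h by simp
qed

text \<open>Both sides of \<open>pker_gauss\<close> converge dominatedly as the scale tends to 0,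
  the left because the kernel is bounded and continuous, the right because \<open>phat\<close> is
  integrable for \<open>l >= 1\<close>.\<close>

lemma pker_inversion:
 assumes s: "l >= 1"
 shows "(LINT t|lborel. cis (t * w) * phat l t) = of_real (2 * pi * pker l w)"
proof -
 have s0: "l > 0" using s by simp
 define h where "h n = 1 / real (Suc n)" for n
 have h0: "h \<longlonglongrightarrow> 0" unfolding h_def by real_asymp
 have 1: "(%n. LINT t|lborel. cis (t * w) * phat l t * of_real (exp (- (h n * t)\<^sup>2 / 2))) \<longlonglongrightarrow>
   (LINT t|lborel. cis (t * w) * phat l t)"
 proof (rule integral_dominated_convergence)
  show "integrable lborel (%t. norm (phat l t))" using integrable_phat[OF s] by simp
  show "AE t in lborel. (%n. cis (t * w) * phat l t * of_real (exp (- (h n * t)\<^sup>2 / 2))) \<longlonglongrightarrow> cis (t * w) * phat l t"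
  proof (rule always_eventually, rule allI)
   fix t
   have "(%n. cis (t * w) * phat l t * of_real (exp (- (h n * t)\<^sup>2 / 2))) \<longlonglongrightarrow> cis (t * w) * phat l t * of_real (exp (- (0 * t)\<^sup>2 / 2))"
    by (intro tendsto_intros h0) auto
   thus "(%n. cis (t * w) * phat l t * of_real (exp (- (h n * t)\<^sup>2 / 2))) \<longlonglongrightarrow> cis (t * w) * phat l t" by simp
  qed
  show "AE t in lborel. norm (cis (t * w) * phat l t * of_real (exp (- (h n * t)\<^sup>2 / 2))) <= norm (phat l t)" for n
   by (auto simp: norm_mult mult_left_le)
 qed (auto simp: cis_conv_exp)
 have 2: "(%n. LINT u|lborel. pker l (w - h n * u) * std_normal_density u) \<longlonglongrightarrow>
   (LINT u|lborel. pker l w * std_normal_density u)"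
 proof (rule integral_dominated_convergence)
  show "integrable lborel (%u. std_normal_density u)" using integrable_normal_moment[of 1 0 0] by simp
  show "AE u in lborel. (%n. pker l (w - h n * u) * std_normal_density u) \<longlonglongrightarrow> pker l w * std_normal_density u"
  proof (rule always_eventually, rule allI)
   fix u
   have "(%n. w - h n * u) \<longlonglongrightarrow> w - 0 * u" by (intro tendsto_intros h0)
   hence "(%n. pker l (w - h n * u)) \<longlonglongrightarrow> pker l w"
    using isCont_tendsto_compose[OF isCont_pker] by fastforce
   thus "(%n. pker l (w - h n * u) * std_normal_density u) \<longlonglongrightarrow> pker l w * std_normal_density u"
    by (intro tendsto_intros)
  qed
  show "AE u in lborel. norm (pker l (w - h n * u) * std_normal_density u) <= std_normal_density u" for n
   using pker_bounds[OF s0] by (auto simp: abs_mult mult_left_le_one_le)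
 qed auto
 have "(LINT u|lborel. pker l w * std_normal_density u) = pker l w"
  using integral_std_normal_moment_even[of 0] by simp
 hence "(%n. complex_of_real (2 * pi * (LINT u|lborel. pker l (w - h n * u) * std_normal_density u))) \<longlonglongrightarrow> of_real (2 * pi * pker l w)"
  using 2 by (intro tendsto_intros) simp
 moreover have "(%n. complex_of_real (2 * pi * (LINT u|lborel. pker l (w - h n * u) * std_normal_density u))) =
   (%n. LINT t|lborel. cis (t * w) * phat l t * of_real (exp (- (h n * t)\<^sup>2 / 2)))"
 proof
  fix n show "complex_of_real (2 * pi * (LINT u|lborel. pker l (w - h n * u) * std_normal_density u)) =
    (LINT t|lborel. cis (t * w) * phat l t * of_real (exp (- (h n * t)\<^sup>2 / 2)))"
   by (rule pker_gauss[OF s]) (simp add: h_def)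
 qed
 ultimately have "(%n. LINT t|lborel. cis (t * w) * phat l t * of_real (exp (- (h n * t)\<^sup>2 / 2))) \<longlonglongrightarrow> of_real (2 * pi * pker l w)"
  by (simp only:)
 thus ?thesis by (rule LIMSEQ_unique[OF 1])
qed


section \<open>Bounds for smoothed sums\<close>

lemma le_nat_floor_iff: "x >= 0 ==> n <= nat \<lfloor>x\<rfloor> \<longleftrightarrow> real n <= x"
 by (simp add: le_nat_iff le_floor_iff)

definition perron_const :: real where
 "perron_const = (LINT t|lborel. (1 + \<bar>t\<bar>) powr (-3/2))"

lemma perron_const_nonneg: "perron_const >= 0"
 unfolding perron_const_def by (rule integral_nonneg_AE) auto

text \<open>The series on the line Re s = l is integrated against \<open>phat\<close>. By inversion
  the n-th term becomes the kernel at ln (x / n), that is the weight 1 - n/x up to x and 0 beyond.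
  The identity is exact, so there is no truncation error; the factor 4 lost in the estimates is
  regained from 2 pi >= 4.\<close>

lemma perron_bound:
 assumes b: "dsum b" and s: "1 < l" "l <= 2" and M: "M >= 0"
  and B: "!!t. norm (ds b (Complex l t)) <= M * (1 + norm (Complex l t)) powr (1/2)" and x: "x >= 1"
 shows "norm (\<Sum>n=1..nat \<lfloor>x\<rfloor>. b n * of_real (1 - real n / x)) <= perron_const * M * x powr l"
proof -
 define w where "w = ln x"
 define f where "f n t = cis (t * w) * phat l t * (b n * of_nat n powr (- Complex l t))" for n t
 have nf: "norm (f n t) = norm (b n) * real n powr (-l) * norm (phat l t)" for n t
  by (simp add: f_def norm_mult norm_nat_powr)
 have f_eq: "f n t = b n * of_real (real n powr (-l)) * (cis (t * (w - ln (real n))) * phat l t)" for n t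
 proof (cases "n = 0")
  case False
  hence "of_nat n powr (- Complex l t) = of_real (real n powr (-l)) * cis (- (t * ln (real n)))"
   by (simp add: powr_def exp_eq_polar mult.commute Ln_of_nat)
  moreover have "cis (t * (w - ln (real n))) = cis (t * w) * cis (- (t * ln (real n)))"
   by (simp add: cis_mult algebra_simps)
  ultimately show ?thesis by (simp add: f_def)
 qed (simp add: f_def)
 have sm: "summable (%n. norm (b n) * real n powr (-l))" using b s by (simp add: dsum_def)
 have ip: "integrable lborel (%t. cis (t * y) * phat l t)" for y
  by (rule Bochner_Integration.integrable_bound[OF integrable_phat[of l]]) (use s in \<open>auto simp: cis_conv_exp norm_mult\<close>)
 have i: "integrable lborel (f n)" for n
  unfolding f_eq by (intro integrable_mult_right ip)
 have "(LINT t|lborel. (\<Sum>n. f n t)) = (\<Sum>n. LINT t|lborel. f n t)"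
 proof (rule integral_suminf)
  show "AE t in lborel. summable (%n. norm (f n t))"
   unfolding nf by (intro always_eventually allI summable_mult2 sm)
  show "summable (%n. LINT t|lborel. norm (f n t))"
   unfolding nf integral_mult_right_zero by (intro summable_mult2 sm)
 qed (rule i)
 moreover have "(LINT t|lborel. f n t) = (if n \<in> {1..nat \<lfloor>x\<rfloor>} then b n * of_real (1 - real n / x) * of_real (2 * pi * x powr (-l)) else 0)" for n
 proof -
  have I: "(LINT t|lborel. f n t) = b n * of_real (real n powr (-l)) * of_real (2 * pi * pker l (w - ln (real n)))"
   unfolding f_eq integral_mult_right_zero using pker_inversion[of l "w - ln (real n)"] s by simp
  show ?thesis
  proof (cases "n \<in> {1..nat \<lfloor>x\<rfloor>}")
   case True
   hence n: "n >= 1" "real n <= x" using x le_nat_floor_iff[of x n] by auto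
   have "pker l (w - ln (real n)) = exp (- (l * (w - ln (real n)))) * (1 - exp (- (w - ln (real n))))"
    using n by (intro pker_pos) (simp add: w_def)
   also have "exp (- (w - ln (real n))) = real n / x"
    using n x by (simp add: w_def exp_diff)
   also have "exp (- (l * (w - ln (real n)))) = x powr (-l) * real n powr l"
    using n x by (simp add: w_def powr_def algebra_simps flip: exp_add)
   finally have P: "pker l (w - ln (real n)) = x powr (-l) * real n powr l * (1 - real n / x)" .
   have "real n powr (-l) * real n powr l = 1" using n by (simp flip: powr_add)
   hence "real n powr (-l) * (2 * pi * pker l (w - ln (real n))) = 2 * pi * x powr (-l) * (1 - real n / x)"
    unfolding P by (simp add: algebra_simps)
   hence "complex_of_real (real n powr (-l)) * of_real (2 * pi * pker l (w - ln (real n))) = of_real (2 * pi * x powr (-l) * (1 - real n / x))"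
    by (simp only: of_real_mult[symmetric])
   thus ?thesis using True unfolding I mult.assoc by simp
  next
   case False
   have "w - ln (real n) <= 0 \<or> n = 0"
   proof (cases "n = 0")
    case n: False
    hence "x <= real n" using False x le_nat_floor_iff[of x n] by auto
    thus ?thesis using x by (simp add: w_def)
   qed simp
   hence "real n powr (-l) = 0 \<or> pker l (w - ln (real n)) = 0" using pker_nonpos by auto
   thus ?thesis using False unfolding I by auto
  qed
 qed
 ultimately have "(LINT t|lborel. (\<Sum>n. f n t)) = (\<Sum>n. if n \<in> {1..nat \<lfloor>x\<rfloor>} then b n * of_real (1 - real n / x) * of_real (2 * pi * x powr (-l)) else 0)"
  by simp
 also have "... = (\<Sum>n=1..nat \<lfloor>x\<rfloor>. b n * of_real (1 - real n / x) * of_real (2 * pi * x powr (-l)))"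
  by (subst suminf_finite[of "{1..nat \<lfloor>x\<rfloor>}"]) auto
 finally have eq: "(LINT t|lborel. (\<Sum>n. f n t)) = (\<Sum>n=1..nat \<lfloor>x\<rfloor>. b n * of_real (1 - real n / x)) * of_real (2 * pi * x powr (-l))"
  by (simp only: sum_distrib_right)
 define Z where "Z = norm (\<Sum>n=1..nat \<lfloor>x\<rfloor>. b n * of_real (1 - real n / x))"
 have "norm (LINT t|lborel. (\<Sum>n. f n t)) <= (LINT t|lborel. 4 * M * (1 + \<bar>t\<bar>) powr (-3/2))"
 proof (rule Bochner_Integration.integral_norm_bound_integral)
  show "integrable lborel (%t. \<Sum>n. f n t)"
  proof (rule integrable_suminf)
   show "AE t in lborel. summable (%n. norm (f n t))"
    unfolding nf by (intro always_eventually allI summable_mult2 sm)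
   show "summable (%n. LINT t|lborel. norm (f n t))"
    unfolding nf integral_mult_right_zero by (intro summable_mult2 sm)
  qed (rule i)
  show "integrable lborel (%t::real. 4 * M * (1 + \<bar>t\<bar>) powr (-3/2))"
   by (intro integrable_mult_right integrable_three_halves)
  fix t
  have "(\<Sum>n. f n t) = cis (t * w) * phat l t * ds b (Complex l t)"
   unfolding f_def ds_def by (rule suminf_mult) (rule ds_summable[OF b], use s in simp)
  hence "norm (\<Sum>n. f n t) = norm (phat l t) * norm (ds b (Complex l t))"
   by (simp add: norm_mult)
  also have "... <= 1 / (1 + t\<^sup>2) * (M * (2 * (1 + \<bar>t\<bar>) powr (1/2)))"
  proof (rule mult_mono)
   have "norm (Complex l t) <= \<bar>l\<bar> + \<bar>t\<bar>" using cmod_le[of "Complex l t"] by simp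
   hence "(1 + norm (Complex l t)) powr (1/2) <= (4 * (1 + \<bar>t\<bar>)) powr (1/2)"
    using s by (intro powr_mono2) auto
   also have "... = 2 * (1 + \<bar>t\<bar>) powr (1/2)" unfolding powr_mult[of 4 "1 + \<bar>t\<bar>"] using powr_half_sqrt[of 4] by simp
   finally show "norm (ds b (Complex l t)) <= M * (2 * (1 + \<bar>t\<bar>) powr (1/2))"
    using M by (intro order_trans[OF B] mult_left_mono)
   show "norm (phat l t) <= 1 / (1 + t\<^sup>2)" using s by (intro norm_phat_le) simp
  qed auto
  also have "... = 2 * M * ((1 + \<bar>t\<bar>) powr (1/2) / (1 + t\<^sup>2))" by simp
  also have "... <= 2 * M * (2 * (1 + \<bar>t\<bar>) powr (-3/2))"
   using M by (intro mult_left_mono sqrt_inverse_le_three_halves) auto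
  finally show "norm (\<Sum>n. f n t) <= 4 * M * (1 + \<bar>t\<bar>) powr (-3/2)" by simp
 qed
 also have "... = 4 * M * perron_const" unfolding integral_mult_right_zero perron_const_def ..
 finally have "Z * (2 * pi * x powr (-l)) <= 4 * M * perron_const"
  unfolding eq norm_mult norm_of_real Z_def by simp
 hence "Z * (2 * pi) <= 4 * (perron_const * M * x powr l)"
  using x by (simp add: powr_minus field_simps)
 moreover have "Z * 4 <= Z * (2 * pi)"
  using pi_ge_two by (intro mult_left_mono) (auto simp: Z_def)
 ultimately have "Z <= perron_const * M * x powr l" by linarith
 thus ?thesis by (simp only: Z_def)
qed

lemma power_le_fact_exp:
 fixes u :: real
 assumes "u >= 0"
 shows "u ^ j <= fact j * exp u"
proof -
 have "(%n. u ^ n /\<^sub>R fact n) sums exp u" by (rule exp_converges)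
 hence "(\<Sum>n\<in>{j}. u ^ n /\<^sub>R fact n) <= exp u"
  using assms by (intro sum_le_suminf[of "%n. u ^ n /\<^sub>R fact n", THEN order_trans])
   (auto simp: sums_iff)
 thus ?thesis by (simp add: field_simps)
qed

lemma ln_power_le: "(x::real) >= 1 ==> ln x ^ j <= fact j * x"
 using power_le_fact_exp[of "ln x" j] by simp

lemma sqrt_ln_power_le:
 assumes x: "(x::real) >= 1"
 shows "sqrt x * ln x ^ j <= 2 ^ j * fact j * x"
proof -
 have "ln (sqrt x) ^ j <= fact j * sqrt x" using x by (intro ln_power_le) simp
 hence "(ln x / 2) ^ j <= fact j * sqrt x" using x by (simp add: ln_sqrt)
 hence "ln x ^ j <= 2 ^ j * fact j * sqrt x" by (simp add: power_divide field_simps)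
 hence "sqrt x * ln x ^ j <= sqrt x * (2 ^ j * fact j * sqrt x)" by (intro mult_left_mono) (use x in auto)
 also have "... = 2 ^ j * fact j * (sqrt x * sqrt x)" by simp
 also have "sqrt x * sqrt x = x" using x by simp
 finally show ?thesis .
qed

lemma abel_decreasing:
 fixes a :: "nat => complex" and w :: "nat => real"
 assumes "m <= N" and T: "!!n. m <= n ==> n <= N ==> norm (\<Sum>i=m..n. a i) <= T"
  and w: "!!n. m <= n ==> n < N ==> w (Suc n) <= w n" and wN: "w N >= 0"
 shows "norm (\<Sum>i=m..N. a i * of_real (w i)) <= T * w m"
proof -
 have "norm ((\<Sum>i=m..N. a i * of_real (w i)) - (\<Sum>i=m..N. a i) * of_real (w N)) <= T * (w m - w N)"
  using assms(1) T w
 proof (induction N rule: dec_induct)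
  case base
  thus ?case by simp
 next
  case (step n)
  have "(\<Sum>i=m..Suc n. a i * of_real (w i)) - (\<Sum>i=m..Suc n. a i) * of_real (w (Suc n)) =
   ((\<Sum>i=m..n. a i * of_real (w i)) - (\<Sum>i=m..n. a i) * of_real (w n)) + (\<Sum>i=m..n. a i) * of_real (w n - w (Suc n))"
   using step.hyps by (simp add: algebra_simps)
  also have "norm ... <= T * (w m - w n) + T * (w n - w (Suc n))"
  proof (intro norm_triangle_mono)
   show "norm ((\<Sum>i=m..n. a i * of_real (w i)) - (\<Sum>i=m..n. a i) * of_real (w n)) <= T * (w m - w n)"
    using step by auto
   have "norm (\<Sum>i=m..n. a i) * (w n - w (Suc n)) <= T * (w n - w (Suc n))"
    using step by (intro mult_right_mono) auto
   thus "norm ((\<Sum>i=m..n. a i) * of_real (w n - w (Suc n))) <= T * (w n - w (Suc n))"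
    using step by (simp add: norm_mult del: of_real_diff)
  qed
  finally show ?case by (simp add: algebra_simps)
 qed
 moreover have "norm ((\<Sum>i=m..N. a i) * of_real (w N)) <= T * w N"
  using T[of N] wN assms(1) by (simp add: norm_mult mult_right_mono)
 ultimately have "norm (((\<Sum>i=m..N. a i * of_real (w i)) - (\<Sum>i=m..N. a i) * of_real (w N)) + (\<Sum>i=m..N. a i) * of_real (w N)) <= T * (w m - w N) + T * w N"
  by (rule norm_triangle_mono)
 thus ?thesis by (simp add: algebra_simps)
qed

lemma smoothed_sum_bound:
 assumes b: "dsum b" and M: "M >= 0"
  and B: "!!s. 1 < Re s ==> Re s <= 2 ==> norm (ds b s) <= M * (1 + norm s) powr (1/2)" and x: "x >= 3"
 shows "norm (\<Sum>n=1..nat \<lfloor>x\<rfloor>. b n * of_real (x - real n)) <= perron_const * M * 3 * x\<^sup>2"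
proof -
 have l: "ln x >= 1" using x ln3_gt_1 by (smt (verit) ln_le_cancel_iff)
 \<comment> \<open>The usual abscissa, at which \<open>x powr \<sigma>\<close> exceeds
   \<open>x\<close> by the factor e only.\<close>
 define \<sigma> where "\<sigma> = 1 + 1 / ln x"
 have s: "1 < \<sigma>" "\<sigma> <= 2" using l by (auto simp: \<sigma>_def)
 have e: "x powr \<sigma> = exp 1 * x" using x l by (simp add: \<sigma>_def powr_def distrib_right exp_add)
 have "(\<Sum>n=1..nat \<lfloor>x\<rfloor>. b n * of_real (x - real n)) = of_real x * (\<Sum>n=1..nat \<lfloor>x\<rfloor>. b n * of_real (1 - real n / x))"
  unfolding sum_distrib_left by (intro sum.cong) (use x in \<open>auto simp: field_simps\<close>)
 hence "norm (\<Sum>n=1..nat \<lfloor>x\<rfloor>. b n * of_real (x - real n)) = x * norm (\<Sum>n=1..nat \<lfloor>x\<rfloor>. b n * of_real (1 - real n / x))"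
  using x by (simp add: norm_mult)
 also have "... <= x * (perron_const * M * x powr \<sigma>)"
  by (intro mult_left_mono perron_bound[OF b s M B]) (use x s in auto)
 also have "... = perron_const * M * exp 1 * x\<^sup>2" by (simp add: e power2_eq_square)
 also have "... <= perron_const * M * 3 * x\<^sup>2"
  using exp_le M perron_const_nonneg by (intro mult_right_mono mult_left_mono) auto
 finally show ?thesis .
qed

section \<open>Removing the smoothing and the logarithmic weight\<close>

text \<open>The smoothed sums at \<open>x + D\<close> and at \<open>x\<close> differ by
  \<open>D\<close> times the sharp sum plus the terms in the interval of length \<open>D\<close>, of
  which there are at most \<open>D + 1\<close>, each bounded by \<open>L * D\<close>.\<close>

lemma sharp_from_smoothed:
 fixes b :: "nat => complex"
 assumes x: "x >= 1" and D: "D > 0"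
  and S: "norm (\<Sum>n=1..nat \<lfloor>x\<rfloor>. b n * of_real (x - real n)) <= T"
   "norm (\<Sum>n=1..nat \<lfloor>x+D\<rfloor>. b n * of_real (x + D - real n)) <= T'"
  and L: "!!n. real n > x ==> real n <= x + D ==> norm (b n) <= L" and L0: "L >= 0"
 shows "norm (\<Sum>n=1..nat \<lfloor>x\<rfloor>. b n) <= (T + T') / D + (D + 1) * L"
proof -
 define N N' where "N = nat \<lfloor>x\<rfloor>" and "N' = nat \<lfloor>x+D\<rfloor>"
 have NN: "N <= N'" using D by (auto simp: N_def N'_def intro!: nat_mono floor_mono)
 have un: "{1..N'} = {1..N} \<union> {Suc N..N'}" using NN by auto
 have split: "(\<Sum>n=1..N'. f n) = (\<Sum>n=1..N. f n) + (\<Sum>n=Suc N..N'. f n)" for f :: "nat => complex"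
  unfolding un by (rule sum.union_disjoint) auto
 have "(\<Sum>n=1..N. b n) * of_real D = (\<Sum>n=1..N'. b n * of_real (x + D - real n)) - (\<Sum>n=1..N. b n * of_real (x - real n))
   - (\<Sum>n=Suc N..N'. b n * of_real (x + D - real n))"
  unfolding split by (simp add: sum_subtractf[symmetric] sum_distrib_left algebra_simps sum.distrib)
 hence "norm (\<Sum>n=1..N. b n) * D = norm ((\<Sum>n=1..N'. b n * of_real (x + D - real n)) - (\<Sum>n=1..N. b n * of_real (x - real n))
   - (\<Sum>n=Suc N..N'. b n * of_real (x + D - real n)))"
  using D by (metis abs_of_pos norm_mult norm_of_real)
 also have "... <= norm (\<Sum>n=1..N'. b n * of_real (x + D - real n)) + norm (\<Sum>n=1..N. b n * of_real (x - real n))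
   + norm (\<Sum>n=Suc N..N'. b n * of_real (x + D - real n))"
  by (intro order_trans[OF norm_triangle_ineq4] add_right_mono norm_triangle_ineq4)
 also have "... <= T' + T + (D + 1) * (L * D)"
 proof (intro add_mono)
  have mem: "real n > x \<and> real n <= x + D" if "n \<in> {Suc N..N'}" for n
   using that x D le_nat_floor_iff[of x n] le_nat_floor_iff[of "x+D" n] by (auto simp: N_def N'_def)
  have "norm (\<Sum>n=Suc N..N'. b n * of_real (x + D - real n)) <= (\<Sum>n=Suc N..N'. norm (b n * of_real (x + D - real n)))"
   by (rule norm_sum)
  also have "... <= (\<Sum>n=Suc N..N'. L * D)"
  proof (rule sum_mono)
   fix n assume "n \<in> {Suc N..N'}"
   from mem[OF this] have "norm (b n) <= L" "\<bar>x + D - real n\<bar> <= D" using L by auto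
   thus "norm (b n * of_real (x + D - real n)) <= L * D"
    unfolding norm_mult norm_of_real using L0 by (intro mult_mono) auto
  qed
  also have "... = real (N' - N) * (L * D)" by simp
  also have "... <= (D + 1) * (L * D)"
  proof (rule mult_right_mono)
   have "real N' <= x + D" using le_nat_floor_iff[of "x+D" N'] x D by (simp add: N'_def)
   moreover have "real (Suc N) > x" using le_nat_floor_iff[of x "Suc N"] x by (simp add: N_def)
   ultimately show "real (N' - N) <= D + 1" using NN by (simp add: of_nat_diff)
  qed (use L0 D in auto)
  finally show "norm (\<Sum>n=Suc N..N'. b n * of_real (x + D - real n)) <= (D + 1) * (L * D)" .
 qed (use S in \<open>auto simp: N_def N'_def\<close>)
 finally have "norm (\<Sum>n=1..N. b n) * D <= ((T + T') / D + (D + 1) * L) * D"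
  using D by (simp add: distrib_right distrib_left add_divide_distrib)
 thus ?thesis using D by (simp add: N_def)
qed

text \<open>Differentiating \<open>2 j\<close> times costs nothing in the bound for the series, whereas removing the weight again by Abel
 summation gains \<open>2 j\<close> logarithms, of which \<open>j\<close> survive the passage from smoothed to sharp sums.\<close>
definition log_weighted :: "nat => (nat => complex) => nat => complex" where
 "log_weighted j a n = a n * of_real (ln (real n)) ^ (2 * j)"

text \<open>The interface between the analytic estimates and the elementary summation, shared by
  Lambda - 1 and by Lambda times a nonprincipal character. All dependence on the modulus is carried
  by \<open>M\<close>.\<close>

definition tame :: "nat => (nat => complex) => real => bool" where
 "tame j a M \<longleftrightarrow> (\<forall>n\<ge>1. norm (a n) <= 1 + 2 * ln (real n)) \<and> M >= 1 \<and> dsum (log_weighted j a) \<and>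
   (\<forall>s. 1 < Re s --> Re s <= 2 --> norm (ds (log_weighted j a) s) <= M * (1 + norm s) powr (1/2))"

lemma log_weighted_sum_bound:
 assumes j: "j >= 1"
 shows "\<exists>C\<ge>1. \<forall>a M. tame j a M --> (\<forall>x\<ge>3. norm (\<Sum>n=1..nat \<lfloor>x\<rfloor>. log_weighted j a n) <= C * M * x * ln x ^ (j + 1))"
proof -
 define P where "P = perron_const"
 have P: "P >= 0" by (simp add: P_def perron_const_nonneg)
 define Q :: real where "Q = 4 * 2 ^ (2 * j + 1)"
 have Q: "Q >= 0" by (simp add: Q_def)
 define C where "C = 1 + 15 * P + Q * (1 + fact j)"
 have main: "norm (\<Sum>n=1..nat \<lfloor>x\<rfloor>. log_weighted j a n) <= C * M * x * ln x ^ (j + 1)"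
  if t: "tame j a M" and x: "x >= 3" for a M x
 proof -
  define b where "b = log_weighted j a"
  note b_n = log_weighted_def[of j a, folded b_def]
  from t have a: "\<forall>n\<ge>1. norm (a n) <= 1 + 2 * ln (real n)" and M: "M >= 1" and d: "dsum b"
   and B: "!!s. 1 < Re s ==> Re s <= 2 ==> norm (ds b s) <= M * (1 + norm s) powr (1/2)"
   by (auto simp: tame_def b_def)
  have l: "ln x >= 1" using x ln3_gt_1 by (smt (verit) ln_le_cancel_iff)
  have lp: "ln x ^ i >= 1" for i using l by simp
  \<comment> \<open>The smoothed sums contribute about x^2 / D and the short interval about D times
    2j + 1 logarithms; with this \<open>D\<close> both are at most of order x times j + 1
    logarithms.\<close>
  define D where "D = x / ln x ^ j"
  have D: "D > 0" "D <= x" using x lp[of j] by (auto simp: D_def field_simps)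
  have S: "norm (\<Sum>n=1..nat \<lfloor>y\<rfloor>. b n * of_real (y - real n)) <= P * M * 3 * y\<^sup>2" if "y >= 3" for y
   unfolding P_def by (rule smoothed_sum_bound[OF d _ B that]) (use M in auto)
  have bL: "norm (b n) <= Q * ln x ^ (2 * j + 1)" if n: "real n > x" "real n <= x + D" for n
  proof -
   have "real n <= x^2" using n x D by (auto simp: power2_eq_square intro: order_trans[of _ "x+x"])
   hence ln: "ln (real n) <= 2 * ln x" using n x by (metis ln_le_cancel_iff ln_realpow numeral_2_eq_2 of_nat_numeral order_less_le_trans order_less_trans rel_simps(51) zero_less_power)
   have ln0: "ln (real n) >= 0" using n x by simp
   have "norm (b n) = norm (a n) * ln (real n) ^ (2*j)" using ln0 by (simp add: b_n norm_mult norm_power)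
   also have "... <= (1 + 2 * (2 * ln x)) * (2 * ln x) ^ (2*j)"
   proof (intro mult_mono power_mono)
    have "norm (a n) <= 1 + 2 * ln (real n)" using a n x by simp
    thus "norm (a n) <= 1 + 2 * (2 * ln x)" using ln by simp
   qed (use ln ln0 l in auto)
   also have "... <= (4 * (2 * ln x)) * (2 * ln x) ^ (2*j)"
    using l by (intro mult_right_mono) auto
   also have "... = Q * ln x ^ (2 * j + 1)" by (simp add: Q_def power_mult_distrib)
   finally show ?thesis .
  qed
  have "norm (\<Sum>n=1..nat \<lfloor>x\<rfloor>. b n) <= (P * M * 3 * x\<^sup>2 + P * M * 3 * (x + D)\<^sup>2) / D + (D + 1) * (Q * ln x ^ (2 * j + 1))"
   by (rule sharp_from_smoothed[OF _ D(1) S S bL]) (use x D Q l in auto)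
  also have "(P * M * 3 * x\<^sup>2 + P * M * 3 * (x + D)\<^sup>2) / D <= 15 * P * M * (x * ln x ^ (j + 1))"
  proof -
   have "(x + D)\<^sup>2 <= (2 * x)\<^sup>2" using D x by (intro power_mono) auto
   hence "P * M * 3 * (x + D)\<^sup>2 <= P * M * 3 * (4 * x\<^sup>2)" using P M by (intro mult_left_mono) (auto simp: power_mult_distrib)
   hence "(P * M * 3 * x\<^sup>2 + P * M * 3 * (x + D)\<^sup>2) / D <= (15 * P * M * x\<^sup>2) / D"
    using D by (intro divide_right_mono) auto
   also have "... = 15 * P * M * (x * ln x ^ j)" using x by (simp add: D_def power2_eq_square)
   also have "... <= 15 * P * M * (x * ln x ^ (j + 1))"
    using P M x l by (intro mult_left_mono power_increasing) auto
   finally show ?thesis .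
  qed
  also have "(D + 1) * (Q * ln x ^ (2 * j + 1)) <= Q * (1 + fact j) * (x * ln x ^ (j + 1))"
  proof -
   have e: "ln x ^ (2 * j + 1) = ln x ^ j * ln x ^ (j + 1)" by (simp flip: power_add add: mult_2)
   have "ln x ^ j ~= 0" using lp[of j] by linarith
   hence "D * ln x ^ j = x" unfolding D_def by (rule nonzero_eq_divide_eq[THEN iffD1]) simp
   hence "(D + 1) * ln x ^ j = x + ln x ^ j" by (simp add: distrib_right)
   also have "... <= (1 + fact j) * x" using ln_power_le[of x j] x by (simp add: algebra_simps)
   finally have "(D + 1) * ln x ^ j * (Q * ln x ^ (j+1)) <= (1 + fact j) * x * (Q * ln x ^ (j+1))"
    using Q l by (intro mult_right_mono) auto
   thus ?thesis unfolding e by (simp add: mult_ac)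
  qed
  also have "15 * P * M * (x * ln x ^ (j + 1)) + Q * (1 + fact j) * (x * ln x ^ (j + 1)) <= C * M * (x * ln x ^ (j + 1))"
  proof -
   have "15 * P * M + Q * (1 + fact j) <= 15 * P * M + Q * (1 + fact j) * M + M"
    using M Q mult_left_mono[of 1 M "Q * (1 + fact j)"] by simp
   also have "... = C * M" by (simp add: C_def algebra_simps)
   finally have "(15 * P * M + Q * (1 + fact j)) * (x * ln x ^ (j + 1)) <= C * M * (x * ln x ^ (j + 1))"
    using x l by (intro mult_right_mono) auto
   thus ?thesis by (simp add: algebra_simps)
  qed
  finally show ?thesis by (simp add: b_def mult_ac)
 qed
 have "C >= 1" using P Q by (simp add: C_def)
 thus ?thesis using main by (intro exI[of _ C]) simp
qed


text \<open>Abel summation against \<open>1 / ln n ^ (2 * j)\<close> starts at the square root of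
  \<open>x\<close>, so that this weight is at most \<open>4 ^ j / ln x ^ (2 * j)\<close>; the terms
  below the square root are estimated trivially. Of the 2j logarithms, j + 1 pay for the sharp sum
  and j - 1 are saved.\<close>

lemma sum_bound_of_log_weighted:
 assumes j: "j >= 1"
 shows "\<exists>C\<ge>1. \<forall>a M. tame j a M --> (\<forall>x\<ge>3. norm (\<Sum>n=1..nat \<lfloor>x\<rfloor>. a n) <= C * M * x * ln x / ln x ^ j)"
proof -
 obtain C where C: "C >= 1" "!!a M x. tame j a M ==> x >= 3 ==> norm (\<Sum>n=1..nat \<lfloor>x\<rfloor>. log_weighted j a n) <= C * M * x * ln x ^ (j + 1)"
  using log_weighted_sum_bound[OF j] by blast
 define C' where "C' = 3 * 2 ^ j * fact j + 4 * C * 4 ^ j"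
 have main: "norm (\<Sum>n=1..nat \<lfloor>x\<rfloor>. a n) <= C' * M * x * ln x / ln x ^ j"
  if t: "tame j a M" and x: "x >= 3" for a M x
 proof -
  define b where "b = log_weighted j a"
  note b_n = log_weighted_def[of j a, folded b_def]
  from t have a: "\<forall>n\<ge>1. norm (a n) <= 1 + 2 * ln (real n)" and M: "M >= 1" and d: "dsum b"
   and B: "!!s. 1 < Re s ==> Re s <= 2 ==> norm (ds b s) <= M * (1 + norm s) powr (1/2)"
   by (auto simp: tame_def b_def)
  define N m where "N = nat \<lfloor>x\<rfloor>" and "m = Suc (nat \<lfloor>sqrt x\<rfloor>)"
  define w where "w n = 1 / ln (real n) ^ (2*j)" for n
  define U where "U = 4 * C * M * x * ln x ^ (j + 1)"
  have l: "ln x >= 1" using x ln3_gt_1 by (smt (verit) ln_le_cancel_iff)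
  have lp: "ln x ^ i >= 1" for i using l by simp
  have lj: "ln x ^ j ~= 0" using lp[of j] by linarith
  have xx: "3 * 1 * 1 <= C * M * x" 
  proof -
   have "1 * 1 * 3 <= C * M * x" using x M C(1) by (intro mult_mono) auto
   thus ?thesis by simp
  qed
  have CMx: "3 * 1 <= C * M * x * ln x ^ (j + 1)"
   by (rule mult_mono) (use xx lp[of "j+1"] in auto)
  have Bn: "norm (\<Sum>n=1..k. b n) <= 2 * C * M * x * ln x ^ (j + 1)" if k: "k <= N" for k
  proof (cases "k >= 3")
   case True
   have kx: "real k <= x" using k le_nat_floor_iff[of x k] x by (simp add: N_def)
   have "norm (\<Sum>n=1..nat \<lfloor>real k\<rfloor>. b n) <= C * M * real k * ln (real k) ^ (j + 1)"
    unfolding b_def by (rule C(2)[OF t]) (use True in simp)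
   also have "... <= C * M * x * ln x ^ (j + 1)"
    using kx True C(1) M by (intro mult_mono power_mono) auto
   finally show ?thesis using CMx by simp
  next
   case False
   have "norm (\<Sum>n=1..k. b n) <= (\<Sum>n=1..k. norm (b n))" by (rule norm_sum)
   also have "... <= (\<Sum>n\<in>{1..2}. norm (b n))" using False by (intro sum_mono2) auto
   also have "{1..2::nat} = {1,2}" by auto
   also have "(\<Sum>n\<in>{1,2}. norm (b n)) = norm (b 2)" using j by (simp add: b_n)
   also have "... = norm (a 2) * ln 2 ^ (2 * j)" by (simp add: b_n norm_mult norm_power)
   also have "... <= (1 + 2 * ln 2) * 1"
    using a[rule_format, of 2] ln2_le_25_over_36 by (intro mult_mono power_le_one) auto
   also have "... <= 3" using ln2_le_25_over_36 by simp
   finally show ?thesis using CMx by simp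
  qed
  have s1: "sqrt x >= 1" using x by simp
  have sx: "sqrt x <= x" using x s1 mult_left_mono[of 1 "sqrt x" "sqrt x"] by simp
  have m: "m >= 2" "real m > sqrt x" "real (m - 1) <= sqrt x"
   using s1 le_nat_floor_iff[of "sqrt x" 1] le_nat_floor_iff[of "sqrt x" m] le_nat_floor_iff[of "sqrt x" "m - 1"] by (auto simp: m_def)
  have mN: "m - 1 <= N" using m sx x le_nat_floor_iff[of x "m - 1"] by (simp add: N_def)
  have wm: "w m <= 4 ^ j / ln x ^ (2 * j)"
  proof -
   have "ln x / 2 = ln (sqrt x)" using x by (simp add: ln_sqrt)
   also have "... <= ln (real m)" using m(2) s1 x by (subst ln_le_cancel_iff) linarith+
   finally have "(ln x / 2) ^ (2 * j) <= ln (real m) ^ (2 * j)" using l by (intro power_mono) auto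
   hence "w m <= 1 / (ln x / 2) ^ (2 * j)" unfolding w_def using l by (intro frac_le) auto
   also have "... = 4 ^ j / ln x ^ (2 * j)" by (simp add: power_divide power_mult)
   finally show ?thesis .
  qed
  have head: "norm (\<Sum>n=1..m - 1. a n) <= 3 * 2 ^ j * fact j * (x * ln x / ln x ^ j)"
  proof -
   have "norm (\<Sum>n=1..m - 1. a n) <= (\<Sum>n=1..m - 1. norm (a n))" by (rule norm_sum)
   also have "... <= (\<Sum>n=1..m - 1. 3 * ln x)"
   proof (rule sum_mono)
    fix n assume n: "n \<in> {1..m - 1}"
    hence "real n <= real (m - 1)" by simp
    hence "real n <= x" using m sx by linarith
    hence "ln (real n) <= ln x" using n by simp
    thus "norm (a n) <= 3 * ln x" using a[rule_format, of n] n l by simp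
   qed
   also have "... = real (m - 1) * (3 * ln x)" by simp
   also have "... <= sqrt x * (3 * ln x)" using m l by (intro mult_right_mono) auto
   also have "... = 3 * ln x * (sqrt x * ln x ^ j) / ln x ^ j" using lj by simp
   also have "... <= 3 * ln x * (2 ^ j * fact j * x) / ln x ^ j"
    using sqrt_ln_power_le[of x j] x l by (intro divide_right_mono mult_left_mono) auto
   also have "... = 3 * 2 ^ j * fact j * (x * ln x / ln x ^ j)" by simp
   finally show ?thesis .
  qed
  have tail: "norm (\<Sum>n=m..N. a n) <= 4 * C * 4 ^ j * M * (x * ln x / ln x ^ j)"
  proof (cases "m <= N")
   case True
   have "norm (\<Sum>n=m..N. b n * of_real (w n)) <= U * w m"
   proof (rule abel_decreasing[OF True])
    fix k assume k: "m <= k" "k <= N"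
    have "(\<Sum>n=1..k. b n) = (\<Sum>n=1..m-1. b n) + (\<Sum>n=m..k. b n)"
    proof -
     have "{1..k} = {1..m-1} \<union> {m..k}" using k m by auto
     thus ?thesis using m by (simp only:) (rule sum.union_disjoint, auto)
    qed
    hence "(\<Sum>n=m..k. b n) = (\<Sum>n=1..k. b n) - (\<Sum>n=1..m-1. b n)" by simp
    hence "norm (\<Sum>n=m..k. b n) <= norm (\<Sum>n=1..k. b n) + norm (\<Sum>n=1..m-1. b n)"
     by (simp only: norm_triangle_ineq4)
    thus "norm (\<Sum>n=m..k. b n) <= U" using Bn[OF k(2)] Bn[OF mN] by (simp add: U_def)
   next
    fix k assume k: "m <= k" "k < N"
    thus "w (Suc k) <= w k" unfolding w_def using m by (intro frac_le power_mono zero_less_power) auto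
   qed (simp add: w_def)
   also have "(\<Sum>n=m..N. b n * of_real (w n)) = (\<Sum>n=m..N. a n)"
   proof (rule sum.cong)
    fix n assume "n \<in> {m..N}"
    hence "ln (real n) > 0" using m by simp
    hence "ln (real n) ^ (2 * j) * w n = 1" by (simp add: w_def)
    hence "of_real (ln (real n)) ^ (2 * j) * of_real (w n) = (1::complex)" by (metis of_real_1 of_real_mult of_real_power)
    thus "b n * of_real (w n) = a n" by (simp add: b_n mult.assoc)
   qed simp
   also have "U * w m <= U * (4 ^ j / ln x ^ (2 * j))"
    using wm CMx by (intro mult_left_mono) (auto simp: U_def)
   also have "... = 4 * C * 4 ^ j * M * (x * ln x * (ln x ^ j / ln x ^ (2 * j)))" by (simp add: U_def)
   also have "ln x ^ j / ln x ^ (2 * j) = 1 / ln x ^ j" using lj by (simp add: mult_2 power_add)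
   finally show ?thesis using C(1) M x l by (simp add: mult_ac)
  next
   case False
   thus ?thesis using C(1) M x l by simp
  qed
  have "{1..N} = {1..m-1} \<union> {m..N}" using mN m by auto
  hence "(\<Sum>n=1..N. a n) = (\<Sum>n=1..m-1. a n) + (\<Sum>n=m..N. a n)"
   using m by (simp only:) (rule sum.union_disjoint, auto)
  hence "norm (\<Sum>n=1..N. a n) <= 3 * 2 ^ j * fact j * (x * ln x / ln x ^ j) + 4 * C * 4 ^ j * M * (x * ln x / ln x ^ j)"
   using norm_triangle_mono[OF head tail] by simp
  also have "... <= 3 * 2 ^ j * fact j * M * (x * ln x / ln x ^ j) + 4 * C * 4 ^ j * M * (x * ln x / ln x ^ j)"
   using M x l by (intro add_right_mono mult_right_mono) auto
  also have "... = (3 * 2 ^ j * fact j + 4 * C * 4 ^ j) * M * (x * ln x / ln x ^ j)" by (simp only: distrib_right)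
  also have "... = C' * M * x * ln x / ln x ^ j" by (simp add: C'_def)
  finally show ?thesis by (simp add: N_def)
 qed
 have "C' >= 1" 
 proof -
  have "4 * 1 * 1 <= 4 * C * 4 ^ j" using C(1) by (intro mult_mono) auto
  moreover have "0 <= 3 * 2 ^ j * (fact j :: real)" by simp
  ultimately show ?thesis unfolding C'_def by linarith
 qed
 thus ?thesis using main by (intro exI[of _ C']) simp
qed

section \<open>Primes congruent to 1 modulo d\<close>

lemma psi_character_bound:
 assumes j: "j >= 1"
 shows "\<exists>C\<ge>1. \<forall>q X N. dchar q X --> X ~= dprin q --> N >= 3 -->
   norm (\<Sum>n=1..N. mangoldt n * X n) <= C * real q * (real N * ln (real N) / ln (real N) ^ j)"
proof -
 obtain C1 where C1: "C1 >= 1" "!!a M. tame j a M ==> (\<forall>x\<ge>3. norm (\<Sum>n=1..nat \<lfloor>x\<rfloor>. a n) <= C1 * M * x * ln x / ln x ^ j)"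
  using sum_bound_of_log_weighted[OF j] by blast
 obtain C2 where C2: "C2 >= 1" "!!q X s. dchar q X ==> X ~= dprin q ==> 1 < Re s ==> Re s <= 2 ==>
   norm (ds (%n. mangoldt n * X n * of_real (ln (real n)) ^ (2 * j)) s) <= C2 * (real q * (1 + norm s)) powr (1/2)"
  using log_deriv_nonprincipal[of "1/2" "2 * j"] by force
 have "norm (\<Sum>n=1..N. mangoldt n * X n) <= C1 * C2 * real q * (real N * ln (real N) / ln (real N) ^ j)"
  if X: "dchar q X" "X ~= dprin q" and N: "N >= 3" for q X N
 proof -
  have q: "real q >= 1" using dcharD(1)[OF X(1)] by simp
  have n: "norm (X n) <= 1" for n by (rule dchar_norm_le[OF X(1)])
  have 1: "\<forall>n\<ge>1. norm (mangoldt n * X n) <= 1 + 2 * ln (real n)"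
  proof (intro allI impI)
   fix k :: nat assume k: "k >= 1"
   have "norm (mangoldt k * X k) <= mangoldt k * 1"
    unfolding norm_mult using n mangoldt_nonneg by (intro mult_mono) auto
   also have "... <= 1 * ln (real k)" using mangoldt_le[of k] k by simp
   also have "... <= 1 + 2 * ln (real k)" using k by simp
   finally show "norm (mangoldt k * X k) <= 1 + 2 * ln (real k)" .
  qed
  have "dsum (%n. mangoldt n * X n)" by (rule dsum_mangoldt[of X, OF n])
  hence 2: "dsum (%n. mangoldt n * X n * of_real (ln (real n)) ^ (2*j))" by (rule dsum_ln_power)
  have 3: "\<forall>s. 1 < Re s --> Re s <= 2 --> norm (ds (%n. mangoldt n * X n * of_real (ln (real n)) ^ (2*j)) s) <= (C2 * real q) * (1 + norm s) powr (1/2)"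
  proof (intro allI impI)
   fix s assume s: "1 < Re s" "Re s <= 2"
   have "norm (ds (%n. mangoldt n * X n * of_real (ln (real n)) ^ (2*j)) s) <= C2 * (real q * (1 + norm s)) powr (1/2)"
    by (rule C2(2)[OF X s])
   also have "... = C2 * (real q powr (1/2) * (1 + norm s) powr (1/2))" using powr_mult[of "real q" "1 + norm s" "1/2"] q by simp
   also have "... <= C2 * (real q powr 1 * (1 + norm s) powr (1/2))"
    using q C2(1) by (intro mult_left_mono mult_right_mono powr_mono) auto
   finally show "norm (ds (%n. mangoldt n * X n * of_real (ln (real n)) ^ (2*j)) s) <= (C2 * real q) * (1 + norm s) powr (1/2)"
    using q by (simp add: mult.assoc)
  qed
  have "1 * 1 <= C2 * real q" using C2(1) q by (intro mult_mono) auto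
  hence M: "C2 * real q >= 1" by simp
  have t: "tame j (%n. mangoldt n * X n) (C2 * real q)"
   using 1 M 2 3 by (simp add: tame_def log_weighted_def[abs_def])
  show ?thesis using C1(2)[OF t, rule_format, of "real N"] N by (simp add: mult.assoc)
 qed
 moreover have "C1 * C2 >= 1" using C1(1) C2(1) mult_mono[of 1 C1 1 C2] by simp
 ultimately show ?thesis by (intro exI[of _ "C1 * C2"]) simp
qed

lemma psi_bound:
 assumes j: "j >= 1"
 shows "\<exists>C\<ge>1. \<forall>N\<ge>3. norm (\<Sum>n=1..N. mangoldt n - 1 :: complex) <= C * (real N * ln (real N) / ln (real N) ^ j)"
proof -
 obtain C1 where C1: "C1 >= 1" "!!a M. tame j a M ==> (\<forall>x\<ge>3. norm (\<Sum>n=1..nat \<lfloor>x\<rfloor>. a n) <= C1 * M * x * ln x / ln x ^ j)"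
  using sum_bound_of_log_weighted[OF j] by blast
 obtain C2 where C2: "C2 >= 1" "\<forall>s. 1 < Re s --> Re s <= 2 -->
   norm (ds (%n. (mangoldt n - 1) * of_real (ln (real n)) ^ (2 * j)) s) <= C2 * (1 + norm s) powr (1/2)"
  using log_deriv_zeta[of "1/2" "2 * j"] by force
 have 1: "\<forall>n\<ge>1. norm (mangoldt n - 1 :: complex) <= 1 + 2 * ln (real n)"
 proof (intro allI impI)
  fix k :: nat assume k: "k >= 1"
  have "norm (mangoldt k - 1 :: complex) <= norm (mangoldt k :: complex) + norm (1 :: complex)" by (rule norm_triangle_ineq4)
  also have "... <= ln (real k) + 1" using mangoldt_le[of k] k by simp
  also have "... <= 1 + 2 * ln (real k)" using k by simp
  finally show "norm (mangoldt k - 1 :: complex) <= 1 + 2 * ln (real k)" .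
 qed
 have dm: "dsum (%n. mangoldt n * 1)" by (rule dsum_mangoldt) simp
 have "dsum (%n. mangoldt n * 1 + (-1) * 1)" by (intro dsum_add dm dsum_cmult dsum_1)
 hence "dsum (%n. mangoldt n - 1)" by simp
 hence 2: "dsum (%n. (mangoldt n - 1) * of_real (ln (real n)) ^ (2*j))" by (rule dsum_ln_power)
 have "norm (\<Sum>n=1..N. mangoldt n - 1 :: complex) <= (C1 * C2) * (real N * ln (real N) / ln (real N) ^ j)" if "N >= 3" for N
 proof -
  have t: "tame j (%n. mangoldt n - 1) C2"
   using 1 C2 2 by (simp add: tame_def log_weighted_def[abs_def])
  show ?thesis using C1(2)[OF t, rule_format, of "real N"] that by (simp add: mult.assoc)
 qed
 moreover have "C1 * C2 >= 1" using C1(1) C2(1) mult_mono[of 1 C1 1 C2] by simp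
 ultimately show ?thesis by (intro exI[of _ "C1 * C2"]) simp
qed

text \<open>A base admits at most 2 ln N + 1 exponents. This disposes of the prime powers not
  coprime to the modulus, with bases up to \<open>q\<close>, and of the proper prime powers, with
  bases up to the square root of \<open>N\<close>.\<close>

lemma mangoldt_sum_prime_powers_le:
 assumes T: "T \<subseteq> {1..N}" and S: "finite S" and N: "N >= 1"
  and TS: "!!n. n \<in> T ==> \<exists>p k. p \<in> S \<and> prime p \<and> n = p ^ k"
 shows "(\<Sum>n\<in>T. mangoldt n :: real) <= real (card S) * (2 * ln (real N) + 1) * ln (real N)"
proof -
 define K where "K = nat \<lfloor>2 * ln (real N)\<rfloor>"
 have l: "ln (real N) >= 0" using N by simp
 have "T \<subseteq> (%(p, k). p ^ k) ` (S \<times> {0..K})"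
 proof
  fix n assume n: "n \<in> T"
  from TS[OF n] obtain p k where pk: "p \<in> S" "prime p" "n = p ^ k" by blast
  have "2 ^ k <= p ^ k" using pk(2) by (intro power_mono prime_ge_2_nat) auto
  also have "... <= N" using T n pk by auto
  finally have "real (2 ^ k) <= real N" by (simp only: of_nat_le_iff)
  hence "ln (real (2 ^ k)) <= ln (real N)" by (subst ln_le_cancel_iff) (use N in auto)
  hence "real k * ln 2 <= ln (real N)" by (simp add: ln_realpow)
  moreover have "real k * (1/2) <= real k * ln 2" using ln2_ge_two_thirds by (intro mult_left_mono) auto
  ultimately have "real k <= 2 * ln (real N)" by simp
  hence "k <= K" using le_nat_floor_iff[of "2 * ln (real N)" k] l by (simp add: K_def)
  thus "n \<in> (%(p, k). p ^ k) ` (S \<times> {0..K})" using pk by (intro image_eqI[of _ _ "(p,k)"]) auto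
 qed
 hence "card T <= card ((%(p, k). p ^ k) ` (S \<times> {0..K}))" using S by (intro card_mono) auto
 also have "... <= card (S \<times> {0..K})" by (intro card_image_le) (use S in auto)
 also have "... = card S * (K + 1)" by (simp add: card_cartesian_product)
 finally have "real (card T) <= real (card S * (K + 1))" by (simp only: of_nat_le_iff)
 hence c: "real (card T) <= real (card S) * (real K + 1)" by (simp add: distrib_left)
 have "real K <= 2 * ln (real N)" using le_nat_floor_iff[of "2 * ln (real N)" K] l by (simp add: K_def)
 hence "real (card S) * (real K + 1) <= real (card S) * (2 * ln (real N) + 1)" by (intro mult_left_mono) auto
 with c have c: "real (card T) <= real (card S) * (2 * ln (real N) + 1)" by (rule order_trans)
 have "(\<Sum>n\<in>T. mangoldt n :: real) <= (\<Sum>n\<in>T. ln (real N))"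
 proof (rule sum_mono)
  fix n assume "n \<in> T"
  hence n: "n >= 1" "n <= N" using T by auto
  have "mangoldt n <= ln (real n)" using n by (intro mangoldt_le) auto
  also have "... <= ln (real N)" using n by simp
  finally show "mangoldt n <= ln (real N)" .
 qed
 also have "... = real (card T) * ln (real N)" by simp
 also have "... <= real (card S) * (2 * ln (real N) + 1) * ln (real N)" by (rule mult_right_mono[OF c l])
 finally show ?thesis .
qed

text \<open>The Siegel-Walfisz theorem for the residue class 1, by orthogonality of characters. The
  bounds for the character sums are linear in \<open>q\<close>, which is harmless as
  \<open>q\<close> is at most a power of the logarithm.\<close>

lemma theta_arith_progression:
 fixes A B :: nat
 shows "\<exists>K\<ge>0. \<forall>N\<ge>3. \<forall>q\<ge>1. real q <= ln (real N) ^ B -->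
  \<bar>(\<Sum>p | prime p \<and> p <= N \<and> [p = 1] (mod q). ln (real p)) - real N / real (totient q)\<bar> <= K * (real N / ln (real N) ^ A)"
proof -
 \<comment> \<open>\<open>B\<close> logarithms pay for the factor \<open>q\<close>, one for the
   logarithm in the bound, and one is to spare.\<close>
 define j where "j = A + B + 2"
 have j: "j >= 1" by (simp add: j_def)
 obtain C1 where C1: "C1 >= 1" "!!q X N. dchar q X ==> X ~= dprin q ==> N >= 3 ==>
   norm (\<Sum>n=1..N. mangoldt n * X n) <= C1 * real q * (real N * ln (real N) / ln (real N) ^ j)"
  using psi_character_bound[OF j] by blast
 obtain C2 where C2: "C2 >= 1" "!!N. N >= 3 ==> norm (\<Sum>n=1..N. mangoldt n - 1 :: complex) <= C2 * (real N * ln (real N) / ln (real N) ^ j)"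
  using psi_bound[OF j] by blast
 define K where "K = C1 + C2 + 3 * fact (A + B + 2) + 3 * (2 ^ (A + 2) * fact (A + 2))"
 have main: "\<bar>(\<Sum>p | prime p \<and> p <= N \<and> [p = 1] (mod q). ln (real p)) - real N / real (totient q)\<bar> <= K * (real N / ln (real N) ^ A)"
  if N: "N >= 3" and q: "q >= 1" and qB: "real q <= ln (real N) ^ B" for N q
 proof -
  define L where "L = ln (real N)"
  have L: "L >= 1" using N ln3_gt_1 ln_le_cancel_iff[of 3 "real N"] unfolding L_def by linarith
  have Lp: "L ^ i > 0" for i using L by simp
  have phi: "totient q > 0" using q by simp
  have q0: "q > 0" using q by simp
  define R where "R = real N / L ^ A"
  have R0: "R >= 0" using L by (simp add: R_def)
  define S where "S X = (\<Sum>n=1..N. mangoldt n * X n)" for X :: "nat => complex"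
  define D where "D = {X. dchar q X}"
  have finD: "finite D" unfolding D_def by (rule finite_dchars)
  have "(\<Sum>X\<in>D. X 1) = of_nat (totient q)" unfolding D_def using dchar_orthogonality[OF q0, of 1] by simp
  moreover have "(\<Sum>X\<in>D. X 1) = (\<Sum>X\<in>D. 1)" by (intro sum.cong) (auto simp: D_def)
  ultimately have "of_nat (card D) = (of_nat (totient q) :: complex)" by simp
  hence cD: "card D = totient q" by (simp only: of_nat_eq_iff)
  have pD: "dprin q \<in> D" by (simp add: D_def dchar_prin q0)
  have sw: "(\<Sum>X\<in>D. S X) = of_real (real (totient q) * (\<Sum>n\<in>{n\<in>{1..N}. [n = 1] (mod q)}. mangoldt n))"
  proof -
   have "(\<Sum>X\<in>D. S X) = (\<Sum>n=1..N. mangoldt n * (\<Sum>X\<in>D. X n))"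
    unfolding S_def sum_distrib_left by (rule sum.swap)
   also have "... = (\<Sum>n=1..N. if [n = 1] (mod q) then of_nat (totient q) * mangoldt n else 0)"
    unfolding D_def dchar_orthogonality[OF q0] by (intro sum.cong) auto
   also have "... = (\<Sum>n\<in>{n\<in>{1..N}. [n = 1] (mod q)}. of_nat (totient q) * mangoldt n)"
    by (rule sum.inter_filter[symmetric]) simp
   also have "... = of_real (real (totient q) * (\<Sum>n\<in>{n\<in>{1..N}. [n = 1] (mod q)}. mangoldt n))"
    by (simp add: sum_distrib_left)
   finally show ?thesis .
  qed
  define T where "T = {n\<in>{1..N}. \<not> coprime n q \<and> primepow n}"
  have prin: "norm (S (dprin q) - of_nat N) <= C2 * (real N * L / L ^ j) + 3 * (real q * L ^ 2)"
  proof -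
   have "(\<Sum>n\<in>T. mangoldt n :: real) <= real (card {1..q}) * (2 * L + 1) * L"
    unfolding L_def
   proof (rule mangoldt_sum_prime_powers_le)
    fix n assume "n \<in> T"
    hence n: "\<not> coprime n q" "primepow n" by (auto simp: T_def)
    then obtain p k where pk: "prime p" "n = p ^ k" by (auto simp: primepow_def)
    have "p dvd q" using n(1) pk prime_imp_coprime[of p q] by (auto simp: coprime_power_left_iff)
    hence "p \<in> {1..q}" using pk(1) q0 by (auto simp: dvd_imp_le prime_gt_0_nat Suc_le_eq)
    thus "\<exists>p k. p \<in> {1..q} \<and> prime p \<and> n = p ^ k" using pk by blast
   qed (use N in \<open>auto simp: T_def\<close>)
   also have "... <= real q * (3 * L) * L" unfolding card_atLeastAtMost using L by (intro mult_right_mono mult_mono) auto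
   finally have T: "(\<Sum>n\<in>T. mangoldt n :: real) <= 3 * (real q * L ^ 2)" by (simp add: power2_eq_square mult_ac)
   have "S (dprin q) = (\<Sum>n=1..N. mangoldt n - (if n \<in> T then mangoldt n else 0))"
    unfolding S_def by (intro sum.cong) (auto simp: dprin_def T_def mangoldt_def)
   also have "... = (\<Sum>n=1..N. mangoldt n) - (\<Sum>n\<in>T. mangoldt n)"
    by (simp add: sum_subtractf T_def flip: sum.inter_filter)
   finally have "S (dprin q) - of_nat N = (\<Sum>n=1..N. mangoldt n - 1) - of_real (\<Sum>n\<in>T. mangoldt n)"
    by (simp add: sum_subtractf)
   hence "norm (S (dprin q) - of_nat N) <= norm (\<Sum>n=1..N. mangoldt n - 1 :: complex) + norm (complex_of_real (\<Sum>n\<in>T. mangoldt n))"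
    by (simp only: norm_triangle_ineq4)
   moreover have "norm (complex_of_real (\<Sum>n\<in>T. mangoldt n)) = (\<Sum>n\<in>T. mangoldt n)"
    unfolding norm_of_real by (intro abs_of_nonneg sum_nonneg mangoldt_nonneg)
   ultimately show ?thesis using C2(2)[OF N] T by (simp add: L_def)
  qed
  define P where "P = (\<Sum>n\<in>{n\<in>{1..N}. [n = 1] (mod q)}. mangoldt n :: real)"
  define t where "t = real (totient q)"
  have t: "t >= 1" using phi by (simp add: t_def Suc_le_eq)
  have "complex_of_real (t * P - real N) = (\<Sum>X\<in>D. S X) - of_nat N" by (simp add: sw P_def t_def)
  also have "... = (\<Sum>X\<in>D - {dprin q}. S X) + (S (dprin q) - of_nat N)"
   using sum.remove[OF finD pD, of S] by simp
  finally have "norm (complex_of_real (t * P - real N)) <= norm (\<Sum>X\<in>D - {dprin q}. S X) + norm (S (dprin q) - of_nat N)"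
   by (simp only: norm_triangle_ineq)
  also have "norm (\<Sum>X\<in>D - {dprin q}. S X) <= (\<Sum>X\<in>D - {dprin q}. C1 * real q * (real N * L / L ^ j))"
   unfolding S_def L_def by (intro order_trans[OF norm_sum] sum_mono C1(2)[OF _ _ N]) (auto simp: D_def)
  also have "... = real (card (D - {dprin q})) * (C1 * real q * (real N * L / L ^ j))" by simp
  also have "... <= t * (C1 * real q * (real N * L / L ^ j))"
  proof (rule mult_right_mono)
   have "card (D - {dprin q}) <= card D" by (intro card_mono finD) auto
   thus "real (card (D - {dprin q})) <= t" by (simp add: t_def cD)
  qed (use C1(1) L in auto)
  also have "norm (S (dprin q) - of_nat N) <= t * (C2 * (real N * L / L ^ j) + 3 * (real q * L ^ 2))"
   using t prin C2(1) L mult_right_mono[of 1 t "C2 * (real N * L / L ^ j) + 3 * (real q * L ^ 2)"] by simp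
  finally have "\<bar>t * P - real N\<bar> <= t * (C1 * real q * (real N * L / L ^ j) + (C2 * (real N * L / L ^ j) + 3 * (real q * L ^ 2)))"
   by (simp add: distrib_left del: of_real_diff)
  moreover have "\<bar>t * P - real N\<bar> = t * \<bar>P - real N / t\<bar>" 
  proof -
   have "t * P - real N = t * (P - real N / t)" using t by (simp add: right_diff_distrib)
   thus ?thesis using t by (simp add: abs_mult)
  qed
  ultimately have "\<bar>P - real N / t\<bar> <= C1 * real q * (real N * L / L ^ j) + (C2 * (real N * L / L ^ j) + 3 * (real q * L ^ 2))"
   using t by simp
  also have "C1 * real q * (real N * L / L ^ j) <= C1 * R"
  proof -
   have "real q * (real N * L / L ^ j) <= L ^ B * (real N * L / L ^ j)" using qB L by (intro mult_right_mono) (auto simp: L_def)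
   also have "... = real N / (L ^ A * L)" using L by (simp add: j_def power_add power2_eq_square)
   also have "... <= R" unfolding R_def using L by (intro frac_le) auto
   finally have "C1 * (real q * (real N * L / L ^ j)) <= C1 * R" using C1(1) by (intro mult_left_mono) auto
   thus ?thesis by (simp only: mult.assoc)
  qed
  also have "C2 * (real N * L / L ^ j) <= C2 * R"
  proof -
   have "real N * L / L ^ j = real N / (L ^ A * L ^ (B + 1))" using L by (simp add: j_def power_add power2_eq_square)
   also have "... <= real N / (L ^ A * 1)" using L Lp by (intro frac_le mult_left_mono one_le_power) auto
   finally show ?thesis using C2(1) by (intro mult_left_mono) (auto simp: R_def)
  qed
  also have "3 * (real q * L ^ 2) <= 3 * fact (A + B + 2) * R"
  proof -
   have "L ^ A * (real q * L ^ 2) <= L ^ A * (L ^ B * L ^ 2)" using qB L by (intro mult_left_mono mult_right_mono) (auto simp: L_def)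
   also have "... = L ^ (A + B + 2)" by (simp only: power_add mult.assoc)
   also have "... <= fact (A + B + 2) * real N" unfolding L_def using N by (intro ln_power_le) auto
   finally have "real q * L ^ 2 <= fact (A + B + 2) * R" using Lp[of A] by (simp add: R_def field_simps)
   thus ?thesis by simp
  qed
  finally have PN: "\<bar>P - real N / t\<bar> <= C1 * R + (C2 * R + 3 * fact (A + B + 2) * R)" by simp
  define Q where "Q = {p. prime p \<and> p <= N \<and> [p = 1] (mod q)}"
  define U where "U = {n\<in>{1..N}. primepow n \<and> \<not> prime n \<and> [n = 1] (mod q)}"
  have QU: "P = (\<Sum>p\<in>Q. ln (real p)) + (\<Sum>n\<in>U. mangoldt n)"
  proof -
   have QN: "Q \<subseteq> {1..N}" using prime_ge_1_nat by (auto simp: Q_def)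
   hence fQ: "finite Q" by (rule finite_subset) simp
   have "P = (\<Sum>n\<in>Q \<union> U. mangoldt n)"
    unfolding P_def
   proof (rule sum.mono_neutral_right)
    show "Q \<union> U \<subseteq> {n \<in> {1..N}. [n = 1] (mod q)}" using QN by (auto simp: Q_def U_def)
    show "\<forall>i\<in>{n \<in> {1..N}. [n = 1] (mod q)} - (Q \<union> U). mangoldt i = (0::real)"
     by (auto simp: Q_def U_def mangoldt_def)
   qed simp
   also have "... = (\<Sum>n\<in>Q. mangoldt n) + (\<Sum>n\<in>U. mangoldt n)"
    by (rule sum.union_disjoint) (use fQ in \<open>auto simp: Q_def U_def\<close>)
   also have "(\<Sum>n\<in>Q. mangoldt n :: real) = (\<Sum>p\<in>Q. ln (real p))"
    by (intro sum.cong) (auto simp: Q_def)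
   finally show ?thesis .
  qed
  have U: "\<bar>\<Sum>n\<in>U. mangoldt n :: real\<bar> <= 3 * (2 ^ (A + 2) * fact (A + 2)) * R"
  proof -
   define s where "s = nat \<lfloor>sqrt (real N)\<rfloor>"
   have sN: "real s <= sqrt (real N)" using le_nat_floor_iff[of "sqrt (real N)" s] by (simp add: s_def)
   have "\<bar>\<Sum>n\<in>U. mangoldt n :: real\<bar> = (\<Sum>n\<in>U. mangoldt n)" by (intro abs_of_nonneg sum_nonneg mangoldt_nonneg)
   also have "... <= real (card {1..s}) * (2 * L + 1) * L"
    unfolding L_def
   proof (rule mangoldt_sum_prime_powers_le)
    fix n assume "n \<in> U"
    hence n: "n <= N" "primepow n" "\<not> prime n" by (auto simp: U_def)
    then obtain p k where pk: "prime p" "n = p ^ k" "k > 0" by (auto simp: primepow_def)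
    have "k ~= 1" using n pk by auto
    hence "k >= 2" using pk(3) by simp
    hence "p ^ 2 <= n" unfolding pk(2) using prime_gt_0_nat[OF pk(1)] by (intro power_increasing) auto
    hence "real (p ^ 2) <= real N" using n(1) by (simp only: of_nat_le_iff)
    hence "real p <= sqrt (real N)" by (simp add: real_le_rsqrt)
    hence "p <= s" using le_nat_floor_iff[of "sqrt (real N)" p] by (simp add: s_def)
    thus "\<exists>p k. p \<in> {1..s} \<and> prime p \<and> n = p ^ k" using pk prime_gt_0_nat[OF pk(1)] by (intro exI[of _ p] exI[of _ k]) auto
   qed (use N in \<open>auto simp: U_def\<close>)
   also have "... <= sqrt (real N) * (3 * L) * L" using L sN by (intro mult_right_mono mult_mono) auto
   also have "... = 3 * (sqrt (real N) * L ^ (A + 2) / L ^ A)" using Lp[of A] L by (simp add: power_add power2_eq_square)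
   also have "... <= 3 * ((2 ^ (A + 2) * fact (A + 2) * real N) / L ^ A)"
    unfolding L_def using N L by (intro mult_left_mono divide_right_mono sqrt_ln_power_le) (auto simp: L_def)
   finally show ?thesis by (simp add: R_def)
  qed
  have "\<bar>(\<Sum>p\<in>Q. ln (real p)) - real N / t\<bar> <= \<bar>P - real N / t\<bar> + \<bar>\<Sum>n\<in>U. mangoldt n :: real\<bar>"
   unfolding QU by simp
  also have "... <= K * R" using add_mono[OF PN U] by (simp add: K_def distrib_right)
  finally show ?thesis by (simp add: Q_def t_def R_def L_def)
 qed
 have "K >= 0" using C1 C2 by (simp add: K_def)
 thus ?thesis using main by (intro exI[of _ K]) simp
qed

section \<open>The mean value\<close>

definition h0 :: "nat => real" where
 "h0 n = (\<Prod>p\<in>prime_factors n. 1 - real p) / real n"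

lemma h0_0 [simp]: "h0 0 = 0" by (simp add: h0_def)

lemma h0_1 [simp]: "h0 (Suc 0) = 1" by (simp add: h0_def)

lemma h0_mult_prime:
 assumes p: "prime p"
 shows "h0 (p * n) = (if p dvd n then 1 / real p else (1 - real p) / real p) * h0 n"
proof (cases "n = 0")
 case False
 have pf: "prime_factors (p * n) = insert p (prime_factors n)"
  using p False by (subst prime_factors_product) (auto simp: prime_prime_factors)
 show ?thesis
 proof (cases "p dvd n")
  case True
  hence "insert p (prime_factors n) = prime_factors n" using p False by (auto simp: prime_factors_dvd)
  thus ?thesis using True by (simp add: h0_def pf)
 next
  case nd: False
  hence "p \<notin> prime_factors n" by (auto simp: prime_factors_dvd)
  thus ?thesis using nd by (simp add: h0_def pf)
 qed
qed simp

lemma prime_mult_cases: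
 assumes "n > (1::nat)"
 obtains p m where "prime p" "n = p * m" "m > 0" "m < n"
proof -
 obtain p where p: "prime p" "p dvd n" using assms prime_factor_nat[of n] by auto
 then obtain m where m: "n = p * m" by (auto elim: dvdE)
 have "m > 0" using assms m by (cases m) auto
 moreover have "m < n" using m prime_gt_1_nat[OF p(1)] \<open>m > 0\<close> by simp
 ultimately show ?thesis using that p(1) m by blast
qed

lemma abs_h0_le: "\<bar>h0 n\<bar> <= 1"
proof (induction n rule: less_induct)
 case (less n)
 show ?case
 proof (cases "n > 1")
  case True
  then obtain p m where p: "prime p" "n = p * m" "m > 0" "m < n" by (rule prime_mult_cases)
  have "real p > 1" using prime_gt_1_nat[OF p(1)] by simp
  hence "\<bar>if p dvd m then 1 / real p else (1 - real p) / real p\<bar> <= 1" by auto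
  hence "\<bar>if p dvd m then 1 / real p else (1 - real p) / real p\<bar> * \<bar>h0 m\<bar> <= 1 * 1"
   using less.IH[OF p(4)] by (intro mult_mono) auto
  thus ?thesis unfolding p(2) h0_mult_prime[OF p(1)] abs_mult by simp
 next
  case False
  hence "n = 0 \<or> n = Suc 0" by auto
  thus ?thesis by auto
 qed
qed

lemma h0_prime_power_mult:
 assumes p: "prime p" "\<not> p dvd e"
 shows "h0 (p ^ i * e) = (if i = 0 then 1 else (1 - real p) / real p ^ i) * h0 e"
proof (induction i)
 case (Suc i)
 have p0: "real p > 0" using prime_gt_0_nat[OF p(1)] by simp
 have "h0 (p ^ Suc i * e) = h0 (p * (p ^ i * e))" by (simp add: mult.assoc)
 also have "... = (if i = 0 then (1 - real p) / real p else 1 / real p) * h0 (p ^ i * e)"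
  unfolding h0_mult_prime[OF p(1)] using p by (cases i) auto
 also have "... = (if Suc i = 0 then 1 else (1 - real p) / real p ^ Suc i) * h0 e"
  unfolding Suc using p0 by (cases "i = 0") auto
 finally show ?case .
qed simp

text \<open>Multiplicativity reduces this to prime powers, where the sum of 1 and of (1 - p)/p^i for
  i <= k telescopes to 1/p^k.\<close>

lemma sum_divisors_h0:
 assumes "m > 0"
 shows "(\<Sum>d | d dvd m. h0 d) = 1 / real m"
 using assms
proof (induction m rule: less_induct)
 case (less m)
 show ?case
 proof (cases "m > 1")
  case True
  then obtain p k e where p: "prime p" "k > 0" "\<not> p dvd e" "m = p ^ k * e" "e > 0" "e < m"
   by (rule prime_power_cases)
  have p0: "real p > 0" using prime_gt_0_nat[OF p(1)] by simp
  have co: "coprime (p ^ k) e" using p by (simp add: prime_imp_coprime)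
  have "(\<Sum>d | d dvd m. h0 d) = (\<Sum>d | d dvd p ^ k. \<Sum>c | c dvd e. h0 (d * c))"
   unfolding p(4) using p(5) prime_gt_0_nat[OF p(1)] by (intro sum_divisors_coprime co) auto
  also have "... = (\<Sum>i\<le>k. \<Sum>c | c dvd e. h0 (p ^ i * c))" by (rule sum_divisors_prime_power[OF p(1)])
  also have "... = (\<Sum>i\<le>k. \<Sum>c | c dvd e. (if i = 0 then 1 else (1 - real p) / real p ^ i) * h0 c)"
  proof (intro sum.cong refl)
   fix i c assume "c \<in> {c. c dvd e}"
   hence "\<not> p dvd c" using p(3) by (auto dest: dvd_trans)
   thus "h0 (p ^ i * c) = (if i = 0 then 1 else (1 - real p) / real p ^ i) * h0 c"
    by (rule h0_prime_power_mult[OF p(1)])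
  qed
  also have "... = (\<Sum>i\<le>k. if i = 0 then 1 else (1 - real p) / real p ^ i) * (1 / real e)"
   unfolding sum_distrib_left[symmetric] less.IH[OF p(6) p(5)] by (simp only: sum_distrib_right)
  also have "(\<Sum>i\<le>k. if i = 0 then 1 else (1 - real p) / real p ^ i) = 1 / real p ^ k"
  proof (induction k)
   case (Suc k)
   thus ?case using p0 by (simp add: field_simps)
  qed simp
  also have "1 / real p ^ k * (1 / real e) = 1 / real m" by (simp add: p(4))
  finally show ?thesis .
 next
  case False
  hence "m = 1" using less.prems by simp
  thus ?thesis by simp
 qed
qed

section \<open>Stephens' constant as a series\<close>

definition mean_ord :: "nat => real" where
 "mean_ord n = (\<Sum>d | d dvd n. h0 d / real d)"

text \<open>The weight \<open>h0 d / d\<close> of the modulus in \<open>mean_ord\<close>, times the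
  density 1/totient(d) of the primes congruent to 1 modulo d.\<close>

definition kd :: "nat => real" where
 "kd n = h0 n / (real n * real (totient n))"

lemma kd_mult_prime:
 assumes p: "prime p"
 shows "kd (p * n) = (if p dvd n then 1 / real p ^ 3 else - 1 / real p ^ 2) * kd n"
proof -
 have p1: "real p > 1" using prime_gt_1_nat[OF p] by simp
 show ?thesis
 proof (cases "p dvd n")
  case True
  have "totient (p * n) = p * totient n"
   using True p totient_mult[of p n] prime_gt_0_nat[OF p] by (simp add: gcd_nat.absorb1 mult.assoc)
  thus ?thesis using True by (simp add: kd_def h0_mult_prime[OF p] power3_eq_cube)
 next
  case False
  have "totient (p * n) = (p - 1) * totient n"
   using False p by (subst totient_mult_coprime) (auto simp: prime_imp_coprime totient_prime)
  hence t: "real (totient (p * n)) = (real p - 1) * real (totient n)"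
   using p1 by (simp add: of_nat_diff)
  have "(1 - real p) / real p * h0 n / (real (p * n) * ((real p - 1) * real (totient n))) = - 1 / real p ^ 2 * (h0 n / (real n * real (totient n)))"
   using p1 by (cases "n = 0 \<or> totient n = 0") (auto simp: field_simps power2_eq_square)
  thus ?thesis using False by (simp add: kd_def h0_mult_prime[OF p] t)
 qed
qed

lemma kd_1 [simp]: "kd (Suc 0) = 1" by (simp add: kd_def)
lemma kd_0 [simp]: "kd 0 = 0" by (simp add: kd_def)

lemma abs_kd_le: "\<bar>kd n\<bar> <= 1 / real n ^ 2"
proof (induction n rule: less_induct)
 case (less n)
 show ?case
 proof (cases "n > 1")
  case True
  then obtain p m where p: "prime p" "n = p * m" "m > 0" "m < n" by (rule prime_mult_cases)
  have p1: "real p > 1" using prime_gt_1_nat[OF p(1)] by simp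
  have "1 / real p ^ 3 <= 1 / real p ^ 2" using p1 by (intro frac_le power_increasing) auto
  hence "\<bar>if p dvd m then 1 / real p ^ 3 else - 1 / real p ^ 2\<bar> <= 1 / real p ^ 2" by auto
  hence "\<bar>if p dvd m then 1 / real p ^ 3 else - 1 / real p ^ 2\<bar> * \<bar>kd m\<bar> <= 1 / real p ^ 2 * (1 / real m ^ 2)"
   using less.IH[OF p(4)] by (intro mult_mono) auto
  thus ?thesis unfolding p(2) kd_mult_prime[OF p(1)] abs_mult by (simp add: power_mult_distrib)
 next
  case False
  hence "n = 0 \<or> n = Suc 0" by auto
  thus ?thesis by auto
 qed
qed

lemma summable_kd: "summable (%n. \<bar>kd n\<bar>)"
 by (rule summable_comparison_test'[OF inverse_power_summable[of 2, where ?'a = real], of 0])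
   (use abs_kd_le in \<open>auto simp: field_simps\<close>)

text \<open>With c = 1/p^3 and d = -1/p^2 the local factor is (1 - c + d)/(1 - c) = 1 - p/(p^3 - 1),
  the factor in Stephens' constant.\<close>

lemma euler_finite_kd:
 assumes "finite P" "!!p. p \<in> P ==> prime p"
 shows "of_real (\<Prod>p\<in>P. 1 - real p / (real p ^ 3 - 1)) * (\<Sum>n. if \<exists>p\<in>P. p dvd n then 0 else of_real (kd n)) = (\<Sum>n. complex_of_real (kd n))"
  (is "of_real ?Q * ?T = ?S")
proof -
 define c d :: "nat => real" where "c p = 1 / real p ^ 3" and "d p = - 1 / real p ^ 2" for p
 have p3: "real p ^ 3 > 1" if "p \<in> P" for p using one_less_power[of "real p" 3] prime_gt_1_nat[OF assms(2)[OF that]] by simp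
 have f: "1 - c p + d p = (1 - c p) * (1 - real p / (real p ^ 3 - 1))" if "p \<in> P" for p
  using p3[OF that] by (simp add: c_def d_def field_simps power2_eq_square power3_eq_cube)
 have "(\<Prod>p\<in>P. 1 - of_real (c p)) * ?S = (\<Prod>p\<in>P. 1 - of_real (c p) + of_real (d p)) * ?T"
  by (rule euler_finite_general) (use assms summable_kd in \<open>simp_all add: kd_mult_prime c_def d_def\<close>)
 also have "(\<Prod>p\<in>P. 1 - of_real (c p) + complex_of_real (d p)) = of_real (\<Prod>p\<in>P. 1 - c p + d p)" by simp
 also have "(\<Prod>p\<in>P. 1 - c p + d p) = (\<Prod>p\<in>P. 1 - c p) * ?Q"
  unfolding prod.distrib[symmetric] by (rule prod.cong[OF refl f])
 also have "(\<Prod>p\<in>P. 1 - of_real (c p)) = complex_of_real (\<Prod>p\<in>P. 1 - c p)" by simp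
 finally have "of_real (\<Prod>p\<in>P. 1 - c p) * ?S = of_real (\<Prod>p\<in>P. 1 - c p) * (of_real ?Q * ?T)"
  by (simp only: of_real_mult mult.assoc)
 moreover have "1 - c p ~= 0" if "p \<in> P" for p using p3[OF that] by (simp add: c_def)
 hence "(\<Prod>p\<in>P. 1 - c p) ~= 0" using assms(1) by simp
 ultimately show ?thesis by (simp only: mult_cancel_left of_real_eq_0_iff) simp
qed

text \<open>An infinite product is identified with its value only if the limit of the partial
  products is nonzero. This holds because no factor vanishes and the sum over indices without small
  prime factors tends to 1, so the sum \<open>c\<close> equals a nonzero partial product times a
  nonzero number.\<close>

lemma stephens_C_sums: "kd sums stephens_C"
proof -
 define c where "c = suminf kd"
 have sk: "summable kd" using summable_kd by (rule summable_rabs_cancel)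
 have c: "(\<Sum>n. complex_of_real (kd n)) = of_real c"
  unfolding c_def using suminf_of_real[OF sk, where ?'a = complex] by simp
 define t where "t n = (if prime n then 1 - real n / (real n ^ 3 - 1) else 1)" for n
 have t0: "t n ~= 0" for n
 proof (cases "prime n")
  case True
  have n2: "real n >= 2" using prime_ge_2_nat[OF True] by simp
  hence "real n ^ 3 >= 2 * 2 * real n" unfolding power3_eq_cube by (intro mult_mono) auto
  hence "real n < real n ^ 3 - 1" using n2 by linarith
  thus ?thesis using n2 by (simp add: t_def)
 qed (simp add: t_def)
 define P where "P y = (\<Prod>p | prime p \<and> p <= y. 1 - real p / (real p ^ 3 - 1))" for y :: nat
 have Pt: "(\<Prod>i\<le>y. t i) = P y" for y
  unfolding P_def t_def by (simp add: prod.inter_filter[symmetric] conj_commute)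
 define F where "F y = (\<Sum>n. if \<exists>p\<in>{p. prime p \<and> p <= y}. p dvd n then 0 else complex_of_real (kd n))" for y
 have F1: "F \<longlonglongrightarrow> 1"
  unfolding F_def using suminf_rough_tendsto[of "%n. complex_of_real (kd n)"] summable_kd by simp
 have PF: "of_real (P y) * F y = of_real c" for y
  unfolding P_def F_def c[symmetric] by (rule euler_finite_kd) auto
 have "(%y. of_real c / F y) \<longlonglongrightarrow> of_real c / 1" by (intro tendsto_divide tendsto_const F1) simp
 moreover have ev: "\<forall>\<^sub>F y in sequentially. F y ~= 0" by (rule tendsto_imp_eventually_ne[OF F1]) simp
 hence "\<forall>\<^sub>F y in sequentially. of_real c / F y = complex_of_real (P y)"
 proof eventually_elim
  case (elim y)
  thus ?case using PF[of y] by (simp add: field_simps)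
 qed
 ultimately have "(%y. complex_of_real (P y)) \<longlonglongrightarrow> of_real c"
  using tendsto_cong by force
 hence lim: "P \<longlonglongrightarrow> c" by (simp add: tendsto_of_real_iff)
 obtain y where y: "F y ~= 0" using ev by (auto simp: eventually_sequentially)
 have "P y ~= 0" unfolding Pt[symmetric] using t0 by simp
 hence "complex_of_real c ~= 0" using PF[of y] y by (metis mult_eq_0_iff of_real_eq_0_iff)
 hence "c ~= 0" by simp
 hence "raw_has_prod t 0 c" unfolding raw_has_prod_def using lim by (simp add: Pt[abs_def, symmetric] cong: tendsto_cong) (simp add: Pt)
 hence "t has_prod c" by (simp add: has_prod_def)
 hence "c = prodinf t" by (rule has_prod_unique)
 hence "c = stephens_C" by (simp add: stephens_C_def t_def[abs_def])
 thus ?thesis using summable_sums[OF sk] by (simp add: c_def)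
qed

lemma sum_inverse_squares_tail:
 assumes "finite T" and M: "M > 0" and T: "!!n. n \<in> T ==> n >= 1 \<and> real n > M"
 shows "(\<Sum>n\<in>T. 1 / real n ^ 2) <= 2 / M"
proof (cases "T = {}")
 case False
 define a b where "a = Min T" and "b = Suc (Max T)"
 have aT: "a \<in> T" unfolding a_def using False assms(1) by (rule Min_in[rotated])
 have a: "a >= 1" "real a > M" using T[OF aT] by auto
 have ab: "a <= b" using aT assms(1) by (simp add: b_def le_SucI)
 have "(\<Sum>n\<in>T. 1 / real n ^ 2) <= (\<Sum>n\<in>{a..<b}. 1 / real n ^ 2)"
  using assms(1) by (intro sum_mono2) (auto simp: a_def b_def less_Suc_eq_le)
 also have "... <= (\<Sum>n\<in>{a..<b}. - 2 / real (Suc n) - (- 2 / real n))"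
 proof (rule sum_mono)
  fix n assume "n \<in> {a..<b}"
  hence n: "real n >= 1" using a(1) by auto
  have "- 2 / real (Suc n) - (- 2 / real n) = 2 / (real n * (real n + 1))"
   using n by (simp add: field_simps)
  moreover have "1 / real n ^ 2 <= 2 / (real n * (real n + 1))" 
  proof -
   have "1 / real n ^ 2 = 2 / (real n * (real n + real n))" using n by (simp add: power2_eq_square)
   also have "... <= 2 / (real n * (real n + 1))" using n by (intro divide_left_mono mult_left_mono mult_pos_pos) auto
   finally show ?thesis .
  qed
  ultimately show "1 / real n ^ 2 <= - 2 / real (Suc n) - (- 2 / real n)" by simp
 qed
 also have "... = - 2 / real b - (- 2 / real a)" by (rule sum_Suc_diff'[OF ab])
 also have "... <= 2 / real a" by simp
 also have "... <= 2 / M" using a M by (intro divide_left_mono) auto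
 finally show ?thesis .
qed (use M in simp)

lemma kd_tail:
 assumes D: "finite D" and M: "M > 0" and DM: "!!n. n >= 1 ==> n \<notin> D ==> real n > M"
 shows "\<bar>stephens_C - (\<Sum>d\<in>D. kd d)\<bar> <= 2 / M"
proof -
 have "(%n. if n \<in> D then kd n else 0) sums (\<Sum>d\<in>D. kd d)"
  using sums_If_finite_set[OF D, of kd] .
 hence s: "(%n. kd n - (if n \<in> D then kd n else 0)) sums (stephens_C - (\<Sum>d\<in>D. kd d))"
  by (rule sums_diff[OF stephens_C_sums])
 hence lim: "(%k. \<bar>\<Sum>n<k. kd n - (if n \<in> D then kd n else 0)\<bar>) \<longlonglongrightarrow> \<bar>stephens_C - (\<Sum>d\<in>D. kd d)\<bar>"
  unfolding sums_def by (rule tendsto_rabs)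
 have bd: "\<bar>\<Sum>n<k. kd n - (if n \<in> D then kd n else 0)\<bar> <= 2 / M" for k
 proof -
  have "\<bar>\<Sum>n<k. kd n - (if n \<in> D then kd n else 0)\<bar> <= (\<Sum>n<k. \<bar>kd n - (if n \<in> D then kd n else 0)\<bar>)" by (rule sum_abs)
  also have "... <= (\<Sum>n<k. if n >= 1 \<and> n \<notin> D then 1 / real n ^ 2 else 0)"
   by (intro sum_mono) (use abs_kd_le in \<open>auto simp: not_le\<close>)
  also have "... = (\<Sum>n\<in>{n\<in>{..<k}. n >= 1 \<and> n \<notin> D}. 1 / real n ^ 2)" by (rule sum.inter_filter[symmetric]) simp
  also have "... <= 2 / M" by (rule sum_inverse_squares_tail) (use M DM in auto)
  finally show ?thesis .
 qed
 show ?thesis by (rule LIMSEQ_le_const2[OF lim]) (use bd in blast)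
qed


section \<open>Summing the average over primes\<close>

lemma cong_1_iff_dvd: "n >= 1 ==> [n = 1] (mod d) \<longleftrightarrow> d dvd n - (1::nat)"
 by (metis cong_altdef_nat cong_sym_eq)

text \<open>Leaving out 1 itself avoids an additional 1 in the bound. The estimate stays useful for
  moduli of size comparable to \<open>N\<close>.\<close>

lemma card_cong_1_le:
 assumes "d >= 1"
 shows "real (card {n\<in>{2..N}. [n = 1] (mod d)}) <= real N / real d"
proof -
 have inj: "inj_on (%n. (n - 1) div d) {n\<in>{2..N}. [n = 1] (mod d)}"
 proof (rule inj_onI)
  fix m n assume m: "m \<in> {n\<in>{2..N}. [n = 1] (mod d)}" and n: "n \<in> {n\<in>{2..N}. [n = 1] (mod d)}"
   and e: "(m - 1) div d = (n - 1) div d"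
  have "d dvd m - 1" "d dvd n - 1" using m n cong_1_iff_dvd[of m d] cong_1_iff_dvd[of n d] by auto
  hence "m - 1 = n - 1" using e by (metis dvd_div_mult_self)
  thus "m = n" using m n by auto
 qed
 have "(%n. (n - 1) div d) ` {n\<in>{2..N}. [n = 1] (mod d)} \<subseteq> {1..N div d}"
 proof
  fix k assume "k \<in> (%n. (n - 1) div d) ` {n\<in>{2..N}. [n = 1] (mod d)}"
  then obtain n where n: "n >= 2" "n <= N" "[n = 1] (mod d)" "k = (n - 1) div d" by auto
  have dn: "d dvd n - 1" using n cong_1_iff_dvd[of n d] by auto
  hence "d <= n - 1" using n by (intro dvd_imp_le) auto
  hence "k >= 1" using n(4) assms by (simp add: div_greater_zero_iff Suc_le_eq)
  moreover have "k <= N div d" unfolding n(4) using n(2) by (intro div_le_mono) simp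
  ultimately show "k \<in> {1..N div d}" by simp
 qed
 hence "card {n\<in>{2..N}. [n = 1] (mod d)} <= card {1..N div d}" by (intro card_inj_on_le[OF inj]) auto
 hence "real (card {n\<in>{2..N}. [n = 1] (mod d)}) <= real (N div d)" by simp
 also have "... <= real N / real d" by (rule of_nat_div_le_of_nat)
 finally show ?thesis .
qed

text \<open>Moduli up to \<open>L ^ B\<close> are treated by the prime number theorem in
  progressions. For larger ones the primes are replaced by all integers congruent to 1, which costs
  one logarithm; the convergent sum of 1/d^2 has a tail below \<open>2 / L ^ B\<close>, and this is
  why \<open>B = A + 1\<close>.\<close>

lemma mean_ord_log_sum:
 fixes A :: nat
 shows "\<exists>K\<ge>0. \<forall>N\<ge>3. \<bar>(\<Sum>p | prime p \<and> p <= N. mean_ord (p - 1) * ln (real p)) - stephens_C * real N\<bar>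
   <= K * (real N / ln (real N) ^ A)"
proof -
 define B where "B = A + 1"
 obtain K where K: "K >= 0" "!!N q. N >= 3 ==> q >= 1 ==> real q <= ln (real N) ^ B ==>
  \<bar>(\<Sum>p | prime p \<and> p <= N \<and> [p = 1] (mod q). ln (real p)) - real N / real (totient q)\<bar> <= K * (real N / ln (real N) ^ (A + B))"
  using theta_arith_progression[of B "A + B"] by blast
 define K' where "K' = K + 2 * fact B + 2"
 have main: "\<bar>(\<Sum>p | prime p \<and> p <= N. mean_ord (p - 1) * ln (real p)) - stephens_C * real N\<bar> <= K' * (real N / ln (real N) ^ A)"
  if N: "N >= 3" for N
 proof -
  define L where "L = ln (real N)"
  have L: "L >= 1" using N ln3_gt_1 ln_le_cancel_iff[of 3 "real N"] unfolding L_def by linarith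
  have Lp: "L ^ i > 0" for i using L by simp
  define th where "th d = (\<Sum>p | prime p \<and> p <= N \<and> [p = 1] (mod d). ln (real p))" for d
  define P where "P = {p. prime p \<and> p <= N}"
  have P: "finite P" by (simp add: P_def)
  define D where "D = {d\<in>{1..N}. real d <= L ^ B}"
  define E where "E = {d\<in>{1..N}. real d > L ^ B}"
  have "(\<Sum>p\<in>P. mean_ord (p - 1) * ln (real p)) = (\<Sum>p\<in>P. \<Sum>d=1..N. if [p = 1] (mod d) then h0 d / real d * ln (real p) else 0)"
  proof (rule sum.cong)
   fix p assume "p \<in> P"
   hence p: "prime p" "p <= N" "p >= 2" using prime_ge_2_nat by (auto simp: P_def)
   have "{d. d dvd p - 1} = {d\<in>{1..N}. [p = 1] (mod d)}"
   proof (intro equalityI subsetI)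
    fix d assume "d \<in> {d. d dvd p - 1}"
    hence d: "d dvd p - 1" by simp
    have "d <= p - 1" using d p by (intro dvd_imp_le) auto
    moreover have "d > 0" using d p by (cases d) auto
    ultimately show "d \<in> {d\<in>{1..N}. [p = 1] (mod d)}" using d p cong_1_iff_dvd[of p d] by auto
   qed (use p cong_1_iff_dvd[of p] in auto)
   hence "mean_ord (p - 1) * ln (real p) = (\<Sum>d\<in>{d\<in>{1..N}. [p = 1] (mod d)}. h0 d / real d * ln (real p))"
    by (simp add: mean_ord_def sum_distrib_right)
   also have "... = (\<Sum>d=1..N. if [p = 1] (mod d) then h0 d / real d * ln (real p) else 0)"
    by (rule sum.inter_filter) simp
   finally show "mean_ord (p - 1) * ln (real p) = (\<Sum>d=1..N. if [p = 1] (mod d) then h0 d / real d * ln (real p) else 0)" .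
  qed simp
  also have "... = (\<Sum>d=1..N. \<Sum>p\<in>P. if [p = 1] (mod d) then h0 d / real d * ln (real p) else 0)"
   by (rule sum.swap)
  also have "... = (\<Sum>d=1..N. h0 d / real d * th d)"
  proof (rule sum.cong)
   fix d
   have "{p \<in> P. [p = 1] (mod d)} = {p. prime p \<and> p <= N \<and> [p = 1] (mod d)}" by (auto simp: P_def)
   thus "(\<Sum>p\<in>P. if [p = 1] (mod d) then h0 d / real d * ln (real p) else 0) = h0 d / real d * th d"
    unfolding sum.inter_filter[OF P, symmetric] th_def sum_distrib_left by simp
  qed simp
  also have "... = (\<Sum>d\<in>D \<union> E. h0 d / real d * th d)" by (intro sum.cong) (auto simp: D_def E_def)
  also have "... = (\<Sum>d\<in>D. h0 d / real d * th d) + (\<Sum>d\<in>E. h0 d / real d * th d)"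
   by (rule sum.union_disjoint) (auto simp: D_def E_def)
  finally have split: "(\<Sum>p\<in>P. mean_ord (p - 1) * ln (real p)) - stephens_C * real N =
    (\<Sum>d\<in>D. h0 d / real d * (th d - real N / real (totient d))) + real N * ((\<Sum>d\<in>D. kd d) - stephens_C) + (\<Sum>d\<in>E. h0 d / real d * th d)"
   by (simp add: right_diff_distrib sum_subtractf kd_def sum_distrib_left mult_ac)
  define R where "R = real N / L ^ A"
  have hd: "\<bar>h0 d / real d\<bar> <= 1 / real d" for d
   using abs_h0_le[of d] by (simp add: abs_divide divide_right_mono)
  have 1: "\<bar>\<Sum>d\<in>D. h0 d / real d * (th d - real N / real (totient d))\<bar> <= K * R"
  proof -
   have "\<bar>\<Sum>d\<in>D. h0 d / real d * (th d - real N / real (totient d))\<bar> <= (\<Sum>d\<in>D. \<bar>h0 d / real d * (th d - real N / real (totient d))\<bar>)" by (rule sum_abs)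
   also have "... <= (\<Sum>d\<in>D. 1 * (K * (real N / L ^ (A + B))))"
   proof (rule sum_mono)
    fix d assume "d \<in> D"
    hence d: "d >= 1" "real d <= L ^ B" by (auto simp: D_def)
    have "1 / real d <= 1" using d(1) by simp
    with hd[of d] have "\<bar>h0 d / real d\<bar> <= 1" by linarith
    moreover have "\<bar>th d - real N / real (totient d)\<bar> <= K * (real N / L ^ (A + B))"
     unfolding th_def L_def by (rule K(2)[OF N d(1)]) (use d(2) in \<open>simp add: L_def\<close>)
    ultimately show "\<bar>h0 d / real d * (th d - real N / real (totient d))\<bar> <= 1 * (K * (real N / L ^ (A + B)))"
     unfolding abs_mult by (rule mult_mono) auto
   qed
   also have "... = real (card D) * (K * (real N / L ^ (A + B)))" by simp
   also have "... <= L ^ B * (K * (real N / L ^ (A + B)))"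
   proof (rule mult_right_mono)
    have "D \<subseteq> {1..nat \<lfloor>L ^ B\<rfloor>}" using Lp[of B] le_nat_floor_iff[of "L ^ B"] by (auto simp: D_def)
    hence "card D <= card {1..nat \<lfloor>L ^ B\<rfloor>}" by (intro card_mono) auto
    thus "real (card D) <= L ^ B" using le_nat_floor_iff[of "L ^ B" "card D"] Lp[of B] by simp
   qed (use K(1) L in auto)
   also have "... = K * R" using L by (simp add: R_def power_add)
   finally show ?thesis .
  qed
  have 2: "\<bar>real N * ((\<Sum>d\<in>D. kd d) - stephens_C)\<bar> <= 2 * fact B * R"
  proof -
   \<comment> \<open>The set \<open>D\<close> is also cut off at \<open>N\<close>. Dividing the
     threshold by \<open>fact B\<close> puts it below \<open>N\<close>, so that every index outside
     \<open>D\<close> exceeds it.\<close>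
   have LBN: "L ^ B / fact B <= real N" using ln_power_le[of "real N" B] N by (simp add: L_def field_simps)
   have "\<bar>stephens_C - (\<Sum>d\<in>D. kd d)\<bar> <= 2 / (L ^ B / fact B)"
   proof (rule kd_tail)
    fix n :: nat assume n: "n >= 1" "n \<notin> D"
    have "L ^ B / fact B <= L ^ B / 1" using Lp[of B] by (intro divide_left_mono) (auto simp: fact_ge_1)
    thus "real n > L ^ B / fact B" using n LBN by (auto simp: D_def)
   qed (use Lp[of B] in \<open>auto simp: D_def\<close>)
   also have "... = 2 * fact B / (L ^ A * L)" by (simp add: B_def)
   also have "... <= 2 * fact B / (L ^ A * 1)" using L Lp[of A] by (intro divide_left_mono mult_left_mono) auto
   finally have "real N * \<bar>(\<Sum>d\<in>D. kd d) - stephens_C\<bar> <= real N * (2 * fact B / L ^ A)"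
    by (intro mult_left_mono) (auto simp: abs_minus_commute)
   thus ?thesis by (simp add: abs_mult R_def mult_ac)
  qed
  have 3: "\<bar>\<Sum>d\<in>E. h0 d / real d * th d\<bar> <= 2 * R"
  proof -
   have "\<bar>\<Sum>d\<in>E. h0 d / real d * th d\<bar> <= (\<Sum>d\<in>E. \<bar>h0 d / real d * th d\<bar>)" by (rule sum_abs)
   also have "... <= (\<Sum>d\<in>E. real N * L * (1 / real d ^ 2))"
   proof (rule sum_mono)
    fix d assume "d \<in> E"
    hence d: "d >= 1" by (auto simp: E_def)
    have "th d <= (\<Sum>p | prime p \<and> p <= N \<and> [p = 1] (mod d). L)"
     unfolding th_def
    proof (rule sum_mono)
     fix p assume "p \<in> {p. prime p \<and> p <= N \<and> [p = 1] (mod d)}"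
     thus "ln (real p) <= L" using prime_gt_0_nat[of p] by (auto simp: L_def)
    qed
    also have "... = real (card {p. prime p \<and> p <= N \<and> [p = 1] (mod d)}) * L" by simp
    also have "... <= real (card {n\<in>{2..N}. [n = 1] (mod d)}) * L"
    proof (intro mult_right_mono of_nat_mono card_mono)
     show "{p. prime p \<and> p <= N \<and> [p = 1] (mod d)} \<subseteq> {n\<in>{2..N}. [n = 1] (mod d)}"
      using prime_ge_2_nat by auto
    qed (use L in auto)
    also have "... <= real N / real d * L" using card_cong_1_le[OF d, of N] L by (intro mult_right_mono) auto
    finally have t: "th d <= real N / real d * L" .
    have "th d >= 0" unfolding th_def
    proof (rule sum_nonneg)
     fix p assume "p \<in> {p. prime p \<and> p <= N \<and> [p = 1] (mod d)}"
     thus "ln (real p) >= 0" using prime_ge_1_nat[of p] by auto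
    qed
    hence "\<bar>h0 d / real d * th d\<bar> <= 1 / real d * (real N / real d * L)"
     unfolding abs_mult using hd[of d] t by (intro mult_mono) auto
    thus "\<bar>h0 d / real d * th d\<bar> <= real N * L * (1 / real d ^ 2)" by (simp add: power2_eq_square)
   qed
   also have "... = real N * L * (\<Sum>d\<in>E. 1 / real d ^ 2)" by (simp only: sum_distrib_left)
   also have "... <= real N * L * (2 / L ^ B)"
    by (intro mult_left_mono sum_inverse_squares_tail) (use L Lp[of B] in \<open>auto simp: E_def\<close>)
   also have "... = 2 * R" using L by (simp add: R_def B_def)
   finally show ?thesis .
  qed
  have "\<bar>(\<Sum>p\<in>P. mean_ord (p - 1) * ln (real p)) - stephens_C * real N\<bar> <= K * R + 2 * fact B * R + 2 * R"
   unfolding split using 1 2 3 by linarith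
  thus ?thesis by (simp add: K'_def P_def R_def L_def distrib_right add_divide_distrib)
 qed
 have "K' >= 0" using K(1) by (simp add: K'_def)
 thus ?thesis using main by (intro exI[of _ K']) simp
qed

lemma inverse_gcd_eq:
 assumes "n > 0"
 shows "1 / real (gcd k n) = (\<Sum>d | d dvd n. if d dvd k then h0 d else 0)"
proof -
 have "gcd k n > 0" using assms by simp
 hence "1 / real (gcd k n) = (\<Sum>d | d dvd gcd k n. h0 d)" by (rule sum_divisors_h0[symmetric])
 also have "{d. d dvd gcd k n} = {d\<in>{d. d dvd n}. d dvd k}" by auto
 also have "(\<Sum>d\<in>{d\<in>{d. d dvd n}. d dvd k}. h0 d) = (\<Sum>d | d dvd n. if d dvd k then h0 d else 0)"
  by (rule sum.inter_filter) (use assms in simp)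
 finally show ?thesis .
qed

text \<open>As an average of reciprocals of gcds the quantity visibly lies between 0 and 1, which is
  hidden by the alternating signs of \<open>h0\<close>.\<close>

lemma mean_ord_eq:
 assumes n: "n > 0"
 shows "mean_ord n = (\<Sum>k=1..n. 1 / real (gcd k n)) / real n"
proof -
 have "(\<Sum>k=1..n. 1 / real (gcd k n)) = (\<Sum>d | d dvd n. \<Sum>k=1..n. if d dvd k then h0 d else 0)"
  unfolding inverse_gcd_eq[OF n] by (rule sum.swap)
 also have "... = (\<Sum>d | d dvd n. real n * (h0 d / real d))"
 proof (rule sum.cong)
  fix d assume "d \<in> {d. d dvd n}"
  hence d: "d dvd n" and d0: "d > 0" using n by (auto intro: dvd_pos_nat)
  have "(\<Sum>k=1..n. if d dvd k then h0 d else 0) = (\<Sum>k\<in>{k\<in>{1..n}. d dvd k}. h0 d)"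
   by (rule sum.inter_filter[symmetric]) simp
  also have "... = real (n div d) * h0 d" by (simp only: card_multiples[OF d0] sum_constant)
  also have "real (n div d) = real n / real d" by (rule real_of_nat_div[OF d])
  finally show "(\<Sum>k=1..n. if d dvd k then h0 d else 0) = real n * (h0 d / real d)" by simp
 qed simp
 also have "... = real n * mean_ord n" by (simp only: mean_ord_def sum_distrib_left)
 finally show ?thesis using n by simp
qed

lemma mean_ord_bounds: "0 <= mean_ord n" "mean_ord n <= 1"
proof -
 have "0 <= mean_ord n \<and> mean_ord n <= 1"
 proof (cases "n > 0")
  case True
  have "(\<Sum>k=1..n. 1 / real (gcd k n)) <= (\<Sum>k=1..n. 1)"
  proof (rule sum_mono)
   fix k assume "k \<in> {1..n}"
   hence "gcd k n >= 1" using True by (simp add: Suc_le_eq)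
   hence "real 1 <= real (gcd k n)" by (simp only: of_nat_le_iff)
   hence "1 <= real (gcd k n)" by (simp only: of_nat_1)
   thus "1 / real (gcd k n) <= 1" using divide_le_eq_1_pos[of "real (gcd k n)" 1] by linarith
  qed
  thus ?thesis unfolding mean_ord_eq[OF True] using True by (auto intro!: divide_nonneg_pos sum_nonneg)
 next
  case False
  \<comment> \<open>For \<open>n = 0\<close> the sum runs over an infinite set and is 0 by
    convention.\<close>
  have "infinite {d::nat. d dvd 0}" by simp
  thus ?thesis using False by (simp add: mean_ord_def)
 qed
 thus "0 <= mean_ord n" "mean_ord n <= 1" by auto
qed

lemma Li_step:
 assumes "2 <= a" "a <= b"
 shows "(b - a) / ln b <= Li b - Li a" "Li b - Li a <= (b - a) / ln a"
proof -
 have c: "continuous_on {2..b} (%t::real. 1 / ln t)"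
  by (intro continuous_intros) auto
 hence i: "(%t. 1 / ln t) integrable_on {2..b}" by (rule integrable_continuous_real)
 have i2: "(%t. 1 / ln t) integrable_on {a..b}"
  by (rule integrable_continuous_real[OF continuous_on_subset[OF c]]) (use assms in auto)
 have "integral {2..a} (%t. 1 / ln t) + integral {a..b} (%t. 1 / ln t) = integral {2..b} (%t. 1 / ln t)"
  by (rule Henstock_Kurzweil_Integration.integral_combine[OF assms i])
 hence e: "Li b - Li a = integral {a..b} (%t. 1 / ln t)" by (simp add: Li_def)
 have "integral {a..b} (%t. 1 / ln b) <= integral {a..b} (%t. 1 / ln t)"
  by (rule integral_le) (use i2 assms in \<open>auto intro!: divide_left_mono\<close>)
 thus "(b - a) / ln b <= Li b - Li a" using assms by (simp add: e)
 have "integral {a..b} (%t. 1 / ln t) <= integral {a..b} (%t. 1 / ln a)"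
  by (rule integral_le) (use i2 assms in \<open>auto intro!: divide_left_mono\<close>)
 thus "Li b - Li a <= (b - a) / ln a" using assms by (simp add: e)
qed

lemma inverse_ln2_le: "1 / ln (2::real) <= 2"
 using ln2_ge_two_thirds by (simp add: field_simps)

lemma sum_inverse_ln:
 assumes "N >= 2"
 shows "\<bar>(\<Sum>n=2..N. 1 / ln (real n)) - Li (real N)\<bar> <= 2"
proof -
 have "1 / ln (real N) <= (\<Sum>n=2..N. 1 / ln (real n)) - Li (real N) \<and> (\<Sum>n=2..N. 1 / ln (real n)) - Li (real N) <= 1 / ln 2"
  using assms
 proof (induction N rule: dec_induct)
  case base
  thus ?case by (simp add: Li_def)
 next
  case (step N)
  have "(\<Sum>n=2..Suc N. 1 / ln (real n)) = (\<Sum>n=2..N. 1 / ln (real n)) + 1 / ln (real (Suc N))"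
   using step.hyps by (simp add: sum.cl_ivl_Suc)
  moreover have "1 / ln (real (Suc N)) <= Li (real (Suc N)) - Li (real N)" "Li (real (Suc N)) - Li (real N) <= 1 / ln (real N)"
   using Li_step[of "real N" "real (Suc N)"] step.hyps by auto
  ultimately show ?case using step.IH by linarith
 qed
 moreover have "1 / ln (real N) >= 0" using assms by simp
 ultimately show ?thesis using inverse_ln2_le by linarith
qed

text \<open>Partial summation removes the weight \<open>ln p\<close>. The comparison is made with
  the discrete sum of 1/ln n, which differs from \<open>Li\<close> by a bounded amount. Starting at
  the square root of \<open>N\<close> makes all logarithms comparable to \<open>ln N\<close>;
  smaller indices are estimated trivially.\<close>

lemma mean_ord_sum_nat:
 fixes A :: nat
 shows "\<exists>K\<ge>0. \<forall>N\<ge>4. \<bar>(\<Sum>p | prime p \<and> p <= N. mean_ord (p - 1)) - stephens_C * Li (real N)\<bar>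
   <= K * (real N / ln (real N) ^ A)"
proof -
 obtain K where K: "K >= 0" "!!N. N >= 3 ==> 
  \<bar>(\<Sum>p | prime p \<and> p <= N. mean_ord (p - 1) * ln (real p)) - stephens_C * real N\<bar> <= K * (real N / ln (real N) ^ A)"
  using mean_ord_log_sum[of A] by blast
 define C where "C = \<bar>stephens_C\<bar>"
 have C: "C >= 0" by (simp add: C_def)
 define K' where "K' = 2 * K * 2 ^ A + (3 + 4 * C) * (2 ^ (A + 1) * fact (A + 1)) + 2 * C * fact A"
 have main: "\<bar>(\<Sum>p | prime p \<and> p <= N. mean_ord (p - 1)) - stephens_C * Li (real N)\<bar> <= K' * (real N / ln (real N) ^ A)"
  if N: "N >= 4" for N
 proof -
  define L where "L = ln (real N)"
  have L: "L >= 1" using N ln3_gt_1 ln_le_cancel_iff[of 3 "real N"] unfolding L_def by linarith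
  have Lp: "L ^ i > 0" for i using L by simp
  define R where "R = real N / L ^ A"
  define a where "a n = (if prime n then mean_ord (n - 1) * ln (real n) else 0) - stephens_C" for n
  define m where "m = Suc (nat \<lfloor>sqrt (real N)\<rfloor>)"
  have s2: "sqrt (real N) >= 2" using N by (intro real_le_rsqrt) auto
  have m: "m >= 3" "real m > sqrt (real N)" "real (m - 1) <= sqrt (real N)"
   using s2 le_nat_floor_iff[of "sqrt (real N)" 2] le_nat_floor_iff[of "sqrt (real N)" m] le_nat_floor_iff[of "sqrt (real N)" "m - 1"]
   by (auto simp: m_def)
  have sN: "2 * sqrt (real N) <= real N" using mult_right_mono[OF s2, of "sqrt (real N)"] by simp
  have mN: "m <= N"
  proof -
   have "real (m - 1) + 1 <= real N" using m(3) sN s2 by linarith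
   thus ?thesis using m(1) by linarith
  qed
  have lm: "L / 2 <= ln (real m)"
  proof -
   have "L / 2 = ln (sqrt (real N))" using N by (simp add: L_def ln_sqrt)
   also have "... <= ln (real m)" using m(2) s2 by (subst ln_le_cancel_iff) linarith+
   finally show ?thesis .
  qed
  have a_sum: "(\<Sum>n=1..k. a n) = (\<Sum>p | prime p \<and> p <= k. mean_ord (p - 1) * ln (real p)) - stephens_C * real k" for k
  proof -
   have "{n\<in>{1..k}. prime n} = {p. prime p \<and> p <= k}" using prime_ge_1_nat by auto
   hence "(\<Sum>n=1..k. if prime n then mean_ord (n - 1) * ln (real n) else 0) = (\<Sum>p | prime p \<and> p <= k. mean_ord (p - 1) * ln (real p))"
    by (subst sum.inter_filter[symmetric]) simp_all
   thus ?thesis by (simp add: a_def sum_subtractf)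
  qed
  have a_le: "\<bar>a n\<bar> <= L + C" if "n >= 1" "n <= N" for n
  proof -
   have l: "0 <= ln (real n)" "ln (real n) <= L" using that by (auto simp: L_def)
   have "mean_ord (n - 1) * ln (real n) <= 1 * L" using l mean_ord_bounds by (intro mult_mono) auto
   moreover have "0 <= mean_ord (n - 1) * ln (real n)" using l mean_ord_bounds by simp
   ultimately have "\<bar>if prime n then mean_ord (n - 1) * ln (real n) else 0\<bar> <= L" using L by auto
   thus ?thesis unfolding a_def C_def by linarith
  qed
  have head1: "\<bar>\<Sum>n=1..m-1. a n\<bar> <= sqrt (real N) * (L + C)"
  proof -
   have "\<bar>\<Sum>n=1..m-1. a n\<bar> <= (\<Sum>n=1..m-1. L + C)"
    by (intro order_trans[OF sum_abs] sum_mono a_le) (use mN in auto)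
   also have "... = real (m - 1) * (L + C)" by simp
   also have "... <= sqrt (real N) * (L + C)" using m(3) L C by (intro mult_right_mono) auto
   finally show ?thesis .
  qed
  define T where "T = K * 2 ^ A * R + sqrt (real N) * (L + C)"
  have R0: "R >= 0" using L by (simp add: R_def)
  have T0: "T >= 0" using K(1) R0 L C by (simp add: T_def)
  have "norm (\<Sum>n=m..N. complex_of_real (a n) * of_real (1 / ln (real n))) <= T * (1 / ln (real m))"
  proof (rule abel_decreasing[OF mN])
   fix k assume k: "m <= k" "k <= N"
   have un: "{1..k} = {1..m-1} \<union> {m..k}" using k m by auto
   have "(\<Sum>n=1..k. a n) = (\<Sum>n=1..m-1. a n) + (\<Sum>n=m..k. a n)"
    unfolding un using m(1) by (intro sum.union_disjoint) auto
   hence "\<bar>\<Sum>n=m..k. a n\<bar> <= \<bar>\<Sum>n=1..k. a n\<bar> + \<bar>\<Sum>n=1..m-1. a n\<bar>" by simp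
   moreover have "\<bar>\<Sum>n=1..k. a n\<bar> <= K * 2 ^ A * R"
   proof -
    have "\<bar>\<Sum>n=1..k. a n\<bar> <= K * (real k / ln (real k) ^ A)" unfolding a_sum by (rule K(2)) (use k m in simp)
    also have "... <= K * (real N / (L / 2) ^ A)"
    proof (intro mult_left_mono frac_le power_mono)
     show "L / 2 <= ln (real k)" using lm k m(1) by (intro order_trans[OF lm]) simp
    qed (use k K(1) L in auto)
    also have "... = K * 2 ^ A * R" by (simp add: R_def power_divide)
    finally show ?thesis .
   qed
   ultimately have "\<bar>\<Sum>n=m..k. a n\<bar> <= T" using head1 by (simp add: T_def)
   thus "norm (\<Sum>n=m..k. complex_of_real (a n)) <= T" by (simp flip: of_real_sum)
  next
   fix k assume k: "m <= k" "k < N"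
   thus "1 / ln (real (Suc k)) <= 1 / ln (real k)" using m(1) by (intro frac_le) auto
  qed (use N in simp)
  also have "T * (1 / ln (real m)) <= T * 2"
  proof (rule mult_left_mono[OF _ T0])
   have "1 / ln (real m) <= 1 / (1 / 2)" using lm L by (intro frac_le) auto
   thus "1 / ln (real m) <= 2" by simp
  qed
  also have "(\<Sum>n=m..N. complex_of_real (a n) * of_real (1 / ln (real n))) = of_real (\<Sum>n=m..N. a n / ln (real n))"
   by simp
  finally have tail: "\<bar>\<Sum>n=m..N. a n / ln (real n)\<bar> <= T * 2" unfolding norm_of_real .
  have head2: "\<bar>\<Sum>n=2..m-1. a n / ln (real n)\<bar> <= sqrt (real N) * (1 + 2 * C)"
  proof -
   have "\<bar>\<Sum>n=2..m-1. a n / ln (real n)\<bar> <= (\<Sum>n=2..m-1. 1 + 2 * C)"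
   proof (intro order_trans[OF sum_abs] sum_mono)
    fix n assume "n \<in> {2..m-1}"
    hence n: "n >= 2" by simp
    have l: "1 / ln (real n) <= 1 / ln 2" using n by (intro frac_le) auto
    hence l: "1 / ln (real n) <= 2" using inverse_ln2_le by simp
    have l0: "ln (real n) > 0" using n by simp
    have e: "a n / ln (real n) = (if prime n then mean_ord (n - 1) else 0) - stephens_C * (1 / ln (real n))"
     using l0 by (simp add: a_def field_simps)
    have "\<bar>stephens_C * (1 / ln (real n))\<bar> <= C * 2"
     unfolding abs_mult C_def using l l0 by (intro mult_mono) auto
    moreover have "\<bar>if prime n then mean_ord (n - 1) else 0\<bar> <= 1" using mean_ord_bounds[of "n - 1"] by auto
    ultimately show "\<bar>a n / ln (real n)\<bar> <= 1 + 2 * C" unfolding e by linarith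
   qed
   also have "... = real (m - 2) * (1 + 2 * C)" using m(1) by (simp add: numeral_2_eq_2)
   also have "... <= sqrt (real N) * (1 + 2 * C)"
   proof (rule mult_right_mono)
    show "real (m - 2) <= sqrt (real N)" using m(3) by simp
   qed (use C in auto)
   finally show ?thesis .
  qed
  have un: "{2..N} = {2..m-1} \<union> {m..N}" using mN m by auto
  have "(\<Sum>n=2..N. a n / ln (real n)) = (\<Sum>n=2..m-1. a n / ln (real n)) + (\<Sum>n=m..N. a n / ln (real n))"
   unfolding un using m(1) by (intro sum.union_disjoint) auto
  hence S: "\<bar>\<Sum>n=2..N. a n / ln (real n)\<bar> <= sqrt (real N) * (1 + 2 * C) + T * 2"
   using head2 tail by linarith
  have "(\<Sum>n=2..N. a n / ln (real n)) = (\<Sum>n=2..N. if prime n then mean_ord (n - 1) else 0) - stephens_C * (\<Sum>n=2..N. 1 / ln (real n))"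
   unfolding sum_distrib_left sum_subtractf[symmetric]
  proof (rule sum.cong)
   fix n assume "n \<in> {2..N}"
   hence "ln (real n) > 0" by simp
   thus "a n / ln (real n) = (if prime n then mean_ord (n - 1) else 0) - stephens_C * (1 / ln (real n))"
    by (simp add: a_def field_simps)
  qed simp
  moreover have "(\<Sum>n=2..N. if prime n then mean_ord (n - 1) else 0) = (\<Sum>p | prime p \<and> p <= N. mean_ord (p - 1))"
  proof -
   have "{n\<in>{2..N}. prime n} = {p. prime p \<and> p <= N}" using prime_ge_2_nat by auto
   thus ?thesis by (subst sum.inter_filter[symmetric]) simp_all
  qed
  ultimately have e: "(\<Sum>p | prime p \<and> p <= N. mean_ord (p - 1)) - stephens_C * Li (real N) =
    (\<Sum>n=2..N. a n / ln (real n)) + stephens_C * ((\<Sum>n=2..N. 1 / ln (real n)) - Li (real N))"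
   by (simp add: algebra_simps)
  have "\<bar>stephens_C * ((\<Sum>n=2..N. 1 / ln (real n)) - Li (real N))\<bar> <= C * 2"
   unfolding abs_mult C_def using sum_inverse_ln[of N] N by (intro mult_left_mono) auto
  hence "\<bar>(\<Sum>p | prime p \<and> p <= N. mean_ord (p - 1)) - stephens_C * Li (real N)\<bar> <= sqrt (real N) * (1 + 2 * C) + T * 2 + 2 * C"
   unfolding e using S by linarith
  also have "... = 2 * K * 2 ^ A * R + (2 * L + (1 + 4 * C)) * sqrt (real N) + 2 * C" by (simp add: T_def algebra_simps)
  also have "(2 * L + (1 + 4 * C)) * sqrt (real N) <= ((3 + 4 * C) * L) * sqrt (real N)"
  proof (rule mult_right_mono)
   have "1 * (1 + 4 * C) <= L * (1 + 4 * C)" using L C by (intro mult_right_mono) auto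
   thus "2 * L + (1 + 4 * C) <= (3 + 4 * C) * L" by (simp add: algebra_simps)
  qed simp
  also have "((3 + 4 * C) * L) * sqrt (real N) = (3 + 4 * C) * (sqrt (real N) * L ^ (A + 1) / L ^ A)"
   using L by (simp add: power_add)
  also have "... <= (3 + 4 * C) * ((2 ^ (A + 1) * fact (A + 1) * real N) / L ^ A)"
   unfolding L_def using N C by (intro mult_left_mono divide_right_mono sqrt_ln_power_le) auto
  also have "... = (3 + 4 * C) * (2 ^ (A + 1) * fact (A + 1)) * R" by (simp add: R_def)
  also have "2 * C <= 2 * C * fact A * R"
  proof -
   have "L ^ A <= fact A * real N" unfolding L_def using N by (intro ln_power_le) auto
   hence "1 <= fact A * R" using Lp[of A] by (simp add: R_def field_simps)
   hence "2 * C * 1 <= 2 * C * (fact A * R)" using C by (intro mult_left_mono) auto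
   thus ?thesis by (simp add: mult.assoc)
  qed
  finally show ?thesis by (simp add: K'_def distrib_right R_def L_def add_divide_distrib)
 qed
 have "K' >= 0" using K(1) C by (simp add: K'_def)
 thus ?thesis using main by (intro exI[of _ K']) simp
qed

lemma mean_ord_sum:
 fixes A :: nat
 shows "\<exists>K\<ge>0. \<forall>x\<ge>5. \<bar>(\<Sum>p | prime p \<and> real p < x. mean_ord (p - 1)) - stephens_C * Li x\<bar> <= K * (x / ln x ^ A)"
proof -
 obtain K where K: "K >= 0" "!!N. N >= 4 ==> 
  \<bar>(\<Sum>p | prime p \<and> p <= N. mean_ord (p - 1)) - stephens_C * Li (real N)\<bar> <= K * (real N / ln (real N) ^ A)"
  using mean_ord_sum_nat[of A] by blast
 define K' where "K' = K * 2 ^ A + 2 * \<bar>stephens_C\<bar> * fact A"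
 have "\<bar>(\<Sum>p | prime p \<and> real p < x. mean_ord (p - 1)) - stephens_C * Li x\<bar> <= K' * (x / ln x ^ A)" if x: "x >= 5" for x
 proof -
  \<comment> \<open>The largest integer strictly below \<open>x\<close>, so that
    \<open>p < x\<close> becomes \<open>p <= N\<close> also for integral \<open>x\<close>.\<close>
  define N where "N = nat (\<lceil>x\<rceil> - 1)"
  have c: "\<lceil>x\<rceil> >= 5" using x by linarith
  have rN: "real N = of_int \<lceil>x\<rceil> - 1" using c by (simp add: N_def)
  have Nx: "real N < x" "x - 1 <= real N" unfolding rN by linarith+
  have N4: "N >= 4" using Nx(2) x by linarith
  have "real p < x \<longleftrightarrow> p <= N" for p
  proof
   assume "real p < x"
   hence "int p < \<lceil>x\<rceil>" by (simp add: less_ceiling_iff)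
   thus "p <= N" by (simp add: N_def)
  next
   assume "p <= N"
   hence "real p <= real N" by simp
   thus "real p < x" using Nx by linarith
  qed
  hence S: "(\<Sum>p | prime p \<and> real p < x. mean_ord (p - 1)) = (\<Sum>p | prime p \<and> p <= N. mean_ord (p - 1))" by simp
  define l where "l = ln x"
  have l: "l > 0" using x by (simp add: l_def)
  have "sqrt x * 2 <= sqrt x * sqrt x" using x by (intro mult_left_mono real_le_rsqrt) auto
  hence "sqrt x * 2 <= x" using x by simp
  moreover have "sqrt x >= 1" using x by simp
  ultimately have sN: "sqrt x <= real N" using Nx by linarith
  have lN: "l / 2 <= ln (real N)"
  proof -
   have "l / 2 = ln (sqrt x)" using x by (simp add: l_def ln_sqrt)
   also have "... <= ln (real N)" using sN x N4 by (subst ln_le_cancel_iff) auto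
   finally show ?thesis .
  qed
  have Lp: "l ^ A > 0" using l by simp
  have 1: "K * (real N / ln (real N) ^ A) <= K * 2 ^ A * (x / l ^ A)"
  proof -
   have "K * (real N / ln (real N) ^ A) <= K * (x / (l / 2) ^ A)"
    using Nx lN l K(1) x by (intro mult_left_mono frac_le power_mono) auto
   thus ?thesis by (simp add: power_divide mult_ac)
  qed
  have "Li x - Li (real N) >= 0" "Li x - Li (real N) <= 2"
  proof -
   have *: "2 <= real N" "real N <= x" using N4 Nx by auto
   have "0 <= (x - real N) / ln x" using Nx x by simp
   also note Li_step(1)[OF *]
   finally show "Li x - Li (real N) >= 0" .
   note Li_step(2)[OF *]
   also have "(x - real N) / ln (real N) <= 1 / ln 2" using Nx N4 by (intro frac_le) auto
   finally show "Li x - Li (real N) <= 2" using inverse_ln2_le by linarith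
  qed
  hence "\<bar>stephens_C * (Li (real N) - Li x)\<bar> <= \<bar>stephens_C\<bar> * 2"
   unfolding abs_mult by (intro mult_left_mono) auto
  also have "... <= 2 * \<bar>stephens_C\<bar> * fact A * (x / l ^ A)"
  proof -
   have "l ^ A <= fact A * x" unfolding l_def using x by (intro ln_power_le) auto
   hence "1 <= fact A * (x / l ^ A)" using Lp by (simp add: field_simps)
   hence "2 * \<bar>stephens_C\<bar> * 1 <= 2 * \<bar>stephens_C\<bar> * (fact A * (x / l ^ A))" by (intro mult_left_mono) auto
   thus ?thesis by (simp add: mult_ac)
  qed
  finally have 2: "\<bar>stephens_C * (Li (real N) - Li x)\<bar> <= 2 * \<bar>stephens_C\<bar> * fact A * (x / l ^ A)" .
  have "(\<Sum>p | prime p \<and> p <= N. mean_ord (p - 1)) - stephens_C * Li x =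
   ((\<Sum>p | prime p \<and> p <= N. mean_ord (p - 1)) - stephens_C * Li (real N)) + stephens_C * (Li (real N) - Li x)"
   by (simp add: algebra_simps)
  hence "\<bar>(\<Sum>p | prime p \<and> p <= N. mean_ord (p - 1)) - stephens_C * Li x\<bar> \<le>
   K * 2 ^ A * (x / l ^ A) + 2 * \<bar>stephens_C\<bar> * fact A * (x / l ^ A)"
   using K(2)[OF N4] 1 2 by linarith
  thus ?thesis unfolding S by (simp add: K'_def l_def distrib_right add_divide_distrib)
 qed
 moreover have "K' >= 0" using K(1) by (simp add: K'_def)
 ultimately show ?thesis by (intro exI[of _ K']) simp
qed

section \<open>The large sieve\<close>

text \<open>Induction on the exponent; the step is Chebyshev's sum inequality, proved by expanding
  the double sum of (y_i - y_j)(y_i^k - y_j^k), whose terms are nonnegative.\<close>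

lemma weighted_power_mean:
 fixes w y :: "'a => real"
 assumes J: "finite J" and w: "!!j. j \<in> J ==> w j >= 0" and y: "!!j. j \<in> J ==> y j >= 0"
 shows "(\<Sum>j\<in>J. w j * y j) ^ Suc n <= (\<Sum>j\<in>J. w j) ^ n * (\<Sum>j\<in>J. w j * y j ^ Suc n)"
proof (induction n)
 case (Suc n)
 define S where "S k = (\<Sum>j\<in>J. w j * y j ^ k)" for k
 have S0: "S k >= 0" for k unfolding S_def using w y by (intro sum_nonneg mult_nonneg_nonneg) auto
 have cheb: "S 1 * S (Suc n) <= S 0 * S (Suc (Suc n))"
 proof -
  have nn: "0 <= (y i - y j) * (y i ^ Suc n - y j ^ Suc n)" if ij: "i \<in> J" "j \<in> J" for i j
  proof (cases "y i <= y j")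
   case True
   hence "y i ^ Suc n <= y j ^ Suc n" using y ij by (intro power_mono) auto
   thus ?thesis using True by (intro mult_nonpos_nonpos) auto
  next
   case False
   hence "y j ^ Suc n <= y i ^ Suc n" using y ij by (intro power_mono) auto
   thus ?thesis using False by (intro mult_nonneg_nonneg) auto
  qed
  have "0 <= (\<Sum>i\<in>J. \<Sum>j\<in>J. w i * w j * ((y i - y j) * (y i ^ Suc n - y j ^ Suc n)))"
   by (intro sum_nonneg mult_nonneg_nonneg[OF mult_nonneg_nonneg] nn w)
  also have "... = (\<Sum>i\<in>J. \<Sum>j\<in>J. (w i * y i ^ Suc (Suc n)) * (w j * y j ^ 0)) + (\<Sum>i\<in>J. \<Sum>j\<in>J. (w i * y i ^ 0) * (w j * y j ^ Suc (Suc n)))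
    - (\<Sum>i\<in>J. \<Sum>j\<in>J. (w i * y i ^ 1) * (w j * y j ^ Suc n)) - (\<Sum>i\<in>J. \<Sum>j\<in>J. (w i * y i ^ Suc n) * (w j * y j ^ 1))"
   by (simp add: algebra_simps flip: sum.distrib sum_subtractf)
  also have "... = S (Suc (Suc n)) * S 0 + S 0 * S (Suc (Suc n)) - S 1 * S (Suc n) - S (Suc n) * S 1"
   unfolding S_def sum_product ..
  finally show ?thesis by (simp add: mult.commute)
 qed
 have "(\<Sum>j\<in>J. w j * y j) ^ Suc (Suc n) = S 1 * (\<Sum>j\<in>J. w j * y j) ^ Suc n" by (simp add: S_def)
 also have "... <= S 1 * (S 0 ^ n * S (Suc n))" using Suc S0[of 1] by (intro mult_left_mono) (auto simp: S_def)
 also have "... = S 0 ^ n * (S 1 * S (Suc n))" by simp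
 also have "... <= S 0 ^ n * (S 0 * S (Suc (Suc n)))" using S0[of 0] cheb by (intro mult_left_mono) auto
 finally show ?case by (simp add: S_def mult_ac)
qed simp

lemma cauchy_schwarz_complex:
 fixes a b :: "'a => complex"
 shows "norm (\<Sum>n\<in>S. a n * b n) ^ 2 <= (\<Sum>n\<in>S. norm (a n) ^ 2) * (\<Sum>n\<in>S. norm (b n) ^ 2)"
proof -
 have "norm (\<Sum>n\<in>S. a n * b n) <= (\<Sum>n\<in>S. norm (a n) * norm (b n))"
  by (rule order_trans[OF norm_sum]) (simp add: norm_mult)
 hence "norm (\<Sum>n\<in>S. a n * b n) ^ 2 <= (\<Sum>n\<in>S. norm (a n) * norm (b n)) ^ 2" by (intro power_mono) auto
 also have "... <= (\<Sum>n\<in>S. norm (a n) ^ 2) * (\<Sum>n\<in>S. norm (b n) ^ 2)" by (rule Cauchy_Schwarz_ineq_sum)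
 finally show ?thesis .
qed

text \<open>The hypothesis is applied to the conjugates of the sums to be estimated; after the
  Cauchy-Schwarz inequality the quantity \<open>L\<close> occurs squared on the left and once on the
  right.\<close>

lemma duality:
 fixes k :: "'a => 'b => complex"
 assumes *: "!!c. (\<Sum>n\<in>S. norm (\<Sum>j\<in>J. c j * k n j) ^ 2) <= \<Lambda> * (\<Sum>j\<in>J. norm (c j) ^ 2)"
  and \<Lambda>: "\<Lambda> >= 0"
 shows "(\<Sum>j\<in>J. norm (\<Sum>n\<in>S. b n * k n j) ^ 2) <= \<Lambda> * (\<Sum>n\<in>S. norm (b n) ^ 2)"
proof -
 define B where "B j = (\<Sum>n\<in>S. b n * k n j)" for j
 define L where "L = (\<Sum>j\<in>J. norm (B j) ^ 2)"
 define N where "N = (\<Sum>n\<in>S. norm (b n) ^ 2)"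
 have L0: "L >= 0" "N >= 0" by (auto simp: L_def N_def intro: sum_nonneg)
 have "complex_of_real L = (\<Sum>j\<in>J. B j * cnj (B j))" unfolding L_def of_real_sum complex_norm_square ..
 also have "... = (\<Sum>j\<in>J. \<Sum>n\<in>S. b n * (cnj (B j) * k n j))"
 proof (rule sum.cong)
  fix j
  have "B j * cnj (B j) = (\<Sum>n\<in>S. b n * k n j) * cnj (B j)" by (simp only: B_def[of j])
  also have "... = (\<Sum>n\<in>S. b n * (cnj (B j) * k n j))" unfolding sum_distrib_right by (simp only: mult_ac)
  finally show "B j * cnj (B j) = (\<Sum>n\<in>S. b n * (cnj (B j) * k n j))" .
 qed simp
 also have "... = (\<Sum>n\<in>S. b n * (\<Sum>j\<in>J. cnj (B j) * k n j))"
  by (subst sum.swap) (simp add: sum_distrib_left)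
 finally have "norm (complex_of_real L) ^ 2 <= N * (\<Sum>n\<in>S. norm (\<Sum>j\<in>J. cnj (B j) * k n j) ^ 2)"
  unfolding N_def by (simp only: cauchy_schwarz_complex)
 also have "... <= N * (\<Lambda> * (\<Sum>j\<in>J. norm (cnj (B j)) ^ 2))" by (intro mult_left_mono * L0)
 also have "(\<Sum>j\<in>J. norm (cnj (B j)) ^ 2) = L" by (simp add: L_def)
 finally have "L * L <= (\<Lambda> * N) * L" unfolding norm_of_real by (simp add: power2_eq_square mult_ac)
 hence "L <= \<Lambda> * N" using L0 \<Lambda> by (cases "L = 0") (auto simp: mult_le_cancel_right)
 thus ?thesis by (simp add: L_def N_def B_def)
qed

section \<open>Exponential sums over well-spaced points\<close>

lemma sin_ge_half:
 fixes x :: real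
 assumes "0 <= x" "x <= pi / 2"
 shows "x / 2 <= sin x"
proof -
 have "\<bar>sin x - (\<Sum>m<3. sin_coeff m * x ^ m)\<bar> <= inverse (fact 3) * \<bar>x\<bar> ^ 3" by (rule Maclaurin_sin_bound)
 moreover have "(\<Sum>m<3. sin_coeff m * x ^ m) = x" by (simp add: eval_nat_numeral sin_coeff_def)
 moreover have "inverse (fact 3) * \<bar>x\<bar> ^ 3 = x * (x * x) / 6" using assms by (simp add: eval_nat_numeral)
 ultimately have 1: "sin x >= x - x * (x * x) / 6" by linarith
 have "pi <= 32 / 10" by (rule order_trans[OF pi_approx(2)]) simp
 hence "x <= 16 / 10" using assms by linarith
 hence "x * x <= (16 / 10) * (16 / 10)" using assms by (intro mult_mono) auto
 hence "x * x <= 3" by simp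
 hence "x * (x * x) <= x * 3" using assms by (intro mult_left_mono) auto
 thus ?thesis using 1 by linarith
qed

definition ee :: "real => complex" where "ee t = cis (2 * pi * t)"

lemma ee_add: "ee (s + t) = ee s * ee t" by (simp add: ee_def cis_mult distrib_left)
lemma ee_minus: "ee (- t) = cnj (ee t)" by (simp add: ee_def cis_cnj)
lemma ee_power: "ee t ^ n = ee (real n * t)" unfolding ee_def by (simp only: Complex.DeMoivre mult.left_commute)
lemma norm_ee [simp]: "norm (ee t) = 1" by (simp add: ee_def)
lemma ee_0 [simp]: "ee 0 = 1" by (simp add: ee_def)
lemma ee_int [simp]: "ee (of_int k) = 1"
 unfolding ee_def using cos_int_2pin[of k] sin_int_2pin[of k] by (simp add: complex_eq_iff)

lemma ee_add_int: "ee (t + of_int k) = ee t" by (simp add: ee_add)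

lemma ee_eq_iff_int: "ee t = 1 \<longleftrightarrow> t \<in> \<int>"
proof
 assume "ee t = 1"
 hence "cos (2 * pi * t) = 1" by (simp add: ee_def complex_eq_iff)
 then obtain k :: int where "2 * pi * t = of_int k * 2 * pi" using cos_one_2pi_int[of "2 * pi * t"] by blast
 hence "t = of_int k" by simp
 thus "t \<in> \<int>" by simp
qed (auto elim!: Ints_cases)

lemma norm_one_minus_ee:
 assumes "\<bar>b\<bar> <= 1 / 2"
 shows "norm (1 - ee b) >= 2 * \<bar>b\<bar>"
proof -
 have "pi * \<bar>b\<bar> / 2 <= sin (pi * \<bar>b\<bar>)"
  using assms by (intro sin_ge_half) auto
 moreover have "3 * \<bar>b\<bar> <= pi * \<bar>b\<bar>" using pi_gt3 by (intro mult_right_mono) auto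
 ultimately have s: "\<bar>b\<bar> <= sin (pi * \<bar>b\<bar>)" by simp
 have "norm (1 - ee b) ^ 2 = (1 - cos (2 * (pi * b))) ^ 2 + sin (2 * (pi * b)) ^ 2"
  by (simp add: ee_def cmod_power2 mult.assoc)
 also have "... = 2 - 2 * cos (2 * (pi * b))" 
  using sin_cos_squared_add[of "2 * (pi * b)"] by (simp add: power2_eq_square algebra_simps)
 also have "... = (2 * sin (pi * b)) ^ 2" by (simp add: cos_double_sin power_mult_distrib)
 also have "sin (pi * b) ^ 2 = sin (pi * \<bar>b\<bar>) ^ 2" by (cases "b >= 0") auto
 hence "(2 * sin (pi * b)) ^ 2 = (2 * sin (pi * \<bar>b\<bar>)) ^ 2" by (simp add: power_mult_distrib)
 finally have "norm (1 - ee b) = 2 * sin (pi * \<bar>b\<bar>)" using s by (subst (asm) power2_eq_iff_nonneg) auto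
 thus ?thesis using s by simp
qed

lemma norm_geometric_ee:
 assumes "\<bar>b\<bar> <= 1 / 2"
 shows "norm (\<Sum>m<n. ee (real m * b)) * \<bar>b\<bar> <= 1"
proof -
 define z where "z = ee b"
 have "(1 - z) * (\<Sum>m<n. z ^ m) = 1 - z ^ n" by (simp add: one_diff_power_eq)
 hence "norm (1 - z) * norm (\<Sum>m<n. z ^ m) = norm (1 - z ^ n)" by (metis norm_mult)
 also have "... <= norm (1::complex) + norm (z ^ n)" by (rule norm_triangle_ineq4)
 also have "... = 2" by (simp add: z_def norm_power)
 finally have "norm (1 - z) * norm (\<Sum>m<n. z ^ m) <= 2" .
 moreover have "2 * \<bar>b\<bar> * norm (\<Sum>m<n. z ^ m) <= norm (1 - z) * norm (\<Sum>m<n. z ^ m)"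
  unfolding z_def by (intro mult_right_mono norm_one_minus_ee assms) auto
 ultimately show ?thesis by (simp add: z_def ee_power mult_ac)
qed


lemma sum_inverse_squares_int:
 assumes T: "finite T" and T2: "!!j. j \<in> T ==> (j::int) >= 2"
 shows "(\<Sum>j\<in>T. 1 / (of_int j - 1) ^ 2) <= (4::real)"
proof -
 have inj: "inj_on (%j. nat (j - 1)) T"
  using T2 by (intro inj_onI) fastforce
 have "(\<Sum>j\<in>T. 1 / (of_int j - 1) ^ 2 :: real) = (\<Sum>j\<in>T. 1 / real (nat (j - 1)) ^ 2)"
 proof (rule sum.cong)
  fix j assume "j \<in> T"
  from T2[OF this] show "1 / (of_int j - 1) ^ 2 = 1 / real (nat (j - 1)) ^ 2" by simp
 qed simp
 also have "... = (\<Sum>n\<in>(%j. nat (j - 1)) ` T. 1 / real n ^ 2)"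
  by (subst sum.reindex[OF inj]) simp
 also have "... <= 2 / (1 / 2)"
  by (rule sum_inverse_squares_tail) (use T T2 in force)+
 finally show ?thesis by simp
qed

lemma sum_swap4:
 "(\<Sum>m\<in>A. \<Sum>l\<in>B. \<Sum>a\<in>C. \<Sum>b\<in>D. f m l a b) = (\<Sum>a\<in>C. \<Sum>b\<in>D. \<Sum>m\<in>A. \<Sum>l\<in>B. f m l a b)"
proof -
 have "(\<Sum>m\<in>A. \<Sum>l\<in>B. \<Sum>a\<in>C. \<Sum>b\<in>D. f m l a b) = (\<Sum>m\<in>A. \<Sum>a\<in>C. \<Sum>l\<in>B. \<Sum>b\<in>D. f m l a b)"
  by (intro sum.cong refl sum.swap)
 also have "... = (\<Sum>a\<in>C. \<Sum>m\<in>A. \<Sum>l\<in>B. \<Sum>b\<in>D. f m l a b)" by (rule sum.swap)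
 also have "... = (\<Sum>a\<in>C. \<Sum>m\<in>A. \<Sum>b\<in>D. \<Sum>l\<in>B. f m l a b)" by (intro sum.cong refl sum.swap)
 also have "... = (\<Sum>a\<in>C. \<Sum>b\<in>D. \<Sum>m\<in>A. \<Sum>l\<in>B. f m l a b)" by (intro sum.cong refl sum.swap)
 finally show ?thesis .
qed

text \<open>The sharp cut-off in \<open>n\<close> is replaced by a Fejer-type weight, so that the
  kernel of the quadratic form is the square of a geometric sum and decays quadratically. Since the
  points lie within 1/2 of each other, no distance has to be taken modulo 1.\<close>

lemma large_sieve_dual:
 fixes P :: "real set" and c :: "real => complex" and Y :: nat
 assumes P: "finite P" and Y: "Y >= 1" and close: "!!a b. a \<in> P ==> b \<in> P ==> \<bar>a - b\<bar> <= 1 / 2"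
  and sp: "!!a b. a \<in> P ==> b \<in> P ==> a ~= b ==> 1 / real Y <= \<bar>a - b\<bar>"
 shows "(\<Sum>n=1..Y. norm (\<Sum>a\<in>P. c a * ee (real n * a)) ^ 2) <= 20 * real Y * (\<Sum>a\<in>P. norm (c a) ^ 2)"
proof -
 define T where "T k = (\<Sum>a\<in>P. c a * ee (k * a))" for k :: real
 define Q where "Q = (\<Sum>m<2*Y. \<Sum>l<2*Y. norm (T (real m - real l)) ^ 2)"
 define D where "D b = (\<Sum>m<2*Y. ee (real m * b))" for b
 define L where "L = (\<Sum>n=1..Y. norm (T (real n)) ^ 2)"
 define S where "S = (\<Sum>a\<in>P. norm (c a) ^ 2)"
 \<comment> \<open>Each \<open>n\<close> up to \<open>Y\<close> is a difference \<open>m - l\<close>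
   with \<open>m, l < 2 * Y\<close> in at least \<open>Y\<close> ways, one for every
   \<open>l < Y\<close>.\<close>
 have "real Y * L = (\<Sum>n=1..Y. \<Sum>l<Y. norm (T (real n)) ^ 2)" by (simp add: L_def sum_distrib_left)
 also have "... = (\<Sum>(n,l)\<in>{1..Y} \<times> {..<Y}. norm (T (real n)) ^ 2)" by (rule sum.cartesian_product)
 also have "... = (\<Sum>(m,l)\<in>(%(n,l). (n + l, l)) ` ({1..Y} \<times> {..<Y}). norm (T (real m - real l)) ^ 2)"
  by (subst sum.reindex) (auto simp: inj_on_def intro!: sum.cong)
 also have "... <= (\<Sum>(m,l)\<in>{..<2*Y} \<times> {..<2*Y}. norm (T (real m - real l)) ^ 2)"
  by (rule sum_mono2) auto
 also have "... = Q" unfolding Q_def by (rule sum.cartesian_product[symmetric])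
 finally have low: "real Y * L <= Q" .
 have "complex_of_real Q = (\<Sum>m<2*Y. \<Sum>l<2*Y. \<Sum>a\<in>P. \<Sum>b\<in>P. c a * cnj (c b) * (ee (real m * (a - b)) * cnj (ee (real l * (a - b)))))"
  unfolding Q_def of_real_sum complex_norm_square
 proof (intro sum.cong refl)
  fix m l
  have "T (real m - real l) * cnj (T (real m - real l)) = (\<Sum>a\<in>P. \<Sum>b\<in>P. (c a * ee ((real m - real l) * a)) * cnj (c b * ee ((real m - real l) * b)))"
   unfolding T_def cnj_sum by (rule sum_product)
  also have "... = (\<Sum>a\<in>P. \<Sum>b\<in>P. c a * cnj (c b) * (ee (real m * (a - b)) * cnj (ee (real l * (a - b)))))"
  proof (intro sum.cong refl)
   fix a b
   have "ee ((real m - real l) * a) * cnj (ee ((real m - real l) * b)) = ee ((real m - real l) * (a - b))"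
    unfolding ee_minus[symmetric] ee_add[symmetric] by (simp add: algebra_simps)
   also have "... = ee (real m * (a - b)) * cnj (ee (real l * (a - b)))"
    unfolding ee_minus[symmetric] ee_add[symmetric] by (simp add: algebra_simps)
   finally show "(c a * ee ((real m - real l) * a)) * cnj (c b * ee ((real m - real l) * b)) =
     c a * cnj (c b) * (ee (real m * (a - b)) * cnj (ee (real l * (a - b))))" by (simp add: mult_ac)
  qed
  finally show "T (real m - real l) * cnj (T (real m - real l)) = ..." .
 qed
 also have "... = (\<Sum>a\<in>P. \<Sum>b\<in>P. \<Sum>m<2*Y. \<Sum>l<2*Y. c a * cnj (c b) * (ee (real m * (a - b)) * cnj (ee (real l * (a - b)))))"
  by (rule sum_swap4)
 also have "... = (\<Sum>a\<in>P. \<Sum>b\<in>P. c a * cnj (c b) * of_real (norm (D (a - b)) ^ 2))"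
 proof (intro sum.cong refl)
  fix a b
  show "(\<Sum>m<2*Y. \<Sum>l<2*Y. c a * cnj (c b) * (ee (real m * (a - b)) * cnj (ee (real l * (a - b))))) =
    c a * cnj (c b) * of_real (norm (D (a - b)) ^ 2)"
   unfolding complex_norm_square D_def cnj_sum sum_product by (simp only: sum_distrib_left)
 qed
 finally have Qeq: "complex_of_real Q = (\<Sum>a\<in>P. \<Sum>b\<in>P. c a * cnj (c b) * of_real (norm (D (a - b)) ^ 2))" .
 have Dsym: "norm (D (a - b)) = norm (D (b - a))" for a b
 proof -
  have "D (b - a) = cnj (D (a - b))"
   unfolding D_def cnj_sum ee_minus[symmetric] by (simp add: algebra_simps)
  thus ?thesis by simp
 qed
 have "Q <= norm (complex_of_real Q)" by simp
 also have "... <= (\<Sum>a\<in>P. \<Sum>b\<in>P. (norm (c a) ^ 2 + norm (c b) ^ 2) / 2 * norm (D (a - b)) ^ 2)"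
  unfolding Qeq
 proof (intro order_trans[OF norm_sum] sum_mono)
  fix a b
  have "0 <= (norm (c a) - norm (c b)) ^ 2" by simp
  hence "norm (c a) * norm (c b) <= (norm (c a) ^ 2 + norm (c b) ^ 2) / 2" by (simp add: power2_eq_square algebra_simps)
  hence "norm (c a) * norm (c b) * norm (D (a - b)) ^ 2 <= (norm (c a) ^ 2 + norm (c b) ^ 2) / 2 * norm (D (a - b)) ^ 2"
   by (rule mult_right_mono) simp
  thus "norm (c a * cnj (c b) * of_real (norm (D (a - b)) ^ 2)) <= (norm (c a) ^ 2 + norm (c b) ^ 2) / 2 * norm (D (a - b)) ^ 2"
   by (simp add: norm_mult norm_power)
 qed
 also have "... = (\<Sum>a\<in>P. \<Sum>b\<in>P. norm (c a) ^ 2 / 2 * norm (D (a - b)) ^ 2) + (\<Sum>a\<in>P. \<Sum>b\<in>P. norm (c b) ^ 2 / 2 * norm (D (a - b)) ^ 2)"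
  by (simp add: sum.distrib[symmetric] add_divide_distrib distrib_right)
 also have "(\<Sum>a\<in>P. \<Sum>b\<in>P. norm (c b) ^ 2 / 2 * norm (D (a - b)) ^ 2) = (\<Sum>a\<in>P. \<Sum>b\<in>P. norm (c a) ^ 2 / 2 * norm (D (a - b)) ^ 2)"
  unfolding sum.swap[of "%a b. norm (c b) ^ 2 / 2 * norm (D (a - b)) ^ 2"] by (subst Dsym) simp
 also have "(\<Sum>a\<in>P. \<Sum>b\<in>P. norm (c a) ^ 2 / 2 * norm (D (a - b)) ^ 2) + (\<Sum>a\<in>P. \<Sum>b\<in>P. norm (c a) ^ 2 / 2 * norm (D (a - b)) ^ 2)
   = (\<Sum>a\<in>P. norm (c a) ^ 2 * (\<Sum>b\<in>P. norm (D (a - b)) ^ 2))"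
  by (simp add: sum_distrib_left flip: sum.distrib)
 also have "... <= (\<Sum>a\<in>P. norm (c a) ^ 2 * (20 * real Y ^ 2))"
 proof (intro sum_mono mult_left_mono)
  fix a assume a: "a \<in> P"
  \<comment> \<open>The points are sorted into cells of width 1/Y, each containing at most one of
    them. The three cells around \<open>a\<close> cost 4 each, the remaining ones at most 4 on
    either side, in total 20.\<close>
  define g where "g j = (if \<bar>j\<bar> <= 1 then 4 else 1 / (of_int \<bar>j\<bar> - 1) ^ 2 :: real)" for j :: int
  define k where "k b = \<lfloor>b * real Y\<rfloor> - \<lfloor>a * real Y\<rfloor>" for b
  have Y0: "real Y > 0" using Y by simp
  have inj: "inj_on k P"
  proof (rule inj_onI, rule ccontr)
   fix b b' assume b: "b \<in> P" "b' \<in> P" "k b = k b'" "b ~= b'"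
   have "\<lfloor>b * real Y\<rfloor> = \<lfloor>b' * real Y\<rfloor>" using b(3) by (simp add: k_def)
   hence "\<bar>b * real Y - b' * real Y\<bar> < 1" by linarith
   moreover have "\<bar>b * real Y - b' * real Y\<bar> = \<bar>b - b'\<bar> * real Y" using Y0 by (simp add: abs_mult flip: left_diff_distrib)
   moreover have "1 / real Y * real Y <= \<bar>b - b'\<bar> * real Y" using sp[OF b(1,2,4)] by (rule mult_right_mono) simp
   ultimately show False using Y0 by simp
  qed
  have Dle: "norm (D (a - b)) ^ 2 <= real Y ^ 2 * g (k b)" if b: "b \<in> P" for b
  proof (cases "\<bar>k b\<bar> <= 1")
   case True
   have "norm (D (a - b)) <= (\<Sum>m<2*Y. norm (ee (real m * (a - b))))" unfolding D_def by (rule norm_sum)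
   hence "norm (D (a - b)) <= 2 * real Y" by simp
   hence "norm (D (a - b)) ^ 2 <= (2 * real Y) ^ 2" by (intro power_mono) auto
   thus ?thesis using True by (simp add: g_def power_mult_distrib)
  next
   case False
   define u where "u = real_of_int \<bar>k b\<bar> - 1"
   have u: "u >= 1" using False by (simp add: u_def)
   have "\<bar>b * real Y - a * real Y\<bar> >= u" unfolding u_def k_def by linarith
   moreover have "\<bar>b * real Y - a * real Y\<bar> = \<bar>a - b\<bar> * real Y" using Y0 by (simp add: abs_mult abs_minus_commute flip: left_diff_distrib)
   ultimately have uY: "u <= \<bar>a - b\<bar> * real Y" by simp
   have "norm (D (a - b)) * u <= norm (D (a - b)) * (\<bar>a - b\<bar> * real Y)" using uY by (intro mult_left_mono) auto
   also have "... = norm (D (a - b)) * \<bar>a - b\<bar> * real Y" by simp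
   also have "... <= 1 * real Y" unfolding D_def by (intro mult_right_mono norm_geometric_ee close a b) auto
   finally have "norm (D (a - b)) <= real Y / u" using u by (simp add: field_simps)
   hence "norm (D (a - b)) ^ 2 <= (real Y / u) ^ 2" by (intro power_mono) auto
   thus ?thesis using False by (simp add: g_def u_def power_divide)
  qed
  have "(\<Sum>b\<in>P. norm (D (a - b)) ^ 2) <= (\<Sum>b\<in>P. real Y ^ 2 * g (k b))" by (intro sum_mono Dle)
  also have "... = real Y ^ 2 * (\<Sum>j\<in>k ` P. g j)" by (simp add: sum.reindex[OF inj] sum_distrib_left)
  also have "real Y ^ 2 * (\<Sum>j\<in>k ` P. g j) <= real Y ^ 2 * 20"
  proof (rule mult_left_mono)
   define J where "J = k ` P"
   have J: "finite J" using P by (simp add: J_def)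
   have g0: "g j >= 0" for j by (simp add: g_def)
   have "(\<Sum>j\<in>J. g j) <= (\<Sum>j\<in>{-1,0,1} \<union> (J \<inter> {2..} \<union> J \<inter> {..-2}). g j)"
    using J g0 by (intro sum_mono2) auto
   also have "... = (\<Sum>j\<in>{-1,0,1}. g j) + ((\<Sum>j\<in>J \<inter> {2..}. g j) + (\<Sum>j\<in>J \<inter> {..-2}. g j))"
    using J by (subst sum.union_disjoint, simp, simp, force, subst sum.union_disjoint) auto
   also have "(\<Sum>j\<in>{-1,0,1}. g j) = 12" by (simp add: g_def)
   also have "(\<Sum>j\<in>J \<inter> {2..}. g j) = (\<Sum>j\<in>J \<inter> {2..}. 1 / (of_int j - 1) ^ 2)"
    by (intro sum.cong) (auto simp: g_def)
   also have "... <= 4" by (rule sum_inverse_squares_int) (use J in auto)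
   also have "(\<Sum>j\<in>J \<inter> {..-2}. g j) = (\<Sum>j\<in>uminus ` (J \<inter> {..-2}). 1 / (of_int j - 1) ^ 2)"
    by (subst sum.reindex) (auto simp: g_def intro!: sum.cong)
   also have "... <= 4" by (rule sum_inverse_squares_int) (use J in auto)
   finally show "(\<Sum>j\<in>k ` P. g j) <= 20" by (simp add: J_def)
  qed simp
  finally show "(\<Sum>b\<in>P. norm (D (a - b)) ^ 2) <= 20 * real Y ^ 2" by (simp add: mult.commute)
 qed auto
 also have "... = real Y * (20 * real Y * S)" by (simp add: S_def power2_eq_square sum_distrib_left mult_ac)
 finally have "real Y * L <= real Y * (20 * real Y * S)" using low by linarith
 thus ?thesis using Y by (simp add: L_def S_def T_def)
qed

text \<open>Splitting the unit interval at 1/2 costs a factor 2 and replaces the distance on the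
  circle by the ordinary one.\<close>

lemma large_sieve:
 fixes P :: "real set" and b :: "nat => complex" and Y :: nat
 assumes P: "finite P" and Y: "Y >= 1" and P01: "P \<subseteq> {0..1}"
  and sp: "!!a b. a \<in> P ==> b \<in> P ==> a ~= b ==> 1 / real Y <= \<bar>a - b\<bar>"
 shows "(\<Sum>a\<in>P. norm (\<Sum>n=1..Y. b n * ee (real n * a)) ^ 2) <= 40 * real Y * (\<Sum>n=1..Y. norm (b n) ^ 2)"
proof -
 have half: "(\<Sum>a\<in>P'. norm (\<Sum>n=1..Y. b n * ee (real n * a)) ^ 2) <= 20 * real Y * (\<Sum>n=1..Y. norm (b n) ^ 2)"
  if "P' \<subseteq> P" "!!a b. a \<in> P' ==> b \<in> P' ==> \<bar>a - b\<bar> <= 1 / 2" for P'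
 proof (rule duality)
  show "(\<Sum>n=1..Y. norm (\<Sum>j\<in>P'. c j * ee (real n * j)) ^ 2) <= 20 * real Y * (\<Sum>j\<in>P'. norm (c j) ^ 2)" for c
  proof (rule large_sieve_dual)
   fix a b assume "a \<in> P'" "b \<in> P'" "a ~= b"
   thus "1 / real Y <= \<bar>a - b\<bar>" using that(1) by (intro sp) auto
  qed (use that finite_subset[OF that(1) P] Y in auto)
 qed simp
 define f where "f a = norm (\<Sum>n=1..Y. b n * ee (real n * a)) ^ 2" for a
 have "(\<Sum>a\<in>P. f a) = (\<Sum>a\<in>P \<inter> {..1/2}. f a) + (\<Sum>a\<in>P - {..1/2}. f a)" by (rule sum.Int_Diff[OF P])
 moreover have "(\<Sum>a\<in>P \<inter> {..1/2}. f a) <= 20 * real Y * (\<Sum>n=1..Y. norm (b n) ^ 2)"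
  unfolding f_def
 proof (rule half)
  fix a b assume "a \<in> P \<inter> {..1/2}" "b \<in> P \<inter> {..1/2}"
  hence "0 <= a" "a <= 1" "0 <= b" "b <= 1" "a <= 1/2" "b <= 1/2" using P01 by auto
  thus "\<bar>a - b\<bar> <= 1 / 2" by linarith
 qed auto
 moreover have "(\<Sum>a\<in>P - {..1/2}. f a) <= 20 * real Y * (\<Sum>n=1..Y. norm (b n) ^ 2)"
  unfolding f_def
 proof (rule half)
  fix a b assume "a \<in> P - {..1/2}" "b \<in> P - {..1/2}"
  hence "0 <= a" "a <= 1" "0 <= b" "b <= 1" "1/2 <= a" "1/2 <= b" using P01 by auto
  thus "\<bar>a - b\<bar> <= 1 / 2" by linarith
 qed auto
 ultimately show ?thesis by (simp add: f_def)
qed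

section \<open>Convolution powers\<close>

text \<open>The coefficients of the r-th power of the Dirichlet series of \<open>F\<close>.\<close>

fun dpow :: "(nat => 'a::comm_semiring_1) => nat => nat => 'a" where
 "dpow F 0 n = (if n = 1 then 1 else 0)"
| "dpow F (Suc r) n = (\<Sum>a | a dvd n. F a * dpow F r (n div a))"

lemma sum_divisor_pairs:
 fixes f :: "nat => nat => 'a::comm_monoid_add"
 shows "(\<Sum>n=1..Z. \<Sum>a | a dvd n. f a (n div a)) = (\<Sum>(a,m)\<in>{(a,m). a >= 1 \<and> m >= 1 \<and> a * m <= Z}. f a m)"
proof -
 have "(\<Sum>n=1..Z. \<Sum>a | a dvd n. f a (n div a)) = (\<Sum>(n,a)\<in>Sigma {1..Z} (%n. {a. a dvd n}). f a (n div a))"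
  by (rule sum.Sigma) auto
 also have "... = (\<Sum>(a,m)\<in>{(a,m). a >= 1 \<and> m >= 1 \<and> a * m <= Z}. f a m)"
 proof (rule sum.reindex_bij_witness[of _ "%(a,m). (a * m, a)" "%(n,a). (a, n div a)"])
  fix x assume "x \<in> Sigma {1..Z} (%n. {a. a dvd n})"
  then obtain n a where x: "x = (n, a)" "1 <= n" "n <= Z" "a dvd n" by auto
  have "a > 0" using x by (auto intro: Nat.gr0I)
  moreover have "n div a > 0" using x dvd_div_eq_0_iff[of a n] by auto
  ultimately show "(case x of (n, a) => (a, n div a)) \<in> {(a,m). a >= 1 \<and> m >= 1 \<and> a * m <= Z}"
   using x by (auto simp: Suc_le_eq)
 qed auto
 finally show ?thesis .
qed

lemma finite_pairs: "finite {(a,m). a >= 1 \<and> m >= 1 \<and> a * m <= (Z::nat)}"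
proof (rule finite_subset)
 show "{(a,m). a >= 1 \<and> m >= 1 \<and> a * m <= Z} \<subseteq> {1..Z} \<times> {1..Z}"
 proof clarify
  fix a m :: nat assume am: "a >= 1" "m >= 1" "a * m <= Z"
  have "a <= Z" "m <= Z" using order_trans[OF _ am(3), of a] order_trans[OF _ am(3), of m] am by auto
  thus "a \<in> {1..Z} \<and> m \<in> {1..Z}" using am by simp
 qed
qed auto


lemma dpow_support:
 assumes F: "!!a. a > M ==> F a = 0" and n: "n > M ^ r"
 shows "dpow F r n = 0"
 using n
proof (induction r arbitrary: n)
 case (Suc r)
 have "F a * dpow F r (n div a) = 0" if "a dvd n" for a
 proof (cases "a > M")
  case False
  have "n div a > M ^ r"
  proof (rule ccontr)
   assume "\<not> n div a > M ^ r"
   hence "a * (n div a) <= M * M ^ r" using False by (intro mult_le_mono) auto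
   thus False using that Suc.prems by simp
  qed
  thus ?thesis using Suc.IH by simp
 qed (use F in simp)
 thus ?case by simp
qed simp

lemma dpow_step:
 fixes F G :: "nat => 'a::comm_ring_1"
 assumes F: "!!a. a > M ==> F a = 0"
 shows "(\<Sum>n=1..M^Suc r. \<Sum>a | a dvd n. F a * G a * (dpow F r (n div a) * G (n div a))) =
  (\<Sum>a=1..M. F a * G a) * (\<Sum>m=1..M^r. dpow F r m * G m)"
proof -
 define Q where "Q = {(a,m). a >= 1 \<and> m >= 1 \<and> a * m <= M ^ Suc r}"
 have "(\<Sum>n=1..M^Suc r. \<Sum>a | a dvd n. F a * G a * (dpow F r (n div a) * G (n div a))) = (\<Sum>(a,m)\<in>Q. F a * G a * (dpow F r m * G m))"
  unfolding Q_def by (rule sum_divisor_pairs)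
 also have "... = (\<Sum>(a,m)\<in>{1..M} \<times> {1..M^r}. F a * G a * (dpow F r m * G m))"
 proof (rule sum.mono_neutral_right)
  show "finite Q" unfolding Q_def by (rule finite_pairs)
  show "{1..M} \<times> {1..M^r} \<subseteq> Q" by (auto simp: Q_def intro: mult_le_mono)
  show "\<forall>i\<in>Q - {1..M} \<times> {1..M^r}. (case i of (a,m) => F a * G a * (dpow F r m * G m)) = 0"
  proof
   fix i assume "i \<in> Q - {1..M} \<times> {1..M^r}"
   moreover obtain a m where i: "i = (a,m)" by (cases i)
   ultimately have "a > M \<or> m > M ^ r" by (auto simp: Q_def)
   hence "F a = 0 \<or> dpow F r m = 0" using F dpow_support[where F = F and M = M and r = r and n = m] by blast
   thus "(case i of (a,m) => F a * G a * (dpow F r m * G m)) = 0" by (auto simp: i)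
  qed
 qed
 also have "... = (\<Sum>a=1..M. F a * G a) * (\<Sum>m=1..M^r. dpow F r m * G m)"
  unfolding sum.cartesian_product[symmetric] sum_product ..
 finally show ?thesis .
qed

lemma dpow_sum:
 fixes F X :: "nat => complex"
 assumes F: "!!a. a > M ==> F a = 0" and X: "!!m n. X (m * n) = X m * X n" and X1: "X 1 = 1"
 shows "(\<Sum>n=1..M^r. dpow F r n * X n) = (\<Sum>a=1..M. F a * X a) ^ r"
proof (induction r)
 case 0
 show ?case using X1 by simp
next
 case (Suc r)
 have "(\<Sum>n=1..M^Suc r. dpow F (Suc r) n * X n) = (\<Sum>n=1..M^Suc r. \<Sum>a | a dvd n. F a * X a * (dpow F r (n div a) * X (n div a)))"
 proof (rule sum.cong)
  fix n
  have "F a * dpow F r (n div a) * X n = F a * X a * (dpow F r (n div a) * X (n div a))" if "a dvd n" for a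
   using X[of a "n div a"] that by simp
  thus "dpow F (Suc r) n * X n = (\<Sum>a | a dvd n. F a * X a * (dpow F r (n div a) * X (n div a)))"
   unfolding dpow.simps sum_distrib_right by (intro sum.cong) auto
 qed simp
 also have "... = (\<Sum>a=1..M. F a * X a) * (\<Sum>m=1..M^r. dpow F r m * X m)" by (rule dpow_step[OF F])
 finally show ?case using Suc by simp
qed

lemma dpow_nonneg: "(!!a. F a >= (0::real)) ==> dpow F r n >= 0"
 by (induction r arbitrary: n) (auto intro!: sum_nonneg)

lemma dpow_mono:
 assumes "!!a. 0 <= (F a::real)" "!!a. F a <= G a"
 shows "dpow F r n <= dpow G r n"
proof (induction r arbitrary: n)
 case (Suc r)
 have G: "0 <= G a" for a using assms order_trans by blast
 show ?case using Suc assms G by (auto intro!: sum_mono mult_mono dpow_nonneg)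
qed simp

lemma norm_dpow_le:
 fixes F :: "nat => complex"
 assumes "!!a. norm (F a) <= B * G a" "B >= 0" "!!a. 0 <= G a"
 shows "norm (dpow F r n) <= B ^ r * dpow G r n"
proof (induction r arbitrary: n)
 case (Suc r)
 have "norm (dpow F (Suc r) n) <= (\<Sum>a | a dvd n. norm (F a * dpow F r (n div a)))"
  unfolding dpow.simps by (rule norm_sum)
 also have "... <= (\<Sum>a | a dvd n. (B * G a) * (B ^ r * dpow G r (n div a)))"
  unfolding norm_mult using assms Suc by (intro sum_mono mult_mono) auto
 also have "... = B ^ Suc r * dpow G (Suc r) n" by (simp add: sum_distrib_left mult_ac)
 finally show ?case .
qed simp

section \<open>Moments of the r-fold divisor function\<close>

definition tauk :: "nat => nat => real" where "tauk = dpow (%_. 1)"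

lemma tauk_nonneg: "tauk r n >= 0" unfolding tauk_def by (rule dpow_nonneg) simp

lemma tauk_Suc: "tauk (Suc r) n = (\<Sum>a | a dvd n. tauk r (n div a))"
 by (simp add: tauk_def)

text \<open>A divisor \<open>a\<close> of \<open>m * n\<close> is determined by the pair of its gcd
  with \<open>m\<close> and the cofactor, which divide \<open>m\<close> and \<open>n\<close>.
  Induction on \<open>r\<close> over this injection gives the bound.\<close>

lemma tauk_submult:
 assumes "m > 0" "n > 0"
 shows "tauk r (m * n) <= tauk r m * tauk r n"
 using assms
proof (induction r arbitrary: m n)
 case 0
 thus ?case by (auto simp: tauk_def)
next
 case (Suc r)
 define h where "h a = (gcd a m, a div gcd a m)" for a
 have inj: "inj_on h {a. a dvd m * n}"
  by (rule inj_onI) (metis h_def dvd_div_mult_self gcd_dvd1 prod.inject)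
 have mem: "fst (h a) dvd m \<and> snd (h a) dvd n \<and> a = fst (h a) * snd (h a)" if "a dvd m * n" for a
 proof -
  have a: "a > 0" using that Suc.prems by (auto intro: Nat.gr0I)
  have g: "gcd a m > 0" using Suc.prems by simp
  have "coprime (a div gcd a m) (m div gcd a m)" using g by (intro div_gcd_coprime) auto
  moreover have "a div gcd a m dvd (m div gcd a m) * n"
  proof -
   have "gcd a m * (a div gcd a m) dvd gcd a m * ((m div gcd a m) * n)" using that by (simp flip: mult.assoc)
   thus ?thesis using g by (simp only: nat_mult_dvd_cancel1)
  qed
  ultimately have "a div gcd a m dvd n" by (simp add: coprime_dvd_mult_right_iff)
  thus ?thesis by (simp add: h_def)
 qed
 have "tauk (Suc r) (m * n) = (\<Sum>a | a dvd m * n. tauk r (m * n div a))" by (rule tauk_Suc)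
 also have "... <= (\<Sum>a | a dvd m * n. tauk r (m div fst (h a)) * tauk r (n div snd (h a)))"
 proof (rule sum_mono)
  fix a assume "a \<in> {a. a dvd m * n}"
  hence a: "fst (h a) dvd m" "snd (h a) dvd n" "a = fst (h a) * snd (h a)" using mem by auto
  have "m * n div a = (m div fst (h a)) * (n div snd (h a))" using a by (metis div_mult_div_if_dvd)
  moreover have "m div fst (h a) > 0" "n div snd (h a) > 0" 
   using a(1,2) Suc.prems dvd_div_eq_0_iff[OF a(1)] dvd_div_eq_0_iff[OF a(2)] by auto
  ultimately show "tauk r (m * n div a) <= tauk r (m div fst (h a)) * tauk r (n div snd (h a))"
   using Suc.IH by simp
 qed
 also have "... = (\<Sum>(b,c)\<in>h ` {a. a dvd m * n}. tauk r (m div b) * tauk r (n div c))"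
  unfolding sum.reindex[OF inj] by (simp add: case_prod_beta)
 also have "... <= (\<Sum>(b,c)\<in>{b. b dvd m} \<times> {c. c dvd n}. tauk r (m div b) * tauk r (n div c))"
 proof (rule sum_mono2)
  show "finite ({b. b dvd m} \<times> {c. c dvd n})" using Suc.prems by simp
  show "h ` {a. a dvd m * n} \<subseteq> {b. b dvd m} \<times> {c. c dvd n}"
  proof
   fix x assume "x \<in> h ` {a. a dvd m * n}"
   then obtain a where a: "a dvd m * n" "x = h a" by blast
   thus "x \<in> {b. b dvd m} \<times> {c. c dvd n}" using mem[OF a(1)] by (simp add: mem_Times_iff)
  qed
 qed (auto intro: mult_nonneg_nonneg tauk_nonneg)
 also have "... = tauk (Suc r) m * tauk (Suc r) n"
  unfolding sum.cartesian_product[symmetric] tauk_Suc sum_product ..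
 finally show ?case .
qed

text \<open>Truncation at \<open>M\<close>; for positive arguments its r-th convolution power counts
  the factorisations into r factors not exceeding \<open>M\<close>.\<close>

definition tri :: "nat => nat => real" where "tri M a = (if a <= M then 1 else 0)"

text \<open>The left side runs over r-tuples of numbers up to \<open>M\<close>, each weighted by
  \<open>D\<close> at the product; submultiplicativity separates the variables.\<close>

lemma sum_dpow_tri_le:
 assumes D: "!!n. D n >= (0::real)" "D 1 <= 1" "!!m n. m > 0 ==> n > 0 ==> D (m * n) <= D m * D n"
 shows "(\<Sum>n=1..M^r. dpow (tri M) r n * D n) <= (\<Sum>a=1..M. D a) ^ r"
proof (induction r)
 case 0
 show ?case using D by simp
next
 case (Suc r)
 have t0: "dpow (tri M) r m >= 0" for m by (rule dpow_nonneg) (simp add: tri_def)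
 have "(\<Sum>n=1..M^Suc r. dpow (tri M) (Suc r) n * D n) <= (\<Sum>n=1..M^Suc r. \<Sum>a | a dvd n. tri M a * D a * (dpow (tri M) r (n div a) * D (n div a)))"
 proof (rule sum_mono)
  fix n assume n: "n \<in> {1..M^Suc r}"
  have "tri M a * dpow (tri M) r (n div a) * D n <= tri M a * D a * (dpow (tri M) r (n div a) * D (n div a))" if "a dvd n" for a
  proof -
   have "a > 0" "n div a > 0" using that n dvd_div_eq_0_iff[OF that] by (auto intro: Nat.gr0I)
   hence "D n <= D a * D (n div a)" using D(3)[of a "n div a"] that by simp
   hence "(tri M a * dpow (tri M) r (n div a)) * D n <= (tri M a * dpow (tri M) r (n div a)) * (D a * D (n div a))"
    using t0 by (intro mult_left_mono mult_nonneg_nonneg) (auto simp: tri_def)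
   thus ?thesis by (simp add: mult_ac)
  qed
  thus "dpow (tri M) (Suc r) n * D n <= (\<Sum>a | a dvd n. tri M a * D a * (dpow (tri M) r (n div a) * D (n div a)))"
   unfolding dpow.simps sum_distrib_right by (intro sum_mono) auto
 qed
 also have "... = (\<Sum>a=1..M. tri M a * D a) * (\<Sum>m=1..M^r. dpow (tri M) r m * D m)"
  by (rule dpow_step) (simp add: tri_def)
 also have "(\<Sum>a=1..M. tri M a * D a) = (\<Sum>a=1..M. D a)" by (intro sum.cong) (auto simp: tri_def)
 also have "(\<Sum>a=1..M. D a) * (\<Sum>m=1..M^r. dpow (tri M) r m * D m) <= (\<Sum>a=1..M. D a) * (\<Sum>a=1..M. D a) ^ r"
  using Suc D by (intro mult_left_mono sum_nonneg) auto
 finally show ?case by simp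
qed

text \<open>Each term is compared with an increment of -10 n^(-1/10). The resulting constant 11 is
  the origin of \<open>ln 11\<close> in \<open>exponent_bound\<close>.\<close>

lemma sum_powr_11: "(\<Sum>n=1..M. real n powr (- 11/10)) <= 11"
proof (cases "M = 0")
 case False
 hence "M >= 1" by simp
 hence "(\<Sum>n=1..M. real n powr (- 11/10)) <= 11 - 10 * real M powr (- 1/10)"
 proof (induction M rule: dec_induct)
  case (step n)
  have n: "real n >= 1" using step.hyps by simp
  have "\<exists>z>real n. z < real (Suc n) \<and> real (Suc n) powr (-1/10) - real n powr (-1/10) = (real (Suc n) - real n) * ((-1/10) * z powr (-1/10 - 1))"
   by (rule MVT2) (use n in \<open>auto intro!: derivative_eq_intros\<close>)
  then obtain z where z: "real n < z" "z < real (Suc n)" "real (Suc n) powr (-1/10) - real n powr (-1/10) = (-1/10) * z powr (-11/10)"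
   by auto
  have "real (Suc n) powr (-11/10) <= z powr (-11/10)" using z n by (intro powr_mono2') auto
  thus ?case using step z(3) by simp
 qed simp
 moreover have "real M powr (-1/10) >= 0" by simp
 ultimately show ?thesis by linarith
qed simp

lemma sum_tauk_weighted: "(\<Sum>n=1..M. tauk r n * real n powr (- 11/10)) <= 11 ^ r"
proof (induction r)
 case 0
 have "(\<Sum>n=1..M. tauk 0 n * real n powr (- 11/10)) = (\<Sum>n=1..M. if n = 1 then 1 else 0)"
  by (intro sum.cong) (auto simp: tauk_def)
 also have "... <= 1" by simp
 finally show ?case by simp
next
 case (Suc r)
 define Q where "Q = {(a,m). a >= 1 \<and> m >= 1 \<and> a * m <= M}"
 define p where "p n = real n powr (- 11/10)" for n
 have p0: "p n >= 0" for n by (simp add: p_def)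
 have "(\<Sum>n=1..M. tauk (Suc r) n * p n) = (\<Sum>n=1..M. \<Sum>a | a dvd n. p a * (tauk r (n div a) * p (n div a)))"
 proof (rule sum.cong)
  fix n
  have eq: "p a * (tauk r (n div a) * p (n div a)) = tauk r (n div a) * p n" if "a dvd n" for a
  proof -
   have "p (a * (n div a)) = p a * p (n div a)" by (simp add: p_def powr_mult)
   thus ?thesis using that by simp
  qed
  thus "tauk (Suc r) n * p n = (\<Sum>a | a dvd n. p a * (tauk r (n div a) * p (n div a)))"
   unfolding tauk_Suc sum_distrib_right by (intro sum.cong refl eq[symmetric]) simp
 qed simp
 also have "... = (\<Sum>(a,m)\<in>Q. p a * (tauk r m * p m))" unfolding Q_def by (rule sum_divisor_pairs)
 also have "... <= (\<Sum>(a,m)\<in>{1..M} \<times> {1..M}. p a * (tauk r m * p m))"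
 proof (rule sum_mono2)
  show "Q \<subseteq> {1..M} \<times> {1..M}"
  proof
   fix x assume "x \<in> Q"
   then obtain a m where am: "x = (a,m)" "a >= 1" "m >= 1" "a * m <= M" by (auto simp: Q_def)
   have "a <= M" "m <= M" using order_trans[OF _ am(4), of a] order_trans[OF _ am(4), of m] am by auto
   thus "x \<in> {1..M} \<times> {1..M}" using am by simp
  qed
 qed (auto intro!: mult_nonneg_nonneg tauk_nonneg p0)
 also have "... = (\<Sum>a=1..M. p a) * (\<Sum>m=1..M. tauk r m * p m)"
  unfolding sum.cartesian_product[symmetric] sum_product ..
 also have "... <= 11 * 11 ^ r"
  using sum_powr_11[of M] Suc by (intro mult_mono) (auto simp: p_def intro!: sum_nonneg mult_nonneg_nonneg tauk_nonneg)
 finally show ?case by (simp add: p_def)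
qed

text \<open>Rankin's trick with exponent 11/10. The excess 1/10 over the true order of magnitude
  reappears as \<open>1 / 10 * L\<close> in \<open>exponent_bound\<close>; in exchange the
  dependence on \<open>r\<close> is a plain power.\<close>

lemma sum_tauk_le: "(\<Sum>n=1..M. tauk r n) <= real M powr (11/10) * 11 ^ r"
proof -
 have "(\<Sum>n=1..M. tauk r n) <= (\<Sum>n=1..M. real M powr (11/10) * (tauk r n * real n powr (- 11/10)))"
 proof (rule sum_mono)
  fix n assume n: "n \<in> {1..M}"
  have "1 = real n powr (11/10) * real n powr (- 11/10)" using n by (simp flip: powr_add)
  also have "... <= real M powr (11/10) * real n powr (- 11/10)" using n by (intro mult_right_mono powr_mono2) auto
  finally have "tauk r n * 1 <= tauk r n * (real M powr (11/10) * real n powr (- 11/10))"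
   by (rule mult_left_mono[OF _ tauk_nonneg])
  thus "tauk r n <= real M powr (11/10) * (tauk r n * real n powr (- 11/10))" by (simp add: mult_ac)
 qed
 also have "... = real M powr (11/10) * (\<Sum>n=1..M. tauk r n * real n powr (- 11/10))" by (simp only: sum_distrib_left)
 also have "... <= real M powr (11/10) * 11 ^ r" by (intro mult_left_mono sum_tauk_weighted) auto
 finally show ?thesis .
qed

text \<open>Of the two factors in the square one keeps its truncation and is unfolded into r-tuples,
  the other is enlarged to the full divisor function, whose submultiplicativity allows the tuples to
  separate.\<close>

lemma sum_dpow_square_le:
 fixes F :: "nat => complex"
 assumes F: "!!a. norm (F a) <= B * tri M a" and B: "B >= 0"
 shows "(\<Sum>n=1..M^r. norm (dpow F r n) ^ 2) <= B ^ (2 * r) * (real M powr (11/10) * 11 ^ r) ^ r"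
proof -
 have t0: "tri M a >= 0" for a by (simp add: tri_def)
 have "(\<Sum>n=1..M^r. norm (dpow F r n) ^ 2) <= (\<Sum>n=1..M^r. B ^ (2 * r) * (dpow (tri M) r n * tauk r n))"
 proof (rule sum_mono)
  fix n
  have d0: "dpow (tri M) r n >= 0" by (rule dpow_nonneg[OF t0])
  have "norm (dpow F r n) ^ 2 <= (B ^ r * dpow (tri M) r n) ^ 2"
   by (intro power_mono norm_dpow_le F B t0) auto
  also have "... = B ^ (2 * r) * (dpow (tri M) r n * dpow (tri M) r n)"
   by (simp add: power_mult_distrib power2_eq_square mult_2 power_add)
  also have "... <= B ^ (2 * r) * (dpow (tri M) r n * tauk r n)"
   unfolding tauk_def using B d0 by (intro mult_left_mono dpow_mono t0) (auto simp: tri_def)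
  finally show "norm (dpow F r n) ^ 2 <= B ^ (2 * r) * (dpow (tri M) r n * tauk r n)" .
 qed
 also have "... = B ^ (2 * r) * (\<Sum>n=1..M^r. dpow (tri M) r n * tauk r n)" by (simp only: sum_distrib_left)
 also have "(\<Sum>n=1..M^r. dpow (tri M) r n * tauk r n) <= (\<Sum>a=1..M. tauk r a) ^ r"
 proof (rule sum_dpow_tri_le)
  show "tauk r 1 <= 1" by (induction r) (simp_all add: tauk_def)
 qed (auto intro: tauk_nonneg tauk_submult)
 also have "... <= (real M powr (11/10) * 11 ^ r) ^ r"
  by (intro power_mono sum_tauk_le sum_nonneg tauk_nonneg)
 finally show ?thesis using B by (simp add: mult_left_mono)
qed

section \<open>Characters of prime modulus\<close>

lemma ee_sum:
 fixes k :: int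
 assumes d: "d >= 1"
 shows "(\<Sum>i<d. ee (real i * (of_int k / real d))) = (if int d dvd k then of_nat d else 0)"
proof -
 define z where "z = ee (of_int k / real d)"
 have zd: "z ^ d = 1" unfolding z_def ee_power using d by simp
 have s: "(\<Sum>i<d. ee (real i * (of_int k / real d))) = (\<Sum>i<d. z ^ i)" by (simp add: z_def ee_power)
 show ?thesis
 proof (cases "int d dvd k")
  case True
  then obtain c where "k = int d * c" by (auto elim: dvdE)
  hence "of_int k / real d = of_int c" using d by simp
  hence "z = 1" by (simp add: z_def)
  thus ?thesis using True s by simp
 next
  case False
  have "z ~= 1"
  proof
   assume "z = 1"
   hence "of_int k / real d \<in> \<int>" by (simp add: z_def ee_eq_iff_int)
   then obtain c where "of_int k / real d = of_int c" by (auto elim: Ints_cases)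
   hence "real_of_int k = of_int (c * int d)" using d by (simp add: field_simps)
   hence "k = c * int d" by (simp only: of_int_eq_iff)
   thus False using False by simp
  qed
  moreover have "(1 - z) * (\<Sum>i<d. z ^ i) = 0" using zd by (simp add: one_diff_power_eq flip: one_diff_power_eq)
  ultimately show ?thesis using False s by simp
 qed
qed

lemma parseval_finite:
 assumes q: "q >= 1"
 shows "(\<Sum>t<q. norm (\<Sum>u<q. B u * ee (real t * (real u / real q))) ^ 2) = real q * (\<Sum>u<q. norm (B u) ^ 2)"
proof -
 have "complex_of_real (\<Sum>t<q. norm (\<Sum>u<q. B u * ee (real t * (real u / real q))) ^ 2) =
   (\<Sum>t<q. \<Sum>u<q. \<Sum>v<q. B u * cnj (B v) * ee (real t * (of_int (int u - int v) / real q)))"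
  unfolding of_real_sum complex_norm_square cnj_sum sum_product
 proof (intro sum.cong refl)
  fix t u v
  have "ee (real t * (real u / real q)) * cnj (ee (real t * (real v / real q))) = ee (real t * (of_int (int u - int v) / real q))"
   unfolding ee_minus[symmetric] ee_add[symmetric] by (simp add: diff_divide_distrib right_diff_distrib)
  thus "B u * ee (real t * (real u / real q)) * cnj (B v * ee (real t * (real v / real q))) =
    B u * cnj (B v) * ee (real t * (of_int (int u - int v) / real q))" by (simp add: mult_ac)
 qed
 also have "... = (\<Sum>u<q. \<Sum>v<q. \<Sum>t<q. B u * cnj (B v) * ee (real t * (of_int (int u - int v) / real q)))"
  by (rule trans[OF sum.swap]) (intro sum.cong refl sum.swap)
 also have "... = (\<Sum>u<q. \<Sum>v<q. if u = v then of_nat q * (B u * cnj (B v)) else 0)"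
 proof (intro sum.cong refl)
  fix u v assume "u \<in> {..<q}" "v \<in> {..<q}"
  hence "int q dvd int u - int v \<longleftrightarrow> u = v"
   by (auto simp: mod_eq_dvd_iff[symmetric])
  thus "(\<Sum>t<q. B u * cnj (B v) * ee (real t * (of_int (int u - int v) / real q))) = (if u = v then of_nat q * (B u * cnj (B v)) else 0)"
   unfolding sum_distrib_left[symmetric] ee_sum[OF q] by simp
 qed
 also have "... = (\<Sum>u<q. of_nat q * (B u * cnj (B u)))" by (intro sum.cong refl) simp
 also have "... = complex_of_real (real q * (\<Sum>u<q. norm (B u) ^ 2))"
  unfolding of_real_mult of_real_sum complex_norm_square by (simp add: sum_distrib_left)
 finally show ?thesis by (simp only: of_real_eq_iff)
qed

section \<open>Indices and characters modulo a prime\<close>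

definition groot :: "nat => nat" where "groot p = (SOME g. residue_primroot p g)"

text \<open>The discrete logarithm to the base \<open>groot p\<close>, represented below
  \<open>p - 1\<close>; it is meaningful for \<open>n\<close> prime to \<open>p\<close>.\<close>

definition ind :: "nat => nat => nat" where
 "ind p n = inv_into {..<p - 1} (%i. groot p ^ i mod p) (n mod p)"

lemma groot: "prime p ==> residue_primroot p (groot p)"
 unfolding groot_def by (rule someI_ex) (use prime_primitive_root_exists[of p] prime_gt_1_nat[of p] in blast)

lemma groot_bij:
 assumes p: "prime p"
 shows "bij_betw (%i. groot p ^ i mod p) {..<p - 1} {1..<p}"
proof -
 have "bij_betw (%i. groot p ^ i mod p) {..<totient p} (totatives p)"
  by (rule residue_primroot_is_generator[OF prime_gt_1_nat[OF p] groot[OF p]])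
 moreover have "totatives p = {1..<p}" unfolding totatives_prime[OF p] by (simp add: set_eq_iff Suc_le_eq)
 ultimately show ?thesis using totient_prime[OF p] by simp
qed

lemma ind:
 assumes p: "prime p" and n: "\<not> p dvd n"
 shows "ind p n < p - 1" "groot p ^ ind p n mod p = n mod p"
proof -
 have "n mod p \<in> {1..<p}" using n prime_gt_0_nat[OF p] by (simp add: Suc_le_eq mod_greater_zero_iff_not_dvd)
 hence *: "n mod p \<in> (%i. groot p ^ i mod p) ` {..<p - 1}" using groot_bij[OF p] by (simp only: bij_betw_def)
 show "groot p ^ ind p n mod p = n mod p" unfolding ind_def by (rule f_inv_into_f[OF *])
 show "ind p n < p - 1" using inv_into_into[OF *] by (simp add: ind_def)
qed

lemma ind_unique:
 assumes p: "prime p" and k: "k < p - 1" "groot p ^ k mod p = n mod p"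
 shows "ind p n = k"
 unfolding ind_def k(2)[symmetric]
 by (rule inv_into_f_f[OF bij_betw_imp_inj_on[OF groot_bij[OF p]]]) (use k(1) in simp)

lemma ind_mult_cong:
 assumes p: "prime p" and n: "\<not> p dvd m" "\<not> p dvd n"
 shows "[ind p (m * n) = ind p m + ind p n] (mod (p - 1))"
proof -
 have mn: "\<not> p dvd m * n" using n p by (simp add: prime_dvd_mult_iff)
 have "groot p ^ (ind p m + ind p n) mod p = (groot p ^ ind p m mod p) * (groot p ^ ind p n mod p) mod p"
  by (simp add: power_add mod_mult_eq)
 also have "... = groot p ^ ind p (m * n) mod p"
  using ind(2)[OF p n(1)] ind(2)[OF p n(2)] ind(2)[OF p mn] by (simp add: mod_mult_eq)
 finally have "[groot p ^ ind p (m * n) = groot p ^ (ind p m + ind p n)] (mod p)" by (simp add: cong_def)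
 moreover have "coprime p (groot p)" "ord p (groot p) = p - 1"
  using groot[OF p] totient_prime[OF p] by (auto simp: residue_primroot_def)
 ultimately show ?thesis by (metis order_divides_expdiff)
qed

lemma ee_cong:
 assumes "[a = b] (mod q)" "q >= 1"
 shows "ee (real t * (real a / real q)) = ee (real t * (real b / real q))"
proof -
 have "int q dvd int a - int b" using assms(1) by (metis cong_iff_dvd_diff cong_int_iff)
 then obtain c where c: "int a - int b = int q * c" by (auto elim: dvdE)
 hence "real_of_int (int a - int b) = real_of_int (int q * c)" by (simp only:)
 hence "real a = real b + real q * of_int c" by simp
 hence "real t * (real a / real q) = real t * (real b / real q) + of_int (int t * c)"
  using assms(2) by (simp add: field_simps)
 thus ?thesis by (simp only: ee_add_int)
qed

text \<open>All characters modulo \<open>p\<close>, the principal one at \<open>t = 0\<close>.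
  Writing them as exponentials of the index makes Parseval's identity modulo \<open>p - 1\<close>
  available and gives the order of \<open>n\<close> through a gcd.\<close>

definition pch :: "nat => nat => nat => complex" where
 "pch p t n = (if p dvd n then 0 else ee (real t * (real (ind p n) / real (p - 1))))"

lemma pch_mult:
 assumes p: "prime p"
 shows "pch p t (m * n) = pch p t m * pch p t n"
proof (cases "p dvd m \<or> p dvd n")
 case False
 have p1: "p - 1 >= 1" using prime_gt_1_nat[OF p] by simp
 have "ee (real t * (real (ind p (m * n)) / real (p - 1))) = ee (real t * (real (ind p m + ind p n) / real (p - 1)))"
  by (rule ee_cong[OF ind_mult_cong p1]) (use p False in auto)
 also have "... = ee (real t * (real (ind p m) / real (p - 1))) * ee (real t * (real (ind p n) / real (p - 1)))"
  by (simp add: add_divide_distrib distrib_left flip: ee_add)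
 finally show ?thesis using False p by (simp add: pch_def prime_dvd_mult_iff)
qed (auto simp: pch_def)

lemma pch_1:
 assumes p: "prime p"
 shows "pch p t 1 = 1"
proof -
 have "ind p 1 = 0" by (rule ind_unique[OF p]) (use prime_gt_1_nat[OF p] in auto)
 thus ?thesis using prime_gt_1_nat[OF p] by (simp add: pch_def)
qed

lemma ord_ratio:
 assumes p: "prime p" and a: "\<not> p dvd a"
 shows "real (ord p a) / (real p - 1) = 1 / real (gcd (ind p a) (p - 1))"
proof -
 have "[a = groot p ^ ind p a] (mod p)" using ind(2)[OF p a] by (simp add: cong_def)
 hence "ord p a = ord p (groot p ^ ind p a)" by (rule ord_cong)
 moreover have "ord p (groot p) = p - 1"
  using groot[OF p] totient_prime[OF p] by (auto simp: residue_primroot_def)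
 ultimately have "ord p a * gcd (ind p a) (p - 1) = p - 1" using ord_power_aux[of p "groot p" "ind p a"] by simp
 hence "real (ord p a) * real (gcd (ind p a) (p - 1)) = real (p - 1)" by (metis of_nat_mult)
 hence *: "real (ord p a) * real (gcd (ind p a) (p - 1)) = 1 * real (p - 1)" by (simp only: mult_1)
 have q: "real (p - 1) ~= 0" "real p - 1 = real (p - 1)" using prime_gt_1_nat[OF p] by auto
 have g: "real (gcd (ind p a) (p - 1)) ~= 0" using prime_gt_1_nat[OF p] by simp
 show ?thesis unfolding q(2) using * by (simp only: frac_eq_eq[OF q(1) g])
qed

text \<open>The mean is subtracted only where \<open>p\<close> does not divide \<open>a\<close>. The
  deviation thus vanishes on multiples of \<open>p\<close>, as nonprincipal characters do; the means
  missing there are accounted for in \<open>order_sum_decomposition\<close>.\<close>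

definition dev :: "nat => nat => real" where
 "dev p a = real (ord p a) / (real p - 1) - (if p dvd a then 0 else mean_ord (p - 1))"

lemma dev_dvd: "prime p ==> p dvd a ==> dev p a = 0"
proof -
 assume p: "prime p" and a: "p dvd a"
 have "\<not> coprime p a" using prime_gt_1_nat[OF p] coprime_common_divisor_nat[of p a p] a by auto
 hence "ord p a = 0" by (simp only: ord_eq_0 not_False_eq_True)
 thus "dev p a = 0" using a by (simp add: dev_def)
qed

text \<open>The reciprocal of the gcd of the index with \<open>p - 1\<close> is the sum of
  \<open>h0 d\<close> over common divisors. The condition that d divides the index is detected by
  additive characters modulo d, which are multiplicative characters of \<open>a\<close> of order
  dividing d; the trivial ones add up to the mean.\<close>

lemma dev_expand:
 assumes p: "prime p"
 shows "of_real (dev p a) = (\<Sum>d | d dvd p - 1. of_real (h0 d / real d) * (\<Sum>i=1..<d. pch p (i * ((p - 1) div d)) a))"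
proof (cases "p dvd a")
 case False
 have p1: "p - 1 > 0" using prime_gt_1_nat[OF p] by simp
 define k where "k = ind p a"
 have fd: "finite {d. d dvd p - 1}" using p1 by simp
 have "complex_of_real (real (ord p a) / (real p - 1)) = (\<Sum>d | d dvd p - 1. of_real (if d dvd k then h0 d else 0))"
  unfolding ord_ratio[OF p False] inverse_gcd_eq[OF p1] k_def by simp
 also have "... = (\<Sum>d | d dvd p - 1. of_real (h0 d / real d) * (\<Sum>i<d. ee (real i * (of_int (int k) / real d))))"
 proof (rule sum.cong)
  fix d assume "d \<in> {d. d dvd p - 1}"
  hence d: "d >= 1" using p1 by (auto simp: Suc_le_eq intro: Nat.gr0I)
  show "of_real (if d dvd k then h0 d else 0) = of_real (h0 d / real d) * (\<Sum>i<d. ee (real i * (of_int (int k) / real d)))"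
   unfolding ee_sum[OF d] using d by simp
 qed simp
 also have "... = (\<Sum>d | d dvd p - 1. of_real (h0 d / real d) * (1 + (\<Sum>i=1..<d. pch p (i * ((p - 1) div d)) a)))"
 proof (rule sum.cong)
  fix d assume "d \<in> {d. d dvd p - 1}"
  hence d: "d dvd p - 1" by simp
  then obtain c where c: "p - 1 = d * c" by (auto elim: dvdE)
  have dp: "d >= 1" "c >= 1" using p1 c by (auto simp: Suc_le_eq intro!: Nat.gr0I)
  have "{..<d} = insert 0 {1..<d}" using dp by auto
  hence "(\<Sum>i<d. ee (real i * (of_int (int k) / real d))) = 1 + (\<Sum>i=1..<d. ee (real i * (of_int (int k) / real d)))" by simp
  also have "(\<Sum>i=1..<d. ee (real i * (of_int (int k) / real d))) = (\<Sum>i=1..<d. pch p (i * ((p - 1) div d)) a)"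
  proof (rule sum.cong)
   fix i
   have "(p - 1) div d = c" unfolding c using dp by simp
   moreover have "real (p - 1) = real d * real c" by (simp only: c of_nat_mult)
   ultimately have "real (i * ((p - 1) div d)) * (real (ind p a) / real (p - 1)) = real i * (of_int (int k) / real d)"
    using dp by (simp add: k_def)
   thus "ee (real i * (of_int (int k) / real d)) = pch p (i * ((p - 1) div d)) a"
    using False by (simp only: pch_def if_False)
  qed simp
  finally show "of_real (h0 d / real d) * (\<Sum>i<d. ee (real i * (of_int (int k) / real d))) =
   of_real (h0 d / real d) * (1 + (\<Sum>i=1..<d. pch p (i * ((p - 1) div d)) a))" by simp
 qed simp
 also have "... = of_real (mean_ord (p - 1)) + (\<Sum>d | d dvd p - 1. of_real (h0 d / real d) * (\<Sum>i=1..<d. pch p (i * ((p - 1) div d)) a))"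
  by (simp add: distrib_left sum.distrib mean_ord_def)
 finally show ?thesis using False by (simp add: dev_def)
qed (use dev_dvd[OF p, of a] in \<open>simp add: pch_def\<close>)

lemma abs_dev_le:
 assumes p: "prime p"
 shows "\<bar>dev p a\<bar> <= 1"
proof (cases "p dvd a")
 case False
 have "gcd (ind p a) (p - 1) ~= 0" using prime_gt_1_nat[OF p] by simp
 hence "gcd (ind p a) (p - 1) >= 1" by linarith
 hence "real 1 <= real (gcd (ind p a) (p - 1))" by (simp only: of_nat_le_iff)
 hence "1 / real (gcd (ind p a) (p - 1)) <= 1 / 1" by (intro divide_left_mono) auto
 moreover have "1 / real (gcd (ind p a) (p - 1)) >= 0" by simp
 moreover have "dev p a = 1 / real (gcd (ind p a) (p - 1)) - mean_ord (p - 1)"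
  using False by (simp add: dev_def ord_ratio[OF p])
 ultimately show ?thesis using mean_ord_bounds[of "p - 1"] by linarith
qed (use dev_dvd[OF p, of a] in simp)

text \<open>No Gauss sums are needed. Parseval over indices evaluates the left side, Parseval over
  residues the right side, by the same sums \<open>A v\<close> over residue classes; the missing
  frequency 0 on either side is subtracted. Comparing them leaves a cross term 2 |A 0| |T|, which
  the class of 0 and the surplus \<open>E\<close> absorb.\<close>

lemma pch_additive_bound:
 assumes p: "prime p" and S: "finite S"
 shows "(\<Sum>t=1..<p-1. norm (\<Sum>n\<in>S. b n * pch p t n) ^ 2) <= (\<Sum>h=1..<p. norm (\<Sum>n\<in>S. b n * ee (real n * (real h / real p))) ^ 2)"
proof -
 define A where "A v = (\<Sum>n\<in>{n\<in>S. n mod p = v}. b n)" for v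
 define B where "B u = A (groot p ^ u mod p)" for u
 have p1: "p > 1" using prime_gt_1_nat[OF p] .
 have mult: "(\<Sum>n\<in>S. b n * pch p t n) = (\<Sum>u<p-1. B u * ee (real t * (real u / real (p - 1))))" for t
 proof -
  define S' where "S' = {n\<in>S. \<not> p dvd n}"
  have "(\<Sum>n\<in>S. b n * pch p t n) = (\<Sum>n\<in>S'. b n * pch p t n)"
   by (rule sum.mono_neutral_right) (use S in \<open>auto simp: S'_def pch_def\<close>)
  also have "... = (\<Sum>u\<in>{..<p-1}. \<Sum>n\<in>{n\<in>S'. ind p n = u}. b n * pch p t n)"
   by (rule sum.group[symmetric]) (use S ind(1)[OF p] in \<open>auto simp: S'_def\<close>)
  also have "... = (\<Sum>u\<in>{..<p-1}. B u * ee (real t * (real u / real (p - 1))))"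
  proof (rule sum.cong)
   fix u assume "u \<in> {..<p-1}"
   hence u: "u < p - 1" by simp
   have g: "groot p ^ u mod p ~= 0"
   proof -
    have "groot p ^ u mod p \<in> {1..<p}" using groot_bij[OF p] u by (auto simp: bij_betw_def)
    thus ?thesis by simp
   qed
   have "n \<in> S' \<and> ind p n = u \<longleftrightarrow> n \<in> S \<and> n mod p = groot p ^ u mod p" for n
   proof
    assume n: "n \<in> S' \<and> ind p n = u"
    hence "\<not> p dvd n" "n \<in> S" by (simp_all add: S'_def)
    thus "n \<in> S \<and> n mod p = groot p ^ u mod p" using ind(2)[OF p, of n] n by simp
   next
    assume n: "n \<in> S \<and> n mod p = groot p ^ u mod p"
    hence "n mod p ~= 0" using g by simp
    hence "\<not> p dvd n" by (simp add: dvd_eq_mod_eq_0)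
    thus "n \<in> S' \<and> ind p n = u" using n ind_unique[OF p u, of n] by (simp add: S'_def)
   qed
   hence "{n\<in>S'. ind p n = u} = {n\<in>S. n mod p = groot p ^ u mod p}" by blast
   hence "B u = (\<Sum>n\<in>{n\<in>S'. ind p n = u}. b n)" by (simp add: B_def A_def)
   moreover have "(\<Sum>n\<in>{n\<in>S'. ind p n = u}. b n * pch p t n) = (\<Sum>n\<in>{n\<in>S'. ind p n = u}. b n * ee (real t * (real u / real (p - 1))))"
    by (intro sum.cong) (auto simp: S'_def pch_def)
   ultimately show "(\<Sum>n\<in>{n\<in>S'. ind p n = u}. b n * pch p t n) = B u * ee (real t * (real u / real (p - 1)))"
    by (simp add: sum_distrib_right)
  qed simp
  finally show ?thesis .
 qed
 have add: "(\<Sum>n\<in>S. b n * ee (real n * (real h / real p))) = (\<Sum>v<p. A v * ee (real h * (real v / real p)))" for h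
 proof -
  have "(\<Sum>n\<in>S. b n * ee (real n * (real h / real p))) = (\<Sum>v\<in>{..<p}. \<Sum>n\<in>{n\<in>S. n mod p = v}. b n * ee (real n * (real h / real p)))"
   by (rule sum.group[symmetric]) (use S p1 in auto)
  also have "... = (\<Sum>v\<in>{..<p}. A v * ee (real h * (real v / real p)))"
  proof (rule sum.cong)
   fix v
   have eq: "b n * ee (real n * (real h / real p)) = b n * ee (real h * (real v / real p))" if "n \<in> {n\<in>S. n mod p = v}" for n
   proof -
    have "[n = v] (mod p)" using that by (auto simp: cong_def)
    hence "ee (real h * (real n / real p)) = ee (real h * (real v / real p))" by (rule ee_cong) (use p1 in simp)
    thus ?thesis by (simp add: mult.commute)
   qed
   thus "(\<Sum>n\<in>{n\<in>S. n mod p = v}. b n * ee (real n * (real h / real p))) = A v * ee (real h * (real v / real p))"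
    unfolding A_def sum_distrib_right by (intro sum.cong refl eq)
  qed simp
  finally show ?thesis .
 qed
 define T where "T = (\<Sum>v=1..<p. A v)"
 define E where "E = (\<Sum>v=1..<p. norm (A v) ^ 2)"
 have sB: "(\<Sum>u<p-1. B u) = T" "(\<Sum>u<p-1. norm (B u) ^ 2) = E"
  unfolding B_def T_def E_def by (rule sum.reindex_bij_betw[OF groot_bij[OF p]])+
 have Mq: "(\<Sum>t=1..<p-1. norm (\<Sum>n\<in>S. b n * pch p t n) ^ 2) = real (p - 1) * E - norm T ^ 2"
 proof -
  have "{..<p-1} = insert 0 {1..<p-1}" using p1 by auto
  hence "(\<Sum>t<p-1. norm (\<Sum>u<p-1. B u * ee (real t * (real u / real (p - 1)))) ^ 2) =
   norm (\<Sum>u<p-1. B u) ^ 2 + (\<Sum>t=1..<p-1. norm (\<Sum>u<p-1. B u * ee (real t * (real u / real (p - 1)))) ^ 2)"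
   by simp
  moreover have "(\<Sum>t<p-1. norm (\<Sum>u<p-1. B u * ee (real t * (real u / real (p - 1)))) ^ 2) = real (p - 1) * E"
   unfolding sB(2)[symmetric] by (rule parseval_finite) (use p1 in simp)
  ultimately show ?thesis unfolding mult sB(1)[symmetric] by simp
 qed
 have Aq: "(\<Sum>h=1..<p. norm (\<Sum>n\<in>S. b n * ee (real n * (real h / real p))) ^ 2) = real p * (norm (A 0) ^ 2 + E) - norm (A 0 + T) ^ 2"
 proof -
  have i: "{..<p} = insert 0 {1..<p}" using p1 by auto
  have "(\<Sum>h<p. norm (\<Sum>v<p. A v * ee (real h * (real v / real p))) ^ 2) =
   norm (\<Sum>v<p. A v) ^ 2 + (\<Sum>h=1..<p. norm (\<Sum>v<p. A v * ee (real h * (real v / real p))) ^ 2)"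
   unfolding i by simp
  moreover have "(\<Sum>h<p. norm (\<Sum>v<p. A v * ee (real h * (real v / real p))) ^ 2) = real p * (norm (A 0) ^ 2 + E)"
  proof -
   have "(\<Sum>v<p. norm (A v) ^ 2) = norm (A 0) ^ 2 + E" unfolding i E_def by simp
   thus ?thesis using parseval_finite[of p A] p1 by simp
  qed
  moreover have "(\<Sum>v<p. A v) = A 0 + T" unfolding i T_def by simp
  ultimately show ?thesis unfolding add by simp
 qed
 have "norm (A 0 + T) ^ 2 <= (norm (A 0) + norm T) ^ 2" by (intro power_mono norm_triangle_ineq) auto
 hence 1: "norm (A 0 + T) ^ 2 <= norm (A 0) ^ 2 + norm T ^ 2 + 2 * (norm (A 0) * norm T)" by (simp add: power2_sum)
 have "2 * (norm (A 0) * norm T) <= (\<Sum>v=1..<p. 2 * (norm (A 0) * norm (A v)))"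
  unfolding sum_distrib_left[symmetric] T_def by (intro mult_left_mono norm_sum) auto
 also have "... <= (\<Sum>v=1..<p. norm (A 0) ^ 2 + norm (A v) ^ 2)"
 proof (rule sum_mono)
  fix v
  have "0 <= (norm (A 0) - norm (A v)) ^ 2" by simp
  thus "2 * (norm (A 0) * norm (A v)) <= norm (A 0) ^ 2 + norm (A v) ^ 2" by (simp add: power2_eq_square algebra_simps)
 qed
 also have "... = real (p - 1) * norm (A 0) ^ 2 + E" by (simp add: sum.distrib E_def)
 finally have 2: "2 * (norm (A 0) * norm T) <= real (p - 1) * norm (A 0) ^ 2 + E" .
 have rp: "real (p - 1) = real p - 1" using p1 by simp
 show ?thesis unfolding Mq Aq using 1 2 unfolding rp by (simp add: algebra_simps)
qed

section \<open>The variance\<close>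

lemma sum_inverse_le_ln:
 assumes "n >= 1"
 shows "(\<Sum>k=1..n. 1 / real k) <= 1 + ln (real n)"
 using assms
proof (induction n rule: dec_induct)
 case (step n)
 have n: "real n > 0" using step.hyps by simp
 have "ln (real n / real (Suc n)) <= real n / real (Suc n) - 1" using n by (intro ln_le_minus_one) auto
 also have "... = - 1 / real (Suc n)" by (simp add: field_simps)
 finally have "1 / real (Suc n) <= ln (real (Suc n)) - ln (real n)" using n by (simp add: ln_div)
 thus ?case using step.IH by simp
qed simp

definition primes_below :: "real => nat set" where
 "primes_below x = {p. prime p \<and> real p < x}"

lemma finite_primes_below [simp]: "finite (primes_below x)"
proof (rule finite_subset)
 show "primes_below x \<subseteq> {..nat \<lceil>x\<rceil>}" by (auto simp: primes_below_def) linarith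
qed simp

lemma primes_below_subset:
 assumes "x >= 0"
 shows "primes_below x \<subseteq> {2..nat \<lfloor>x\<rfloor>}"
 using assms le_nat_floor_iff[of x] prime_ge_2_nat by (auto simp: primes_below_def)

lemma card_primes_below: "x >= 0 ==> real (card (primes_below x)) <= x"
proof -
 assume x: "x >= 0"
 have "card (primes_below x) <= card {2..nat \<lfloor>x\<rfloor>}" by (intro card_mono primes_below_subset x) auto
 hence "card (primes_below x) <= nat \<lfloor>x\<rfloor>" by simp
 thus ?thesis using le_nat_floor_iff[OF x] by simp
qed

lemma sum_divisors_inverse_le:
 assumes x: "x >= 1" and p: "p \<in> primes_below x"
 shows "(\<Sum>d | d dvd p - 1. 1 / real d) <= 1 + ln x"
proof -
 have pp: "prime p" "real p < x" using p by (auto simp: primes_below_def)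
 have p1: "p - 1 >= 1" using prime_ge_2_nat[OF pp(1)] by simp
 have "(\<Sum>d | d dvd p - 1. 1 / real d) <= (\<Sum>d=1..p-1. 1 / real d)"
 proof (rule sum_mono2)
  show "{d. d dvd p - 1} \<subseteq> {1..p-1}"
  proof
   fix d assume "d \<in> {d. d dvd p - 1}"
   hence d: "d dvd p - 1" by simp
   have "d <= p - 1" using d p1 by (intro dvd_imp_le) auto
   moreover have "d > 0" using d p1 by (cases d) auto
   ultimately show "d \<in> {1..p-1}" by simp
  qed
 qed auto
 also have "... <= 1 + ln (real (p - 1))" by (rule sum_inverse_le_ln[OF p1])
 also have "... <= 1 + ln x" using p1 pp(2) by simp
 finally show ?thesis .
qed

text \<open>After exchanging the sums the primes are replaced by all integers congruent to 1; losing
  the density of primes costs one logarithm, which is harmless here.\<close>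

lemma sum_divisor_count_le:
 assumes x: "x >= 1"
 shows "(\<Sum>p\<in>primes_below x. real (card {d. d dvd p - 1})) <= x * (1 + ln x)"
proof -
 define N where "N = nat \<lfloor>x\<rfloor>"
 have N: "real N <= x" "N >= 1" using le_nat_floor_iff[of x] x by (auto simp: N_def)
 have "(\<Sum>p\<in>primes_below x. real (card {d. d dvd p - 1})) = (\<Sum>p\<in>primes_below x. \<Sum>d=1..N. if [p = 1] (mod d) then 1 else 0)"
 proof (rule sum.cong)
  fix p assume p: "p \<in> primes_below x"
  have p2: "p >= 2" "p <= N" using primes_below_subset[of x] x p by (auto simp: N_def)
  have "{d. d dvd p - 1} = {d\<in>{1..N}. [p = 1] (mod d)}"
  proof (intro equalityI subsetI)
   fix d assume "d \<in> {d. d dvd p - 1}"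
   hence d: "d dvd p - 1" by simp
   have "d <= p - 1" using d p2 by (intro dvd_imp_le) auto
   moreover have "d > 0" using d p2 by (cases d) auto
   ultimately show "d \<in> {d\<in>{1..N}. [p = 1] (mod d)}" using d p2 cong_1_iff_dvd[of p d] by auto
  qed (use p2 cong_1_iff_dvd[of p] in auto)
  hence "real (card {d. d dvd p - 1}) = (\<Sum>d\<in>{d\<in>{1..N}. [p = 1] (mod d)}. 1)" by simp
  also have "... = (\<Sum>d=1..N. if [p = 1] (mod d) then 1 else 0)" by (rule sum.inter_filter) simp
  finally show "real (card {d. d dvd p - 1}) = (\<Sum>d=1..N. if [p = 1] (mod d) then 1 else 0)" .
 qed simp
 also have "... = (\<Sum>d=1..N. \<Sum>p\<in>primes_below x. if [p = 1] (mod d) then 1 else 0)" by (rule sum.swap)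
 also have "... <= (\<Sum>d=1..N. x * (1 / real d))"
 proof (rule sum_mono)
  fix d assume "d \<in> {1..N}"
  hence d: "d >= 1" by simp
  have "(\<Sum>p\<in>primes_below x. if [p = 1] (mod d) then 1 else (0::real)) = (\<Sum>p\<in>{p\<in>primes_below x. [p = 1] (mod d)}. 1)"
   by (rule sum.inter_filter[symmetric]) simp
  also have "... = real (card {p\<in>primes_below x. [p = 1] (mod d)})" by simp
  also have "... <= real (card {n\<in>{2..N}. [n = 1] (mod d)})"
   using primes_below_subset[of x] x by (intro of_nat_mono card_mono) (auto simp: N_def)
  also have "... <= real N / real d" by (rule card_cong_1_le[OF d])
  also have "... <= x / real d" using N by (intro divide_right_mono) auto
  finally show "(\<Sum>p\<in>primes_below x. if [p = 1] (mod d) then 1 else 0) <= x * (1 / real d)" by simp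
 qed
 also have "... = x * (\<Sum>d=1..N. 1 / real d)" by (simp only: sum_distrib_left)
 also have "... <= x * (1 + ln (real N))" using x N by (intro mult_left_mono sum_inverse_le_ln) auto
 also have "... <= x * (1 + ln x)" using x N by (intro mult_left_mono) auto
 finally show ?thesis .
qed

lemma farey_spacing:
 assumes "prime p" "prime q" "1 <= h" "h < p" "1 <= k" "k < q" "(p, h) ~= (q, k)"
 shows "1 / (real p * real q) <= \<bar>real h / real p - real k / real q\<bar>"
proof -
 have pq: "real p > 0" "real q > 0" using assms prime_gt_0_nat by auto
 have "int h * int q ~= int k * int p"
 proof
  assume "int h * int q = int k * int p"
  hence e: "h * q = k * p" by (simp flip: of_nat_mult)
  hence "p dvd h * q" by simp
  hence "p dvd h \<or> p dvd q" using assms(1) by (simp add: prime_dvd_mult_iff)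
  moreover have "\<not> p dvd h" using assms by (auto dest: dvd_imp_le)
  ultimately have "p = q" using assms(1,2) by (simp add: primes_dvd_imp_eq)
  moreover from this e have "h = k" using assms by auto
  ultimately show False using assms(7) by simp
 qed
 hence "\<bar>int h * int q - int k * int p\<bar> >= 1" by linarith
 hence "real_of_int \<bar>int h * int q - int k * int p\<bar> >= 1" by linarith
 hence "\<bar>real h * real q - real k * real p\<bar> >= 1" by simp
 moreover have "real h / real p - real k / real q = (real h * real q - real k * real p) / (real p * real q)"
  using pq by (simp add: field_simps)
 ultimately show ?thesis using pq by (simp add: abs_divide divide_right_mono)
qed

text \<open>The fractions h/p with prime denominators below \<open>x\<close> are distinct and have
  spacing at least 1/x^2, so a length \<open>Y >= x ^ 2\<close> is what the large sieve asks
  for.\<close>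

lemma large_sieve_characters:
 assumes x: "x >= 1" and Y: "x ^ 2 <= real Y"
 shows "(\<Sum>p\<in>primes_below x. \<Sum>t=1..<p-1. norm (\<Sum>n=1..Y. b n * pch p t n) ^ 2) <= 40 * real Y * (\<Sum>n=1..Y. norm (b n) ^ 2)"
proof -
 define J where "J = Sigma (primes_below x) (%p. {1..<p})"
 define f where "f = (%(p, h). real h / real p)"
 have "1 <= x ^ 2" using x by simp
 hence "real Y >= 1" using Y by linarith
 hence Y1: "Y >= 1" by simp
 have sp: "1 / real Y <= \<bar>f u - f v\<bar>" if uv: "u \<in> J" "v \<in> J" "u ~= v" for u v
 proof -
  obtain p h q k where e: "u = (p, h)" "v = (q, k)" by (cases u, cases v)
  have m: "prime p" "real p < x" "1 <= h" "h < p" "prime q" "real q < x" "1 <= k" "k < q"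
   using uv e by (auto simp: J_def primes_below_def)
  have pq: "real p > 0" "real q > 0" using m prime_gt_0_nat by auto
  have "real p * real q <= x * x" using m x by (intro mult_mono) auto
  hence "real p * real q <= real Y" using Y by (simp add: power2_eq_square)
  hence "1 / real Y <= 1 / (real p * real q)" using pq Y1 by (intro divide_left_mono) auto
  also have "... <= \<bar>real h / real p - real k / real q\<bar>" using farey_spacing m uv e by auto
  finally show ?thesis by (simp add: f_def e)
 qed
 have inj: "inj_on f J"
 proof (rule inj_onI, rule ccontr)
  fix u v assume uv: "u \<in> J" "v \<in> J" "f u = f v" "u ~= v"
  have "0 < 1 / real Y" using Y1 by simp
  thus False using sp[OF uv(1,2,4)] uv(3) by simp
 qed
 have "(\<Sum>p\<in>primes_below x. \<Sum>t=1..<p-1. norm (\<Sum>n=1..Y. b n * pch p t n) ^ 2) \<le>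
   (\<Sum>p\<in>primes_below x. \<Sum>h=1..<p. norm (\<Sum>n=1..Y. b n * ee (real n * (real h / real p))) ^ 2)"
  by (intro sum_mono pch_additive_bound) (auto simp: primes_below_def)
 also have "... = (\<Sum>(p,h)\<in>J. norm (\<Sum>n=1..Y. b n * ee (real n * (real h / real p))) ^ 2)"
  unfolding J_def by (rule sum.Sigma) auto
 also have "... = (\<Sum>a\<in>f ` J. norm (\<Sum>n=1..Y. b n * ee (real n * a)) ^ 2)"
  by (subst sum.reindex[OF inj]) (simp add: f_def case_prod_beta)
 also have "... <= 40 * real Y * (\<Sum>n=1..Y. norm (b n) ^ 2)"
 proof (rule large_sieve[OF _ Y1])
  show "finite (f ` J)" by (simp add: J_def)
  show "f ` J \<subseteq> {0..1}"
  proof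
   fix y assume "y \<in> f ` J"
   then obtain p h where ph: "h < p" "y = real h / real p" by (auto simp: J_def f_def)
   thus "y \<in> {0..1}" by simp
  qed
  fix a c assume "a \<in> f ` J" "c \<in> f ` J" "a ~= c"
  then obtain u v where "u \<in> J" "v \<in> J" "a = f u" "c = f v" "u ~= v" by blast
  thus "1 / real Y <= \<bar>a - c\<bar>" using sp by blast
 qed
 finally show ?thesis .
qed

section \<open>Power moments of the total deviation\<close>

definition tot_dev :: "real => nat => real" where
 "tot_dev x a = (\<Sum>p\<in>primes_below x. dev p a)"

lemma abs_tot_dev_le: "x >= 0 ==> \<bar>tot_dev x a\<bar> <= x"
proof -
 assume x: "x >= 0"
 have "\<bar>tot_dev x a\<bar> <= (\<Sum>p\<in>primes_below x. \<bar>dev p a\<bar>)" unfolding tot_dev_def by (rule sum_abs)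
 also have "... <= (\<Sum>p\<in>primes_below x. 1)" by (intro sum_mono abs_dev_le) (auto simp: primes_below_def)
 also have "... <= x" using card_primes_below[OF x] by simp
 finally show ?thesis .
qed

definition tdev :: "real => nat => nat => complex" where
 "tdev x M a = (if a <= M then of_real (tot_dev x a) else 0)"

text \<open>The power mean inequality replaces the character sums over \<open>a \<le> M\<close> by their \<open>r\<close>-th powers, which are sums of
 length \<open>M ^ r \<ge> x ^ 2\<close>, long enough for the large sieve to be sharp.\<close>
lemma variance_power_bound:
 fixes M r :: nat
 assumes x: "x >= 1" and r: "r >= 1" and Y: "x ^ 2 <= real (M ^ r)"
 shows "(\<Sum>a=1..M. tot_dev x a ^ 2) ^ (2 * r) \<le>
  (x * (1 + ln x)) ^ (2 * r - 1) * ((1 + ln x) * (40 * real (M ^ r) * (\<Sum>n=1..M^r. norm (dpow (tdev x M) r n) ^ 2)))"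
proof -
 define P where "P = primes_below x"
 define J where "J = Sigma P (%p. Sigma {d. d dvd p - 1} (%d. {1..<d}))"
 define G where "G p t = (\<Sum>a=1..M. tdev x M a * pch p t a)" for p t
 define w where "w = (%(p::nat, d, i::nat). 1 / real d)"
 define y where "y = (%(p, d, i). norm (G p (i * ((p - 1) div d))))"
 define S where "S = (\<Sum>a=1..M. tot_dev x a ^ 2)"
 have pr: "prime p" "real p < x" if "p \<in> P" for p using that by (auto simp: P_def primes_below_def)
 have p1: "p - 1 >= 1" if "p \<in> P" for p using prime_ge_2_nat[OF pr(1)[OF that]] by simp
 have fD: "finite {d. d dvd p - 1}" if "p \<in> P" for p using p1[OF that] by simp
 have fP: "finite P" by (simp add: P_def)
 have fS: "finite (Sigma {d. d dvd p - 1} (%d. {1..<d}))" if "p \<in> P" for p using fD[OF that] by auto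
 have fJ: "finite J" unfolding J_def by (rule finite_SigmaI[OF fP fS])
 have sJ: "(\<Sum>p\<in>P. \<Sum>d | d dvd p - 1. \<Sum>i=1..<d. f p d i) = (\<Sum>(p,d,i)\<in>J. f p d i)" for f :: "nat => nat => nat => real"
 proof -
  have "(\<Sum>p\<in>P. \<Sum>d | d dvd p - 1. \<Sum>i=1..<d. f p d i) = (\<Sum>p\<in>P. \<Sum>(d,i)\<in>Sigma {d. d dvd p - 1} (%d. {1..<d}). f p d i)"
   using fD by (intro sum.cong refl sum.Sigma) auto
  also have "... = (\<Sum>(p,d,i)\<in>J. f p d i)" unfolding J_def using fP fS by (intro sum.Sigma) auto
  finally show ?thesis .
 qed
 have lx: "ln x >= 0" using x by simp
 \<comment> \<open>Duality: of the two factors of the square one stays as a coefficient and only the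
   other one is expanded into characters.\<close>
 have "complex_of_real S = (\<Sum>a=1..M. tdev x M a * (\<Sum>p\<in>P. of_real (dev p a)))"
  unfolding S_def of_real_sum by (intro sum.cong) (auto simp: tdev_def tot_dev_def P_def power2_eq_square)
 also have "... = (\<Sum>a=1..M. \<Sum>p\<in>P. \<Sum>d | d dvd p - 1. \<Sum>i=1..<d. of_real (h0 d / real d) * (tdev x M a * pch p (i * ((p - 1) div d)) a))"
 proof (intro sum.cong refl)
  fix a
  have "(\<Sum>p\<in>P. complex_of_real (dev p a)) = (\<Sum>p\<in>P. \<Sum>d | d dvd p - 1. \<Sum>i=1..<d. of_real (h0 d / real d) * pch p (i * ((p - 1) div d)) a)"
   by (intro sum.cong refl) (simp only: dev_expand[OF pr(1)] sum_distrib_left)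
  hence "tdev x M a * (\<Sum>p\<in>P. complex_of_real (dev p a)) = (\<Sum>p\<in>P. \<Sum>d | d dvd p - 1. \<Sum>i=1..<d. tdev x M a * (of_real (h0 d / real d) * pch p (i * ((p - 1) div d)) a))"
   by (simp only: sum_distrib_left)
  thus "tdev x M a * (\<Sum>p\<in>P. complex_of_real (dev p a)) = (\<Sum>p\<in>P. \<Sum>d | d dvd p - 1. \<Sum>i=1..<d. of_real (h0 d / real d) * (tdev x M a * pch p (i * ((p - 1) div d)) a))"
   by (simp only: mult.left_commute)
 qed
 also have "... = (\<Sum>p\<in>P. \<Sum>d | d dvd p - 1. \<Sum>i=1..<d. \<Sum>a=1..M. of_real (h0 d / real d) * (tdev x M a * pch p (i * ((p - 1) div d)) a))"
  by (rule trans[OF sum.swap], rule sum.cong[OF refl], rule trans[OF sum.swap], rule sum.cong[OF refl], rule sum.swap)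
 also have "... = (\<Sum>p\<in>P. \<Sum>d | d dvd p - 1. \<Sum>i=1..<d. of_real (h0 d / real d) * G p (i * ((p - 1) div d)))"
  by (simp only: G_def sum_distrib_left)
 finally have "norm (complex_of_real S) <= (\<Sum>p\<in>P. \<Sum>d | d dvd p - 1. \<Sum>i=1..<d. norm (of_real (h0 d / real d) * G p (i * ((p - 1) div d))))"
  by (simp only:) (intro order_trans[OF norm_sum] sum_mono order_refl)
 also have "... <= (\<Sum>p\<in>P. \<Sum>d | d dvd p - 1. \<Sum>i=1..<d. 1 / real d * norm (G p (i * ((p - 1) div d))))"
  unfolding norm_mult norm_of_real abs_divide
  by (intro sum_mono mult_right_mono) (auto intro!: divide_right_mono abs_h0_le)
 also have "... = (\<Sum>j\<in>J. w j * y j)" unfolding sJ by (simp add: w_def y_def case_prod_beta)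
 finally have S1: "S <= (\<Sum>j\<in>J. w j * y j)" by simp
 have S0: "S >= 0" unfolding S_def by (intro sum_nonneg) auto
 \<comment> \<open>For given \<open>p\<close> and \<open>d\<close> the d - 1 weights 1/d sum to at
   most 1, so the total weight is at most the number of pairs of a prime and a divisor of p -
   1.\<close>
 have W: "(\<Sum>j\<in>J. w j) <= x * (1 + ln x)"
 proof -
  have "(\<Sum>j\<in>J. w j) = (\<Sum>p\<in>P. \<Sum>d | d dvd p - 1. \<Sum>i=1..<d. 1 / real d)" unfolding sJ by (simp add: w_def case_prod_beta)
  also have "... <= (\<Sum>p\<in>P. \<Sum>d | d dvd p - 1. 1)"
  proof (intro sum_mono)
   fix p d
   show "(\<Sum>i=1..<d. 1 / real d) <= 1" by (cases "d = 0") (auto simp: field_simps)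
  qed
  also have "... = (\<Sum>p\<in>P. real (card {d. d dvd p - 1}))" by simp
  also have "... <= x * (1 + ln x)" unfolding P_def by (rule sum_divisor_count_le[OF x])
  finally show ?thesis .
 qed
 have "S ^ (2 * r) <= (\<Sum>j\<in>J. w j * y j) ^ (2 * r)" by (intro power_mono S1 S0)
 also have "... = (\<Sum>j\<in>J. w j * y j) ^ Suc (2 * r - 1)" using r by simp
 also have "... <= (\<Sum>j\<in>J. w j) ^ (2 * r - 1) * (\<Sum>j\<in>J. w j * y j ^ Suc (2 * r - 1))"
  by (rule weighted_power_mean[OF fJ]) (auto simp: w_def y_def)
 also have "... <= (x * (1 + ln x)) ^ (2 * r - 1) * ((1 + ln x) * (40 * real (M ^ r) * (\<Sum>n=1..M^r. norm (dpow (tdev x M) r n) ^ 2)))"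
 proof (rule mult_mono)
  show "(\<Sum>j\<in>J. w j) ^ (2 * r - 1) <= (x * (1 + ln x)) ^ (2 * r - 1)"
   by (intro power_mono W sum_nonneg) (auto simp: w_def)
  have "(\<Sum>j\<in>J. w j * y j ^ Suc (2 * r - 1)) = (\<Sum>p\<in>P. \<Sum>d | d dvd p - 1. \<Sum>i=1..<d. 1 / real d * norm (G p (i * ((p - 1) div d))) ^ (2 * r))"
   unfolding sJ using r by (simp add: w_def y_def case_prod_beta)
  \<comment> \<open>For fixed \<open>d\<close> the characters that occur are distinct, so the sum
    may be extended to all nonprincipal ones; the repetition over \<open>d\<close> costs the sum of
    1/d, at most 1 + ln x.\<close>
  also have "... <= (\<Sum>p\<in>P. \<Sum>d | d dvd p - 1. 1 / real d * (\<Sum>t=1..<p-1. norm (G p t) ^ (2 * r)))"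
  proof (intro sum_mono)
   fix p d assume p: "p \<in> P" and "d \<in> {d. d dvd p - 1}"
   then obtain c where c: "p - 1 = d * c" by (auto elim: dvdE)
   have dc: "d > 0" "c > 0" using p1[OF p] c by (auto intro!: Nat.gr0I)
   have dv: "(p - 1) div d = c" unfolding c using dc by simp
   have "(\<Sum>i=1..<d. norm (G p (i * c)) ^ (2 * r)) = (\<Sum>t\<in>(%i. i * c) ` {1..<d}. norm (G p t) ^ (2 * r))"
    using dc by (subst sum.reindex) (auto simp: inj_on_def)
   also have "... <= (\<Sum>t=1..<p-1. norm (G p t) ^ (2 * r))"
   proof (rule sum_mono2)
    show "(%i. i * c) ` {1..<d} \<subseteq> {1..<p-1}"
    proof
     fix t assume "t \<in> (%i. i * c) ` {1..<d}"
     then obtain i where "1 <= i" "i < d" "t = i * c" by auto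
     hence "t < d * c" "1 <= t" using dc by auto
     thus "t \<in> {1..<p-1}" unfolding c by simp
    qed
   qed auto
   finally have "1 / real d * (\<Sum>i=1..<d. norm (G p (i * c)) ^ (2 * r)) <= 1 / real d * (\<Sum>t=1..<p-1. norm (G p t) ^ (2 * r))"
    by (rule mult_left_mono) simp
   thus "(\<Sum>i=1..<d. 1 / real d * norm (G p (i * ((p - 1) div d))) ^ (2 * r)) <= 1 / real d * (\<Sum>t=1..<p-1. norm (G p t) ^ (2 * r))"
    by (simp only: dv sum_distrib_left)
  qed
  also have "... = (\<Sum>p\<in>P. (\<Sum>d | d dvd p - 1. 1 / real d) * (\<Sum>t=1..<p-1. norm (G p t) ^ (2 * r)))"
   by (simp only: sum_distrib_right)
  also have "... <= (\<Sum>p\<in>P. (1 + ln x) * (\<Sum>t=1..<p-1. norm (G p t) ^ (2 * r)))"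
   by (intro sum_mono mult_right_mono sum_divisors_inverse_le x sum_nonneg) (auto simp: P_def)
  also have "... = (1 + ln x) * (\<Sum>p\<in>P. \<Sum>t=1..<p-1. norm (G p t) ^ (2 * r))" by (simp only: sum_distrib_left)
  also have "(\<Sum>p\<in>P. \<Sum>t=1..<p-1. norm (G p t) ^ (2 * r)) = (\<Sum>p\<in>P. \<Sum>t=1..<p-1. norm (\<Sum>n=1..M^r. dpow (tdev x M) r n * pch p t n) ^ 2)"
  proof (intro sum.cong refl)
   fix p t assume p: "p \<in> P"
   have "(\<Sum>n=1..M^r. dpow (tdev x M) r n * pch p t n) = G p t ^ r"
    unfolding G_def by (rule dpow_sum) (auto simp: tdev_def pch_mult[OF pr(1)[OF p]] pch_1[OF pr(1)[OF p], simplified])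
   thus "norm (G p t) ^ (2 * r) = norm (\<Sum>n=1..M^r. dpow (tdev x M) r n * pch p t n) ^ 2"
    by (simp add: norm_power power_mult[symmetric] mult.commute)
  qed
  also have "(1 + ln x) * ... <= (1 + ln x) * (40 * real (M ^ r) * (\<Sum>n=1..M^r. norm (dpow (tdev x M) r n) ^ 2))"
   unfolding P_def by (intro mult_left_mono large_sieve_characters[OF x Y]) (use lx in simp)
  finally show "(\<Sum>j\<in>J. w j * y j ^ Suc (2 * r - 1)) <= (1 + ln x) * (40 * real (M ^ r) * (\<Sum>n=1..M^r. norm (dpow (tdev x M) r n) ^ 2))" .
  show "0 <= (x * (1 + ln x)) ^ (2 * r - 1)" using x lx by simp
  show "0 <= (\<Sum>j\<in>J. w j * y j ^ Suc (2 * r - 1))" by (intro sum_nonneg) (auto simp: w_def y_def)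
 qed
 finally show ?thesis by (simp add: S_def)
qed

text \<open>Here \<open>X = ln x\<close> and \<open>L\<close> is about \<open>ln N\<close>: this is where the constant 4.8365 enters. The large sieve saves
 \<open>exp (- X)\<close>, while the divisor sums cost at most \<open>0.4 X + (5 / 12) ^ 2 * ln 11 * X\<close> to leading order, which is less than \<open>0.82 X\<close>.\<close>
lemma exponent_bound:
 fixes X L :: real and r :: nat
 assumes X: "X >= 2000" and L: "48 / 10 * sqrt X <= L" "L < 2 * X" and r: "real r <= 2 * X / L + 1"
 shows "- X + real r * (1 / 10 * L) + ln 11 * real (r * r) <= - (1 / 10 * sqrt X) * real (2 * r)"
proof -
 define s where "s = sqrt X"
 have s: "s >= 44" unfolding s_def using X by (intro real_le_rsqrt) auto
 have Xs: "X = s * s" using X by (simp add: s_def)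
 have L0: "L > 0" using L(1) s by (simp add: s_def)
 \<comment> \<open>5/12 is 2 divided by 4.8; the bound on \<open>r\<close> is thus a multiple of the
   square root of ln x.\<close>
 have "2 * X / L <= 2 * X / (48 / 10 * s)" using L X s L0 by (intro divide_left_mono) (auto simp: s_def)
 also have "... = 5 / 12 * s" using s by (simp add: Xs)
 finally have rs: "real r <= 5 / 12 * s + 1" using r by linarith
 have "real r * L <= (2 * X / L + 1) * L" using r L0 by (intro mult_right_mono) auto
 also have "... = 2 * X + L" using L0 by (simp add: distrib_right)
 finally have 1: "real r * L <= 4 * X" using L by linarith
 have e1: "(13 / 8 :: real) <= exp (1 / 2)"
  using exp_lower_Taylor_quadratic[of "1/2 :: real"] by (simp add: power2_eq_square)
 have "(11 :: real) <= (13 / 8) ^ 5" by (simp add: eval_nat_numeral)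
 also have "... <= exp (1 / 2) ^ 5" by (intro power_mono e1) simp
 also have "... = exp (5 / 2)" by (simp flip: exp_of_nat_mult)
 finally have l11: "ln 11 <= (5 / 2 :: real)" by (subst (asm) ln_le_cancel_iff[symmetric]) auto
 have "real r * real r <= (5 / 12 * s + 1) * (5 / 12 * s + 1)" using rs by (intro mult_mono) auto
 hence "ln 11 * (real r * real r) <= 5 / 2 * ((5 / 12 * s + 1) * (5 / 12 * s + 1))"
  by (rule mult_mono[OF l11]) auto
 also have "... = (125 / 288) * (s * s) + 25 / 12 * s + 5 / 2" by (simp add: algebra_simps)
 also have "... <= 1 / 2 * (s * s)"
 proof -
  have "44 * s <= s * s" using s by (intro mult_right_mono) auto
  thus ?thesis using s by linarith
 qed
 finally have 2: "ln 11 * real (r * r) <= 1 / 2 * X" by (simp add: Xs)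
 have "2 * real r <= s" using rs s by linarith
 hence "s * (2 * real r) <= s * s" using s by (intro mult_left_mono) auto
 hence 3: "1 / 10 * s * real (2 * r) <= 1 / 10 * X" by (simp add: Xs)
 have "real r * (1 / 10 * L) <= 4 / 10 * X" using 1 by (simp add: mult.commute)
 thus ?thesis using 2 3 unfolding s_def by linarith
qed

text \<open>If \<open>M >= x ^ 2\<close>, then \<open>r = 1\<close> suffices: the variance occurs
  squared on the left and once on the right, and a full factor x is saved. Otherwise
  \<open>r\<close> is the least exponent with \<open>M ^ r >= x ^ 2\<close>, and the 2r-th moment
  inequality saves one factor exp (- X), part of which is spent on the divisor sums. As
  \<open>r\<close> is at most of order sqrt X, taking the 2r-th root leaves exp (- sqrt X /
  10).\<close>

lemma variance_bound:
 fixes M :: nat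
 assumes x: "x > 0" "ln x >= 2000" and M: "M >= 1" "48 / 10 * sqrt (ln x) <= ln (real M)"
 shows "(\<Sum>a=1..M. tot_dev x a ^ 2) <= 40 * real M * x ^ 2 * (1 + ln x) ^ 2 * exp (- (1 / 10 * sqrt (ln x)))"
proof -
 define X where "X = ln x"
 define L where "L = ln (real M)"
 define S where "S = (\<Sum>a=1..M. tot_dev x a ^ 2)"
 define eps where "eps = exp (- (1 / 10 * sqrt X))"
 have X: "X >= 2000" using x by (simp add: X_def)
 have xX: "x = exp X" using x by (simp add: X_def)
 have Mexp: "real M = exp L" using M by (simp add: L_def)
 have x1: "x >= 1" using X by (simp add: xX)
 have S0: "S >= 0" unfolding S_def by (intro sum_nonneg) auto
 have sX: "44 <= sqrt X" using X by (intro real_le_rsqrt) auto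
 hence L0: "L > 0" using M(2) by (simp add: L_def X_def)
 have sqX: "sqrt X <= X" using mult_right_mono[of 1 "sqrt X" "sqrt X"] sX X by simp
 show ?thesis
 proof (cases "L >= 2 * X")
  case True
  have "x ^ 2 = exp (2 * X)" unfolding xX by (simp flip: exp_of_nat_mult)
  also have "... <= real (M ^ 1)" using True by (simp add: Mexp)
  finally have Y: "x ^ 2 <= real (M ^ 1)" .
  have dp: "(\<Sum>n=1..M^1. norm (dpow (tdev x M) 1 n) ^ 2) = S"
   unfolding S_def
  proof (rule sum.cong)
   fix n assume n: "n \<in> {1..M}"
   have "dpow (tdev x M) 1 n = (\<Sum>a | a dvd n. if a = n then tdev x M a else 0)"
   proof -
    have "n div a = 1 \<longleftrightarrow> a = n" if "a dvd n" for a using that n by (auto elim!: dvdE)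
    hence "tdev x M a * (if n div a = 1 then 1 else 0) = (if a = n then tdev x M a else 0)" if "a dvd n" for a
     using that by auto
    thus ?thesis unfolding One_nat_def dpow.simps by (intro sum.cong) auto
   qed
   also have "... = tdev x M n" using n by (simp add: sum.delta')
   finally show "norm (dpow (tdev x M) 1 n) ^ 2 = tot_dev x n ^ 2" using n by (simp add: tdev_def)
  qed simp
  have "S ^ 2 <= (x * (1 + X)) * ((1 + X) * (40 * real M * S))"
   using variance_power_bound[OF x1 _ Y] unfolding dp by (simp add: S_def X_def)
  hence "S * S <= (40 * real M * x * (1 + X) ^ 2) * S" by (simp add: power2_eq_square mult_ac)
  hence "S <= 40 * real M * x * (1 + X) ^ 2"
   using S0 x1 by (cases "S = 0") (auto simp: mult_le_cancel_right)
  also have "... <= 40 * real M * (x ^ 2 * eps) * (1 + X) ^ 2"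
  proof (intro mult_right_mono mult_left_mono)
   have "X <= 2 * X - 1 / 10 * sqrt X" using sqX X by simp
   hence "exp X <= exp (2 * X - 1 / 10 * sqrt X)" by simp
   moreover have "x ^ 2 * eps = exp (2 * X - 1 / 10 * sqrt X)"
    unfolding xX eps_def exp_of_nat_mult[symmetric] exp_add[symmetric] by simp
   ultimately show "x <= x ^ 2 * eps" by (simp only: xX)
  qed auto
  finally show ?thesis by (simp add: S_def X_def eps_def mult_ac)
 next
  case False
  define r where "r = nat \<lceil>2 * X / L\<rceil>"
  have q0: "2 * X / L > 0" using X L0 by simp
  have r: "real r >= 2 * X / L" "real r <= 2 * X / L + 1" "r >= 1" using q0 by (auto simp: r_def) linarith+
  have rL: "2 * X <= real r * L" using r(1) L0 by (simp add: field_simps)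
  have Mr: "real (M ^ r) = exp (real r * L)" by (simp add: Mexp flip: exp_of_nat_mult)
  have "x ^ 2 = exp (2 * X)" unfolding xX by (simp flip: exp_of_nat_mult)
  also have "... <= real (M ^ r)" using rL unfolding Mr by simp
  finally have Y: "x ^ 2 <= real (M ^ r)" .
  define u where "u = 1 + X"
  have u: "u >= 1" using X by (simp add: u_def)
  have D: "(\<Sum>n=1..M^r. norm (dpow (tdev x M) r n) ^ 2) <= x ^ (2 * r) * (real M powr (11/10) * 11 ^ r) ^ r"
  proof (rule sum_dpow_square_le)
   show "norm (tdev x M a) <= x * tri M a" for a
    using abs_tot_dev_le[of x a] x1 by (simp add: tdev_def tri_def)
  qed (use x1 in simp)
  have "S ^ (2 * r) <= (x * u) ^ (2 * r - 1) * (u * (40 * real (M ^ r) * (\<Sum>n=1..M^r. norm (dpow (tdev x M) r n) ^ 2)))"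
   using variance_power_bound[OF x1 r(3) Y] unfolding S_def u_def X_def .
  also have "... <= (x * u) ^ (2 * r - 1) * (u * (40 * real (M ^ r) * (x ^ (2 * r) * (real M powr (11/10) * 11 ^ r) ^ r)))"
   using D x1 u by (intro mult_left_mono) auto
  also have "... = (x * u) ^ (2 * r) / x * (40 * real M ^ r * (x ^ (2 * r) * (real M powr (11/10) * 11 ^ r) ^ r))"
  proof -
   have "(x * u) ^ (2 * r) = (x * u) ^ (2 * r - 1) * (x * u)" using r(3) by (simp flip: power_Suc2)
   hence e: "(x * u) ^ (2 * r) / x = (x * u) ^ (2 * r - 1) * u" using x1 by simp
   show ?thesis unfolding e by (simp only: mult.assoc of_nat_power)
  qed
  also have "... = (x ^ 2 * u * real M) ^ (2 * r) * (40 * exp (- X + real r * (1 / 10 * L) + ln 11 * real (r * r)))"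
  proof -
   have 1: "(real M powr (11/10) * 11 ^ r) ^ r = exp (real r * (11 / 10 * L) + ln 11 * real (r * r))"
   proof -
    have "real M powr (11/10) = exp (11 / 10 * L)" by (simp add: Mexp powr_def)
    moreover have "(11::real) ^ r = exp (real r * ln 11)" by (simp add: exp_of_nat_mult)
    ultimately have "(real M powr (11/10) * 11 ^ r) ^ r = exp (real r * (11 / 10 * L + real r * ln 11))"
     by (simp only: exp_add[symmetric] exp_of_nat_mult[symmetric])
    thus ?thesis by (simp add: algebra_simps)
   qed
   have 2: "real M ^ r * exp (real r * (11 / 10 * L) + ln 11 * real (r * r)) / x =
     real M ^ (2 * r) * exp (- X + real r * (1 / 10 * L) + ln 11 * real (r * r))"
    unfolding Mexp xX exp_of_nat_mult[symmetric] exp_add[symmetric] exp_diff[symmetric] by (simp add: algebra_simps)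
   have "(x * u) ^ (2 * r) / x * (40 * real M ^ r * (x ^ (2 * r) * exp (real r * (11 / 10 * L) + ln 11 * real (r * r))))
     = (x * u) ^ (2 * r) * x ^ (2 * r) * 40 * (real M ^ r * exp (real r * (11 / 10 * L) + ln 11 * real (r * r)) / x)"
    by simp
   also have "... = (x ^ 2 * u * real M) ^ (2 * r) * (40 * exp (- X + real r * (1 / 10 * L) + ln 11 * real (r * r)))"
    unfolding 2 by (simp add: power_mult_distrib power_mult[symmetric] power_add[symmetric] mult_2 mult_ac)
   finally show ?thesis unfolding 1 .
  qed
  also have "... <= (x ^ 2 * u * real M) ^ (2 * r) * (40 ^ (2 * r) * eps ^ (2 * r))"
  proof (intro mult_left_mono mult_mono)
   have "(40::real) ^ 1 <= 40 ^ (2 * r)" using r(3) by (intro power_increasing) auto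
   thus "(40::real) <= 40 ^ (2 * r)" by simp
   have "exp (- X + real r * (1 / 10 * L) + ln 11 * real (r * r)) <= exp (- (1 / 10 * sqrt X) * real (2 * r))"
    using exponent_bound[OF X _ _ r(2)] M(2) False by (simp add: L_def X_def del: of_nat_mult)
   also have "... = eps ^ (2 * r)" unfolding eps_def exp_of_nat_mult[symmetric] by (simp only: mult.commute)
   finally show "exp (- X + real r * (1 / 10 * L) + ln 11 * real (r * r)) <= eps ^ (2 * r)" .
  qed (use x1 u in auto)
  also have "... = (40 * real M * x ^ 2 * u * eps) ^ (2 * r)" by (simp add: power_mult_distrib mult_ac)
  finally have "S ^ (2 * r) <= (40 * real M * x ^ 2 * u * eps) ^ (2 * r)" .
  hence "S <= 40 * real M * x ^ 2 * u * eps"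
   by (subst (asm) power_mono_iff) (use r(3) S0 u in \<open>auto simp: eps_def\<close>)
  also have "... <= 40 * real M * x ^ 2 * u ^ 2 * eps"
   using u by (intro mult_right_mono mult_left_mono) (auto simp: power2_eq_square eps_def)
  finally show ?thesis by (simp add: S_def u_def X_def eps_def)
 qed
qed

section \<open>Primes dividing a, and the final estimate\<close>

text \<open>One of the two factors is bounded by the number of primes below \<open>x\<close>. This
  wasteful step leaves a bound of order x ln x per \<open>a\<close>, still far below x^2.\<close>

lemma prime_divisor_count_square_sum:
 assumes x: "x >= 1"
 shows "(\<Sum>a=1..M. real (card {p\<in>primes_below x. p dvd a}) ^ 2) <= x * (real M * (1 + ln x))"
proof -
 have "(\<Sum>a=1..M. real (card {p\<in>primes_below x. p dvd a}) ^ 2) <= (\<Sum>a=1..M. x * real (card {p\<in>primes_below x. p dvd a}))"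
 proof (rule sum_mono)
  fix a
  have "card {p\<in>primes_below x. p dvd a} <= card (primes_below x)" by (intro card_mono) auto
  hence "real (card {p\<in>primes_below x. p dvd a}) <= x" using card_primes_below[of x] x by linarith
  thus "real (card {p\<in>primes_below x. p dvd a}) ^ 2 <= x * real (card {p\<in>primes_below x. p dvd a})"
   unfolding power2_eq_square by (intro mult_right_mono) auto
 qed
 also have "... = x * (\<Sum>a=1..M. \<Sum>p\<in>primes_below x. if p dvd a then 1 else 0)"
  unfolding sum_distrib_left by (intro sum.cong refl) (simp flip: sum.inter_filter sum_distrib_left)
 also have "(\<Sum>a=1..M. \<Sum>p\<in>primes_below x. if p dvd a then 1 else (0::real)) = (\<Sum>p\<in>primes_below x. \<Sum>a=1..M. if p dvd a then 1 else 0)"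
  by (rule sum.swap)
 also have "x * ... <= x * (\<Sum>p\<in>primes_below x. real M * (1 / real p))"
 proof (intro mult_left_mono sum_mono)
  fix p assume "p \<in> primes_below x"
  hence p: "p > 0" using prime_gt_0_nat by (auto simp: primes_below_def)
  have e: "(\<Sum>a=1..M. if p dvd a then 1 else (0::real)) = real (card {a\<in>{1..M}. p dvd a})"
   by (simp flip: sum.inter_filter)
  have "{a\<in>{1..M}. p dvd a} \<subseteq> (%i. p * i) ` {1..M div p}"
  proof
   fix a assume "a \<in> {a\<in>{1..M}. p dvd a}"
   then obtain c where c: "a = p * c" "1 <= a" "a <= M" by (auto elim: dvdE)
   have "c >= 1" using c by (cases c) auto
   moreover have "c <= M div p" using div_le_mono[OF c(3), of p] c(1) p by simp
   ultimately show "a \<in> (%i. p * i) ` {1..M div p}" using c(1) by auto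
  qed
  hence "card {a\<in>{1..M}. p dvd a} <= card ((%i. p * i) ` {1..M div p})" by (intro card_mono) auto
  also have "... <= card {1..M div p}" by (rule card_image_le) simp
  also have "card {1..M div p} = M div p" by simp
  finally have "real (card {a\<in>{1..M}. p dvd a}) <= real (M div p)" by (simp only: of_nat_le_iff)
  moreover have "real (M div p) <= real M * (1 / real p)" using of_nat_div_le_of_nat[of M p] by simp
  ultimately show "(\<Sum>a=1..M. if p dvd a then 1 else 0) <= real M * (1 / real p)" unfolding e by (rule order_trans)
 qed (use x in simp)
 also have "... <= x * (real M * (1 + ln x))"
 proof -
  define N where "N = nat \<lfloor>x\<rfloor>"
  have N: "real N <= x" "N >= 1" using le_nat_floor_iff[of x] x by (auto simp: N_def)
  have "(\<Sum>p\<in>primes_below x. 1 / real p) <= (\<Sum>p=1..N. 1 / real p)"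
   using primes_below_subset[of x] x by (intro sum_mono2) (auto simp: N_def)
  also have "... <= 1 + ln (real N)" by (rule sum_inverse_le_ln[OF N(2)])
  also have "... <= 1 + ln x" using N by simp
  finally show ?thesis unfolding sum_distrib_left[symmetric] using x by (intro mult_left_mono) auto
 qed
 finally show ?thesis .
qed

lemma order_sum_decomposition:
 "order_sum a x = tot_dev x a + (\<Sum>p\<in>primes_below x. mean_ord (p - 1)) - (\<Sum>p\<in>{p\<in>primes_below x. p dvd a}. mean_ord (p - 1))"
proof -
 have "order_sum a x = (\<Sum>p\<in>primes_below x. dev p a + mean_ord (p - 1) - (if p dvd a then mean_ord (p - 1) else 0))"
  unfolding order_sum_def primes_below_def by (intro sum.cong) (auto simp: dev_def)
 also have "... = tot_dev x a + (\<Sum>p\<in>primes_below x. mean_ord (p - 1)) - (\<Sum>p\<in>primes_below x. if p dvd a then mean_ord (p - 1) else 0)"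
  by (simp add: sum_subtractf sum.distrib tot_dev_def)
 also have "(\<Sum>p\<in>primes_below x. if p dvd a then mean_ord (p - 1) else 0) = (\<Sum>p\<in>{p\<in>primes_below x. p dvd a}. mean_ord (p - 1))"
  by (rule sum.inter_filter[symmetric]) simp
 finally show ?thesis .
qed

lemma square_sum3: "(u + v - w) ^ 2 <= 3 * (u ^ 2 + v ^ 2 + w ^ 2 :: real)"
proof -
 have "0 <= (u - v) ^ 2 + (u + w) ^ 2 + (v + w) ^ 2" by simp
 thus ?thesis by (simp add: power2_eq_square algebra_simps)
qed

theorem theorem1p2:
 fixes E :: real
 assumes "E > 0"
 shows "\<exists>K x0. \<forall>x N. x \<ge> x0 \<longrightarrow> N > exp (4.8365 * sqrt (ln x)) \<longrightarrow>
      (1 / N) * (\<Sum>a\<in>{1..nat \<lfloor>N\<rfloor>}. (order_sum a x - stephens_C * Li x)\<^sup>2)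
       \<le> K * x\<^sup>2 / (ln x) powr E"
proof -
 \<comment> \<open>An integer exponent not below \<open>E\<close>; the error of the mean value is
   squared later, which leaves \<open>2 * A\<close> logarithms.\<close>
 define A where "A = nat \<lceil>E\<rceil>"
 have A: "E <= real A" unfolding A_def by (rule real_nat_ceiling_ge)
 obtain K where K: "K >= 0" "!!x. x >= 5 ==> \<bar>(\<Sum>p | prime p \<and> real p < x. mean_ord (p - 1)) - stephens_C * Li x\<bar> <= K * (x / ln x ^ A)"
  using mean_ord_sum[of A] by blast
 have "((%X::real. 40 * (1 + X) ^ 2 * exp (- (1 / 10 * sqrt X)) * X powr E) \<longlongrightarrow> 0) at_top"
  using assms by real_asymp
 hence "\<forall>\<^sub>F X::real in at_top. 40 * (1 + X) ^ 2 * exp (- (1 / 10 * sqrt X)) * X powr E < 1"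
  by (rule order_tendstoD) simp
 then obtain X1 where X1: "!!X. X >= X1 ==> 40 * (1 + X) ^ 2 * exp (- (1 / 10 * sqrt X)) * X powr E < 1"
  by (auto simp: eventually_at_top_linorder)
 have "((%X::real. (1 + X) * exp (- X) * X powr E) \<longlongrightarrow> 0) at_top"
  using assms by real_asymp
 hence "\<forall>\<^sub>F X::real in at_top. (1 + X) * exp (- X) * X powr E < 1"
  by (rule order_tendstoD) simp
 then obtain X2 where X2: "!!X. X >= X2 ==> (1 + X) * exp (- X) * X powr E < 1"
  by (auto simp: eventually_at_top_linorder)
 \<comment> \<open>2000 is the threshold of \<open>variance_bound\<close>; from \<open>X1\<close>
   and \<open>X2\<close> on the two exponential savings outweigh the power
   \<open>X powr E\<close>.\<close>
 define X0 where "X0 = max 2000 (max X1 X2)"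
 have main: "(1 / N) * (\<Sum>a\<in>{1..nat \<lfloor>N\<rfloor>}. (order_sum a x - stephens_C * Li x)\<^sup>2) <= (6 + 3 * K ^ 2) * x\<^sup>2 / (ln x) powr E"
  if x: "x >= exp X0" and N: "N > exp (4.8365 * sqrt (ln x))" for x N
 proof -
  define X where "X = ln x"
  have x0: "x > 0" using x exp_gt_zero[of X0] by linarith
  have XX: "X >= X0" using x x0 by (simp add: X_def ln_ge_iff)
  have X: "X >= 2000" "X >= X1" "X >= X2" using XX by (auto simp: X0_def)
  have xX: "x = exp X" using x0 by (simp add: X_def)
  have x5: "x >= 5" using exp_ge_add_one_self[of X] X xX by linarith
  have x1: "x >= 1" using x5 by simp
  define M where "M = nat \<lfloor>N\<rfloor>"
  have s: "44 <= sqrt X" using X by (intro real_le_rsqrt) auto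
  have N0: "N > exp (4.8365 * sqrt X)" using N by (simp add: X_def)
  have "exp (4.8365 * sqrt X) >= 1 + 4.8365 * sqrt X" by (rule exp_ge_add_one_self)
  moreover have "1 + 4.8365 * sqrt X >= 2" using s by simp
  ultimately have N2: "N >= 2" using N0 by linarith
  have MN: "real M <= N" "M >= 1" "N <= 2 * real M"
  proof -
   have "real M = of_int \<lfloor>N\<rfloor>" using N2 by (simp add: M_def)
   thus "real M <= N" "N <= 2 * real M" using N2 by linarith+
   thus "M >= 1" using N2 by linarith
  qed
  have "4.8365 * sqrt X <= ln N" using N0 N2 by (metis less_eq_real_def ln_exp ln_less_cancel_iff exp_gt_zero order_less_trans)
  also have "... <= ln (2 * real M)" using MN N2 by simp
  also have "... = ln 2 + ln (real M)" using MN by (simp add: ln_mult)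
  \<comment> \<open>Rounding \<open>N\<close> down to \<open>M\<close> costs at most ln 2, which is
    less than (4.8365 - 4.8) * 44.\<close>
  finally have LM: "48 / 10 * sqrt X <= ln (real M)" using s ln2_le_25_over_36 by simp
  define R where "R = x\<^sup>2 / X powr E"
  have Xp: "X powr E > 0" using X by simp
  have V: "(\<Sum>a=1..M. tot_dev x a ^ 2) <= real M * R"
  proof -
   have "(\<Sum>a=1..M. tot_dev x a ^ 2) <= 40 * real M * x ^ 2 * (1 + X) ^ 2 * exp (- (1 / 10 * sqrt X))"
    unfolding X_def by (rule variance_bound) (use x0 X LM MN in \<open>auto simp: X_def\<close>)
   also have "... = real M * (x ^ 2 * (40 * (1 + X) ^ 2 * exp (- (1 / 10 * sqrt X)) * X powr E) / X powr E)" using Xp by simp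
   also have "... <= real M * (x ^ 2 * 1 / X powr E)"
    using X1[OF X(2)] by (intro mult_left_mono divide_right_mono) auto
   finally show ?thesis by (simp add: R_def)
  qed
  define e where "e = (\<Sum>p\<in>primes_below x. mean_ord (p - 1)) - stephens_C * Li x"
  have "\<bar>e\<bar> <= K * (x / X ^ A)" using K(2)[OF x5] by (simp add: e_def primes_below_def X_def)
  hence "\<bar>e\<bar> ^ 2 <= (K * (x / X ^ A)) ^ 2" by (intro power_mono) auto
  hence "e ^ 2 <= K ^ 2 * (x ^ 2 / X ^ (2 * A))" by (simp add: power_mult_distrib power_divide power_mult[symmetric] mult.commute)
  also have "... <= K ^ 2 * R"
  proof -
   have "X powr E <= X powr real (2 * A)" using X A assms by (intro powr_mono) auto
   also have "... = X ^ (2 * A)" using X by (intro powr_realpow) auto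
   finally show ?thesis unfolding R_def using Xp X by (intro mult_left_mono divide_left_mono mult_pos_pos zero_less_power) auto
  qed
  finally have e2: "e ^ 2 <= K ^ 2 * R" .
  define w where "w a = (\<Sum>p\<in>{p\<in>primes_below x. p dvd a}. mean_ord (p - 1))" for a
  have W: "(\<Sum>a=1..M. w a ^ 2) <= real M * R"
  proof -
   have "(\<Sum>a=1..M. w a ^ 2) <= (\<Sum>a=1..M. real (card {p\<in>primes_below x. p dvd a}) ^ 2)"
   proof (intro sum_mono power_mono)
    fix a
    have "w a <= (\<Sum>p\<in>{p\<in>primes_below x. p dvd a}. 1)" unfolding w_def by (intro sum_mono mean_ord_bounds)
    thus "w a <= real (card {p\<in>primes_below x. p dvd a})" by simp
    show "0 <= w a" unfolding w_def by (intro sum_nonneg mean_ord_bounds)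
   qed
   also have "... <= x * (real M * (1 + X))" unfolding X_def by (rule prime_divisor_count_square_sum[OF x1])
   also have "... = real M * (x ^ 2 * ((1 + X) * exp (- X) * X powr E) / X powr E)"
    using Xp x0 by (simp add: xX exp_minus power2_eq_square)
   also have "... <= real M * (x ^ 2 * 1 / X powr E)"
    using X2[OF X(3)] by (intro mult_left_mono divide_right_mono) auto
   finally show ?thesis by (simp add: R_def)
  qed
  have "(\<Sum>a=1..M. (order_sum a x - stephens_C * Li x)\<^sup>2) <= (\<Sum>a=1..M. 3 * (tot_dev x a ^ 2 + e ^ 2 + w a ^ 2))"
  proof (rule sum_mono)
   fix a
   have "order_sum a x - stephens_C * Li x = tot_dev x a + e - w a"
    by (simp add: order_sum_decomposition e_def w_def)
   thus "(order_sum a x - stephens_C * Li x)\<^sup>2 <= 3 * (tot_dev x a ^ 2 + e ^ 2 + w a ^ 2)" by (simp only: square_sum3)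
  qed
  also have "... = 3 * ((\<Sum>a=1..M. tot_dev x a ^ 2) + real M * e ^ 2 + (\<Sum>a=1..M. w a ^ 2))"
   by (simp add: sum.distrib flip: sum_distrib_left)
  also have "... <= 3 * (real M * R + real M * (K ^ 2 * R) + real M * R)"
   using V W e2 by (intro mult_left_mono add_mono) auto
  also have "... = real M * ((6 + 3 * K ^ 2) * R)" by (simp add: algebra_simps)
  also have "... <= N * ((6 + 3 * K ^ 2) * R)"
   using MN Xp by (intro mult_right_mono) (auto simp: R_def)
  finally have "(\<Sum>a=1..M. (order_sum a x - stephens_C * Li x)\<^sup>2) <= N * ((6 + 3 * K ^ 2) * R)" .
  hence "(1 / N) * (\<Sum>a=1..M. (order_sum a x - stephens_C * Li x)\<^sup>2) <= (6 + 3 * K ^ 2) * R"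
   using N2 by (simp add: field_simps)
  thus ?thesis by (simp add: M_def R_def X_def)
 qed
 show ?thesis by (intro exI[of _ "6 + 3 * K ^ 2"] exI[of _ "exp X0"] allI impI main)
qed

end
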